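(* Let $q\in(0,1)$, $n\ge1$, and let $\beta$ be the automorphism of $C(\partial B^{2n}_q)$ given by $\beta(w_1)=w_1^*$ and $\beta(w_j)=w_j$ for $j=2,\ldots,n$. The following is a complete (up to unitary equivalence) list of irreducible representations of the $C^*$-algebra $C(S^{2n}_{q,\beta})=C^*(e_0,e_1,\ldots,e_n)$: $$\{\varrho_1^\theta,\varrho_2^\theta,\ldots,\varrho_n^\theta:\theta\in\mathbb C,\ |\theta|=1\}\cup\{\sigma_+,\sigma_-\}.$$ Here the representations $\varrho_1^\theta$ are $1$-dimensional, $\varrho_j^\theta$, $j=2,\ldots,n$, act on $\mathcal H_{j-1}$, and $\sigma_+,\sigma_-$ act on $\mathcal H_n$. On the generators $e_0,e_1,\ldots,e_n$ these representations are given by the following formulae: $$\varrho_1^\theta(e_i)=\begin{cases}0,&0\le i\le n-1\\ \theta,&i=n;\end{cases}$$ for $2\le j\le n-1$, $$\varrho_j^\theta(e_i)\xi_{k_1,\ldots,k_{j-1}}=\begin{cases}0,&0\le i\le n-j\\ \theta q^{(k_1+k_2+\cdots+k_{j-1})/2}\xi_{k_1,\ldots,k_{j-1}},&i=n-j+1\\ S_{i+j-n-1}(\xi_{k_1,\ldots,k_{j-1}}),&n-j+2\le i\le n;\end{cases}$$ for $n\ge2$, $$\varrho_n^\theta(e_i)\xi_{k_1,\ldots,k_{n-1}}=\begin{cases}0,&i=0\\ \overline{\theta}q^{(k_1+k_2+\cdots+k_{n-1})/2}\xi_{k_1,\ldots,k_{n-1}},&i=1\\ S_{i-1}(\xi_{k_1,\ldots,k_{n-1}}),&2\le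 i\le n;\end{cases}$$ $$\sigma_+(e_i)\xi_{k_1,\ldots,k_n}=\begin{cases}q^{(1+k_1+k_2+\cdots+k_n)/2}\xi_{k_1,\ldots,k_n},&i=0\\ S_1^*(\xi_{k_1,\ldots,k_n}),&i=1\\ S_i(\xi_{k_1,\ldots,k_n}),&2\le i\le n;\end{cases}$$ $$\sigma_-(e_i)\xi_{k_1,\ldots,k_n}=\begin{cases}-q^{(k_1+k_2+\cdots+k_n)/2}\xi_{k_1,\ldots,k_n},&i=0\\ S_i(\xi_{k_1,\ldots,k_n}),&1\le i\le n.\end{cases}$$
   Context: $C(B^{2n}_q)$ is the universal unital $C^*$-algebra generated by $z_1,\ldots,z_n$ subject to $z_iz_j=q^{1/2}z_jz_i$ and $z_iz_j^*=q^{-1/2}z_j^*z_i$ for $i<j$, and $z_i^*z_i-qz_iz_i^*=(1-q)(1-\sum_{j=i+1}^nz_jz_j^* )$ for $i=1,\ldots,n$. Let $J_{2n}$ be the closed two-sided ideal generated by $1-\sum_{j=1}^nz_jz_j^*$, $C(\partial B^{2n}_q)=C(B^{2n}_q)/J_{2n}$, $\pi:C(B^{2n}_q)\to C(\partial B^{2n}_q)$ the quotient map, and $w_i=\pi(z_i)$. $C(S^{2n}_{q,\beta})=\{(x,y)\in C(B^{2n}_q)\oplus C(B^{2n}_q):\pi(x)=\beta(\pi(y))\}$. When $\beta$ is the automorphism of $C(\partial B^{2n}_q)$ given by $\beta(w_1)=w_1^*$ and $\beta(w_j)=w_j$ for $j=2,\ldots,n$, the algebra $C(S^{2n}_{q,\beta})$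 is generated as a $C^*$-algebra by $$e_0=\Bigl(\bigl(1-z_1^*z_1-\sum_{j=2}^nz_jz_j^*\bigr)^{1/2},\,-\bigl(1-\sum_{j=1}^nz_jz_j^*\bigr)^{1/2}\Bigr),\quad e_1=(z_1^*,z_1),\quad e_i=(z_i,z_i)\ (i=2,\ldots,n),$$ where the square roots make sense because $\sum_{j=1}^nz_jz_j^*\le1$ and $z_1^*z_1+\sum_{j=2}^nz_jz_j^*\le1$ in $C(B^{2n}_q)$. For $m\ge1$, $\mathcal H_m$ is a Hilbert space with orthonormal basis $\{\xi_{k_1,\ldots,k_m}:k_i=0,1,\ldots\}$, and for $1\le r\le m$, $S_r$ is the weighted shift on $\mathcal H_m$ defined by $$S_r(\xi_{k_1,\ldots,k_m})=\begin{cases}\sqrt{(1-q^{1+k_r})q^{k_{r+1}+k_{r+2}+\cdots+k_m}}\;\xi_{k_1,\ldots,k_{r-1},1+k_r,k_{r+1},\ldots,k_m},&1\le r\le m-1\\ \sqrt{1-q^{1+k_m}}\;\xi_{k_1,\ldots,k_{m-1},1+k_m},&r=m.\end{cases}$$ *)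

theory Defs
  imports
    "HOL-Analysis.Infinite_Sum"
    "HOL-Algebra.QuotRing"
    "HOL-Algebra.Module"
    "HOL-Library.Poly_Mapping"
begin

section \<open>Normed *-algebras over the complex numbers\<close>

text \<open>The library has no C*-algebras, so they are carried by an extension of the HOL-Algebra
  records: ring operations, scalar multiplication (from \<^type>\<open>module\<close>), involution and norm.\<close>

record 'a cstar = "(complex, 'a) module" +
  star :: "'a \<Rightarrow> 'a" (\<open>_\<^sup>\<star>\<index>\<close> [1000] 999)
  nrm :: "'a \<Rightarrow> real"

definition norm_lim :: "('a, 'm) cstar_scheme \<Rightarrow> (nat \<Rightarrow> 'a) \<Rightarrow> 'a \<Rightarrow> bool" where
  "norm_lim A s x \<longleftrightarrow> (\<lambda>k. nrm A (s k \<ominus>\<^bsub>A\<^esub> x)) \<longlonglongrightarrow> 0"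

definition norm_closed :: "('a, 'm) cstar_scheme \<Rightarrow> 'a set \<Rightarrow> bool" where
  "norm_closed A D \<longleftrightarrow> D \<subseteq> carrier A \<and>
     (\<forall>s x. (\<forall>k. s k \<in> D) \<and> x \<in> carrier A \<and> norm_lim A s x \<longrightarrow> x \<in> D)"

definition closed_star_subalgebra :: "('a, 'm) cstar_scheme \<Rightarrow> 'a set \<Rightarrow> bool" where
  "closed_star_subalgebra A D \<longleftrightarrow> norm_closed A D \<and> \<zero>\<^bsub>A\<^esub> \<in> D \<and>
     (\<forall>x\<in>D. \<forall>y\<in>D. x \<oplus>\<^bsub>A\<^esub> y \<in> D \<and> x \<otimes>\<^bsub>A\<^esub> y \<in> D) \<and>
     (\<forall>c. \<forall>x\<in>D. c \<odot>\<^bsub>A\<^esub> x \<in> D) \<and> (\<forall>x\<in>D. x\<^sup>\<star>\<^bsub>A\<^esub> \<in> D)"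

definition generated_cstar :: "('a, 'm) cstar_scheme \<Rightarrow> 'a set \<Rightarrow> 'a set" where
  "generated_cstar A X = \<Inter>{D. closed_star_subalgebra A D \<and> X \<subseteq> D}"

text \<open>In a unital algebra a ring ideal is automatically closed under scalar multiplication.\<close>

definition closed_ideal :: "('a, 'm) cstar_scheme \<Rightarrow> 'a set \<Rightarrow> 'a set" where
  "closed_ideal A X = \<Inter>{I. ideal I A \<and> norm_closed A I \<and> X \<subseteq> I}"

definition star_automorphism :: "('a, 'm) cstar_scheme \<Rightarrow> ('a \<Rightarrow> 'a) \<Rightarrow> bool" where
  "star_automorphism A \<beta> \<longleftrightarrow> \<beta> \<in> ring_iso A A \<and>
     (\<forall>c. \<forall>x\<in>carrier A. \<beta> (c \<odot>\<^bsub>A\<^esub> x) = c \<odot>\<^bsub>A\<^esub> \<beta> x) \<and>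
     (\<forall>x\<in>carrier A. \<beta> (x\<^sup>\<star>\<^bsub>A\<^esub>) = (\<beta> x)\<^sup>\<star>\<^bsub>A\<^esub>)"

definition positive_elem :: "('a, 'm) cstar_scheme \<Rightarrow> 'a \<Rightarrow> bool" where
  "positive_elem A a \<longleftrightarrow> (\<exists>b\<in>carrier A. a = b\<^sup>\<star>\<^bsub>A\<^esub> \<otimes>\<^bsub>A\<^esub> b)"

text \<open>The positive square root; meaningful when the argument is positive.\<close>

definition sqrt_elem :: "('a, 'm) cstar_scheme \<Rightarrow> 'a \<Rightarrow> 'a" where
  "sqrt_elem A a = (THE b. b \<in> carrier A \<and> positive_elem A b \<and> b \<otimes>\<^bsub>A\<^esub> b = a)"

definition quotient_cstar :: "('a, 'm) cstar_scheme \<Rightarrow> 'a set \<Rightarrow> 'a set cstar" where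
  "quotient_cstar A I =
     \<lparr>carrier = carrier (A Quot I), mult = mult (A Quot I), one = one (A Quot I),
      zero = zero (A Quot I), add = add (A Quot I),
      smult = (\<lambda>c X. \<Union>x\<in>X. I +>\<^bsub>A\<^esub> (c \<odot>\<^bsub>A\<^esub> x)),
      star = (\<lambda>X. \<Union>x\<in>X. I +>\<^bsub>A\<^esub> x\<^sup>\<star>\<^bsub>A\<^esub>),
      nrm = (\<lambda>X. Inf (nrm A ` X))\<rparr>"


section \<open>Hausdorff completion\<close>

text \<open>Cauchy sequences modulo null sequences, for a *-algebra equipped with a seminorm.\<close>

definition cauchy_seqs :: "('a, 'm) cstar_scheme \<Rightarrow> (nat \<Rightarrow> 'a) set" where
  "cauchy_seqs A = {s. (\<forall>k. s k \<in> carrier A) \<and>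
     (\<forall>e>0. \<exists>N. \<forall>k\<ge>N. \<forall>l\<ge>N. nrm A (s k \<ominus>\<^bsub>A\<^esub> s l) < e)}"

definition cauchy_rel :: "('a, 'm) cstar_scheme \<Rightarrow> ((nat \<Rightarrow> 'a) \<times> (nat \<Rightarrow> 'a)) set" where
  "cauchy_rel A = {(s, t). s \<in> cauchy_seqs A \<and> t \<in> cauchy_seqs A \<and>
     (\<lambda>k. nrm A (s k \<ominus>\<^bsub>A\<^esub> t k)) \<longlonglongrightarrow> 0}"

definition cauchy_class :: "('a, 'm) cstar_scheme \<Rightarrow> (nat \<Rightarrow> 'a) \<Rightarrow> (nat \<Rightarrow> 'a) set" where
  "cauchy_class A s = cauchy_rel A `` {s}"

definition completion :: "('a, 'm) cstar_scheme \<Rightarrow> (nat \<Rightarrow> 'a) set cstar" where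
  "completion A =
     \<lparr>carrier = cauchy_seqs A // cauchy_rel A,
      mult = (\<lambda>X Y. \<Union>s\<in>X. \<Union>t\<in>Y. cauchy_class A (\<lambda>k. s k \<otimes>\<^bsub>A\<^esub> t k)),
      one = cauchy_class A (\<lambda>_. \<one>\<^bsub>A\<^esub>),
      zero = cauchy_class A (\<lambda>_. \<zero>\<^bsub>A\<^esub>),
      add = (\<lambda>X Y. \<Union>s\<in>X. \<Union>t\<in>Y. cauchy_class A (\<lambda>k. s k \<oplus>\<^bsub>A\<^esub> t k)),
      smult = (\<lambda>c X. \<Union>s\<in>X. cauchy_class A (\<lambda>k. c \<odot>\<^bsub>A\<^esub> s k)),
      star = (\<lambda>X. \<Union>s\<in>X. cauchy_class A (\<lambda>k. (s k)\<^sup>\<star>\<^bsub>A\<^esub>)),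
      nrm = (\<lambda>X. THE r. \<forall>s\<in>X. (\<lambda>k. nrm A (s k)) \<longlonglongrightarrow> r)\<rparr>"


section \<open>Universal unital C*-algebras given by generators and relations\<close>

text \<open>A word is a list of letters \<open>(g, b)\<close>, standing for the generator \<open>g\<close> if \<open>b\<close> is false and
  for its adjoint if \<open>b\<close> is true. Written additively, words form a monoid under concatenation,
  so that the multiplication of \<open>'g star_word \<Rightarrow>\<^sub>0 complex\<close> is that of noncommutative
  *-polynomials.\<close>

datatype 'g star_word = Word (letters: "('g \<times> bool) list")

instantiation star_word :: (type) monoid_add
begin

definition zero_star_word :: "'a star_word" where
  "0 = Word []"

definition plus_star_word :: "'a star_word \<Rightarrow> 'a star_word \<Rightarrow> 'a star_word" where
  "u + v = Word (letters u @ letters v)"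

instance
  by standard (auto simp: zero_star_word_def plus_star_word_def)

end

type_synonym 'g star_poly = "'g star_word \<Rightarrow>\<^sub>0 complex"

definition word_star :: "'g star_word \<Rightarrow> 'g star_word" where
  "word_star w = Word (rev (map (\<lambda>(g, b). (g, \<not> b)) (letters w)))"

definition poly_star :: "'g star_poly \<Rightarrow> 'g star_poly" where
  "poly_star p = Poly_Mapping.map cnj (Poly_Mapping.map_key word_star p)"

definition poly_scale :: "complex \<Rightarrow> 'g star_poly \<Rightarrow> 'g star_poly" where
  "poly_scale c p = Poly_Mapping.map ((*) c) p"

definition poly_gen :: "'g \<Rightarrow> 'g star_poly" where
  "poly_gen g = Poly_Mapping.single (Word [(g, False)]) 1"

definition free_star_carrier :: "'g set \<Rightarrow> 'g star_poly set" where
  "free_star_carrier G = {p. \<forall>w\<in>Poly_Mapping.keys p. set (letters w) \<subseteq> G \<times> UNIV}"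

definition cstar_seminorm :: "'g set \<Rightarrow> ('g star_poly \<Rightarrow> real) \<Rightarrow> bool" where
  "cstar_seminorm G N \<longleftrightarrow>
     (\<forall>x\<in>free_star_carrier G. 0 \<le> N x \<and> N (poly_star x * x) = (N x)\<^sup>2 \<and>
        (\<forall>c. N (poly_scale c x) = cmod c * N x) \<and>
        (\<forall>y\<in>free_star_carrier G. N (x + y) \<le> N x + N y \<and> N (x * y) \<le> N x * N y))"

text \<open>The supremum is taken over the same values as the usual one over all representations of
  the relations: *-homomorphisms into C*-algebras and C*-seminorms correspond to each other. It is
  finite whenever the relations bound the norms of the generators, as they do below.\<close>

definition universal_norm :: "'g set \<Rightarrow> 'g star_poly set \<Rightarrow> 'g star_poly \<Rightarrow> real" where
  "universal_norm G R x = Sup {N x | N. cstar_seminorm G N \<and> (\<forall>r\<in>R. N r = 0)}"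

definition free_star_algebra :: "'g set \<Rightarrow> ('g star_poly \<Rightarrow> real) \<Rightarrow> 'g star_poly cstar" where
  "free_star_algebra G N =
     \<lparr>carrier = free_star_carrier G, mult = (*), one = 1, zero = 0, add = (+),
      smult = poly_scale, star = poly_star, nrm = N\<rparr>"

definition universal_cstar :: "'g set \<Rightarrow> 'g star_poly set \<Rightarrow> (nat \<Rightarrow> 'g star_poly) set cstar" where
  "universal_cstar G R = completion (free_star_algebra G (universal_norm G R))"

definition universal_gen :: "'g set \<Rightarrow> 'g star_poly set \<Rightarrow> 'g \<Rightarrow> (nat \<Rightarrow> 'g star_poly) set" where
  "universal_gen G R g =
     cauchy_class (free_star_algebra G (universal_norm G R)) (\<lambda>_. poly_gen g)"


section \<open>Quantum balls, their boundaries, and the glued spheres\<close>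

type_synonym qball_elem = "(nat \<Rightarrow> nat star_poly) set"

definition qball_relators :: "real \<Rightarrow> nat \<Rightarrow> nat star_poly set" where
  "qball_relators q n = (let z = poly_gen; z' = (\<lambda>i. poly_star (poly_gen i)) in
     {z i * z j - poly_scale (of_real (q powr (1/2))) (z j * z i) | i j.
        1 \<le> i \<and> i < j \<and> j \<le> n} \<union>
     {z i * z' j - poly_scale (of_real (q powr (-1/2))) (z' j * z i) | i j.
        1 \<le> i \<and> i < j \<and> j \<le> n} \<union>
     {z' i * z i - poly_scale (of_real q) (z i * z' i)
        - poly_scale (of_real (1 - q)) (1 - (\<Sum>j=i+1..n. z j * z' j)) | i.
        1 \<le> i \<and> i \<le> n})"

definition qball :: "real \<Rightarrow> nat \<Rightarrow> qball_elem cstar" where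
  "qball q n = universal_cstar {1..n} (qball_relators q n)"

definition qball_gen :: "real \<Rightarrow> nat \<Rightarrow> nat \<Rightarrow> qball_elem" where
  "qball_gen q n i = universal_gen {1..n} (qball_relators q n) i"

definition qboundary_ideal :: "real \<Rightarrow> nat \<Rightarrow> qball_elem set" where
  "qboundary_ideal q n = (let B = qball q n; z = qball_gen q n in
     closed_ideal B {\<one>\<^bsub>B\<^esub> \<ominus>\<^bsub>B\<^esub> (\<Oplus>\<^bsub>B\<^esub>j\<in>{1..n}. z j \<otimes>\<^bsub>B\<^esub> (z j)\<^sup>\<star>\<^bsub>B\<^esub>)})"

definition qboundary :: "real \<Rightarrow> nat \<Rightarrow> qball_elem set cstar" where
  "qboundary q n = quotient_cstar (qball q n) (qboundary_ideal q n)"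

definition qboundary_proj :: "real \<Rightarrow> nat \<Rightarrow> qball_elem \<Rightarrow> qball_elem set" where
  "qboundary_proj q n x = qboundary_ideal q n +>\<^bsub>qball q n\<^esub> x"

definition qboundary_gen :: "real \<Rightarrow> nat \<Rightarrow> nat \<Rightarrow> qball_elem set" where
  "qboundary_gen q n i = qboundary_proj q n (qball_gen q n i)"

definition qsphere ::
  "real \<Rightarrow> nat \<Rightarrow> (qball_elem set \<Rightarrow> qball_elem set) \<Rightarrow> (qball_elem \<times> qball_elem) cstar" where
  "qsphere q n \<beta> = (let B = qball q n; \<pi> = qboundary_proj q n in
     \<lparr>carrier = {(x, y). x \<in> carrier B \<and> y \<in> carrier B \<and> \<pi> x = \<beta> (\<pi> y)},
      mult = (\<lambda>(x, y) (x', y'). (x \<otimes>\<^bsub>B\<^esub> x', y \<otimes>\<^bsub>B\<^esub> y')),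
      one = (\<one>\<^bsub>B\<^esub>, \<one>\<^bsub>B\<^esub>),
      zero = (\<zero>\<^bsub>B\<^esub>, \<zero>\<^bsub>B\<^esub>),
      add = (\<lambda>(x, y) (x', y'). (x \<oplus>\<^bsub>B\<^esub> x', y \<oplus>\<^bsub>B\<^esub> y')),
      smult = (\<lambda>c (x, y). (c \<odot>\<^bsub>B\<^esub> x, c \<odot>\<^bsub>B\<^esub> y)),
      star = (\<lambda>(x, y). (x\<^sup>\<star>\<^bsub>B\<^esub>, y\<^sup>\<star>\<^bsub>B\<^esub>)),
      nrm = (\<lambda>(x, y). max (nrm B x) (nrm B y))\<rparr>)"

definition qsphere_gen :: "real \<Rightarrow> nat \<Rightarrow> nat \<Rightarrow> qball_elem \<times> qball_elem" where
  "qsphere_gen q n i = (let B = qball q n; z = qball_gen q n in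
     if i = 0 then
       (sqrt_elem B (\<one>\<^bsub>B\<^esub> \<ominus>\<^bsub>B\<^esub> (z 1)\<^sup>\<star>\<^bsub>B\<^esub> \<otimes>\<^bsub>B\<^esub> z 1
          \<ominus>\<^bsub>B\<^esub> (\<Oplus>\<^bsub>B\<^esub>j\<in>{2..n}. z j \<otimes>\<^bsub>B\<^esub> (z j)\<^sup>\<star>\<^bsub>B\<^esub>)),
        \<ominus>\<^bsub>B\<^esub> (sqrt_elem B (\<one>\<^bsub>B\<^esub> \<ominus>\<^bsub>B\<^esub> (\<Oplus>\<^bsub>B\<^esub>j\<in>{1..n}. z j \<otimes>\<^bsub>B\<^esub> (z j)\<^sup>\<star>\<^bsub>B\<^esub>))))
     else if i = 1 then ((z 1)\<^sup>\<star>\<^bsub>B\<^esub>, z 1)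
     else (z i, z i))"


section \<open>Hilbert spaces and representations\<close>

definition complex_ring :: "complex ring" where
  "complex_ring = \<lparr>carrier = UNIV, mult = (*), one = 1, zero = 0, add = (+)\<rparr>"

text \<open>The ring multiplication and unit inherited from the record \<^type>\<open>module\<close> play no role
  here. The inner product is linear in its first argument.\<close>

record 'h hilbert = "(complex, 'h) module" +
  ip :: "'h \<Rightarrow> 'h \<Rightarrow> complex"

definition hnorm :: "('h, 'm) hilbert_scheme \<Rightarrow> 'h \<Rightarrow> real" where
  "hnorm H v = sqrt (Re (ip H v v))"

definition hlim :: "('h, 'm) hilbert_scheme \<Rightarrow> (nat \<Rightarrow> 'h) \<Rightarrow> 'h \<Rightarrow> bool" where
  "hlim H s v \<longleftrightarrow> (\<lambda>k. hnorm H (s k \<ominus>\<^bsub>H\<^esub> v)) \<longlonglongrightarrow> 0"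

locale hilbert_space = module complex_ring H for H :: "('h, 'm) hilbert_scheme" (structure) +
  assumes ip_add_left: "\<lbrakk>u \<in> carrier H; v \<in> carrier H; w \<in> carrier H\<rbrakk>
      \<Longrightarrow> ip H (u \<oplus> v) w = ip H u w + ip H v w"
    and ip_smult_left: "\<lbrakk>u \<in> carrier H; w \<in> carrier H\<rbrakk> \<Longrightarrow> ip H (c \<odot> u) w = c * ip H u w"
    and ip_commute: "\<lbrakk>u \<in> carrier H; v \<in> carrier H\<rbrakk> \<Longrightarrow> ip H v u = cnj (ip H u v)"
    and ip_pos: "\<lbrakk>v \<in> carrier H; v \<noteq> \<zero>\<rbrakk> \<Longrightarrow> Re (ip H v v) > 0"
    and complete: "\<lbrakk>\<And>k. s k \<in> carrier H;
        \<And>e. e > 0 \<Longrightarrow> \<exists>N. \<forall>k\<ge>N. \<forall>l\<ge>N. hnorm H (s k \<ominus> s l) < e\<rbrakk>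
      \<Longrightarrow> \<exists>v\<in>carrier H. hlim H s v"

definition closed_subspace :: "('h, 'm) hilbert_scheme \<Rightarrow> 'h set \<Rightarrow> bool" where
  "closed_subspace H K \<longleftrightarrow> submodule K complex_ring H \<and>
     (\<forall>s v. (\<forall>k. s k \<in> K) \<and> v \<in> carrier H \<and> hlim H s v \<longrightarrow> v \<in> K)"

definition hlinear :: "('h, 'm) hilbert_scheme \<Rightarrow> ('k, 'l) hilbert_scheme \<Rightarrow> ('h \<Rightarrow> 'k) \<Rightarrow> bool" where
  "hlinear H K T \<longleftrightarrow> T \<in> carrier H \<rightarrow> carrier K \<and>
     (\<forall>u\<in>carrier H. \<forall>v\<in>carrier H. T (u \<oplus>\<^bsub>H\<^esub> v) = T u \<oplus>\<^bsub>K\<^esub> T v) \<and>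
     (\<forall>c. \<forall>v\<in>carrier H. T (c \<odot>\<^bsub>H\<^esub> v) = c \<odot>\<^bsub>K\<^esub> T v)"

definition bounded_operator :: "('h, 'm) hilbert_scheme \<Rightarrow> ('h \<Rightarrow> 'h) \<Rightarrow> bool" where
  "bounded_operator H T \<longleftrightarrow> hlinear H H T \<and> (\<exists>C. \<forall>v\<in>carrier H. hnorm H (T v) \<le> C * hnorm H v)"

definition adjoint_op :: "('h, 'm) hilbert_scheme \<Rightarrow> ('h \<Rightarrow> 'h) \<Rightarrow> 'h \<Rightarrow> 'h" where
  "adjoint_op H T v = (THE u. u \<in> carrier H \<and> (\<forall>w\<in>carrier H. ip H (T w) v = ip H w u))"

definition unitary_op ::
  "('h, 'm) hilbert_scheme \<Rightarrow> ('k, 'l) hilbert_scheme \<Rightarrow> ('h \<Rightarrow> 'k) \<Rightarrow> bool" where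
  "unitary_op H K U \<longleftrightarrow> hlinear H K U \<and> bij_betw U (carrier H) (carrier K) \<and>
     (\<forall>u\<in>carrier H. \<forall>v\<in>carrier H. ip K (U u) (U v) = ip H u v)"

text \<open>A representation is a *-homomorphism into the bounded operators; the last clause says that
  \<open>\<pi> (x\<^sup>\<star>)\<close> is the adjoint of \<open>\<pi> x\<close>.\<close>

definition representation ::
  "('a, 'm) cstar_scheme \<Rightarrow> ('h, 'l) hilbert_scheme \<Rightarrow> ('a \<Rightarrow> 'h \<Rightarrow> 'h) \<Rightarrow> bool" where
  "representation A H \<pi> \<longleftrightarrow> hilbert_space H \<and>
     (\<forall>x\<in>carrier A. bounded_operator H (\<pi> x)) \<and>
     (\<forall>x\<in>carrier A. \<forall>v\<in>carrier H.
        (\<forall>y\<in>carrier A. \<pi> (x \<oplus>\<^bsub>A\<^esub> y) v = \<pi> x v \<oplus>\<^bsub>H\<^esub> \<pi> y v \<and>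
                        \<pi> (x \<otimes>\<^bsub>A\<^esub> y) v = \<pi> x (\<pi> y v)) \<and>
        (\<forall>c. \<pi> (c \<odot>\<^bsub>A\<^esub> x) v = c \<odot>\<^bsub>H\<^esub> \<pi> x v) \<and>
        (\<forall>u\<in>carrier H. ip H (\<pi> x u) v = ip H u (\<pi> (x\<^sup>\<star>\<^bsub>A\<^esub>) v)))"

text \<open>As usual, the zero representation is not counted as irreducible.\<close>

definition irreducible_representation ::
  "('a, 'm) cstar_scheme \<Rightarrow> ('h, 'l) hilbert_scheme \<Rightarrow> ('a \<Rightarrow> 'h \<Rightarrow> 'h) \<Rightarrow> bool" where
  "irreducible_representation A H \<pi> \<longleftrightarrow> representation A H \<pi> \<and>
     (\<exists>x\<in>carrier A. \<exists>v\<in>carrier H. \<pi> x v \<noteq> \<zero>\<^bsub>H\<^esub>) \<and>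
     (\<forall>K. closed_subspace H K \<and> (\<forall>x\<in>carrier A. \<forall>v\<in>K. \<pi> x v \<in> K)
        \<longrightarrow> K = {\<zero>\<^bsub>H\<^esub>} \<or> K = carrier H)"

definition unitarily_equivalent ::
  "('a, 'm) cstar_scheme \<Rightarrow> ('h, 'l) hilbert_scheme \<Rightarrow> ('a \<Rightarrow> 'h \<Rightarrow> 'h) \<Rightarrow>
   ('k, 'r) hilbert_scheme \<Rightarrow> ('a \<Rightarrow> 'k \<Rightarrow> 'k) \<Rightarrow> bool" where
  "unitarily_equivalent A H \<pi> K \<rho> \<longleftrightarrow>
     (\<exists>U. unitary_op H K U \<and> (\<forall>x\<in>carrier A. \<forall>v\<in>carrier H. U (\<pi> x v) = \<rho> x (U v)))"


section \<open>The weighted shifts\<close>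

text \<open>The space with orthonormal basis indexed by the lists \<open>[k\<^sub>1, \<dots>, k\<^sub>m]\<close>, realised as the
  square-summable functions supported on lists of length \<open>m\<close>; for \<open>m = 0\<close> it is
  one-dimensional, spanned by \<open>\<xi> []\<close>.\<close>

definition shift_space :: "nat \<Rightarrow> (nat list \<Rightarrow> complex) hilbert" where
  "shift_space m =
     \<lparr>carrier = {f. (\<forall>k. length k \<noteq> m \<longrightarrow> f k = 0) \<and> (\<lambda>k. (cmod (f k))\<^sup>2) summable_on UNIV},
      mult = undefined, one = undefined, zero = (\<lambda>_. 0), add = (\<lambda>f g k. f k + g k),
      smult = (\<lambda>c f k. c * f k), ip = (\<lambda>f g. \<Sum>\<^sub>\<infinity>k. f k * cnj (g k))\<rparr>"

definition xi :: "nat list \<Rightarrow> nat list \<Rightarrow> complex" (\<open>\<xi>\<close>) where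
  "\<xi> k = (\<lambda>l. if l = k then 1 else 0)"

text \<open>The coordinate \<open>k\<^sub>r\<close> is \<open>k ! (r - 1)\<close>, and \<open>k\<^sub>r\<^sub>+\<^sub>1, \<dots>, k\<^sub>m\<close> is \<open>drop r k\<close>, which is empty
  for \<open>r = m\<close>.\<close>

definition shift_weight :: "real \<Rightarrow> nat \<Rightarrow> nat list \<Rightarrow> real" where
  "shift_weight q r k = sqrt ((1 - q ^ (1 + k ! (r - 1))) * q ^ sum_list (drop r k))"

definition shift_op :: "real \<Rightarrow> nat \<Rightarrow> (nat list \<Rightarrow> complex) \<Rightarrow> nat list \<Rightarrow> complex" where
  "shift_op q r f = (\<lambda>l. if 1 \<le> r \<and> r \<le> length l \<and> l ! (r - 1) > 0
     then (let k = l[r - 1 := l ! (r - 1) - 1] in of_real (shift_weight q r k) * f k)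
     else 0)"

text \<open>The effect of \<open>S\<^sub>r\<close> on the basis, which is how it is usually defined.\<close>

lemma shift_op_xi:
  assumes "1 \<le> r" "r \<le> length k"
  shows "shift_op q r (\<xi> k) =
    (\<lambda>l. of_real (shift_weight q r k) * \<xi> (k[r - 1 := 1 + k ! (r - 1)]) l)"
proof
  fix l :: "nat list"
  let ?k = "l[r - 1 := l ! (r - 1) - 1]"
  have "?k = k \<and> r \<le> length l \<and> l ! (r - 1) > 0 \<longleftrightarrow> l = k[r - 1 := 1 + k ! (r - 1)]"
    using assms by (auto simp: list_eq_iff_nth_eq nth_list_update)
  then show "shift_op q r (\<xi> k) l =
    of_real (shift_weight q r k) * \<xi> (k[r - 1 := 1 + k ! (r - 1)]) l"
    using assms by (auto simp: shift_op_def xi_def Let_def)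
qed


section \<open>The list of representations\<close>

datatype irrep_label = Rho nat complex | Sigma_plus | Sigma_minus

definition irrep_labels :: "nat \<Rightarrow> irrep_label set" where
  "irrep_labels n = {Rho j \<theta> | j \<theta>. 1 \<le> j \<and> j \<le> n \<and> cmod \<theta> = 1} \<union> {Sigma_plus, Sigma_minus}"

fun irrep_dim :: "nat \<Rightarrow> irrep_label \<Rightarrow> nat" where
  "irrep_dim n (Rho j \<theta>) = j - 1"
| "irrep_dim n Sigma_plus = n"
| "irrep_dim n Sigma_minus = n"

text \<open>\<open>irrep_formula q n l i k\<close> is the prescribed image of \<open>\<xi> k\<close> under the \<open>i\<close>-th generator in the
  representation with label \<open>l\<close>.\<close>

fun irrep_formula :: "real \<Rightarrow> nat \<Rightarrow> irrep_label \<Rightarrow> nat \<Rightarrow> nat list \<Rightarrow> nat list \<Rightarrow> complex" where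
  "irrep_formula q n (Rho j \<theta>) i k =
     (if j = 1 then
        if i \<le> n - 1 then (\<lambda>_. 0)
        else (\<lambda>l. \<theta> * \<xi> k l)
      else if j \<le> n - 1 then
        if i \<le> n - j then (\<lambda>_. 0)
        else if i = n - j + 1 then (\<lambda>l. \<theta> * of_real (q powr (real (sum_list k) / 2)) * \<xi> k l)
        else shift_op q (i + j - n - 1) (\<xi> k)
      else
        if i = 0 then (\<lambda>_. 0)
        else if i = 1 then (\<lambda>l. cnj \<theta> * of_real (q powr (real (sum_list k) / 2)) * \<xi> k l)
        else shift_op q (i - 1) (\<xi> k))"
| "irrep_formula q n Sigma_plus i k =
     (if i = 0 then (\<lambda>l. of_real (q powr (real (1 + sum_list k) / 2)) * \<xi> k l)
      else if i = 1 then adjoint_op (shift_space n) (shift_op q 1) (\<xi> k)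
      else shift_op q i (\<xi> k))"
| "irrep_formula q n Sigma_minus i k =
     (if i = 0 then (\<lambda>l. - of_real (q powr (real (sum_list k) / 2)) * \<xi> k l)
      else shift_op q i (\<xi> k))"

end

theory Submission
  imports Defs
begin

text \<open>
  Write \<open>D i = 1 - \<Sum>\<^sub>j\<^sub>>\<^sub>i z\<^sub>j z\<^sub>j\<^sup>*\<close>. The relations give \<open>z\<^sub>i z\<^sub>i\<^sup>* = D i - D (i - 1)\<close> and
  \<open>z\<^sub>i\<^sup>* z\<^sub>i = D i - q D (i - 1)\<close>; \<open>D m\<close> commutes with \<open>z\<^sub>j\<close> for \<open>j \<le> m\<close> and \<open>q\<close>-commutes with it for
  \<open>j > m\<close>. These elements are positive contractions (\<open>pos_D\<close>), so the two roots in \<open>e\<^sub>0\<close> are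
  \<open>q\<^sup>1\<^sup>/\<^sup>2 T\<close> and \<open>T\<close> with \<open>T = (D 0)\<^sup>1\<^sup>/\<^sup>2\<close>.

  Generation: \<open>e\<^sub>0\<^sup>2 = (q D 0, D 0)\<close> and \<open>e\<^sub>0\<close> together separate the two components, so the generated
  algebra contains \<open>J \<oplus> 0\<close> and \<open>0 \<oplus> J\<close>. The second projection of the generated algebra is dense, and a
  gluing is bounded with respect to the quotient norm on the other component
  (\<open>glue_bounded\<close>), so every element of the sphere is a limit of generated ones.

  Irreducible representations of the ball: let \<open>m\<close> be least with \<open>D m\<close> acting nontrivially. Then
  \<open>z\<^sub>i = 0\<close> for \<open>i < m\<close>, and the powers \<open>(D m)\<^sup>k v\<close> converge to vectors fixed by \<open>D m\<close>; not all of these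
  limits vanish (\<open>vacuum_exists\<close>). Fixed vectors are annihilated by \<open>z\<^sub>j\<^sup>*\<close>, \<open>j > m\<close>, while \<open>z\<^sub>m\<close> acts
  on them as a unitary, which irreducibility forces to be a scalar (\<open>coherent_of_vacuum\<close>). So there is
  a unit vector \<open>p\<close> with \<open>z\<^sub>i\<^sup>* p = c\<^sub>i p\<close> for all \<open>i\<close>. Normal ordering shows that the \<open>c\<^sub>i\<close> determine
  the vector state of \<open>p\<close>, hence the representation (\<open>coherent_equivalent\<close>). The models on
  \<open>shift_space (n - m)\<close> realise exactly the possible values: \<open>c\<^sub>m\<close> on the unit circle and all other
  \<open>c\<^sub>i = 0\<close>.

  The sphere: in an irreducible representation one of the orthogonal ideals \<open>J \<oplus> 0\<close>, \<open>0 \<oplus> J\<close>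
  vanishes, so the representation factors through a projection to the ball. Representations that
  kill \<open>J \<oplus> 0\<close> come from the second component and give \<open>\<sigma>\<^sub>-\<close> and all \<open>\<rho>\<^sub>j\<close>; the one other
  comes from the first component with \<open>D 0\<close> acting nontrivially and is \<open>\<sigma>\<^sub>+\<close>.
\<close>

text \<open>The formulae below carry many subscripted operations, so the structure argument may also be
  written as a plain subscript; \<open>cr\<close> is the carrier.\<close>

unbundle no rtrancl_syntax

syntax "_index" :: "logic => index" (\<open>\<^sub>_\<close> [1000])

notation star (\<open>_\<^sup>*\<index>\<close> [1000] 999)

notation LIMSEQ (infix \<open>---->\<close> 60)

notation mult (infixl \<open>\<cdot>\<index>\<close> 70)

abbreviation (input) cr where "cr == carrier"

abbreviation (input) polys where "polys == free_star_carrier"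

section \<open>Abstract C*-algebras carried by records\<close>

text \<open>*-algebras and C*-seminorms are separated from C*-algebras because the free *-algebra with its universal seminorm has to be treated before
  it is completed.\<close>

locale star_alg = ring A for A :: "('a, 'm) cstar_scheme" (structure) +
assumes smult_closed [simp, intro]: "x : cr A ==> c \<odot> x : cr A"
 and smult_r_distr: "x : cr A ==> y : cr A ==> c \<odot> (x \<oplus> y) = c \<odot> x \<oplus> c \<odot> y"
 and smult_l_distr: "x : cr A ==> (c + d) \<odot> x = c \<odot> x \<oplus> d \<odot> x"
 and smult_smult: "x : cr A ==> c \<odot> (d \<odot> x) = (c * d) \<odot> x"
 and smult_one [simp]: "x : cr A ==> 1 \<odot> x = x"
 and smult_mult_left: "x : cr A ==> y : cr A ==> (c \<odot> x) \<cdot> y = c \<odot> (x \<cdot> y)"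
 and smult_mult_right: "x : cr A ==> y : cr A ==> x \<cdot> (c \<odot> y) = c \<odot> (x \<cdot> y)"
 and star_closed [simp, intro]: "x : cr A ==> x\<^sup>* : cr A"
 and star_add: "x : cr A ==> y : cr A ==> (x \<oplus> y)\<^sup>* = x\<^sup>* \<oplus> y\<^sup>*"
 and star_mult: "x : cr A ==> y : cr A ==> (x \<cdot> y)\<^sup>* = y\<^sup>* \<cdot> x\<^sup>*"
 and star_smult: "x : cr A ==> (c \<odot> x)\<^sup>* = cnj c \<odot> x\<^sup>*"
 and star_star [simp]: "x : cr A ==> (x\<^sup>*)\<^sup>* = x"

locale seminorm_alg = star_alg +
assumes nrm_nonneg: "x : cr A ==> 0 <= nrm A x"
 and nrm_triangle: "x : cr A ==> y : cr A ==> nrm A (x \<oplus> y) <= nrm A x + nrm A y"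
 and nrm_mult: "x : cr A ==> y : cr A ==> nrm A (x \<cdot> y) <= nrm A x * nrm A y"
 and nrm_smult: "x : cr A ==> nrm A (c \<odot> x) = cmod c * nrm A x"
 and nrm_cstar: "x : cr A ==> nrm A (x\<^sup>* \<cdot> x) = (nrm A x)\<^sup>2"

locale cstar_alg = seminorm_alg +
assumes nrm_eq_0D: "x : cr A ==> nrm A x = 0 ==> x = \<zero>"
 and nrm_complete: "(!!k. s k : cr A) ==>
  (!!e. e > 0 ==> EX N. ALL k>=N. ALL l>=N. nrm A (s k \<ominus> s l) < e) ==>
  EX x:cr A. norm_lim A s x"

context star_alg
begin

lemma smult_zero_right [simp]: "c \<odot> \<zero> = \<zero>"
proof -
have "c \<odot> \<zero> \<oplus> c \<odot> \<zero> = c \<odot> \<zero> \<oplus> \<zero>"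
 using smult_r_distr[of \<zero> \<zero> c] by simp
then show ?thesis by (simp add: add.l_cancel_one)
qed

lemma smult_zero_left [simp]: "x : cr A ==> 0 \<odot> x = \<zero>"
proof -
assume x: "x : cr A"
have "0 \<odot> x \<oplus> 0 \<odot> x = 0 \<odot> x \<oplus> \<zero>"
 using smult_l_distr[of x 0 0] x by simp
then show ?thesis using x by (simp add: add.l_cancel_one)
qed

lemma smult_neg: "x : cr A ==> (- c) \<odot> x = \<ominus> (c \<odot> x)"
proof -
assume x: "x : cr A"
have "(- c) \<odot> x \<oplus> c \<odot> x = \<zero>" using smult_l_distr[of x "-c" c] x by simp
then show ?thesis using minus_equality[of "(- c) \<odot> x" "c \<odot> x"] x by simp
qed

lemma minus_eq_smult: "x : cr A ==> \<ominus> x = (- 1) \<odot> x"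
by (simp add: smult_neg)

lemma diff_eq_smult: "x : cr A ==> y : cr A ==> x \<ominus> y = x \<oplus> (- 1) \<odot> y"
by (simp add: minus_eq minus_eq_smult)

lemma smult_minus: "x : cr A ==> c \<odot> (\<ominus> x) = (- c) \<odot> x"
by (simp add: minus_eq_smult smult_smult)

lemma smult_diff: "x : cr A ==> y : cr A ==> c \<odot> (x \<ominus> y) = c \<odot> x \<ominus> c \<odot> y"
by (simp add: diff_eq_smult smult_r_distr smult_smult)

lemma star_minus: "x : cr A ==> (\<ominus> x)\<^sup>* = \<ominus> (x\<^sup>*)"
by (simp add: minus_eq_smult star_smult)

lemma star_diff: "x : cr A ==> y : cr A ==> (x \<ominus> y)\<^sup>* = x\<^sup>* \<ominus> y\<^sup>*"
by (simp add: minus_eq star_add star_minus)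

lemma star_zero [simp]: "\<zero>\<^sup>* = \<zero>"
using star_smult[of \<zero> 0] by simp

lemma star_one [simp]: "\<one>\<^sup>* = \<one>"
proof -
have "\<one>\<^sup>* = \<one>\<^sup>* \<cdot> (\<one>\<^sup>*)\<^sup>*" by simp
also have "... = (\<one>\<^sup>* \<cdot> \<one>)\<^sup>*" by (subst star_mult) auto
finally show ?thesis by simp
qed

text \<open>Rewriting with these rules multiplies out an expression into a sum of scalar multiples of
  words.\<close>

lemmas expand_simps = diff_eq_smult minus_eq_smult smult_r_distr smult_smult smult_mult_left
smult_mult_right l_distr r_distr m_assoc star_add star_mult star_smult

lemma smult_collect:
"x : cr A ==> c \<odot> x \<oplus> d \<odot> x = (c + d) \<odot> x"
"x : cr A ==> y : cr A ==> c \<odot> x \<oplus> (d \<odot> x \<oplus> y) = (c + d) \<odot> x \<oplus> y"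
"x : cr A ==> x \<oplus> d \<odot> x = (1 + d) \<odot> x"
"x : cr A ==> y : cr A ==> x \<oplus> (d \<odot> x \<oplus> y) = (1 + d) \<odot> x \<oplus> y"
"x : cr A ==> c \<odot> x \<oplus> x = (c + 1) \<odot> x"
"x : cr A ==> y : cr A ==> c \<odot> x \<oplus> (x \<oplus> y) = (c + 1) \<odot> x \<oplus> y"
"x : cr A ==> x \<oplus> x = 2 \<odot> x"
"x : cr A ==> y : cr A ==> x \<oplus> (x \<oplus> y) = 2 \<odot> x \<oplus> y"
using smult_l_distr[of x c d] smult_l_distr[of x 1 d] smult_l_distr[of x c 1] smult_l_distr[of x 1 1]
by (simp_all add: a_assoc[symmetric])

definition self_adj :: "'a => bool" where
"self_adj x \<longleftrightarrow> x : cr A & x\<^sup>* = x"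

lemma self_adjD: "self_adj x ==> x : cr A"
"self_adj x ==> x\<^sup>* = x"
by (simp_all add: self_adj_def)

lemma self_adjI: "x : cr A ==> x\<^sup>* = x ==> self_adj x"
by (simp add: self_adj_def)

declare self_adjD [simp]

lemma self_adj_combine:
"self_adj x ==> self_adj y ==> self_adj (x \<oplus> y)"
"self_adj x ==> self_adj y ==> self_adj (x \<ominus> y)"
"self_adj x ==> self_adj (of_real r \<odot> x)"
"self_adj x ==> self_adj (x \<cdot> x)"
"self_adj \<one>" "self_adj \<zero>"
by (auto intro!: self_adjI simp: star_add star_diff star_smult star_mult)

lemma self_adj_star_mult: "x : cr A ==> self_adj (x\<^sup>* \<cdot> x)"
by (auto intro!: self_adjI simp: star_mult)

lemma self_adj_pow: "self_adj x ==> self_adj (x [^] (k::nat))"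
proof (induction k)
case (Suc k)
have "x [^] Suc k = x \<cdot> x [^] k" using Suc.prems nat_pow_Suc2 by auto
then show ?case using Suc by (auto intro!: self_adjI simp: star_mult)
qed (auto simp: self_adj_combine)

lemma self_adj_commuting_mult:
"self_adj x ==> self_adj y ==> x \<cdot> y = y \<cdot> x ==> self_adj (x \<cdot> y)"
by (auto intro!: self_adjI simp: star_mult)

end

context seminorm_alg
begin

lemma nrm_zero [simp]: "nrm A \<zero> = 0"
using nrm_smult[of \<zero> 0] by simp

lemma nrm_minus [simp]: "x : cr A ==> nrm A (\<ominus> x) = nrm A x"
by (simp add: minus_eq_smult nrm_smult)

lemma nrm_diff: "x : cr A ==> y : cr A ==> nrm A (x \<ominus> y) <= nrm A x + nrm A y"
using nrm_triangle[of x "\<ominus> y"] by (simp add: minus_eq)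

lemma nrm_diff_commute: "x : cr A ==> y : cr A ==> nrm A (x \<ominus> y) = nrm A (y \<ominus> x)"
using nrm_minus[of "x \<ominus> y"] by (simp add: minus_eq minus_add a_comm)

lemma nrm_diff_triangle:
assumes "x : cr A" "y : cr A" "z : cr A"
shows "nrm A (x \<ominus> z) <= nrm A (x \<ominus> y) + nrm A (y \<ominus> z)"
proof -
have "x \<ominus> z = (x \<ominus> y) \<oplus> (y \<ominus> z)" using assms
 by algebra
then show ?thesis using nrm_triangle[of "x \<ominus> y" "y \<ominus> z"] assms by simp
qed

lemma nrm_diff_abs:
assumes "x : cr A" "y : cr A"
shows "\<bar>nrm A x - nrm A y\<bar> <= nrm A (x \<ominus> y)"
proof -
have "x = (x \<ominus> y) \<oplus> y" "y = (y \<ominus> x) \<oplus> x" using assms by algebra+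
then have "nrm A x <= nrm A (x \<ominus> y) + nrm A y" "nrm A y <= nrm A (y \<ominus> x) + nrm A x"
 using nrm_triangle assms by (metis minus_closed)+
then show ?thesis using nrm_diff_commute assms by fastforce
qed

lemma nrm_star [simp]: assumes x: "x : cr A" shows "nrm A (x\<^sup>*) = nrm A x"
proof -
have le: "nrm A y <= nrm A (y\<^sup>*)" if y: "y : cr A" for y
proof (cases "nrm A y = 0")
 case False
 have "nrm A y * nrm A y <= nrm A (y\<^sup>*) * nrm A y"
  using nrm_cstar[OF y] nrm_mult[of "y\<^sup>*" y] y by (simp add: power2_eq_square)
 then show ?thesis using False nrm_nonneg[OF y] by (simp add: mult_le_cancel_right)
qed (use nrm_nonneg y in auto)
show ?thesis using le[of x] le[of "x\<^sup>*"] x by simp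
qed

lemma nrm_one_le: "nrm A \<one> <= 1"
proof -
have "(nrm A \<one>)\<^sup>2 = nrm A \<one>" using nrm_cstar[of \<one>] by simp
then show ?thesis using nrm_nonneg[of \<one>] by (auto simp: power2_eq_square)
qed

lemma nrm_pow: "x : cr A ==> nrm A (x [^] Suc k) <= nrm A x ^ Suc k"
proof (induction k)
case (Suc k)
have "nrm A (x [^] Suc (Suc k)) <= nrm A (x [^] Suc k) * nrm A x"
 using Suc.prems nrm_mult[of "x [^] Suc k" x] by simp
also have "... <= nrm A x ^ Suc k * nrm A x"
 using Suc nrm_nonneg by (intro mult_right_mono) auto
finally show ?case by (simp add: mult.commute)
qed simp

lemma nrm_self_adj_square: "self_adj x ==> nrm A (x \<cdot> x) = (nrm A x)\<^sup>2"
using nrm_cstar[of x] by auto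

text \<open>For self-adjoint elements the norm is the spectral radius.\<close>

lemma nrm_self_adj_pow2: "self_adj x ==> nrm A (x [^] (2 ^ k :: nat)) = nrm A x ^ 2 ^ k"
proof (induction k)
case (Suc k)
have "x [^] (2 ^ Suc k :: nat) = x [^] (2 ^ k :: nat) \<cdot> x [^] (2 ^ k :: nat)"
 using Suc.prems by (simp add: nat_pow_mult mult_2)
then show ?case using Suc nrm_self_adj_square[OF self_adj_pow[OF Suc.prems]]
 by (simp add: power_mult[symmetric] mult.commute)
qed auto

lemma norm_lim_const: "x : cr A ==> norm_lim A (%_. x) x"
by (simp add: norm_lim_def minus_eq r_neg)

lemma norm_lim_squeeze:
assumes "!!k. s k : cr A" "x : cr A" "!!k. nrm A (s k \<ominus> x) <= b k" "b ----> 0"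
shows "norm_lim A s x"
unfolding norm_lim_def
by (rule tendsto_sandwich[OF _ _ tendsto_const assms(4)])
  (use assms nrm_nonneg in auto)

lemma norm_lim_add:
assumes "!!k. s k : cr A" "x : cr A" "!!k. t k : cr A" "y : cr A"
 "norm_lim A s x" "norm_lim A t y"
shows "norm_lim A (%k. s k \<oplus> t k) (x \<oplus> y)"
proof (rule norm_lim_squeeze[where b="%k. nrm A (s k \<ominus> x) + nrm A (t k \<ominus> y)"])
show "nrm A (s k \<oplus> t k \<ominus> (x \<oplus> y)) <= nrm A (s k \<ominus> x) + nrm A (t k \<ominus> y)" for k
proof -
 have "s k \<oplus> t k \<ominus> (x \<oplus> y) = (s k \<ominus> x) \<oplus> (t k \<ominus> y)"
  using assms(1)[of k] assms(2) assms(3)[of k] assms(4) by algebra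
 then show ?thesis using nrm_triangle[of "s k \<ominus> x" "t k \<ominus> y"] assms by simp
qed
show "(%k. nrm A (s k \<ominus> x) + nrm A (t k \<ominus> y)) ----> 0"
 using assms(5,6) unfolding norm_lim_def by (rule tendsto_add_zero)
qed (use assms in auto)

lemma norm_lim_smult:
assumes "!!k. s k : cr A" "x : cr A" "norm_lim A s x"
shows "norm_lim A (%k. c \<odot> s k) (c \<odot> x)"
proof -
have "nrm A (c \<odot> s k \<ominus> c \<odot> x) = cmod c * nrm A (s k \<ominus> x)" for k
 using assms(1)[of k] assms(2) by (simp add: smult_diff[symmetric] nrm_smult)
then show ?thesis using assms(3) unfolding norm_lim_def by (simp add: tendsto_mult_right_zero)
qed

lemma norm_lim_minus:
assumes "!!k. s k : cr A" "x : cr A" "norm_lim A s x"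
shows "norm_lim A (%k. \<ominus> s k) (\<ominus> x)"
using norm_lim_smult[OF assms, of "-1"] assms by (simp add: minus_eq_smult)

lemma norm_lim_diff:
assumes "!!k. s k : cr A" "x : cr A" "!!k. t k : cr A" "y : cr A"
 "norm_lim A s x" "norm_lim A t y"
shows "norm_lim A (%k. s k \<ominus> t k) (x \<ominus> y)"
using norm_lim_add[OF assms(1,2) _ _ assms(5), of "%k. \<ominus> t k" "\<ominus> y"] norm_lim_minus[OF assms(3,4,6)] assms
by (simp add: minus_eq)

lemma norm_lim_star:
assumes "!!k. s k : cr A" "x : cr A" "norm_lim A s x"
shows "norm_lim A (%k. (s k)\<^sup>*) (x\<^sup>*)"
proof -
have "nrm A ((s k)\<^sup>* \<ominus> x\<^sup>*) = nrm A (s k \<ominus> x)" for k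
 using assms(1)[of k] assms(2) by (simp add: star_diff[symmetric])
then show ?thesis using assms(3) unfolding norm_lim_def by simp
qed

lemma norm_lim_nrm:
assumes "!!k. s k : cr A" "x : cr A" "norm_lim A s x"
shows "(%k. nrm A (s k)) ----> nrm A x"
proof -
have "(%k. nrm A (s k) - nrm A x) ----> 0"
 by (rule tendsto_rabs_zero_cancel, rule tendsto_sandwich[OF _ _ tendsto_const assms(3)[unfolded norm_lim_def]])
   (use nrm_diff_abs assms in auto)
then show ?thesis by (simp add: LIM_zero_iff)
qed

lemma norm_lim_mult:
assumes s: "!!k. s k : cr A" "x : cr A" "!!k. t k : cr A" "y : cr A"
 and l: "norm_lim A s x" "norm_lim A t y"
shows "norm_lim A (%k. s k \<cdot> t k) (x \<cdot> y)"
proof (rule norm_lim_squeeze[where b="%k. nrm A (s k) * nrm A (t k \<ominus> y) + nrm A (s k \<ominus> x) * nrm A y"])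
show "nrm A (s k \<cdot> t k \<ominus> x \<cdot> y) <= nrm A (s k) * nrm A (t k \<ominus> y) + nrm A (s k \<ominus> x) * nrm A y" for k
proof -
 have "s k \<cdot> t k \<ominus> x \<cdot> y = s k \<cdot> (t k \<ominus> y) \<oplus> (s k \<ominus> x) \<cdot> y"
  using s(1)[of k] s(2) s(3)[of k] s(4) by algebra
 then have "nrm A (s k \<cdot> t k \<ominus> x \<cdot> y) <= nrm A (s k \<cdot> (t k \<ominus> y)) + nrm A ((s k \<ominus> x) \<cdot> y)"
  using nrm_triangle s by simp
 also have "... <= nrm A (s k) * nrm A (t k \<ominus> y) + nrm A (s k \<ominus> x) * nrm A y"
  by (intro add_mono nrm_mult) (use s in auto)
 finally show ?thesis .
qed
have "(%k. nrm A (s k) * nrm A (t k \<ominus> y) + nrm A (s k \<ominus> x) * nrm A y) ----> nrm A x * 0 + 0 * nrm A y"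
 using l unfolding norm_lim_def
 by (intro tendsto_intros norm_lim_nrm s) (auto simp: norm_lim_def)
then show "(%k. nrm A (s k) * nrm A (t k \<ominus> y) + nrm A (s k \<ominus> x) * nrm A y) ----> 0" by simp
qed (use s in auto)

lemma norm_lim_Suc: "norm_lim A s x ==> norm_lim A (%k. s (Suc k)) x"
unfolding norm_lim_def by (rule LIMSEQ_Suc)

end

context cstar_alg
begin

lemma nrm_diff_eq_0D: "x : cr A ==> y : cr A ==> nrm A (x \<ominus> y) = 0 ==> x = y"
proof -
assume a: "x : cr A" "y : cr A" "nrm A (x \<ominus> y) = 0"
have "x = (x \<ominus> y) \<oplus> y" using a by algebra
also have "x \<ominus> y = \<zero>" using nrm_eq_0D a by simp
finally show "x = y" using a by simp
qed

lemma norm_lim_unique: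
assumes "!!k. s k : cr A" "x : cr A" "y : cr A" "norm_lim A s x" "norm_lim A s y"
shows "x = y"
proof -
have "norm_lim A (%k. s k \<ominus> s k) (x \<ominus> y)" by (rule norm_lim_diff) (use assms in auto)
moreover have "s k \<ominus> s k = \<zero>" for k using assms(1)[of k] by (simp add: minus_eq r_neg)
ultimately have "(%k. nrm A \<zero>) ----> nrm A (x \<ominus> y)"
 using norm_lim_nrm[of "%k. \<zero>" "x \<ominus> y"] assms by simp
then have "nrm A (x \<ominus> y) = 0" by (simp add: LIMSEQ_const_iff)
then show ?thesis using nrm_diff_eq_0D assms by blast
qed

lemma star_mult_eq_0D: "x : cr A ==> x\<^sup>* \<cdot> x = \<zero> ==> x = \<zero>"
using nrm_cstar[of x] nrm_eq_0D[of x] by simp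

lemma self_adj_square_0D: "self_adj x ==> x \<cdot> x = \<zero> ==> x = \<zero>"
using star_mult_eq_0D[of x] by auto

lemma self_adj_cube_0D: "self_adj x ==> x \<cdot> (x \<cdot> x) = \<zero> ==> x = \<zero>"
proof -
assume x: "self_adj x" "x \<cdot> (x \<cdot> x) = \<zero>"
have "(x \<cdot> x) \<cdot> (x \<cdot> x) = \<zero>" using x by (simp add: m_assoc[of x])
then have "x \<cdot> x = \<zero>" using self_adj_square_0D[OF self_adj_combine(4)] x by simp
then show ?thesis using self_adj_square_0D x by simp
qed

lemma norm_lim_self_adj:
assumes "!!k. self_adj (s k)" "x : cr A" "norm_lim A s x"
shows "self_adj x"
proof -
have "norm_lim A (%k. (s k)\<^sup>*) (x\<^sup>*)" by (rule norm_lim_star) (use assms in auto)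
then have "norm_lim A s (x\<^sup>*)" using assms by simp
then show ?thesis using norm_lim_unique[of s "x\<^sup>*" x] assms by (auto intro!: self_adjI)
qed

end

section \<open>Square roots\<close>

primrec sqrt_iter :: "('a, 'm) cstar_scheme => 'a => nat => 'a" where
"sqrt_iter A x 0 = \<zero>\<^sub>A"
| "sqrt_iter A x (Suc k) = (1/2) \<odot>\<^sub>A (x \<oplus>\<^sub>A sqrt_iter A x k \<cdot>\<^sub>A sqrt_iter A x k)"

primrec sqrt_bound :: "nat => real" where
"sqrt_bound 0 = 0"
| "sqrt_bound (Suc k) = (1 + (sqrt_bound k)\<^sup>2) / 2"

lemma sqrt_bound_props: "0 <= sqrt_bound k & sqrt_bound k <= 1 & sqrt_bound k <= sqrt_bound (Suc k)"
proof (induction k)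
case (Suc k)
then have "(sqrt_bound k)\<^sup>2 <= (sqrt_bound (Suc k))\<^sup>2" "(sqrt_bound k)\<^sup>2 <= 1"
 by (auto intro: power_mono simp del: sqrt_bound.simps simp: abs_square_le_1)
then show ?case by simp
qed simp

lemma sqrt_bound_convergent: "convergent sqrt_bound"
by (rule Bseq_mono_convergent)
  (use sqrt_bound_props in \<open>auto intro!: BseqI'[of _ 1] incseq_SucI simp del: sqrt_bound.simps simp: monoD incseq_def[symmetric]\<close>)

context cstar_alg
begin

text \<open>For self-adjoint \<open>a\<close> this is positivity together with norm at most 2. No spectral theory is needed to state it, and it makes
  the iteration for the square root converge.\<close>

definition pos :: "'a => bool" where
"pos a \<longleftrightarrow> self_adj a & nrm A (\<one> \<ominus> a) <= 1"

text \<open>If \<open>y\<close> is the limit of \<open>y \<mapsto> (x + y\<^sup>2)/2\<close>, then \<open>(1 - y)\<^sup>2 = 1 - x\<close>; the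
  iteration is run at \<open>x = 1 - a\<close>.\<close>

definition csqrt :: "'a => 'a" where
"csqrt a = \<one> \<ominus> (THE y. y : cr A & norm_lim A (sqrt_iter A (\<one> \<ominus> a)) y)"

lemma sqrt_iter_closed [simp, intro]: "x : cr A ==> sqrt_iter A x k : cr A"
by (induction k) auto

lemma sqrt_iter_bounds:
assumes x: "x : cr A" "nrm A x <= 1"
shows "nrm A (sqrt_iter A x k) <= sqrt_bound k \<and>
 nrm A (sqrt_iter A x (Suc k) \<ominus> sqrt_iter A x k) <= sqrt_bound (Suc k) - sqrt_bound k"
proof (induction k)
case 0
have "sqrt_iter A x (Suc 0) \<ominus> sqrt_iter A x 0 = (1/2) \<odot> x" using x by (simp add: minus_eq)
then show ?case using x by (simp add: nrm_smult)
next
case (Suc k)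
define y where "y = sqrt_iter A x k"
define y' where "y' = sqrt_iter A x (Suc k)"
have yc: "y : cr A" "y' : cr A" using x unfolding y_def y'_def by blast+
have e: "y' = (1/2) \<odot> (x \<oplus> y \<cdot> y)" by (simp add: y_def y'_def)
have b: "nrm A y <= sqrt_bound k" "nrm A (y' \<ominus> y) <= sqrt_bound (Suc k) - sqrt_bound k"
 using Suc by (auto simp: y_def y'_def simp del: sqrt_iter.simps sqrt_bound.simps)
have b': "nrm A y' <= sqrt_bound (Suc k)"
proof -
 have "nrm A y' <= (nrm A x + nrm A y * nrm A y) / 2"
  unfolding e using nrm_triangle[of x "y \<cdot> y"] nrm_mult[of y y] x yc by (simp add: nrm_smult)
 also have "... <= sqrt_bound (Suc k)"
  using x(2) b(1) nrm_nonneg[OF yc(1)] by (simp add: power2_eq_square) (intro add_mono mult_mono, auto)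
 finally show ?thesis .
qed
have "sqrt_iter A x (Suc (Suc k)) \<ominus> y' = (1/2) \<odot> (y' \<cdot> (y' \<ominus> y) \<oplus> (y' \<ominus> y) \<cdot> y)"
proof -
 have "sqrt_iter A x (Suc (Suc k)) \<ominus> y' = (1/2) \<odot> (x \<oplus> y' \<cdot> y') \<ominus> (1/2) \<odot> (x \<oplus> y \<cdot> y)"
  using e by (simp add: y'_def[symmetric] del: sqrt_iter.simps) (simp add: y'_def y_def)
 also have "... = (1/2) \<odot> ((x \<oplus> y' \<cdot> y') \<ominus> (x \<oplus> y \<cdot> y))"
  using x yc by (simp add: smult_diff)
 also have "(x \<oplus> y' \<cdot> y') \<ominus> (x \<oplus> y \<cdot> y) = y' \<cdot> (y' \<ominus> y) \<oplus> (y' \<ominus> y) \<cdot> y"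
  using x(1) yc by algebra
 finally show ?thesis .
qed
then have "nrm A (sqrt_iter A x (Suc (Suc k)) \<ominus> y')
  <= (nrm A y' * nrm A (y' \<ominus> y) + nrm A (y' \<ominus> y) * nrm A y) / 2"
 using nrm_triangle[of "y' \<cdot> (y' \<ominus> y)" "(y' \<ominus> y) \<cdot> y"] nrm_mult[of y' "y' \<ominus> y"] nrm_mult[of "y' \<ominus> y" y] yc
 by (simp add: nrm_smult)
also have "... <= (sqrt_bound (Suc k) * (sqrt_bound (Suc k) - sqrt_bound k)
  + (sqrt_bound (Suc k) - sqrt_bound k) * sqrt_bound k) / 2"
 using b b' nrm_nonneg yc sqrt_bound_props
 by (intro divide_right_mono add_mono mult_mono) (auto simp del: sqrt_bound.simps)
also have "... = ((sqrt_bound (Suc k))\<^sup>2 - (sqrt_bound k)\<^sup>2) / 2"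
 by (simp add: algebra_simps power2_eq_square del: sqrt_bound.simps)
also have "... = sqrt_bound (Suc (Suc k)) - sqrt_bound (Suc k)"
 by (simp only: sqrt_bound.simps(2)[of "Suc k"] sqrt_bound.simps(2)[of k]) (simp add: field_simps)
finally show ?case using b' by (simp add: y'_def del: sqrt_iter.simps sqrt_bound.simps)
qed

lemma sqrt_iter_diff:
assumes x: "x : cr A" "nrm A x <= 1"
shows "nrm A (sqrt_iter A x (k + d) \<ominus> sqrt_iter A x k) <= sqrt_bound (k + d) - sqrt_bound k"
proof (induction d)
case 0 then show ?case using x by (simp add: minus_eq r_neg)
next
case (Suc d)
show ?case
 using Suc nrm_diff_triangle[of "sqrt_iter A x (k + Suc d)" "sqrt_iter A x (k + d)" "sqrt_iter A x k"]
  sqrt_iter_bounds[OF x, of "k + d"] sqrt_iter_closed[OF x(1)]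
 by (simp del: sqrt_iter.simps sqrt_bound.simps)
qed

lemma sqrt_iter_lim:
assumes x: "x : cr A" "nrm A x <= 1"
shows "EX y:cr A. norm_lim A (sqrt_iter A x) y"
proof (rule nrm_complete)
fix e :: real assume e: "e > 0"
have "Cauchy sqrt_bound" using sqrt_bound_convergent by (rule convergent_Cauchy)
then obtain N where N: "!!k l. k >= N ==> l >= N ==> \<bar>sqrt_bound k - sqrt_bound l\<bar> < e"
 using e unfolding Cauchy_def dist_real_def by meson
have le: "nrm A (sqrt_iter A x k \<ominus> sqrt_iter A x l) < e" if "N <= l" "l <= k" for k l
 using sqrt_iter_diff[OF x, of l "k - l"] N[of k l] that by auto
have "nrm A (sqrt_iter A x k \<ominus> sqrt_iter A x l) < e" if "N <= l" "N <= k" for k l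
 using le[of l k] le[of k l] that nrm_diff_commute[of "sqrt_iter A x k" "sqrt_iter A x l"] x
 by (cases "l <= k") auto
then show "EX N. ALL k>=N. ALL l>=N. nrm A (sqrt_iter A x k \<ominus> sqrt_iter A x l) < e" by blast
qed (use x in auto)

lemma posD: "pos a ==> self_adj a" "pos a ==> nrm A (\<one> \<ominus> a) <= 1" "pos a ==> a : cr A"
by (auto simp: pos_def)

lemma csqrt_lim:
assumes "pos a"
shows "csqrt a : cr A" "norm_lim A (sqrt_iter A (\<one> \<ominus> a)) (\<one> \<ominus> csqrt a)"
proof -
have a: "\<one> \<ominus> a : cr A" "nrm A (\<one> \<ominus> a) <= 1" using assms by (auto simp: pos_def)
obtain y where y: "y : cr A" "norm_lim A (sqrt_iter A (\<one> \<ominus> a)) y"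
 using sqrt_iter_lim[OF a] by auto
have "csqrt a = \<one> \<ominus> y" unfolding csqrt_def
 by (rule arg_cong[where f="%y. \<one> \<ominus> y"], rule the_equality)
   (use y norm_lim_unique[OF sqrt_iter_closed[OF a(1)]] in auto)
moreover have "\<one> \<ominus> (\<one> \<ominus> y) = y" using y(1) by algebra
ultimately show "csqrt a : cr A" "norm_lim A (sqrt_iter A (\<one> \<ominus> a)) (\<one> \<ominus> csqrt a)"
 using y by auto
qed

lemma sqrt_iter_self_adj: "self_adj x ==> self_adj (sqrt_iter A x k)"
by (induction k) (auto intro!: self_adj_combine self_adj_combine(3)[of _ "1/2", simplified])

lemma csqrt_pos:
assumes "pos a" shows "pos (csqrt a)"
proof -
have a: "\<one> \<ominus> a : cr A" "nrm A (\<one> \<ominus> a) <= 1" using assms by (auto simp: pos_def)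
have "self_adj (\<one> \<ominus> csqrt a)"
 by (rule norm_lim_self_adj[OF sqrt_iter_self_adj _ csqrt_lim(2)[OF assms]])
   (use assms csqrt_lim(1)[OF assms] in \<open>auto simp: pos_def intro!: self_adj_combine\<close>)
then have "self_adj (\<one> \<ominus> (\<one> \<ominus> csqrt a))" by (auto intro: self_adj_combine)
moreover have "\<one> \<ominus> (\<one> \<ominus> csqrt a) = csqrt a" using csqrt_lim(1)[OF assms] by algebra
moreover have "nrm A (\<one> \<ominus> csqrt a) <= 1"
proof (rule LIMSEQ_le_const2)
 show "(%k. nrm A (sqrt_iter A (\<one> \<ominus> a) k)) ----> nrm A (\<one> \<ominus> csqrt a)"
  by (rule norm_lim_nrm) (use a csqrt_lim[OF assms] in auto)
 show "EX N. ALL k>=N. nrm A (sqrt_iter A (\<one> \<ominus> a) k) <= 1"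
  using sqrt_iter_bounds[OF a] sqrt_bound_props order_trans by blast
qed
ultimately show ?thesis by (simp add: pos_def)
qed

lemma csqrt_self_adj: "pos a ==> self_adj (csqrt a)"
using csqrt_pos posD by blast

lemma csqrt_square:
assumes "pos a" shows "csqrt a \<cdot> csqrt a = a"
proof -
define x where "x = \<one> \<ominus> a"
define y where "y = \<one> \<ominus> csqrt a"
have c: "x : cr A" "y : cr A" "a : cr A" "csqrt a : cr A"
 using csqrt_lim(1)[OF assms] assms by (auto simp: x_def y_def pos_def)
have l: "norm_lim A (sqrt_iter A x) y" using csqrt_lim(2)[OF assms] by (simp add: x_def y_def)
have "norm_lim A (%k. (1/2) \<odot> (x \<oplus> sqrt_iter A x k \<cdot> sqrt_iter A x k)) ((1/2) \<odot> (x \<oplus> y \<cdot> y))"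
 by (intro norm_lim_smult norm_lim_add norm_lim_mult norm_lim_const l) (use c in auto)
then have "norm_lim A (%k. sqrt_iter A x (Suc k)) ((1/2) \<odot> (x \<oplus> y \<cdot> y))" by simp
moreover have "norm_lim A (%k. sqrt_iter A x (Suc k)) y" using l by (rule norm_lim_Suc)
ultimately have "y = (1/2) \<odot> (x \<oplus> y \<cdot> y)"
 using norm_lim_unique[of "%k. sqrt_iter A x (Suc k)"] c by (metis sqrt_iter_closed a_closed m_closed smult_closed)
then have "2 \<odot> y = 2 \<odot> ((1/2) \<odot> (x \<oplus> y \<cdot> y))" by simp
then have "y \<oplus> y = x \<oplus> y \<cdot> y" using c by (simp add: smult_smult smult_collect)
then have y2: "y \<cdot> y = y \<oplus> y \<ominus> x" using c by (metis a_comm add.m_closed add.inv_solve_right m_closed minus_eq)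
have "csqrt a = \<one> \<ominus> y" using c unfolding y_def by algebra
then have "csqrt a \<cdot> csqrt a = (\<one> \<ominus> y) \<cdot> (\<one> \<ominus> y)" by simp
also have "... = \<one> \<ominus> (y \<oplus> y) \<oplus> y \<cdot> y"
 using c by (simp add: ring_simprules)
also have "... = \<one> \<ominus> x" unfolding y2 using c by algebra
also have "... = a" unfolding x_def using c by algebra
finally show ?thesis .
qed

lemma sqrt_iter_intertwine:
assumes "x : cr A" "y : cr A" "c : cr A" "c \<cdot> x = y \<cdot> c"
shows "c \<cdot> sqrt_iter A x k = sqrt_iter A y k \<cdot> c"
proof (induction k)
case (Suc k)
let ?x = "sqrt_iter A x k" let ?y = "sqrt_iter A y k"
have "c \<cdot> (?x \<cdot> ?x) = (?y \<cdot> ?y) \<cdot> c"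
 using Suc assms by (metis m_assoc sqrt_iter_closed)
then show ?case using assms by (simp add: smult_mult_left smult_mult_right r_distr l_distr)
qed (use assms in simp)

lemma csqrt_intertwine:
assumes a: "pos a" "pos b" and c: "c : cr A" "c \<cdot> a = b \<cdot> c"
shows "c \<cdot> csqrt a = csqrt b \<cdot> c"
proof -
have ca: "a : cr A" "b : cr A" "csqrt a : cr A" "csqrt b : cr A"
 using a csqrt_lim(1) posD by auto
have i: "c \<cdot> (\<one> \<ominus> a) = (\<one> \<ominus> b) \<cdot> c" using c ca by (simp add: minus_eq r_distr l_distr r_minus l_minus)
have "norm_lim A (%k. c \<cdot> sqrt_iter A (\<one> \<ominus> a) k) (c \<cdot> (\<one> \<ominus> csqrt a))"
 by (intro norm_lim_mult norm_lim_const csqrt_lim(2) a) (use c ca in auto)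
moreover have "norm_lim A (%k. sqrt_iter A (\<one> \<ominus> b) k \<cdot> c) ((\<one> \<ominus> csqrt b) \<cdot> c)"
 by (intro norm_lim_mult norm_lim_const csqrt_lim(2) a) (use c ca in auto)
ultimately have "c \<cdot> (\<one> \<ominus> csqrt a) = (\<one> \<ominus> csqrt b) \<cdot> c"
 using sqrt_iter_intertwine[OF _ _ c(1) i] ca c
 by (metis (no_types, lifting) ext m_closed minus_closed norm_lim_unique one_closed sqrt_iter_closed)
then have e: "c \<ominus> c \<cdot> csqrt a = c \<ominus> csqrt b \<cdot> c" using c ca by (simp add: minus_eq r_distr l_distr r_minus l_minus)
have "c \<cdot> csqrt a = c \<ominus> (c \<ominus> c \<cdot> csqrt a)" using c ca by algebra
also have "... = csqrt b \<cdot> c" unfolding e using c ca by algebra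
finally show ?thesis .
qed

lemma csqrt_commute:
"pos a ==> c : cr A ==> c \<cdot> a = a \<cdot> c ==> c \<cdot> csqrt a = csqrt a \<cdot> c"
by (rule csqrt_intertwine)

text \<open>The root is a limit of polynomials in its argument, so it stays in every closed algebra.\<close>

lemma csqrt_mem:
assumes "norm_closed A E" "!!x c. x : E ==> c \<odot> x : E"
 "!!x y. x : E ==> y : E ==> x \<oplus> y : E" "!!x y. x : E ==> y : E ==> x \<cdot> y : E"
 "\<one> : E" "a : E" "pos a"
shows "csqrt a : E"
proof -
have sub: "E <= cr A" using assms(1) by (simp add: norm_closed_def)
have m: "x \<ominus> y : E" if "x : E" "y : E" for x y
 using that assms(2,3) sub by (auto simp: diff_eq_smult subset_iff)
have z: "\<zero> : E" using assms(2)[of \<one> 0] assms(5) by simp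
have "sqrt_iter A (\<one> \<ominus> a) k : E" for k
 by (induction k) (use assms(2-6) m z in auto)
then have "\<one> \<ominus> csqrt a : E"
 using assms(1) csqrt_lim[OF assms(7)] unfolding norm_closed_def by blast
then have "\<one> \<ominus> (\<one> \<ominus> csqrt a) : E" using assms(5) m by blast
moreover have "\<one> \<ominus> (\<one> \<ominus> csqrt a) = csqrt a" using csqrt_lim(1)[OF assms(7)] by algebra
ultimately show ?thesis by simp
qed

end

context cstar_alg
begin

lemma real_imag_parts:
assumes x: "x : cr A"
defines "r \<equiv> (1/2) \<odot> (x \<oplus> x\<^sup>*)" and "s \<equiv> (- \<i>/2) \<odot> (x \<ominus> x\<^sup>*)"
shows "self_adj r" "self_adj s" "x = r \<oplus> \<i> \<odot> s" "nrm A r <= nrm A x" "nrm A s <= nrm A x"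
 "x\<^sup>* \<cdot> x \<oplus> x \<cdot> x\<^sup>* = 2 \<odot> (r \<cdot> r \<oplus> s \<cdot> s)"
proof -
show "self_adj r" "self_adj s" unfolding r_def s_def using x
 by (auto intro!: self_adjI simp: expand_simps a_ac)
show "x = r \<oplus> \<i> \<odot> s" unfolding r_def s_def using x
 by (simp add: expand_simps a_ac smult_collect)
show "nrm A r <= nrm A x" "nrm A s <= nrm A x" unfolding r_def s_def
 using nrm_triangle[of x "x\<^sup>*"] nrm_diff[of x "x\<^sup>*"] x by (simp_all add: nrm_smult)
show "x\<^sup>* \<cdot> x \<oplus> x \<cdot> x\<^sup>* = 2 \<odot> (r \<cdot> r \<oplus> s \<cdot> s)" unfolding r_def s_def using x
 by (simp add: expand_simps a_ac smult_collect)
qed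

text \<open>With \<open>k = (1 - r\<^sup>2)\<^sup>1\<^sup>/\<^sup>2\<close> the element \<open>k + \<i>r\<close> is unitary, and unitaries have norm
  1.\<close>

lemma pos_square:
assumes r: "self_adj r" "nrm A r <= 1"
shows "pos (r \<cdot> r)"
proof -
define a where "a = \<one> \<ominus> r \<cdot> r"
have rr: "r : cr A" using r by simp
have "\<one> \<ominus> a = r \<cdot> r" unfolding a_def using rr by algebra
moreover have "nrm A (r \<cdot> r) <= 1"
 using nrm_self_adj_square[OF r(1)] r nrm_nonneg[OF rr] by (simp add: abs_square_le_1)
ultimately have a: "pos a" unfolding pos_def a_def using r by (auto intro: self_adj_combine)
define k where "k = csqrt a"
have k: "self_adj k" "k : cr A" "k \<cdot> k = a"
 using csqrt_self_adj[OF a] csqrt_square[OF a] by (auto simp: k_def)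
have rk: "r \<cdot> k = k \<cdot> r" unfolding k_def
 by (rule csqrt_commute[OF a rr]) (use rr in \<open>simp add: a_def expand_simps\<close>)
define u where "u = k \<oplus> \<i> \<odot> r"
have uc: "u : cr A" unfolding u_def using k rr by auto
have us: "u\<^sup>* = k \<oplus> (- \<i>) \<odot> r" unfolding u_def using k r by (simp add: star_add star_smult)
have "u\<^sup>* \<cdot> u = k \<cdot> k \<oplus> r \<cdot> r"
 unfolding us unfolding u_def using k(2) rr rk by (simp add: expand_simps a_ac smult_collect)
also have "... = \<one>" unfolding k(3) a_def using rr by algebra
finally have "(nrm A u)\<^sup>2 <= 1" using nrm_cstar[OF uc] nrm_one_le by simp
then have u1: "nrm A u <= 1" using nrm_nonneg[OF uc] by (simp add: abs_square_le_1)
have "k = (1/2) \<odot> (u \<oplus> u\<^sup>*)" unfolding us unfolding u_def using k rr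
 by (simp add: expand_simps a_ac smult_collect)
then have "nrm A k <= 1" using u1 nrm_triangle[of u "u\<^sup>*"] uc by (simp add: nrm_smult)
then have "nrm A (\<one> \<ominus> r \<cdot> r) <= 1"
 using nrm_self_adj_square[OF k(1)] k nrm_nonneg[OF k(2)] unfolding a_def by (simp add: abs_square_le_1)
then show ?thesis using r by (auto simp: pos_def intro: self_adj_combine)
qed

lemma pos_scale:
assumes "pos a" "0 <= c" "c <= 1"
shows "pos (of_real c \<odot> a)"
proof -
have a: "a : cr A" "self_adj a" using assms posD by auto
have "\<one> \<ominus> of_real c \<odot> a = of_real (1 - c) \<odot> \<one> \<oplus> of_real c \<odot> (\<one> \<ominus> a)"
proof -
 have "of_real (1 - c) \<odot> \<one> = \<one> \<ominus> of_real c \<odot> \<one>"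
  using smult_l_distr[of \<one> 1 "- of_real c"] by (simp add: smult_neg minus_eq)
 moreover have "of_real c \<odot> (\<one> \<ominus> a) = of_real c \<odot> \<one> \<ominus> of_real c \<odot> a"
  using a by (simp add: smult_diff)
 ultimately show ?thesis
  using one_closed smult_closed[OF one_closed, of "of_real c"] smult_closed[OF a(1), of "of_real c"] by algebra
qed
then have "nrm A (\<one> \<ominus> of_real c \<odot> a) <= (1 - c) * nrm A \<one> + c * nrm A (\<one> \<ominus> a)"
 using nrm_triangle[of "of_real (1 - c) \<odot> \<one>" "of_real c \<odot> (\<one> \<ominus> a)"] a assms(2,3)
 by (simp add: nrm_smult del: of_real_diff)
also have "... <= (1 - c) * 1 + c * 1"
 using assms nrm_one_le by (intro add_mono mult_left_mono) (auto simp: pos_def)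
finally show ?thesis using a by (auto simp: pos_def intro: self_adj_combine)
qed

lemma pos_average:
assumes "pos a" "pos b" "pos d"
shows "pos ((1/3) \<odot> (a \<oplus> b \<oplus> d))"
proof -
have c: "a : cr A" "b : cr A" "d : cr A" using assms posD by auto
have "\<one> \<ominus> (1/3) \<odot> (a \<oplus> b \<oplus> d) = (1/3) \<odot> ((\<one> \<ominus> a) \<oplus> (\<one> \<ominus> b) \<oplus> (\<one> \<ominus> d))"
proof -
 have e: "(\<one> \<ominus> a) \<oplus> (\<one> \<ominus> b) \<oplus> (\<one> \<ominus> d) = 3 \<odot> \<one> \<ominus> (a \<oplus> b \<oplus> d)"
  using c smult_l_distr[of \<one> 2 1] by (simp add: smult_collect(7)[symmetric]) algebra
 show ?thesis unfolding e using c by (subst smult_diff) (auto simp: smult_smult)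
qed
then have "nrm A (\<one> \<ominus> (1/3) \<odot> (a \<oplus> b \<oplus> d)) <= (nrm A (\<one> \<ominus> a) + nrm A (\<one> \<ominus> b) + nrm A (\<one> \<ominus> d)) / 3"
 using nrm_triangle[of "(\<one> \<ominus> a) \<oplus> (\<one> \<ominus> b)" "\<one> \<ominus> d"] nrm_triangle[of "\<one> \<ominus> a" "\<one> \<ominus> b"] c
 by (simp add: nrm_smult)
also have "... <= 1" using assms by (simp add: pos_def)
finally have "nrm A (\<one> \<ominus> (1/3) \<odot> (a \<oplus> b \<oplus> d)) <= 1" .
moreover have "self_adj (of_real (1/3) \<odot> (a \<oplus> b \<oplus> d))"
 by (intro self_adj_combine posD assms)
ultimately show ?thesis by (simp add: pos_def)
qed

lemma commuting_squares_sum_0D: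
assumes a: "self_adj a" "self_adj b" "a \<cdot> b = b \<cdot> a" "a \<cdot> a \<oplus> b \<cdot> b = \<zero>"
shows "a = \<zero>"
proof -
define u where "u = a \<oplus> \<i> \<odot> b"
have c: "a : cr A" "b : cr A" "u : cr A" using a by (auto simp: u_def)
have us: "u\<^sup>* = a \<oplus> (- \<i>) \<odot> b" unfolding u_def using c a(1,2) by (simp add: star_add star_smult)
have "u\<^sup>* \<cdot> u = a \<cdot> a \<oplus> b \<cdot> b"
 unfolding us unfolding u_def using c a(3) by (simp add: expand_simps a_ac smult_collect)
then have "u = \<zero>" using a(4) star_mult_eq_0D[OF c(3)] by simp
then have "u \<oplus> u\<^sup>* = \<zero>" by simp
moreover have "u \<oplus> u\<^sup>* = 2 \<odot> a" unfolding u_def using c a(1,2) by (simp add: expand_simps a_ac smult_collect)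
ultimately have "(1/2) \<odot> (2 \<odot> a) = \<zero>" by simp
then show ?thesis using c by (simp add: smult_smult)
qed

text \<open>Commuting positive roots \<open>R\<close>, \<open>S\<close> of the same element satisfy \<open>(R - S)(R + S) = 0\<close>; so the positive
  elements \<open>h R h\<close> and \<open>h S h\<close> with \<open>h = R - S\<close> add up to zero.\<close>

lemma pos_root_unique:
assumes R: "pos R" "pos S" and eq: "R \<cdot> R = S \<cdot> S" and comm: "R \<cdot> S = S \<cdot> R"
shows "R = S"
proof -
define h where "h = R \<ominus> S"
define p where "p = csqrt R"
define t where "t = csqrt S"
have sa: "self_adj R" "self_adj S" "self_adj p" "self_adj t" "self_adj h"
 using R csqrt_self_adj posD by (auto simp: h_def p_def t_def intro: self_adj_combine)
have c: "R : cr A" "S : cr A" "p : cr A" "t : cr A" "h : cr A"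
 using sa by auto
have pp: "p \<cdot> p = R" "t \<cdot> t = S" using R csqrt_square by (auto simp: p_def t_def)
have pR: "R \<cdot> p = p \<cdot> R" unfolding p_def by (rule csqrt_commute) (use R c in auto)
have pS: "S \<cdot> p = p \<cdot> S" unfolding p_def by (rule csqrt_commute) (use R c comm in auto)
have tR: "R \<cdot> t = t \<cdot> R" unfolding t_def by (rule csqrt_commute) (use R c comm in auto)
have tS: "S \<cdot> t = t \<cdot> S" unfolding t_def by (rule csqrt_commute) (use R c in auto)
have pt: "p \<cdot> t = t \<cdot> p" unfolding t_def by (rule csqrt_commute) (use R c pS in auto)
have hp: "h \<cdot> p = p \<cdot> h" "h \<cdot> t = t \<cdot> h" unfolding h_def using c pR pS tR tS
 by (simp_all add: minus_eq l_distr r_distr l_minus r_minus)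
have hp': "h \<cdot> (p \<cdot> y) = p \<cdot> (h \<cdot> y)" "h \<cdot> (t \<cdot> y) = t \<cdot> (h \<cdot> y)" if "y : cr A" for y
 using hp c that m_assoc by metis+
have sq: "(p \<cdot> h) \<cdot> (p \<cdot> h) = h \<cdot> (R \<cdot> h)" "(t \<cdot> h) \<cdot> (t \<cdot> h) = h \<cdot> (S \<cdot> h)"
 using c hp hp' by (simp_all add: m_assoc pp[symmetric])
have "h \<cdot> (R \<cdot> h) \<oplus> h \<cdot> (S \<cdot> h) = h \<cdot> ((R \<oplus> S) \<cdot> (R \<ominus> S))"
 using c unfolding h_def by algebra
also have "(R \<oplus> S) \<cdot> (R \<ominus> S) = (R \<cdot> R \<ominus> S \<cdot> S) \<oplus> (S \<cdot> R \<ominus> R \<cdot> S)"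
 using c by algebra
also have "... = \<zero>" using c eq comm by (simp add: minus_eq r_neg)
finally have z: "h \<cdot> (R \<cdot> h) \<oplus> h \<cdot> (S \<cdot> h) = \<zero>" using c by simp
have comm': "(p \<cdot> h) \<cdot> (t \<cdot> h) = (t \<cdot> h) \<cdot> (p \<cdot> h)"
proof -
 have "p \<cdot> (t \<cdot> (h \<cdot> h)) = t \<cdot> (p \<cdot> (h \<cdot> h))" using pt c by (metis m_assoc m_closed)
 then show ?thesis using c hp' by (simp add: m_assoc)
qed
have s2: "self_adj (p \<cdot> h)" "self_adj (t \<cdot> h)" using sa hp by (auto intro: self_adj_commuting_mult)
have p0: "p \<cdot> h = \<zero>"
 by (rule commuting_squares_sum_0D[OF s2 comm']) (simp add: sq z)
have t0: "t \<cdot> h = \<zero>"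
 by (rule commuting_squares_sum_0D[OF s2(2) s2(1) comm'[symmetric]]) (use c z in \<open>simp add: sq a_comm\<close>)
have "h \<cdot> (R \<cdot> h) = \<zero>" "h \<cdot> (S \<cdot> h) = \<zero>" by (simp_all add: sq[symmetric] p0 t0)
then have "h \<cdot> (h \<cdot> h) = \<zero>"
proof -
 have "h \<cdot> (h \<cdot> h) = h \<cdot> ((R \<ominus> S) \<cdot> h)" by (simp add: h_def)
 also have "... = h \<cdot> (R \<cdot> h) \<ominus> h \<cdot> (S \<cdot> h)" using c by algebra
 finally show ?thesis using \<open>h \<cdot> (R \<cdot> h) = \<zero>\<close> \<open>h \<cdot> (S \<cdot> h) = \<zero>\<close> by (simp add: minus_eq)
qed
then have "h = \<zero>" using self_adj_cube_0D sa by blast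
moreover have "R = h \<oplus> S" unfolding h_def using c by algebra
ultimately show ?thesis using c by simp
qed

lemma csqrt_eqI:
assumes "pos a" "pos S" "S \<cdot> S = a"
shows "csqrt a = S"
proof (rule pos_root_unique)
have S: "S : cr A" using assms posD by auto
have "S \<cdot> csqrt a = csqrt a \<cdot> S"
 by (rule csqrt_commute) (use assms S in \<open>auto simp: m_assoc[symmetric]\<close>)
then show "csqrt a \<cdot> S = S \<cdot> csqrt a" by simp
qed (use assms csqrt_pos csqrt_square in auto)

text \<open>An element of the form \<open>x\<^sup>\<star>x\<close> is never the negative of a nonzero square.\<close>

lemma star_mult_neg_square_0D:
assumes x: "x : cr A" and g: "self_adj g" and eq: "x\<^sup>* \<cdot> x = \<ominus> (g \<cdot> g)"
shows "x = \<zero>"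
proof -
have small: "y = \<zero>" if y: "y : cr A" and h: "self_adj h" and eq: "y\<^sup>* \<cdot> y = \<ominus> (h \<cdot> h)"
 and n: "nrm A y <= 1" "nrm A h <= 1" for y h
proof -
 define r where "r = (1/2) \<odot> (y \<oplus> y\<^sup>*)"
 define s where "s = (- \<i>/2) \<odot> (y \<ominus> y\<^sup>*)"
 note rs = real_imag_parts[OF y, folded r_def s_def]
 have hc: "h : cr A" "r : cr A" "s : cr A" using h rs by auto
 define P where "P = (1/6) \<odot> (h \<cdot> h)"
 define Q where "Q = (1/6) \<odot> (y \<cdot> y\<^sup>*)"
 have PQc: "P : cr A" "Q : cr A" using hc y by (auto simp: P_def Q_def)
 have pos3: "pos (r \<cdot> r)" "pos (s \<cdot> s)" "pos (h \<cdot> h)"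
  using rs h n by (auto intro!: pos_square)
 have pos_P: "pos P" unfolding P_def using pos_scale[OF pos3(3), of "1/6"] by simp
 have "y \<cdot> y\<^sup>* = (y\<^sup>* \<cdot> y \<oplus> y \<cdot> y\<^sup>*) \<oplus> h \<cdot> h"
  unfolding eq using y star_closed[OF y] m_closed[OF y star_closed[OF y]] hc by algebra
 also have "... = 2 \<odot> (r \<cdot> r \<oplus> s \<cdot> s) \<oplus> h \<cdot> h" using rs by simp
 finally have "Q = (1/6) \<odot> (2 \<odot> (r \<cdot> r \<oplus> s \<cdot> s) \<oplus> h \<cdot> h)" by (simp add: Q_def)
 then have "Q = (1/3) \<odot> (r \<cdot> r \<oplus> s \<cdot> s \<oplus> of_real (1/2) \<odot> (h \<cdot> h))"
  using hc by (simp add: expand_simps a_ac)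
 then have pos_Q: "pos Q" using pos_average[OF pos3(1,2) pos_scale[OF pos3(3), of "1/2"]] by simp
 have "nrm A P <= 1" "nrm A Q <= 1"
  using n nrm_nonneg nrm_mult[of h h] nrm_mult[of y "y\<^sup>*"] mult_mono[OF n(2) n(2)] mult_mono[OF n(1) n(1)] hc y
  by (auto simp: P_def Q_def nrm_smult)
 then have pos2: "pos (P \<cdot> P)" "pos (Q \<cdot> Q)" using pos_P pos_Q posD by (auto intro!: pos_square)
 have "h \<cdot> h = \<ominus> (y\<^sup>* \<cdot> y)" using eq y hc by simp
 then have yP: "y \<cdot> P = \<ominus> (Q \<cdot> y)"
  using y by (simp add: P_def Q_def expand_simps)
 have "y \<cdot> (P \<cdot> P) = \<ominus> (Q \<cdot> (y \<cdot> P))"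
 proof -
  have "y \<cdot> (P \<cdot> P) = (\<ominus> (Q \<cdot> y)) \<cdot> P" using y PQc by (simp add: m_assoc[symmetric] yP)
  then show ?thesis using y PQc by (simp add: l_minus m_assoc)
 qed
 also have "... = (Q \<cdot> Q) \<cdot> y" using yP y PQc by (simp add: r_minus m_assoc)
 finally have "y \<cdot> csqrt (P \<cdot> P) = csqrt (Q \<cdot> Q) \<cdot> y"
  by (intro csqrt_intertwine pos2 y)
 then have "y \<cdot> P = Q \<cdot> y" using csqrt_eqI[OF pos2(1) pos_P] csqrt_eqI[OF pos2(2) pos_Q] by simp
 then have "y \<cdot> P \<oplus> y \<cdot> P = \<ominus> (Q \<cdot> y) \<oplus> Q \<cdot> y" using yP by simp
 then have "2 \<odot> (y \<cdot> P) = \<zero>" using y PQc by (simp add: smult_collect l_neg)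
 then have "(1/2) \<odot> (2 \<odot> (y \<cdot> P)) = \<zero>" by simp
 then have "y \<cdot> P = \<zero>" using y PQc by (simp add: smult_smult)
 then have "6 \<odot> (y \<cdot> P) = \<zero>" by simp
 then have "y \<cdot> (h \<cdot> h) = \<zero>" using y hc by (simp add: P_def smult_mult_right smult_smult)
 then have "y\<^sup>* \<cdot> (y \<cdot> (h \<cdot> h)) = \<zero>" using y by simp
 then have "(y\<^sup>* \<cdot> y) \<cdot> (y\<^sup>* \<cdot> y) = \<zero>"
  unfolding eq using y hc by (simp add: m_assoc[of "y\<^sup>*", symmetric] eq l_minus r_minus)
 then have "y\<^sup>* \<cdot> y = \<zero>" using self_adj_square_0D self_adj_star_mult y by blast
 then show ?thesis using star_mult_eq_0D y by blast
qed
define t where "t = 1 / (1 + nrm A x + nrm A g)"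
have gc: "g : cr A" using g by simp
have t: "t > 0" "t * nrm A x <= 1" "t * nrm A g <= 1"
 using nrm_nonneg[OF x] nrm_nonneg[OF gc] by (auto simp: t_def field_simps add_nonneg_pos)
have "of_real t \<odot> x = \<zero>"
proof (rule small[where h="of_real t \<odot> g"])
 show "(of_real t \<odot> x)\<^sup>* \<cdot> (of_real t \<odot> x) = \<ominus> ((of_real t \<odot> g) \<cdot> (of_real t \<odot> g))"
  using x gc eq by (simp add: star_smult smult_mult_left smult_mult_right smult_smult smult_minus smult_neg)
qed (use x g gc t in \<open>auto simp: nrm_smult intro: self_adj_combine\<close>)
then have "of_real (1/t) \<odot> (of_real t \<odot> x) = \<zero>" by (metis smult_zero_right)
then show ?thesis using x t by (simp add: smult_smult)
qed

lemma pos_positive_elem: "pos a ==> positive_elem A a"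
using csqrt_self_adj[of a] csqrt_square[of a] by (auto simp: positive_elem_def intro!: bexI[of _ "csqrt a"])

lemma sqrt_elem_eq_csqrt:
assumes a: "pos a" shows "sqrt_elem A a = csqrt a"
unfolding sqrt_elem_def
proof (rule the_equality)
show "csqrt a : cr A & positive_elem A (csqrt a) & csqrt a \<cdot> csqrt a = a"
 using a csqrt_pos csqrt_square pos_positive_elem posD by auto
fix b assume b: "b : cr A & positive_elem A b & b \<cdot> b = a"
then obtain c where cc: "c : cr A" "b = c\<^sup>* \<cdot> c" by (auto simp: positive_elem_def)
define T where "T = csqrt a"
define t where "t = csqrt T"
define h where "h = T \<ominus> b"
have T: "pos T" "T \<cdot> T = a" using a csqrt_pos csqrt_square by (auto simp: T_def)
have t: "self_adj t" "t \<cdot> t = T" using T csqrt_self_adj csqrt_square by (auto simp: t_def)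
have bs: "self_adj b" using cc self_adj_star_mult by auto
have c: "T : cr A" "t : cr A" "b : cr A" "h : cr A" using T t b posD by (auto simp: h_def)
have hs: "self_adj h" using T posD bs by (auto simp: h_def intro: self_adj_combine)
have bT: "b \<cdot> T = T \<cdot> b" unfolding T_def
 by (rule csqrt_commute[OF a]) (use b c in \<open>auto simp: m_assoc[symmetric]\<close>)
have bt: "b \<cdot> t = t \<cdot> b" unfolding t_def by (rule csqrt_commute) (use T c bT in auto)
have Tt: "T \<cdot> t = t \<cdot> T" unfolding t_def by (rule csqrt_commute) (use T c in auto)
have ht: "h \<cdot> t = t \<cdot> h" unfolding h_def using c bt Tt
 by (simp add: minus_eq l_distr r_distr l_minus r_minus)
have "h \<cdot> (b \<cdot> h) \<oplus> h \<cdot> (T \<cdot> h) = h \<cdot> ((b \<oplus> T) \<cdot> (T \<ominus> b))"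
 unfolding h_def using c by algebra
also have "(b \<oplus> T) \<cdot> (T \<ominus> b) = (T \<cdot> T \<ominus> b \<cdot> b) \<oplus> (b \<cdot> T \<ominus> T \<cdot> b)" using c by algebra
also have "... = \<zero>" using T b bT c posD(3)[OF a] by (simp add: minus_eq r_neg)
finally have z: "h \<cdot> (b \<cdot> h) \<oplus> h \<cdot> (T \<cdot> h) = \<zero>" using c by simp
have th: "(t \<cdot> h) \<cdot> (t \<cdot> h) = h \<cdot> (T \<cdot> h)"
proof -
 have "(t \<cdot> h) \<cdot> (t \<cdot> h) = (h \<cdot> t) \<cdot> (t \<cdot> h)" using ht by simp
 then show ?thesis using c by (simp add: t(2)[symmetric] m_assoc)
qed
have "(c \<cdot> h)\<^sup>* \<cdot> (c \<cdot> h) = h \<cdot> (b \<cdot> h)"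
 using cc hs c by (simp add: star_mult m_assoc)
also have "... = \<ominus> (h \<cdot> (T \<cdot> h))" using z c minus_equality[of "h \<cdot> (b \<cdot> h)" "h \<cdot> (T \<cdot> h)"] by simp
finally have "c \<cdot> h = \<zero>"
 using star_mult_neg_square_0D[of "c \<cdot> h" "t \<cdot> h"] th cc c
  self_adj_commuting_mult[OF t(1) hs ht[symmetric]] by simp
then have hb: "b \<cdot> h = \<zero>" using cc c by (simp add: m_assoc)
then have "h \<cdot> (T \<cdot> h) = \<zero>" using z c by simp
then have "h \<cdot> (h \<cdot> h) = \<zero>" using hb c
 by (subst (2) h_def) (simp add: minus_eq l_distr r_distr l_minus r_minus)
then have "h = \<zero>" using self_adj_cube_0D hs by blast
moreover have "T = h \<oplus> b" unfolding h_def using c by algebra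
ultimately show "b = csqrt a" using c by (simp add: T_def)
qed

end

section \<open>The completion of a C*-seminormed algebra\<close>

context seminorm_alg
begin

lemma cauchy_seqsD: "s : cauchy_seqs A ==> s k : cr A"
by (simp add: cauchy_seqs_def)

lemma cauchy_seqsD':
"s : cauchy_seqs A ==> e > 0 ==> EX N. ALL k>=N. ALL l>=N. nrm A (s k \<ominus> s l) < e"
by (simp add: cauchy_seqs_def)

lemma cauchy_seqs_bounded:
assumes s: "s : cauchy_seqs A"
shows "EX M>0. ALL k. nrm A (s k) <= M"
proof -
obtain N where N: "!!k l. k >= N ==> l >= N ==> nrm A (s k \<ominus> s l) < 1"
 using cauchy_seqsD'[OF s, of 1] by auto
define M where "M = 1 + nrm A (s N) + (\<Sum>k\<le>N. nrm A (s k))"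
have c: "s k : cr A" for k using s by (rule cauchy_seqsD)
have nn: "0 <= (\<Sum>k\<le>N. nrm A (s k))" using c nrm_nonneg by (simp add: sum_nonneg)
have "nrm A (s k) <= M" for k
proof (cases "k <= N")
 case True
 then have "nrm A (s k) <= (\<Sum>k\<le>N. nrm A (s k))" using c nrm_nonneg by (intro member_le_sum) auto
 then show ?thesis using nrm_nonneg[OF c[of N]] by (simp add: M_def)
next
 case False
 then have "nrm A (s k) <= nrm A (s N) + 1" using N[of k N] nrm_diff_abs[OF c[of k] c[of N]] by simp
 then show ?thesis using nn by (simp add: M_def)
qed
moreover have "M > 0" using nn nrm_nonneg[OF c[of N]] by (simp add: M_def)
ultimately show ?thesis by blast
qed

lemma cauchy_seqs_compose:
assumes s: "s : cauchy_seqs A" "t : cauchy_seqs A" and u: "!!k. u k : cr A"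
 and M: "!!k l. nrm A (u k \<ominus> u l) <= M * (nrm A (s k \<ominus> s l) + nrm A (t k \<ominus> t l))"
shows "u : cauchy_seqs A"
proof -
have "EX N. ALL k>=N. ALL l>=N. nrm A (u k \<ominus> u l) < e" if e: "e > 0" for e
proof -
 define d where "d = e / (2 * (\<bar>M\<bar> + 1))"
 have d: "d > 0" using e by (simp add: d_def)
 obtain N1 N2 where N: "!!k l. k >= N1 ==> l >= N1 ==> nrm A (s k \<ominus> s l) < d"
  "!!k l. k >= N2 ==> l >= N2 ==> nrm A (t k \<ominus> t l) < d"
  using cauchy_seqsD'[OF s(1) d] cauchy_seqsD'[OF s(2) d] by blast
 have "nrm A (u k \<ominus> u l) < e" if kl: "k >= max N1 N2" "l >= max N1 N2" for k l
 proof -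
  let ?n = "nrm A (s k \<ominus> s l) + nrm A (t k \<ominus> t l)"
  have n: "0 <= ?n" "?n < 2 * d"
   using N[of k l] kl nrm_nonneg cauchy_seqsD[OF s(1)] cauchy_seqsD[OF s(2)] by force+
  have "nrm A (u k \<ominus> u l) <= (\<bar>M\<bar> + 1) * ?n"
  proof -
   have "M * ?n <= (\<bar>M\<bar> + 1) * ?n" using n by (intro mult_right_mono) auto
   then show ?thesis using M[of k l] by linarith
  qed
  also have "... < (\<bar>M\<bar> + 1) * (2 * d)" using n by (intro mult_strict_left_mono) auto
  also have "... = e" by (simp add: d_def field_simps)
  finally show ?thesis .
 qed
 then show ?thesis by blast
qed
then show ?thesis using u by (simp add: cauchy_seqs_def)
qed

lemma diff_mult_bound:
assumes "x : cr A" "y : cr A" "x' : cr A" "y' : cr A"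
 and "nrm A x <= M" "nrm A y' <= M" "M > 0"
shows "nrm A (x \<cdot> y \<ominus> x' \<cdot> y') <= M * (nrm A (x \<ominus> x') + nrm A (y \<ominus> y'))"
proof -
have "x \<cdot> y \<ominus> x' \<cdot> y' = x \<cdot> (y \<ominus> y') \<oplus> (x \<ominus> x') \<cdot> y'" using assms(1-4) by algebra
then have "nrm A (x \<cdot> y \<ominus> x' \<cdot> y') <= nrm A (x \<cdot> (y \<ominus> y')) + nrm A ((x \<ominus> x') \<cdot> y')"
 using nrm_triangle assms by simp
also have "... <= nrm A x * nrm A (y \<ominus> y') + nrm A (x \<ominus> x') * nrm A y'"
 by (intro add_mono nrm_mult) (use assms in auto)
also have "... <= M * nrm A (y \<ominus> y') + nrm A (x \<ominus> x') * M"
 using assms nrm_nonneg by (intro add_mono mult_mono) auto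
finally show ?thesis by (simp add: algebra_simps)
qed

lemma diff_add_bound:
assumes "x : cr A" "y : cr A" "x' : cr A" "y' : cr A"
shows "nrm A ((x \<oplus> y) \<ominus> (x' \<oplus> y')) <= nrm A (x \<ominus> x') + nrm A (y \<ominus> y')"
proof -
have "(x \<oplus> y) \<ominus> (x' \<oplus> y') = (x \<ominus> x') \<oplus> (y \<ominus> y')" using assms by algebra
then show ?thesis using nrm_triangle assms by simp
qed

lemma cauchy_seqs_const: "x : cr A ==> (%_. x) : cauchy_seqs A"
by (simp add: cauchy_seqs_def minus_eq r_neg)

lemma cauchy_seqs_add:
assumes "s : cauchy_seqs A" "t : cauchy_seqs A"
shows "(%k. s k \<oplus> t k) : cauchy_seqs A"
by (rule cauchy_seqs_compose[OF assms, of _ 1])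
  (use assms diff_add_bound cauchy_seqsD in auto)

lemma cauchy_seqs_mult:
assumes s: "s : cauchy_seqs A" "t : cauchy_seqs A"
shows "(%k. s k \<cdot> t k) : cauchy_seqs A"
proof -
obtain M1 M2 where M: "M1 > 0" "!!k. nrm A (s k) <= M1" "M2 > 0" "!!k. nrm A (t k) <= M2"
 using cauchy_seqs_bounded[OF s(1)] cauchy_seqs_bounded[OF s(2)] by blast
show ?thesis
proof (rule cauchy_seqs_compose[OF s, of _ "M1 + M2"])
 show "nrm A (s k \<cdot> t k \<ominus> s l \<cdot> t l) <= (M1 + M2) * (nrm A (s k \<ominus> s l) + nrm A (t k \<ominus> t l))" for k l
  by (rule diff_mult_bound) (use s cauchy_seqsD M(1,3) M(2)[of k] M(4)[of l] in auto)
qed (use s cauchy_seqsD in auto)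
qed

lemma cauchy_seqs_smult:
assumes "s : cauchy_seqs A" shows "(%k. c \<odot> s k) : cauchy_seqs A"
by (rule cauchy_seqs_compose[OF assms assms, of _ "cmod c"])
  (use assms cauchy_seqsD in \<open>auto simp: smult_diff[symmetric] nrm_smult nrm_nonneg algebra_simps\<close>)

lemma cauchy_seqs_star:
assumes "s : cauchy_seqs A" shows "(%k. (s k)\<^sup>*) : cauchy_seqs A"
by (rule cauchy_seqs_compose[OF assms assms, of _ 1])
  (use assms cauchy_seqsD in \<open>auto simp: star_diff[symmetric] nrm_nonneg\<close>)

lemma cauchy_rel_equiv: "equiv (cauchy_seqs A) (cauchy_rel A)"
proof (rule equivI)
show "cauchy_rel A <= cauchy_seqs A \<times> cauchy_seqs A" by (auto simp: cauchy_rel_def)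
show "refl_on (cauchy_seqs A) (cauchy_rel A)"
 by (auto simp: refl_on_def cauchy_rel_def cauchy_seqsD minus_eq r_neg)
show "sym (cauchy_rel A)"
 by (rule symI) (auto simp: cauchy_rel_def cauchy_seqsD nrm_diff_commute)
show "trans (cauchy_rel A)"
proof (rule transI, unfold cauchy_rel_def, clarsimp)
 fix s t u assume c: "s : cauchy_seqs A" "t : cauchy_seqs A" "u : cauchy_seqs A"
  and l: "(%k. nrm A (s k \<ominus> t k)) ----> 0" "(%k. nrm A (t k \<ominus> u k)) ----> 0"
 show "(%k. nrm A (s k \<ominus> u k)) ----> 0"
  by (rule tendsto_sandwich[OF _ _ tendsto_const tendsto_add_zero[OF l]])
    (use c nrm_nonneg nrm_diff_triangle cauchy_seqsD in auto)
qed
qed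

lemma cauchy_class_eq_iff:
"s : cauchy_seqs A ==> t : cauchy_seqs A ==>
 cauchy_class A s = cauchy_class A t \<longleftrightarrow> (%k. nrm A (s k \<ominus> t k)) ----> 0"
unfolding cauchy_class_def
using eq_equiv_class_iff[OF cauchy_rel_equiv, of s t] by (auto simp: cauchy_rel_def)

lemma cauchy_class_memD:
assumes "t : cauchy_class A s"
shows "t : cauchy_seqs A" "s : cauchy_seqs A" "cauchy_class A t = cauchy_class A s"
proof -
have r: "(s, t) : cauchy_rel A" using assms by (simp add: cauchy_class_def)
then show "t : cauchy_seqs A" "s : cauchy_seqs A" by (auto simp: cauchy_rel_def)
show "cauchy_class A t = cauchy_class A s"
 unfolding cauchy_class_def using equiv_class_eq[OF cauchy_rel_equiv r] by simp
qed

lemma cauchy_class_self: "s : cauchy_seqs A ==> s : cauchy_class A s"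
unfolding cauchy_class_def by (rule equiv_class_self[OF cauchy_rel_equiv])

lemma completion_carrier: "cr (completion A) = cauchy_class A ` cauchy_seqs A"
by (auto simp: completion_def quotient_def cauchy_class_def)

lemma completion_cases:
assumes "X : cr (completion A)"
obtains s where "s : cauchy_seqs A" "X = cauchy_class A s"
using assms by (auto simp: completion_carrier)

lemma cauchy_class_UN:
assumes "s : cauchy_seqs A" "!!s'. s' : cauchy_class A s ==> F s' = F s"
shows "(\<Union>s'\<in>cauchy_class A s. F s') = F s"
using assms cauchy_class_self[OF assms(1)] by blast

lemma completion_mult:
assumes s: "s : cauchy_seqs A" "t : cauchy_seqs A"
shows "cauchy_class A s \<cdot>\<^bsub>completion A\<^esub> cauchy_class A t = cauchy_class A (%k. s k \<cdot> t k)"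
proof -
have eq: "cauchy_class A (%k. s' k \<cdot> t' k) = cauchy_class A (%k. s k \<cdot> t k)"
 if st: "s' : cauchy_class A s" "t' : cauchy_class A t" for s' t'
proof -
 note c = cauchy_class_memD[OF st(1)] cauchy_class_memD[OF st(2)]
 have l: "(%k. nrm A (s' k \<ominus> s k)) ----> 0" "(%k. nrm A (t' k \<ominus> t k)) ----> 0"
  using c cauchy_class_eq_iff by auto
 obtain M1 M2 where M: "M1 > 0" "!!k. nrm A (s' k) <= M1" "M2 > 0" "!!k. nrm A (t k) <= M2"
  using cauchy_seqs_bounded[OF c(1)] cauchy_seqs_bounded[OF s(2)] by blast
 have "nrm A (s' k \<cdot> t' k \<ominus> s k \<cdot> t k) <= (M1 + M2) * (nrm A (s' k \<ominus> s k) + nrm A (t' k \<ominus> t k))" for k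
  by (rule diff_mult_bound) (use s c cauchy_seqsD M(1,3) M(2)[of k] M(4)[of k] in auto)
 then have "(%k. nrm A (s' k \<cdot> t' k \<ominus> s k \<cdot> t k)) ----> 0"
  by (intro tendsto_sandwich[OF _ _ tendsto_const tendsto_mult_right_zero[OF tendsto_add_zero[OF l], of "M1 + M2"]])
    (use c nrm_nonneg cauchy_seqsD in auto)
 then show ?thesis using cauchy_class_eq_iff cauchy_seqs_mult c by auto
qed
have "cauchy_class A s \<cdot>\<^bsub>completion A\<^esub> cauchy_class A t
  = (\<Union>s'\<in>cauchy_class A s. \<Union>t'\<in>cauchy_class A t. cauchy_class A (%k. s' k \<cdot> t' k))"
 by (simp add: completion_def)
also have "... = (\<Union>s'\<in>cauchy_class A s. \<Union>t'\<in>cauchy_class A t. cauchy_class A (%k. s k \<cdot> t k))"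
 using eq by (simp cong: SUP_cong)
finally show ?thesis using cauchy_class_self s by auto
qed

lemma completion_add:
assumes s: "s : cauchy_seqs A" "t : cauchy_seqs A"
shows "cauchy_class A s \<oplus>\<^bsub>completion A\<^esub> cauchy_class A t = cauchy_class A (%k. s k \<oplus> t k)"
proof -
have eq: "cauchy_class A (%k. s' k \<oplus> t' k) = cauchy_class A (%k. s k \<oplus> t k)"
 if st: "s' : cauchy_class A s" "t' : cauchy_class A t" for s' t'
proof -
 note c = cauchy_class_memD[OF st(1)] cauchy_class_memD[OF st(2)]
 have l: "(%k. nrm A (s' k \<ominus> s k)) ----> 0" "(%k. nrm A (t' k \<ominus> t k)) ----> 0"
  using c cauchy_class_eq_iff by auto
 have "(%k. nrm A ((s' k \<oplus> t' k) \<ominus> (s k \<oplus> t k))) ----> 0"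
  by (rule tendsto_sandwich[OF _ _ tendsto_const tendsto_add_zero[OF l]])
    (use c nrm_nonneg cauchy_seqsD diff_add_bound in auto)
 then show ?thesis using cauchy_class_eq_iff cauchy_seqs_add c by auto
qed
have "cauchy_class A s \<oplus>\<^bsub>completion A\<^esub> cauchy_class A t
  = (\<Union>s'\<in>cauchy_class A s. \<Union>t'\<in>cauchy_class A t. cauchy_class A (%k. s' k \<oplus> t' k))"
 by (simp add: completion_def)
also have "... = (\<Union>s'\<in>cauchy_class A s. \<Union>t'\<in>cauchy_class A t. cauchy_class A (%k. s k \<oplus> t k))"
 using eq by (simp cong: SUP_cong)
finally show ?thesis using cauchy_class_self s by auto
qed

lemma completion_smult:
assumes s: "s : cauchy_seqs A"
shows "c \<odot>\<^bsub>completion A\<^esub> cauchy_class A s = cauchy_class A (%k. c \<odot> s k)"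
proof -
have "cauchy_class A (%k. c \<odot> s' k) = cauchy_class A (%k. c \<odot> s k)"
 if "s' : cauchy_class A s" for s'
proof -
note c = cauchy_class_memD[OF that]
have l: "(%k. nrm A (s' k \<ominus> s k)) ----> 0" using c cauchy_class_eq_iff by auto
have "nrm A (c \<odot> s' k \<ominus> c \<odot> s k) = cmod c * nrm A (s' k \<ominus> s k)" for k
 using c cauchy_seqsD by (simp add: smult_diff[symmetric] nrm_smult)
then have "(%k. nrm A (c \<odot> s' k \<ominus> c \<odot> s k)) ----> 0" using tendsto_mult_right_zero[OF l] by simp
then show ?thesis
 using cauchy_class_eq_iff cauchy_seqs_smult c by auto
qed
then have "(\<Union>s'\<in>cauchy_class A s. cauchy_class A (%k. c \<odot> s' k)) = cauchy_class A (%k. c \<odot> s k)"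
 by (rule cauchy_class_UN[OF s])
then show ?thesis by (simp add: completion_def)
qed

lemma completion_star:
assumes s: "s : cauchy_seqs A"
shows "(cauchy_class A s)\<^sup>*\<^bsub>completion A\<^esub> = cauchy_class A (%k. (s k)\<^sup>*)"
unfolding completion_def module.simps cstar.simps
proof (rule cauchy_class_UN[OF s, where F="%s. cauchy_class A (%k. (s k)\<^sup>*)"])
fix s' assume "s' : cauchy_class A s"
note c = cauchy_class_memD[OF this]
have l: "(%k. nrm A (s' k \<ominus> s k)) ----> 0" using c cauchy_class_eq_iff by auto
then have "(%k. nrm A ((s' k)\<^sup>* \<ominus> (s k)\<^sup>*)) ----> 0"
 using c cauchy_seqsD by (simp add: star_diff[symmetric])
then show "cauchy_class A (%k. (s' k)\<^sup>*) = cauchy_class A (%k. (s k)\<^sup>*)"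
 using cauchy_class_eq_iff cauchy_seqs_star c by auto
qed

lemma completion_nrm:
assumes s: "s : cauchy_seqs A"
shows "(%k. nrm A (s k)) ----> nrm (completion A) (cauchy_class A s)"
proof -
have c: "s k : cr A" for k using s by (rule cauchy_seqsD)
have "Cauchy (%k. nrm A (s k))"
proof (rule CauchyI)
 fix e :: real assume "0 < e"
 then obtain N where "!!k l. k >= N ==> l >= N ==> nrm A (s k \<ominus> s l) < e" using cauchy_seqsD'[OF s] by blast
 then show "EX M. ALL m>=M. ALL n>=M. norm (nrm A (s m) - nrm A (s n)) < e"
  using nrm_diff_abs[OF c c] by (metis real_norm_def order_le_less_trans)
qed
then obtain r where r: "(%k. nrm A (s k)) ----> r" using Cauchy_convergent convergent_def by blast
have all: "(%k. nrm A (t k)) ----> r" if "t : cauchy_class A s" for t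
proof -
 note t = cauchy_class_memD[OF that]
 have l: "(%k. nrm A (t k \<ominus> s k)) ----> 0" using t cauchy_class_eq_iff by auto
 have "(%k. nrm A (t k) - nrm A (s k)) ----> 0"
  by (rule tendsto_rabs_zero_cancel, rule tendsto_sandwich[OF _ _ tendsto_const l])
    (use nrm_diff_abs t cauchy_seqsD c in auto)
 from tendsto_add[OF this r] show ?thesis by simp
qed
have "nrm (completion A) (cauchy_class A s) = (THE r. ALL t:cauchy_class A s. (%k. nrm A (t k)) ----> r)"
 by (simp add: completion_def)
also have "... = r"
 by (rule the_equality) (use all cauchy_class_self[OF s] r LIMSEQ_unique in blast)+
finally show ?thesis using r by simp
qed

lemma completion_one: "\<one>\<^bsub>completion A\<^esub> = cauchy_class A (%_. \<one>)"
and completion_zero: "\<zero>\<^bsub>completion A\<^esub> = cauchy_class A (%_. \<zero>)"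
by (simp_all add: completion_def)

lemmas completion_ops = completion_mult completion_add completion_smult completion_star
completion_one completion_zero
lemmas cauchy_seqs_ops = cauchy_seqs_const cauchy_seqs_mult cauchy_seqs_add cauchy_seqs_smult
cauchy_seqs_star

lemma cauchy_class_closed: "s : cauchy_seqs A ==> cauchy_class A s : cr (completion A)"
by (simp add: completion_carrier)

lemma cauchy_seqs_neg: "s : cauchy_seqs A ==> (%k. \<ominus> s k) : cauchy_seqs A"
using cauchy_seqs_smult[of s "-1"] cauchy_seqsD[of s] by (simp add: minus_eq_smult)

lemma cauchy_seqs_diff:
"s : cauchy_seqs A ==> t : cauchy_seqs A ==> (%k. s k \<ominus> t k) : cauchy_seqs A"
using cauchy_seqs_add[of s "%k. \<ominus> t k"] cauchy_seqs_neg[of t] by (simp add: minus_eq)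

lemma completion_ring: "ring (completion A)"
proof (rule ringI)
show "abelian_group (completion A)"
proof (rule abelian_groupI)
 fix X assume "X : cr (completion A)"
 then obtain s where s: "s : cauchy_seqs A" "X = cauchy_class A s" by (rule completion_cases)
 have "cauchy_class A (%k. \<ominus> s k) \<oplus>\<^bsub>completion A\<^esub> X = \<zero>\<^bsub>completion A\<^esub>"
  using s cauchy_seqsD[OF s(1)] by (simp add: completion_ops cauchy_seqs_neg l_neg)
 then show "EX Y:cr (completion A). Y \<oplus>\<^bsub>completion A\<^esub> X = \<zero>\<^bsub>completion A\<^esub>"
  using cauchy_class_closed cauchy_seqs_neg s by blast
qed (auto elim!: completion_cases simp: completion_ops cauchy_seqs_ops cauchy_class_closed
  cauchy_seqsD a_ac)
show "monoid (completion A)"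
 by (rule monoidI) (auto elim!: completion_cases simp: completion_ops cauchy_seqs_ops
  cauchy_class_closed cauchy_seqsD m_assoc)
qed (auto elim!: completion_cases simp: completion_ops cauchy_seqs_ops cauchy_class_closed
  cauchy_seqsD l_distr r_distr)

lemma completion_star_alg: "star_alg (completion A)"
proof -
interpret C: ring "completion A" by (rule completion_ring)
show ?thesis
 by unfold_locales (auto elim!: completion_cases simp: completion_ops cauchy_seqs_ops cauchy_class_closed
  cauchy_seqsD smult_r_distr smult_l_distr smult_smult smult_mult_left smult_mult_right
  star_add star_mult star_smult)
qed

lemma completion_seminorm_alg: "seminorm_alg (completion A)"
proof -
interpret C: star_alg "completion A" by (rule completion_star_alg)
show ?thesis
proof
 fix X c assume "X : cr (completion A)"
 then obtain s where s: "s : cauchy_seqs A" "X = cauchy_class A s" by (rule completion_cases)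
 note sl = completion_nrm[OF s(1), folded s(2)] and sc = cauchy_seqsD[OF s(1)]
 show "0 <= nrm (completion A) X"
  by (rule LIMSEQ_le_const[OF sl]) (use sc nrm_nonneg in auto)
 have "(%k. nrm A (c \<odot> s k)) ----> nrm (completion A) (c \<odot>\<^bsub>completion A\<^esub> X)"
  using completion_nrm[OF cauchy_seqs_smult[OF s(1)]] s by (simp add: completion_ops)
 moreover have "(%k. nrm A (c \<odot> s k)) ----> cmod c * nrm (completion A) X"
  using sc tendsto_mult_left[OF sl] by (simp add: nrm_smult)
 ultimately show "nrm (completion A) (c \<odot>\<^bsub>completion A\<^esub> X) = cmod c * nrm (completion A) X"
  by (rule LIMSEQ_unique)
 have "(%k. nrm A ((s k)\<^sup>* \<cdot> s k)) ----> nrm (completion A) (X\<^sup>*\<^bsub>completion A\<^esub> \<cdot>\<^bsub>completion A\<^esub> X)"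
  using completion_nrm[OF cauchy_seqs_mult[OF cauchy_seqs_star[OF s(1)] s(1)]] s
  by (simp add: completion_ops cauchy_seqs_ops)
 moreover have "(%k. nrm A ((s k)\<^sup>* \<cdot> s k)) ----> (nrm (completion A) X)\<^sup>2"
  using sc tendsto_power[OF sl, of 2] by (simp add: nrm_cstar)
 ultimately show "nrm (completion A) (X\<^sup>*\<^bsub>completion A\<^esub> \<cdot>\<^bsub>completion A\<^esub> X) = (nrm (completion A) X)\<^sup>2"
  by (rule LIMSEQ_unique)
 fix Y assume "Y : cr (completion A)"
 then obtain t where t: "t : cauchy_seqs A" "Y = cauchy_class A t" by (rule completion_cases)
 note tl = completion_nrm[OF t(1), folded t(2)] and tc = cauchy_seqsD[OF t(1)]
 have "(%k. nrm A (s k \<oplus> t k)) ----> nrm (completion A) (X \<oplus>\<^bsub>completion A\<^esub> Y)"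
  using completion_nrm[OF cauchy_seqs_add[OF s(1) t(1)]] s t by (simp add: completion_ops)
 then show "nrm (completion A) (X \<oplus>\<^bsub>completion A\<^esub> Y) <= nrm (completion A) X + nrm (completion A) Y"
  by (rule LIMSEQ_le[OF _ tendsto_add[OF sl tl]]) (use sc tc nrm_triangle in auto)
 have "(%k. nrm A (s k \<cdot> t k)) ----> nrm (completion A) (X \<cdot>\<^bsub>completion A\<^esub> Y)"
  using completion_nrm[OF cauchy_seqs_mult[OF s(1) t(1)]] s t by (simp add: completion_ops)
 then show "nrm (completion A) (X \<cdot>\<^bsub>completion A\<^esub> Y) <= nrm (completion A) X * nrm (completion A) Y"
  by (rule LIMSEQ_le[OF _ tendsto_mult[OF sl tl]]) (use sc tc nrm_mult in auto)
qed
qed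

lemma completion_diff:
assumes s: "s : cauchy_seqs A" "t : cauchy_seqs A"
shows "cauchy_class A s \<ominus>\<^bsub>completion A\<^esub> cauchy_class A t = cauchy_class A (%k. s k \<ominus> t k)"
proof -
interpret C: star_alg "completion A" by (rule completion_star_alg)
show ?thesis using s cauchy_seqsD[OF s(1)] cauchy_seqsD[OF s(2)]
 by (simp add: C.diff_eq_smult diff_eq_smult completion_ops cauchy_seqs_ops cauchy_class_closed)
qed

abbreviation embed :: "'a => (nat => 'a) set" where
"embed x \<equiv> cauchy_class A (%_. x)"

lemma nrm_embed: "x : cr A ==> nrm (completion A) (embed x) = nrm A x"
using completion_nrm[OF cauchy_seqs_const[of x]] LIMSEQ_unique tendsto_const by blast

lemma embed_dense:
assumes s: "s : cauchy_seqs A"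
shows "norm_lim (completion A) (%k. embed (s k)) (cauchy_class A s)"
unfolding norm_lim_def
proof (rule LIMSEQ_I)
interpret C: seminorm_alg "completion A" by (rule completion_seminorm_alg)
have c: "s k : cr A" for k using s by (rule cauchy_seqsD)
fix e :: real assume e: "0 < e"
then obtain N where N: "!!k l. k >= N ==> l >= N ==> nrm A (s k \<ominus> s l) < e/2"
 using cauchy_seqsD'[OF s, of "e/2"] by auto
have "nrm (completion A) (embed (s k) \<ominus>\<^bsub>completion A\<^esub> cauchy_class A s) <= e/2" if "k >= N" for k
proof (rule LIMSEQ_le_const2)
 show "(%l. nrm A (s k \<ominus> s l)) ----> nrm (completion A) (embed (s k) \<ominus>\<^bsub>completion A\<^esub> cauchy_class A s)"
  using completion_nrm[OF cauchy_seqs_diff[OF cauchy_seqs_const[OF c[of k]] s]]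
  by (simp add: completion_diff cauchy_seqs_const c s)
 show "EX N. ALL l>=N. nrm A (s k \<ominus> s l) <= e/2" using N[OF that] by (auto intro!: exI[of _ N] less_imp_le)
qed
then show "EX no. ALL k>=no. norm (nrm (completion A) (embed (s k) \<ominus>\<^bsub>completion A\<^esub> cauchy_class A s) - 0) < e"
 using e C.nrm_nonneg c s by (intro exI[of _ N]) (force simp: cauchy_class_closed cauchy_seqs_const)
qed

text \<open>All operations are computed on representing sequences, so the axioms pass to the limit termwise.\<close>

theorem completion_cstar_alg: "cstar_alg (completion A)"
proof -
interpret C: seminorm_alg "completion A" by (rule completion_seminorm_alg)
let ?n = "nrm (completion A)"
show ?thesis
proof
 fix X assume "X : cr (completion A)" and z: "?n X = 0"
 then obtain s where s: "s : cauchy_seqs A" "X = cauchy_class A s" by (auto elim: completion_cases)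
 have "(%k. nrm A (s k \<ominus> \<zero>)) ----> 0"
  using completion_nrm[OF s(1)] z s cauchy_seqsD[OF s(1)] by (simp add: minus_eq)
 then show "X = \<zero>\<^bsub>completion A\<^esub>"
  using cauchy_class_eq_iff[OF s(1) cauchy_seqs_const[of \<zero>]] s by (simp add: completion_zero)
next
 fix S :: "nat => (nat => 'a) set" assume S: "!!k. S k : cr (completion A)"
  and cau: "!!e. e > 0 ==> EX N. ALL k>=N. ALL l>=N. ?n (S k \<ominus>\<^bsub>completion A\<^esub> S l) < e"
 have "EX d. d : cr A & ?n (embed d \<ominus>\<^bsub>completion A\<^esub> S k) < 1 / real (Suc k)" for k
 proof -
  obtain s where s: "s : cauchy_seqs A" "S k = cauchy_class A s" using completion_cases[OF S[of k]] by metis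
  have "\<forall>\<^sub>F j in sequentially. ?n (embed (s j) \<ominus>\<^bsub>completion A\<^esub> S k) < 1 / real (Suc k)"
   using embed_dense[OF s(1)] unfolding norm_lim_def s(2) by (rule order_tendstoD) simp
  then show ?thesis using cauchy_seqsD[OF s(1)] eventually_happens'[OF sequentially_bot] by blast
 qed
 then obtain d where d: "!!k. d k : cr A"
  "!!k. ?n (embed (d k) \<ominus>\<^bsub>completion A\<^esub> S k) < 1 / real (Suc k)" by metis
 have dc: "embed (d k) : cr (completion A)" for k using d by (simp add: cauchy_class_closed cauchy_seqs_const)
 have b: "nrm A (d k \<ominus> d l) <= 1 / real (Suc k) + ?n (S k \<ominus>\<^bsub>completion A\<^esub> S l) + 1 / real (Suc l)" for k l
 proof -
  have "nrm A (d k \<ominus> d l) = ?n (embed (d k) \<ominus>\<^bsub>completion A\<^esub> embed (d l))"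
   using d by (simp add: completion_diff cauchy_seqs_const nrm_embed)
  also have "... <= ?n (embed (d k) \<ominus>\<^bsub>completion A\<^esub> S k) + ?n (S k \<ominus>\<^bsub>completion A\<^esub> S l)
    + ?n (S l \<ominus>\<^bsub>completion A\<^esub> embed (d l))"
   using C.nrm_diff_triangle[of "embed (d k)" "S k" "embed (d l)"]
    C.nrm_diff_triangle[of "S k" "S l" "embed (d l)"] dc S by force
  finally show ?thesis using d(2)[of k] d(2)[of l] C.nrm_diff_commute[OF dc S, of l l] by linarith
 qed
 have "EX N. ALL k>=N. ALL l>=N. nrm A (d k \<ominus> d l) < e" if e: "e > 0" for e
 proof -
  obtain N where N: "!!k l. k >= N ==> l >= N ==> ?n (S k \<ominus>\<^bsub>completion A\<^esub> S l) < e/3"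
   using cau[of "e/3"] e by auto
  obtain M where M: "1 / real (Suc M) < e/3" using e nat_approx_posE[of "e/3"] by auto
  have "nrm A (d k \<ominus> d l) < e" if "k >= max N M" "l >= max N M" for k l
  proof -
   have "1 / real (Suc k) <= 1 / real (Suc M)" "1 / real (Suc l) <= 1 / real (Suc M)"
    using that by (auto intro!: divide_left_mono)
   then show ?thesis using b[of k l] N[of k l] that M by linarith
  qed
  then show ?thesis by blast
 qed
 then have dC: "d : cauchy_seqs A" using d by (simp add: cauchy_seqs_def)
 have l1: "(%k. 1 / real (Suc k) + ?n (embed (d k) \<ominus>\<^bsub>completion A\<^esub> cauchy_class A d)) ----> 0"
  using embed_dense[OF dC] unfolding norm_lim_def by (intro tendsto_add_zero LIMSEQ_Suc[OF lim_1_over_n])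
 have "norm_lim (completion A) S (cauchy_class A d)"
 proof (rule C.norm_lim_squeeze[OF S cauchy_class_closed[OF dC] _ l1])
  fix k
  show "?n (S k \<ominus>\<^bsub>completion A\<^esub> cauchy_class A d)
    <= 1 / real (Suc k) + ?n (embed (d k) \<ominus>\<^bsub>completion A\<^esub> cauchy_class A d)"
   using C.nrm_diff_triangle[OF S dc cauchy_class_closed[OF dC], of k k] d(2)[of k]
    C.nrm_diff_commute[OF dc S, of k k] by linarith
 qed
 then show "EX X:cr (completion A). norm_lim (completion A) S X"
  using cauchy_class_closed[OF dC] by blast
qed
qed

end

section \<open>Universal C*-algebras\<close>

subsection \<open>The free *-algebra\<close>

lemma poly_scale_conv_mult: "poly_scale c p = Poly_Mapping.single 0 c * p"
unfolding poly_scale_def by (rule mult_map_scale_conv_mult)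

lemma word_star_word_star [simp]: "word_star (word_star w) = w"
by (cases w) (simp add: word_star_def rev_map comp_def case_prod_beta)

lemma inj_word_star: "inj word_star"
by (rule inj_on_inverseI[of _ word_star]) simp

lemma word_star_add: "word_star (u + v) = word_star v + word_star u"
by (simp add: word_star_def plus_star_word_def)

lemma word_star_zero [simp]: "word_star 0 = 0"
by (simp add: word_star_def zero_star_word_def)

lemma lookup_poly_star: "Poly_Mapping.lookup (poly_star p) w = cnj (Poly_Mapping.lookup p (word_star w))"
unfolding poly_star_def
by (simp add: map.rep_eq Poly_Mapping.map_key.rep_eq[OF inj_word_star] when_def)

lemma poly_star_single [simp]:
"poly_star (Poly_Mapping.single w c) = Poly_Mapping.single (word_star w) (cnj c)"
by (rule poly_mapping_eqI) (auto simp: lookup_poly_star lookup_single when_def)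

lemma poly_star_add: "poly_star (p + q) = poly_star p + poly_star q"
by (rule poly_mapping_eqI) (simp add: lookup_poly_star lookup_add)

lemma poly_star_zero [simp]: "poly_star 0 = 0"
by (rule poly_mapping_eqI) (simp add: lookup_poly_star)

lemma poly_star_poly_star [simp]: "poly_star (poly_star p) = p"
by (rule poly_mapping_eqI) (simp add: lookup_poly_star)

lemma poly_mapping_additive_induct [case_names zero single add]:
assumes "P 0" "!!k v. P (Poly_Mapping.single k v)" "!!p q. P p ==> P q ==> P (p + q)"
shows "P (p :: 'a \<Rightarrow>\<^sub>0 'b::comm_monoid_add)"
proof (induction p rule: update_induct)
case (update f a b)
have "Poly_Mapping.update a b f = f + Poly_Mapping.single a b"
 by (rule poly_mapping_eqI)
   (use update(1) in \<open>auto simp: lookup_update lookup_add lookup_single when_def in_keys_iff\<close>)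
then show ?case using update assms by simp
qed (use assms(1) in simp)

lemma poly_star_mult:
fixes p q :: "'g star_poly"
shows "poly_star (p * q) = poly_star q * poly_star p"
proof (induction p rule: poly_mapping_additive_induct)
case (single u a)
show ?case
 by (induction q rule: poly_mapping_additive_induct)
   (auto simp: mult_single word_star_add poly_star_add distrib_left distrib_right mult.commute)
qed (auto simp: poly_star_add distrib_left distrib_right)

lemma poly_star_one [simp]: "poly_star (1 :: 'g star_poly) = 1"
by (simp only: single_one[symmetric] poly_star_single) simp

lemma scale_central: "Poly_Mapping.single 0 c * p = p * Poly_Mapping.single 0 (c :: complex)"
by (induction p rule: poly_mapping_additive_induct)
  (auto simp: mult_single distrib_left distrib_right mult.commute)

lemma poly_star_scale: "poly_star (poly_scale c p) = poly_scale (cnj c) (poly_star p)"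
by (simp add: poly_scale_conv_mult poly_star_mult scale_central)

lemma mult_scale_left: "p * (Poly_Mapping.single 0 c * r) = Poly_Mapping.single 0 (c :: complex) * (p * r)"
by (metis mult.assoc scale_central)

abbreviation word_in :: "'g set => 'g star_word => bool" where
"word_in G w \<equiv> set (letters w) <= G \<times> UNIV"

lemma free_star_carrier_single: "word_in G w ==> Poly_Mapping.single w c : polys G"
by (auto simp: free_star_carrier_def)

lemma free_star_carrier_gen: "g : G ==> poly_gen g : polys G"
by (auto simp: poly_gen_def free_star_carrier_def)

lemma word_in_zero [simp]: "word_in G 0"
by (simp add: zero_star_word_def)

lemma word_in_add: "word_in G (u + v) \<longleftrightarrow> word_in G u & word_in G v"
by (auto simp: plus_star_word_def)

lemma word_in_star: "word_in G (word_star w) \<longleftrightarrow> word_in G w"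
proof -
have iff: "A <= G \<times> UNIV \<longleftrightarrow> fst ` A <= G" for A :: "('a \<times> bool) set"
 by (auto simp: image_subset_iff subset_eq)
have "fst ` set (letters (word_star w)) = fst ` set (letters w)"
 by (simp add: word_star_def image_image case_prod_beta)
then show ?thesis by (simp only: iff)
qed

lemma polys_closed [intro]:
shows "0 : polys G" "1 : polys G"
 "x : polys G ==> y : polys G ==> x + y : polys G"
 "x : polys G ==> y : polys G ==> x * y : polys G"
 "x : polys G ==> poly_scale c x : polys G"
 "x : polys G ==> poly_star x : polys G"
proof -
show m: "x * y : polys G" if "x : polys G" "y : polys G" for x y
proof -
 have "word_in G w" if w: "w : Poly_Mapping.keys (x * y)" for w
 proof -
  obtain u v where "w = u + v" "u : Poly_Mapping.keys x" "v : Poly_Mapping.keys y"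
   using subsetD[OF keys_mult w] by blast
  then show ?thesis using \<open>x : _\<close> \<open>y : _\<close> by (simp add: word_in_add free_star_carrier_def)
 qed
 then show ?thesis by (auto simp: free_star_carrier_def)
qed
show "1 : polys G" using free_star_carrier_single[of 0 G 1] by simp
show "x + y : polys G" if "x : polys G" "y : polys G"
 using that keys_add[of x y] unfolding free_star_carrier_def by blast
show "poly_scale c x : polys G" if "x : polys G"
 unfolding poly_scale_conv_mult by (rule m) (use that free_star_carrier_single[of 0 G c] in auto)
have "word_in G w" if "w : Poly_Mapping.keys (poly_star x)" "x : polys G" for w
proof -
 have "word_star w : Poly_Mapping.keys x" using that(1) by (simp add: in_keys_iff lookup_poly_star)
 then show ?thesis using that(2) word_in_star[of w G] by (auto simp: free_star_carrier_def)
qed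
then show "poly_star x : polys G" if "x : polys G"
 using that by (auto simp: free_star_carrier_def)
qed (auto simp: free_star_carrier_def)

lemma free_star_induct [consumes 1, case_names one gen gen_star add scale mult]:
assumes p: "p : polys G"
 and one: "P 1"
 and gen: "!!g. g : G ==> P (poly_gen g)"
 and gen_star: "!!g. g : G ==> P (poly_star (poly_gen g))"
 and add: "!!x y. x : polys G ==> y : polys G ==> P x ==> P y ==> P (x + y)"
 and scale: "!!c x. x : polys G ==> P x ==> P (poly_scale c x)"
 and mult: "!!x y. x : polys G ==> y : polys G ==> P x ==> P y ==> P (x * y)"
shows "P p"
proof -
have word: "P (Poly_Mapping.single (Word l) 1)" if "word_in G (Word l)" for l
 using that
proof (induction l)
 case Nil
 then show ?case using one by (simp add: zero_star_word_def[symmetric])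
next
 case (Cons a l)
 obtain g b where a: "a = (g, b)" by (cases a)
 let ?x = "if b then poly_star (poly_gen g) else poly_gen g"
 have g: "g : G" using Cons.prems a by auto
 have "Poly_Mapping.single (Word (a # l)) 1 = ?x * Poly_Mapping.single (Word l) 1"
  by (simp add: a poly_gen_def mult_single plus_star_word_def word_star_def)
 moreover have "P (?x * Poly_Mapping.single (Word l) 1)"
  by (rule mult) (use Cons g gen gen_star free_star_carrier_gen in \<open>auto intro!: free_star_carrier_single polys_closed\<close>)
 ultimately show ?case by simp
qed
have mono: "P (Poly_Mapping.single w c)" if w: "word_in G w" for w c
proof -
 have "Poly_Mapping.single w c = poly_scale c (Poly_Mapping.single w 1)"
  by (simp add: poly_scale_conv_mult mult_single)
 then show ?thesis using scale word[of "letters w"] w free_star_carrier_single[OF w, of 1] by simp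
qed
have "p : polys G --> P p"
proof (induction p rule: update_induct)
 case const
 then show ?case using mono[of 0 0] by simp
next
 case (update f a b)
 have eq: "Poly_Mapping.update a b f = f + Poly_Mapping.single a b"
  by (rule poly_mapping_eqI)
    (use update(1) in \<open>auto simp: lookup_update lookup_add lookup_single when_def in_keys_iff\<close>)
 show ?case
 proof
  assume c: "Poly_Mapping.update a b f : polys G"
  then have "f : polys G" "word_in G a"
   using update by (auto simp: free_star_carrier_def keys_update)
  then show "P (Poly_Mapping.update a b f)"
   unfolding eq using add update mono free_star_carrier_single by blast
 qed
qed
then show ?thesis using p by simp
qed

lemma free_star_algebra_simps [simp]:
"cr (free_star_algebra G N) = polys G"
"x \<cdot>\<^bsub>free_star_algebra G N\<^esub> y = x * y"
"x \<oplus>\<^bsub>free_star_algebra G N\<^esub> y = x + y"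
"\<one>\<^bsub>free_star_algebra G N\<^esub> = 1" "\<zero>\<^bsub>free_star_algebra G N\<^esub> = 0"
"c \<odot>\<^bsub>free_star_algebra G N\<^esub> x = poly_scale c x"
"x\<^sup>*\<^bsub>free_star_algebra G N\<^esub> = poly_star x"
"nrm (free_star_algebra G N) = N"
by (simp_all add: free_star_algebra_def)

lemma free_star_alg: "star_alg (free_star_algebra G N)"
proof -
have "ring (free_star_algebra G N)"
proof (rule ringI)
 show "abelian_group (free_star_algebra G N)"
 proof (rule abelian_groupI)
  fix x assume "x : cr (free_star_algebra G N)"
  then show "EX y:cr (free_star_algebra G N). y \<oplus>\<^bsub>free_star_algebra G N\<^esub> x = \<zero>\<^bsub>free_star_algebra G N\<^esub>"
   by (intro bexI[of _ "- x"]) (auto simp: free_star_carrier_def in_keys_iff)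
 qed (auto simp: algebra_simps)
 show "monoid (free_star_algebra G N)" by (rule monoidI) (auto simp: mult.assoc)
qed (auto simp: algebra_simps)
then interpret ring "free_star_algebra G N" .
have closed: "Poly_Mapping.single 0 c * x : polys G" if "x : polys G" for c x
 using polys_closed(5)[OF that, of c] by (simp add: poly_scale_conv_mult)
show ?thesis
proof
 fix x y :: "'a star_poly" and c d
 show "c \<odot>\<^bsub>free_star_algebra G N\<^esub> (d \<odot>\<^bsub>free_star_algebra G N\<^esub> x) = (c * d) \<odot>\<^bsub>free_star_algebra G N\<^esub> x"
  by (simp add: poly_scale_conv_mult mult.assoc[symmetric] mult_single)
 show "x \<cdot>\<^bsub>free_star_algebra G N\<^esub> (c \<odot>\<^bsub>free_star_algebra G N\<^esub> y)
   = c \<odot>\<^bsub>free_star_algebra G N\<^esub> (x \<cdot>\<^bsub>free_star_algebra G N\<^esub> y)"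
  by (simp add: poly_scale_conv_mult mult_scale_left)
qed (auto simp: poly_scale_conv_mult distrib_left distrib_right single_add mult.assoc
   poly_star_add poly_star_mult scale_central[symmetric] poly_star_scale[unfolded poly_scale_conv_mult] closed)
qed

lemma free_star_diff [simp]:
assumes "x : polys G" "y : polys G"
shows "x \<ominus>\<^bsub>free_star_algebra G N\<^esub> y = x - y"
proof -
interpret star_alg "free_star_algebra G N" by (rule free_star_alg)
have "poly_scale (- 1) y = - y"
 by (simp add: poly_scale_conv_mult single_uminus)
then show ?thesis using assms diff_eq_smult[of x y] by simp
qed

lemma free_star_carrier_diff [intro]:
assumes "x : polys G" "y : polys G"
shows "x - y : polys G"
proof -
interpret star_alg "free_star_algebra G undefined" by (rule free_star_alg)
show ?thesis using minus_closed[of x y] assms by simp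
qed

lemma free_star_carrier_sum [intro]:
"(!!i. i : I ==> f i : polys G) ==> sum f I : polys G"
by (induction I rule: infinite_finite_induct) auto

lemma cstar_seminorm_iff: "cstar_seminorm G N \<longleftrightarrow> seminorm_alg (free_star_algebra G N)"
proof
interpret star_alg "free_star_algebra G N" by (rule free_star_alg)
assume N: "cstar_seminorm G N"
show "seminorm_alg (free_star_algebra G N)"
 by unfold_locales (use N in \<open>auto simp: cstar_seminorm_def\<close>)
next
assume "seminorm_alg (free_star_algebra G N)"
then interpret seminorm_alg "free_star_algebra G N" .
show "cstar_seminorm G N"
 unfolding cstar_seminorm_def
 using nrm_nonneg nrm_triangle nrm_mult nrm_smult nrm_cstar by simp
qed

lemma norm_closedD:
assumes "norm_closed A E" "!!k. s k : E" "x : cr A" "norm_lim A s x"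
shows "x : E"
proof -
have "ALL s x. (ALL k. s k : E) & x : cr A & norm_lim A s x --> x : E"
 using assms(1) unfolding norm_closed_def by (rule conjunct2)
from this[rule_format, of s x] show ?thesis using assms(2-) by simp
qed

lemma norm_closedI:
assumes "E <= cr A"
 "!!s x. (!!k. s k : E) ==> x : cr A ==> norm_lim A s x ==> x : E"
shows "norm_closed A E"
unfolding norm_closed_def using assms by auto

subsection \<open>The universal norm\<close>

locale universal_alg =
fixes G :: "'g set" and R :: "'g star_poly set"
assumes relators: "R <= polys G"
 and gen_bounded: "g : G ==>
  EX B. ALL N. cstar_seminorm G N & (ALL r:R. N r = 0) --> N (poly_gen g) <= B"
begin

abbreviation adm :: "('g star_poly => real) => bool" where
"adm N \<equiv> cstar_seminorm G N & (ALL r:R. N r = 0)"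

lemma adm_bounded:
assumes "x : polys G"
shows "EX B. ALL N. adm N --> N x <= B"
using assms
proof (induction x rule: free_star_induct)
case one
then show ?case using seminorm_alg.nrm_one_le[of "free_star_algebra G _"] by (auto simp: cstar_seminorm_iff)
next
case (gen g)
then show ?case by (rule gen_bounded)
next
case (gen_star g)
have eq: "N (poly_star (poly_gen g)) = N (poly_gen g)" if "adm N" for N
 using that seminorm_alg.nrm_star[of "free_star_algebra G N" "poly_gen g"] free_star_carrier_gen[OF gen_star]
 by (simp add: cstar_seminorm_iff)
obtain B where B: "!!N. adm N ==> N (poly_gen g) <= B" using gen_bounded[OF gen_star] by blast
have "N (poly_star (poly_gen g)) <= B" if N: "adm N" for N unfolding eq[OF N] by (rule B[OF N])
then show ?case by blast
next
case (add x y)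
then obtain B C where BC: "!!N. adm N ==> N x <= B" "!!N. adm N ==> N y <= C" by blast
have "N (x + y) <= B + C" if N: "adm N" for N
proof -
 have "N (x + y) <= N x + N y" using N add(1,2) by (simp add: cstar_seminorm_def)
 then show ?thesis using BC[OF N] by linarith
qed
then show ?case by blast
next
case (scale c x)
then obtain B where "!!N. adm N ==> N x <= B" by blast
then have "N (poly_scale c x) <= cmod c * B" if "adm N" for N
 using that scale(1) unfolding cstar_seminorm_def by (simp add: mult_left_mono)
then show ?case by blast
next
case (mult x y)
then obtain B C where BC: "!!N. adm N ==> N x <= B" "!!N. adm N ==> N y <= C" by blast
have "N (x * y) <= \<bar>B\<bar> * \<bar>C\<bar>" if N: "adm N" for N
proof -
 have "N (x * y) <= N x * N y" "0 <= N x" "0 <= N y" using N mult(1,2) by (auto simp: cstar_seminorm_def)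
 moreover have "N x * N y <= \<bar>B\<bar> * \<bar>C\<bar>"
  by (rule mult_mono) (use BC[OF N] calculation in auto)
 ultimately show ?thesis by linarith
qed
then show ?case by blast
qed

lemma adm_zero: "adm (%_. 0)"
by (simp add: cstar_seminorm_def)

lemma adm_le_universal:
assumes "adm N" "x : polys G"
shows "N x <= universal_norm G R x"
proof -
obtain B where "!!N. adm N ==> N x <= B" using adm_bounded assms by blast
then have "bdd_above {N x | N. adm N}" by (auto intro!: bdd_aboveI[of _ B])
then show ?thesis unfolding universal_norm_def using assms(1) by (intro cSup_upper) auto
qed

lemma universal_norm_le:
assumes "!!N. adm N ==> N x <= c" shows "universal_norm G R x <= c"
unfolding universal_norm_def by (rule cSup_least) (use assms adm_zero in auto)

lemma universal_norm_relator: "r : R ==> universal_norm G R r = 0"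
proof -
assume r: "r : R"
have "{N r | N. adm N} = {0}" using r adm_zero by auto
then show ?thesis by (simp add: universal_norm_def)
qed

lemma universal_cstar_seminorm: "cstar_seminorm G (universal_norm G R)"
unfolding cstar_seminorm_def
proof (intro ballI conjI allI)
fix x y c assume x: "x : polys G"
let ?U = "universal_norm G R"
show nn: "0 <= ?U x" using adm_le_universal[OF adm_zero x] .
show "?U (poly_scale c x) = cmod c * ?U x"
proof (rule antisym)
 show "?U (poly_scale c x) <= cmod c * ?U x"
 proof (rule universal_norm_le)
  fix N assume N: "adm N"
  have "N (poly_scale c x) = cmod c * N x" using N x by (simp add: cstar_seminorm_def)
  also have "... <= cmod c * ?U x" using adm_le_universal[OF N x] by (simp add: mult_left_mono)
  finally show "N (poly_scale c x) <= cmod c * ?U x" .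
 qed
 show "cmod c * ?U x <= ?U (poly_scale c x)"
 proof (cases "c = 0")
  case True
  then show ?thesis using adm_le_universal[OF adm_zero, of "poly_scale c x"] x by auto
 next
  case False
  have "?U x <= ?U (poly_scale c x) / cmod c"
  proof (rule universal_norm_le)
   fix N assume N: "adm N"
   have "cmod c * N x = N (poly_scale c x)" using N x by (simp add: cstar_seminorm_def)
   also have "... <= ?U (poly_scale c x)" using adm_le_universal[OF N] x by auto
   finally show "N x <= ?U (poly_scale c x) / cmod c" using False by (simp add: field_simps)
  qed
  then show ?thesis using False by (simp add: field_simps)
 qed
qed
have xx: "poly_star x * x : polys G" using x by blast
show "?U (poly_star x * x) = (?U x)\<^sup>2"
proof (rule antisym)
 show "?U (poly_star x * x) <= (?U x)\<^sup>2"
 proof (rule universal_norm_le)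
  fix N assume N: "adm N"
  have "N (poly_star x * x) = (N x)\<^sup>2" "0 <= N x" using N x by (auto simp: cstar_seminorm_def)
  then show "N (poly_star x * x) <= (?U x)\<^sup>2" using adm_le_universal[OF N x] by (simp add: power_mono)
 qed
 have nn': "0 <= ?U (poly_star x * x)" using adm_le_universal[OF adm_zero xx] .
 have "?U x <= sqrt (?U (poly_star x * x))"
 proof (rule universal_norm_le)
  fix N assume N: "adm N"
  have "N (poly_star x * x) = (N x)\<^sup>2" "0 <= N x" using N x by (auto simp: cstar_seminorm_def)
  then show "N x <= sqrt (?U (poly_star x * x))" using adm_le_universal[OF N xx] by (simp add: real_le_rsqrt)
 qed
 then have "(?U x)\<^sup>2 <= (sqrt (?U (poly_star x * x)))\<^sup>2" using nn by (rule power_mono)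
 then show "(?U x)\<^sup>2 <= ?U (poly_star x * x)" using nn' by simp
qed
fix y assume y: "y : polys G"
show "?U (x + y) <= ?U x + ?U y"
proof (rule universal_norm_le)
 fix N assume N: "adm N"
 have "N (x + y) <= N x + N y" using N x y by (simp add: cstar_seminorm_def)
 then show "N (x + y) <= ?U x + ?U y"
  using adm_le_universal[OF N x] adm_le_universal[OF N y] by linarith
qed
show "?U (x * y) <= ?U x * ?U y"
proof (rule universal_norm_le)
 fix N assume N: "adm N"
 have "N (x * y) <= N x * N y" "0 <= N x" "0 <= N y" using N x y by (auto simp: cstar_seminorm_def)
 moreover have "N x * N y <= ?U x * ?U y"
  by (rule mult_mono) (use adm_le_universal[OF N] x y nn calculation in auto)
 ultimately show "N (x * y) <= ?U x * ?U y" by linarith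
qed
qed

abbreviation poly_alg :: "'g star_poly cstar" where
"poly_alg \<equiv> free_star_algebra G (universal_norm G R)"

abbreviation ucstar :: "(nat => 'g star_poly) set cstar" where
"ucstar \<equiv> universal_cstar G R"

sublocale P: seminorm_alg poly_alg
using universal_cstar_seminorm by (simp add: cstar_seminorm_iff)

sublocale U: cstar_alg ucstar
unfolding universal_cstar_def by (rule P.completion_cstar_alg)

definition \<iota> :: "'g star_poly => (nat => 'g star_poly) set" where
"\<iota> x = cauchy_class poly_alg (%_. x)"

lemma cauchy_const: "x : polys G ==> (%_. x) : cauchy_seqs poly_alg"
using P.cauchy_seqs_const by simp

lemma \<iota>_closed [intro]: "x : polys G ==> \<iota> x : cr ucstar"
unfolding \<iota>_def universal_cstar_def using P.cauchy_class_closed cauchy_const by auto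

lemma \<iota>_hom:
"\<iota> 1 = \<one>\<^sub>ucstar" "\<iota> 0 = \<zero>\<^sub>ucstar"
"x : polys G ==> y : polys G ==> \<iota> (x + y) = \<iota> x \<oplus>\<^sub>ucstar \<iota> y"
"x : polys G ==> y : polys G ==> \<iota> (x - y) = \<iota> x \<ominus>\<^sub>ucstar \<iota> y"
"x : polys G ==> y : polys G ==> \<iota> (x * y) = \<iota> x \<cdot>\<^sub>ucstar \<iota> y"
"x : polys G ==> \<iota> (poly_scale c x) = c \<odot>\<^sub>ucstar \<iota> x"
"x : polys G ==> \<iota> (poly_star x) = (\<iota> x)\<^sup>*\<^sub>ucstar"
unfolding \<iota>_def universal_cstar_def
by (simp_all add: P.completion_ops P.completion_diff cauchy_const)

lemma \<iota>_nrm: "x : polys G ==> nrm ucstar (\<iota> x) = universal_norm G R x"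
unfolding \<iota>_def universal_cstar_def using P.nrm_embed by simp

lemma \<iota>_relator: "r : R ==> \<iota> r = \<zero>\<^sub>ucstar"
using U.nrm_eq_0D[OF \<iota>_closed[of r]] \<iota>_nrm[of r] universal_norm_relator[of r] relators by auto

lemma \<iota>_dense:
assumes "X : cr ucstar"
obtains s where "s : cauchy_seqs poly_alg" "X = cauchy_class poly_alg s"
 "!!k. s k : polys G" "norm_lim ucstar (%k. \<iota> (s k)) X"
proof -
obtain s where s: "s : cauchy_seqs poly_alg" "X = cauchy_class poly_alg s"
 using assms P.completion_cases unfolding universal_cstar_def by blast
show ?thesis
 by (rule that[OF s]) (use P.cauchy_seqsD[OF s(1)] P.embed_dense[OF s(1)] s in
  \<open>simp_all add: \<iota>_def universal_cstar_def\<close>)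
qed

end

section \<open>Hilbert spaces\<close>

context hilbert_space
begin

lemma scalar_simps [simp]: "a : cr complex_ring" "add complex_ring a b = a + b"
"mult complex_ring a b = a * b" "one complex_ring = 1" "zero complex_ring = 0"
by (simp_all add: complex_ring_def)

lemma hsmult_closed [simp, intro]: "v : cr H ==> c \<odot> v : cr H"
using smult_closed[of c v] by simp

lemma hsmult_simps:
"u : cr H ==> v : cr H ==> c \<odot> (u \<oplus> v) = c \<odot> u \<oplus> c \<odot> v"
"v : cr H ==> (a + b) \<odot> v = a \<odot> v \<oplus> b \<odot> v"
"v : cr H ==> a \<odot> (b \<odot> v) = (a * b) \<odot> v"
"v : cr H ==> 1 \<odot> v = v"
"v : cr H ==> 0 \<odot> v = \<zero>"
"c \<odot> \<zero> = \<zero>"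
using smult_r_distr[of c u v] smult_l_distr[of a b v] smult_assoc1[of a b v] smult_one[of v]
 smult_l_null[of v] smult_r_null[of c] by simp_all

lemma hminus_eq: "v : cr H ==> \<ominus> v = (- 1) \<odot> v"
proof -
assume v: "v : cr H"
have "(- 1) \<odot> v \<oplus> v = ((- 1) + 1) \<odot> v" using v by (subst hsmult_simps(2)) (auto simp: hsmult_simps(4))
also have "... = \<zero>" using v by (simp add: hsmult_simps(5))
finally show ?thesis using M.minus_equality[of "(- 1) \<odot> v" v] v by simp
qed

lemma hdiff_eq: "u : cr H ==> v : cr H ==> u \<ominus> v = u \<oplus> (- 1) \<odot> v"
by (simp add: M.minus_eq hminus_eq)

lemma ip_add_right: "[|u : cr H; v : cr H; w : cr H|] ==> ip H u (v \<oplus> w) = ip H u v + ip H u w"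
using ip_commute[of "v \<oplus> w" u] ip_commute[of v u] ip_commute[of w u] by (simp add: ip_add_left)

lemma ip_smult_right: "[|u : cr H; v : cr H|] ==> ip H u (c \<odot> v) = cnj c * ip H u v"
using ip_commute[of "c \<odot> v" u] ip_commute[of v u] by (simp add: ip_smult_left)

lemma ip_zero [simp]: "v : cr H ==> ip H \<zero> v = 0" "v : cr H ==> ip H v \<zero> = 0"
using ip_smult_left[of v v 0] ip_smult_right[of v v 0] by (simp_all add: hsmult_simps)

lemma ip_diff_left: "[|u : cr H; v : cr H; w : cr H|] ==> ip H (u \<ominus> v) w = ip H u w - ip H v w"
by (simp add: hdiff_eq ip_add_left ip_smult_left)

lemma ip_diff_right: "[|u : cr H; v : cr H; w : cr H|] ==> ip H u (v \<ominus> w) = ip H u v - ip H u w"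
by (simp add: hdiff_eq ip_add_right ip_smult_right)

lemma ip_self_nonneg: "v : cr H ==> 0 <= Re (ip H v v)"
using ip_pos[of v] by (cases "v = \<zero>") auto

lemma hnorm_square: "v : cr H ==> (hnorm H v)\<^sup>2 = Re (ip H v v)"
by (simp add: hnorm_def ip_self_nonneg)

lemma ip_self: "v : cr H ==> ip H v v = of_real ((hnorm H v)\<^sup>2)"
proof -
assume v: "v : cr H"
have "Im (ip H v v) = 0" using arg_cong[OF ip_commute[OF v v], of Im] by simp
then show ?thesis using v by (simp add: hnorm_square complex_eq_iff)
qed

lemma hnorm_nonneg [simp]: "v : cr H ==> 0 <= hnorm H v"
by (simp add: hnorm_def ip_self_nonneg)

lemma hnorm_zero [simp]: "hnorm H \<zero> = 0"
by (simp add: hnorm_def)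

lemma hnorm_eq_0D: "v : cr H ==> hnorm H v = 0 ==> v = \<zero>"
using ip_pos[of v] hnorm_square[of v] by fastforce

lemma hnorm_smult: "v : cr H ==> hnorm H (c \<odot> v) = cmod c * hnorm H v"
proof -
assume v: "v : cr H"
have "ip H (c \<odot> v) (c \<odot> v) = (c * cnj c) * ip H v v"
 using v by (simp add: ip_smult_left ip_smult_right)
also have "... = of_real ((cmod c * hnorm H v)\<^sup>2)"
 using v by (simp add: complex_norm_square[symmetric] ip_self power_mult_distrib)
finally show ?thesis using v by (simp add: hnorm_def ip_self_nonneg)
qed

lemma Cauchy_Schwarz:
assumes u: "u : cr H" and v: "v : cr H"
shows "cmod (ip H u v) <= hnorm H u * hnorm H v"
proof (cases "v = \<zero>")
case False
define a where "a = ip H u v"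
define n where "n = (hnorm H v)\<^sup>2"
have n: "n > 0" using ip_pos[OF v False] v by (simp add: n_def hnorm_square)
have vu: "ip H v u = cnj a" using ip_commute[OF u v] by (simp add: a_def)
have "ip H (u \<ominus> (a / of_real n) \<odot> v) (u \<ominus> (a / of_real n) \<odot> v) =
  ip H u u - cnj a / of_real n * a - a / of_real n * cnj a + (a / of_real n) * (cnj a / of_real n) * ip H v v"
 using u v by (simp add: ip_diff_left ip_diff_right ip_smult_left ip_smult_right vu a_def[symmetric] algebra_simps)
also have "ip H v v = of_real n" using v by (simp add: ip_self n_def)
also have "ip H u u - cnj a / of_real n * a - a / of_real n * cnj a + (a / of_real n) * (cnj a / of_real n) * of_real n
  = of_real ((hnorm H u)\<^sup>2 - (cmod a)\<^sup>2 / n)"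
proof -
 have n0: "complex_of_real n ~= 0" using n by simp
 define b where "b = a * cnj a / of_real n"
 have e: "cnj a / of_real n * a = b" "a / of_real n * cnj a = b"
  "(a / of_real n) * (cnj a / of_real n) * of_real n = b"
  using n0 by (simp_all add: b_def)
 have b: "b = of_real ((cmod a)\<^sup>2 / n)" unfolding b_def by (simp add: complex_norm_square[symmetric])
 show ?thesis unfolding e using u by (simp add: ip_self b)
qed
finally have "0 <= (hnorm H u)\<^sup>2 - (cmod a)\<^sup>2 / n"
 using ip_self_nonneg[OF M.minus_closed[OF u hsmult_closed[OF v, of "a / of_real n"]]] by (simp only: Re_complex_of_real)
then have "(cmod a)\<^sup>2 / n <= (hnorm H u)\<^sup>2" by linarith
then have "(cmod a)\<^sup>2 <= (hnorm H u)\<^sup>2 * n" by (simp only: pos_divide_le_eq[OF n])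
then have "(cmod a)\<^sup>2 <= (hnorm H u * hnorm H v)\<^sup>2" by (simp add: n_def power_mult_distrib)
then show ?thesis unfolding a_def by (rule power2_le_imp_le) (use u v in auto)
qed (use u in simp)

lemma hnorm_triangle:
assumes u: "u : cr H" and v: "v : cr H"
shows "hnorm H (u \<oplus> v) <= hnorm H u + hnorm H v"
proof (rule power2_le_imp_le)
have "ip H v u = cnj (ip H u v)" using u v by (rule ip_commute)
then have "(hnorm H (u \<oplus> v))\<^sup>2 = (hnorm H u)\<^sup>2 + 2 * Re (ip H u v) + (hnorm H v)\<^sup>2"
 using u v by (simp add: hnorm_square ip_add_left ip_add_right)
also have "... <= (hnorm H u)\<^sup>2 + 2 * (hnorm H u * hnorm H v) + (hnorm H v)\<^sup>2"
 using Cauchy_Schwarz[OF u v] complex_Re_le_cmod[of "ip H u v"] by linarith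
finally show "(hnorm H (u \<oplus> v))\<^sup>2 <= (hnorm H u + hnorm H v)\<^sup>2" by (simp add: power2_sum)
qed (use u v in auto)

lemma hnorm_diff_commute: "u : cr H ==> v : cr H ==> hnorm H (u \<ominus> v) = hnorm H (v \<ominus> u)"
proof -
assume a: "u : cr H" "v : cr H"
have "u \<ominus> v = (-1) \<odot> (v \<ominus> u)" using a by (simp add: hdiff_eq hsmult_simps M.a_comm)
then show ?thesis using a by (simp add: hnorm_smult)
qed

lemma hdiff_split: "[|u : cr H; v : cr H; w : cr H|] ==> u \<ominus> w = (u \<ominus> v) \<oplus> (v \<ominus> w)"
proof -
assume a: "u : cr H" "v : cr H" "w : cr H"
have "(u \<oplus> \<ominus> v) \<oplus> (v \<oplus> \<ominus> w) = u \<oplus> ((\<ominus> v \<oplus> v) \<oplus> \<ominus> w)" using a by (simp add: M.a_assoc)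
then show ?thesis using a by (simp add: M.minus_eq M.l_neg)
qed

lemma hnorm_diff_triangle:
"[|u : cr H; v : cr H; w : cr H|] ==> hnorm H (u \<ominus> w) <= hnorm H (u \<ominus> v) + hnorm H (v \<ominus> w)"
using hdiff_split[of u v w] hnorm_triangle[of "u \<ominus> v" "v \<ominus> w"] by simp

lemma hnorm_diff_abs:
assumes "u : cr H" "v : cr H"
shows "\<bar>hnorm H u - hnorm H v\<bar> <= hnorm H (u \<ominus> v)"
proof -
have z: "w \<ominus> \<zero> = w" if "w : cr H" for w using that by (simp add: M.minus_eq)
show ?thesis
 using hnorm_diff_triangle[of u v \<zero>] hnorm_diff_triangle[of v u \<zero>] hnorm_diff_commute[of u v]
  assms z[OF assms(1)] z[OF assms(2)] by simp
qed

lemma hdiff_eq_0D: "u : cr H ==> v : cr H ==> u \<ominus> v = \<zero> ==> u = v"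
using M.minus_equality[of "u" "\<ominus> v"] by (simp add: M.minus_eq)

lemma ip_eqI:
assumes "u : cr H" "v : cr H" "!!w. w : cr H ==> ip H w u = ip H w v"
shows "u = v"
proof -
have "ip H (u \<ominus> v) (u \<ominus> v) = 0" using assms by (simp add: ip_diff_right)
then have "u \<ominus> v = \<zero>" using ip_pos[of "u \<ominus> v"] assms(1,2) by (metis M.minus_closed less_irrefl zero_complex.sel(1))
then show ?thesis using hdiff_eq_0D assms(1,2) by blast
qed

lemma hlim_const: "v : cr H ==> hlim H (%_. v) v"
by (simp add: hlim_def M.minus_eq M.r_neg)

lemma hlim_squeeze:
assumes "!!k. s k : cr H" "v : cr H" "!!k. hnorm H (s k \<ominus> v) <= b k" "b ----> 0"
shows "hlim H s v"
unfolding hlim_def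
by (rule tendsto_sandwich[OF _ _ tendsto_const assms(4)]) (use assms in auto)

lemma hlim_unique:
assumes s: "!!k. s k : cr H" and c: "u : cr H" "v : cr H" and l: "hlim H s u" "hlim H s v"
shows "u = v"
proof -
have "(%k. hnorm H (s k \<ominus> u) + hnorm H (s k \<ominus> v)) ----> 0"
 using l unfolding hlim_def by (rule tendsto_add_zero)
moreover have "hnorm H (u \<ominus> v) <= hnorm H (s k \<ominus> u) + hnorm H (s k \<ominus> v)" for k
 using hnorm_diff_triangle[OF c(1) s[of k] c(2)] hnorm_diff_commute[OF c(1) s[of k]] by linarith
ultimately have "hnorm H (u \<ominus> v) <= 0" by (intro LIMSEQ_le_const) auto
moreover have "0 <= hnorm H (u \<ominus> v)" using c by (intro hnorm_nonneg) auto
ultimately have "hnorm H (u \<ominus> v) = 0" by linarith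
then have "u \<ominus> v = \<zero>" using c by (intro hnorm_eq_0D) auto
then show ?thesis by (rule hdiff_eq_0D[OF c])
qed

lemma hlim_add:
assumes c: "!!k. s k : cr H" "!!k. t k : cr H" "u : cr H" "v : cr H"
 and l: "hlim H s u" "hlim H t v"
shows "hlim H (%k. s k \<oplus> t k) (u \<oplus> v)"
proof (rule hlim_squeeze)
fix k
have "s k \<oplus> t k \<ominus> (u \<oplus> v) = (s k \<ominus> u) \<oplus> (t k \<ominus> v)"
 using c by (simp add: hdiff_eq hsmult_simps M.a_ac)
then show "hnorm H (s k \<oplus> t k \<ominus> (u \<oplus> v)) <= hnorm H (s k \<ominus> u) + hnorm H (t k \<ominus> v)"
 using hnorm_triangle c by simp
show "(%k. hnorm H (s k \<ominus> u) + hnorm H (t k \<ominus> v)) ----> 0"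
 using l unfolding hlim_def by (rule tendsto_add_zero)
qed (use c in auto)

lemma hlim_smult:
assumes c: "!!k. s k : cr H" "u : cr H" and l: "hlim H s u"
shows "hlim H (%k. a \<odot> s k) (a \<odot> u)"
proof -
have "a \<odot> s k \<ominus> a \<odot> u = a \<odot> (s k \<ominus> u)" for k using c by (simp add: hdiff_eq hsmult_simps mult.commute)
then show ?thesis using l tendsto_mult_right_zero c unfolding hlim_def by (simp add: hnorm_smult)
qed

lemma hlim_hnorm:
assumes c: "!!k. s k : cr H" "u : cr H" and l: "hlim H s u"
shows "(%k. hnorm H (s k)) ----> hnorm H u"
proof -
have "(%k. hnorm H (s k) - hnorm H u) ----> 0"
 by (rule tendsto_rabs_zero_cancel, rule tendsto_sandwich[OF _ _ tendsto_const l[unfolded hlim_def]])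
   (use hnorm_diff_abs c in auto)
then show ?thesis by (simp add: LIM_zero_iff)
qed

lemma hlim_ip:
assumes c: "!!k. s k : cr H" "u : cr H" "!!k. t k : cr H" "v : cr H"
 and l: "hlim H s u" "hlim H t v"
shows "(%k. ip H (s k) (t k)) ----> ip H u v"
proof -
have "(%k. ip H (s k) (t k) - ip H u v) ----> 0"
proof (rule tendsto_norm_zero_cancel, rule tendsto_sandwich[OF _ _ tendsto_const])
 show "\<forall>\<^sub>F k in sequentially. norm (ip H (s k) (t k) - ip H u v)
   <= hnorm H (s k) * hnorm H (t k \<ominus> v) + hnorm H (s k \<ominus> u) * hnorm H v"
 proof (rule always_eventually, rule allI)
  fix k
  have "ip H (s k) (t k) - ip H u v = ip H (s k) (t k \<ominus> v) + ip H (s k \<ominus> u) v"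
   using c by (simp add: ip_diff_left ip_diff_right)
  then show "norm (ip H (s k) (t k) - ip H u v)
    <= hnorm H (s k) * hnorm H (t k \<ominus> v) + hnorm H (s k \<ominus> u) * hnorm H v"
   using norm_triangle_ineq[of "ip H (s k) (t k \<ominus> v)" "ip H (s k \<ominus> u) v"]
    Cauchy_Schwarz[of "s k" "t k \<ominus> v"] Cauchy_Schwarz[of "s k \<ominus> u" v] c by auto
 qed
 have "(%k. hnorm H (s k) * hnorm H (t k \<ominus> v) + hnorm H (s k \<ominus> u) * hnorm H v)
   ----> hnorm H u * 0 + 0 * hnorm H v"
  using l unfolding hlim_def by (intro tendsto_intros hlim_hnorm c) (auto simp: hlim_def)
 then show "(%k. hnorm H (s k) * hnorm H (t k \<ominus> v) + hnorm H (s k \<ominus> u) * hnorm H v) ----> 0" by simp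
qed auto
then show ?thesis by (simp add: LIM_zero_iff)
qed

lemma hlim_bounded_linear:
assumes T: "hlinear H H T" "!!v. v : cr H ==> hnorm H (T v) <= C * hnorm H v"
 and c: "!!k. s k : cr H" "u : cr H" and l: "hlim H s u"
shows "hlim H (%k. T (s k)) (T u)"
proof (rule hlim_squeeze[where b="%k. C * hnorm H (s k \<ominus> u)"])
have Tc: "T v : cr H" if "v : cr H" for v using T(1) that by (auto simp: hlinear_def)
then show "T (s k) : cr H" "T u : cr H" for k using c by auto
have "T (s k) \<ominus> T u = T (s k \<ominus> u)" for k
 using T(1) c Tc by (simp add: hdiff_eq hlinear_def)
then show "hnorm H (T (s k) \<ominus> T u) <= C * hnorm H (s k \<ominus> u)" for k using T(2) c by simp
show "(%k. C * hnorm H (s k \<ominus> u)) ----> 0"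
 using l unfolding hlim_def by (rule tendsto_mult_right_zero)
qed

lemma hcauchy_limI:
assumes c: "!!k. s k : cr H" and b: "!!k l. k <= l ==> hnorm H (s k \<ominus> s l) <= b k" "b ----> 0"
shows "EX v:cr H. hlim H s v"
proof (rule complete[OF c])
fix e :: real assume "e > 0"
then have "\<forall>\<^sub>F k in sequentially. b k < e" using b(2) by (intro order_tendstoD)
then obtain N where N: "!!k. k >= N ==> b k < e" by (auto simp: eventually_sequentially)
have "hnorm H (s k \<ominus> s l) < e" if "k >= N" "l >= N" for k l
 using b(1)[of k l] b(1)[of l k] N that hnorm_diff_commute[OF c c, of k l]
 by (cases "k <= l") force+
then show "EX N. ALL k>=N. ALL l>=N. hnorm H (s k \<ominus> s l) < e" by blast
qed

lemma closed_subspaceI: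
assumes "K <= cr H" "\<zero> : K" "!!u v. u : K ==> v : K ==> u \<oplus> v : K"
 "!!c v. v : K ==> c \<odot> v : K"
 "!!s v. (!!k. s k : K) ==> v : cr H ==> hlim H s v ==> v : K"
shows "closed_subspace H K"
unfolding closed_subspace_def
proof (intro conjI allI impI)
show "submodule K complex_ring H"
proof (rule submoduleI)
 fix a assume "a : K"
 then show "\<ominus> a : K" using assms(1,4) by (auto simp: hminus_eq)
qed (use assms in auto)
qed (use assms(5) in blast)

lemma closed_subspaceD:
assumes "closed_subspace H K"
shows "K <= cr H" "\<zero> : K" "!!u v. u : K ==> v : K ==> u \<oplus> v : K"
 "!!c v. v : K ==> c \<odot> v : K"
 "!!s v. (!!k. s k : K) ==> v : cr H ==> hlim H s v ==> v : K"
proof -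
have s: "submodule K complex_ring H" using assms by (simp add: closed_subspace_def)
show K: "K <= cr H" by (rule submoduleE(1)[OF s])
show a: "u \<oplus> v : K" if "u : K" "v : K" for u v using submoduleE(5)[OF s] that by simp
show m: "c \<odot> v : K" if "v : K" for c v using submoduleE(4)[OF s _ that] by simp
obtain v where v: "v : K" using submoduleE(2)[OF s] by blast
have "0 \<odot> v = \<zero>" using v K by (auto simp: hsmult_simps)
then show "\<zero> : K" using m[OF v, of 0] by simp
show "v : K" if "!!k. s k : K" "v : cr H" "hlim H s v" for s v
 using assms that unfolding closed_subspace_def by blast
qed

definition hclosure :: "'h set => 'h set" where
"hclosure L = {v : cr H. EX s. (ALL k. s k : L) & hlim H s v}"

lemma hclosure_iff:
assumes L: "L <= cr H"
shows "v : hclosure L \<longleftrightarrow> v : cr H & (ALL e>0. EX u:L. hnorm H (u \<ominus> v) < e)"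
proof
assume v: "v : hclosure L"
then obtain s where s: "!!k. s k : L" "hlim H s v" "v : cr H" by (auto simp: hclosure_def)
have "EX u:L. hnorm H (u \<ominus> v) < e" if "e > 0" for e
proof -
 have "\<forall>\<^sub>F k in sequentially. hnorm H (s k \<ominus> v) < e" using s(2) that unfolding hlim_def by (intro order_tendstoD)
 then show ?thesis using eventually_happens'[OF sequentially_bot] s(1) by blast
qed
then show "v : cr H & (ALL e>0. EX u:L. hnorm H (u \<ominus> v) < e)" using s by blast
next
assume v: "v : cr H & (ALL e>0. EX u:L. hnorm H (u \<ominus> v) < e)"
then have "EX u. u : L & hnorm H (u \<ominus> v) < 1 / real (Suc k)" for k
 by (metis of_nat_0_less_iff zero_less_Suc zero_less_divide_1_iff)
then obtain s where s: "!!k. s k : L" "!!k. hnorm H (s k \<ominus> v) < 1 / real (Suc k)" by metis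
have "hlim H s v"
 by (rule hlim_squeeze[OF _ _ less_imp_le[OF s(2)] LIMSEQ_Suc[OF lim_1_over_n]]) (use s L v in auto)
then show "v : hclosure L" using s v by (auto simp: hclosure_def)
qed

lemma hclosure_closed_subspace:
assumes L: "L <= cr H" "\<zero> : L" "!!u v. u : L ==> v : L ==> u \<oplus> v : L"
 "!!c v. v : L ==> c \<odot> v : L"
shows "closed_subspace H (hclosure L)"
proof (rule closed_subspaceI)
show "hclosure L <= cr H" by (auto simp: hclosure_def)
show "\<zero> : hclosure L" using L(2) hlim_const[of \<zero>] by (auto simp: hclosure_def)
show "u \<oplus> v : hclosure L" if uv: "u : hclosure L" "v : hclosure L" for u v
proof -
 obtain s t where "!!k. s k : L" "hlim H s u" "u : cr H" "!!k. t k : L" "hlim H t v" "v : cr H"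
  using uv by (auto simp: hclosure_def)
 then show ?thesis using hlim_add[of s t u v] L by (auto simp: hclosure_def intro!: exI[of _ "%k. s k \<oplus> t k"])
qed
show "c \<odot> v : hclosure L" if v: "v : hclosure L" for c v
proof -
 obtain s where "!!k. s k : L" "hlim H s v" "v : cr H" using v by (auto simp: hclosure_def)
 then show ?thesis using hlim_smult[of s v c] L by (auto simp: hclosure_def intro!: exI[of _ "%k. c \<odot> s k"])
qed
fix s v assume s: "!!k. s k : hclosure L" and v: "v : cr H" and l: "hlim H s v"
have sc: "s k : cr H" for k using s by (auto simp: hclosure_def)
have "EX u:L. hnorm H (u \<ominus> v) < e" if e: "e > 0" for e
proof -
 have "\<forall>\<^sub>F k in sequentially. hnorm H (s k \<ominus> v) < e/2" using l e unfolding hlim_def by (intro order_tendstoD) auto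
 then obtain k where k: "hnorm H (s k \<ominus> v) < e/2" using eventually_happens'[OF sequentially_bot] by blast
 obtain u where u: "u : L" "hnorm H (u \<ominus> s k) < e/2" using s[of k] e hclosure_iff[OF L(1)] half_gt_zero by blast
 then show ?thesis using k hnorm_diff_triangle[of u "s k" v] L(1) sc[of k] v by (intro bexI[of _ u]) auto
qed
then show "v : hclosure L" using v hclosure_iff[OF L(1)] by blast
qed

lemma subset_hclosure: "L <= cr H ==> L <= hclosure L"
by (auto simp: hclosure_def intro!: exI[of _ "%_. _"] hlim_const)

lemma adjoint_op_eq:
assumes v: "v : cr H" and u: "u : cr H" "!!w. w : cr H ==> ip H (T w) v = ip H w u"
shows "adjoint_op H T v = u"
unfolding adjoint_op_def by (rule the_equality) (use u in \<open>auto intro: ip_eqI\<close>)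

end

section \<open>Representations of C*-algebras\<close>

locale star_rep = A: star_alg A + H: hilbert_space H
for A :: "('a, 'm) cstar_scheme" and H :: "('h, 'l) hilbert_scheme" +
fixes \<pi> :: "'a => 'h => 'h"
assumes rep: "representation A H \<pi>"
begin

lemma rep_closed [simp, intro]: "x : cr A ==> v : cr H ==> \<pi> x v : cr H"
using rep by (auto simp: representation_def bounded_operator_def hlinear_def)

lemma rep_simps:
"x : cr A ==> u : cr H ==> v : cr H ==> \<pi> x (u \<oplus>\<^sub>H v) = \<pi> x u \<oplus>\<^sub>H \<pi> x v"
"x : cr A ==> v : cr H ==> \<pi> x (c \<odot>\<^sub>H v) = c \<odot>\<^sub>H \<pi> x v"
"x : cr A ==> y : cr A ==> v : cr H ==> \<pi> (x \<oplus>\<^sub>A y) v = \<pi> x v \<oplus>\<^sub>H \<pi> y v"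
"x : cr A ==> y : cr A ==> v : cr H ==> \<pi> (x \<cdot>\<^sub>A y) v = \<pi> x (\<pi> y v)"
"x : cr A ==> v : cr H ==> \<pi> (c \<odot>\<^sub>A x) v = c \<odot>\<^sub>H \<pi> x v"
using rep by (auto simp: representation_def bounded_operator_def hlinear_def)

lemma rep_adjoint:
"x : cr A ==> u : cr H ==> v : cr H ==> ip H (\<pi> x u) v = ip H u (\<pi> (x\<^sup>*\<^sub>A) v)"
using rep by (auto simp: representation_def)

lemma rep_adjoint':
"x : cr A ==> u : cr H ==> v : cr H ==> ip H u (\<pi> x v) = ip H (\<pi> (x\<^sup>*\<^sub>A) u) v"
using rep_adjoint[of "x\<^sup>*\<^sub>A" u v] by simp

lemma rep_zero: "v : cr H ==> \<pi> \<zero>\<^sub>A v = \<zero>\<^sub>H"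
using rep_simps(5)[of "\<zero>\<^sub>A" v 0] by (simp add: H.hsmult_simps)

lemma rep_zero_right: "x : cr A ==> \<pi> x \<zero>\<^sub>H = \<zero>\<^sub>H"
using rep_simps(2)[of x "\<zero>\<^sub>H" 0] by (simp add: H.hsmult_simps)

lemma rep_diff: "x : cr A ==> y : cr A ==> v : cr H ==> \<pi> (x \<ominus>\<^sub>A y) v = \<pi> x v \<ominus>\<^sub>H \<pi> y v"
by (simp add: A.diff_eq_smult H.hdiff_eq rep_simps)

lemma rep_bounded: assumes "x : cr A"
obtains C where "C >= 0" "!!v. v : cr H ==> hnorm H (\<pi> x v) <= C * hnorm H v"
proof -
obtain C where C: "!!v. v : cr H ==> hnorm H (\<pi> x v) <= C * hnorm H v"
 using rep assms unfolding representation_def bounded_operator_def by metis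
have "hnorm H (\<pi> x v) <= \<bar>C\<bar> * hnorm H v" if "v : cr H" for v
 using C[OF that] mult_right_mono[of C "\<bar>C\<bar>" "hnorm H v"] H.hnorm_nonneg[OF that] by linarith
then show ?thesis by (intro that[of "\<bar>C\<bar>"]) auto
qed

lemma rep_hlinear: "x : cr A ==> hlinear H H (\<pi> x)"
using rep by (auto simp: representation_def bounded_operator_def)

lemma rep_hlim:
assumes x: "x : cr A" and s: "!!k. s k : cr H" "v : cr H" "hlim H s v"
shows "hlim H (%k. \<pi> x (s k)) (\<pi> x v)"
proof -
obtain C where "!!v. v : cr H ==> hnorm H (\<pi> x v) <= C * hnorm H v"
 using rep_bounded[OF x] by blast
then show ?thesis using H.hlim_bounded_linear[OF rep_hlinear[OF x] _ s] by blast
qed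

lemma rep_norm_square:
assumes "x : cr A" "v : cr H"
shows "(hnorm H (\<pi> x v))\<^sup>2 = Re (ip H v (\<pi> (x\<^sup>*\<^sub>A \<cdot>\<^sub>A x) v))"
using assms by (simp add: H.hnorm_square rep_adjoint rep_simps)

lemma rep_star_mult_0D:
assumes "x : cr A" "v : cr H" "\<pi> (x\<^sup>*\<^sub>A \<cdot>\<^sub>A x) v = \<zero>\<^sub>H"
shows "\<pi> x v = \<zero>\<^sub>H"
using rep_norm_square[OF assms(1,2)] assms H.hnorm_eq_0D[of "\<pi> x v"] by simp

end

locale cstar_rep = star_rep A H \<pi> + A: cstar_alg A
for A :: "('a, 'm) cstar_scheme" and H :: "('h, 'l) hilbert_scheme" and \<pi> :: "'a => 'h => 'h"
begin

lemma rep_one_contractive: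
assumes v: "v : cr H" shows "hnorm H (\<pi> \<one>\<^sub>A v) <= hnorm H v"
proof -
let ?w = "\<pi> \<one>\<^sub>A v"
have "(hnorm H ?w)\<^sup>2 = Re (ip H v ?w)" using rep_norm_square[of "\<one>\<^sub>A" v] v by simp
also have "... <= hnorm H v * hnorm H ?w"
 using H.Cauchy_Schwarz[of v ?w] complex_Re_le_cmod[of "ip H v ?w"] v by fastforce
finally have "(hnorm H ?w)\<^sup>2 <= hnorm H v * hnorm H ?w" .
show ?thesis
proof (cases "hnorm H ?w = 0")
 case False
 then have "0 < hnorm H ?w" using H.hnorm_nonneg[of ?w] v by (simp add: order_less_le)
 moreover have "hnorm H ?w * hnorm H ?w <= hnorm H v * hnorm H ?w"
  using \<open>(hnorm H ?w)\<^sup>2 <= hnorm H v * hnorm H ?w\<close> by (simp add: power2_eq_square)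
 ultimately show ?thesis by (simp only: mult_le_cancel_right_pos)
qed (use v in simp)
qed

lemma rep_self_adj_contractive:
assumes h: "A.self_adj h" "nrm A h <= 1" and v: "v : cr H"
shows "hnorm H (\<pi> h v) <= hnorm H v"
proof -
have hc: "h : cr A" using h by simp
have "A.pos (h \<cdot>\<^sub>A h)" using h by (rule A.pos_square)
define a where "a = \<one>\<^sub>A \<ominus>\<^sub>A h \<cdot>\<^sub>A h"
have "\<one>\<^sub>A \<ominus>\<^sub>A a = h \<cdot>\<^sub>A h"
 using hc unfolding a_def by (simp add: A.diff_eq_smult A.smult_r_distr A.smult_smult A.a_assoc[symmetric])
   (simp add: A.smult_collect(3))
moreover have "nrm A (h \<cdot>\<^sub>A h) <= 1"
 using A.nrm_self_adj_square[OF h(1)] h A.nrm_nonneg[OF hc] by (simp add: abs_square_le_1)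
ultimately have a: "A.pos a" using h unfolding A.pos_def a_def by (auto intro: A.self_adj_combine)
define k where "k = A.csqrt a"
have k: "A.self_adj k" "k \<cdot>\<^sub>A k = a"
 using A.csqrt_self_adj[OF a] A.csqrt_square[OF a] by (auto simp: k_def)
have kc: "k : cr A" using k by simp
have "h \<cdot>\<^sub>A h \<oplus>\<^sub>A k \<cdot>\<^sub>A k = \<one>\<^sub>A" unfolding k(2) a_def using hc
 by (simp add: A.minus_eq A.a_lcomm A.r_neg)
then have "\<pi> (h \<cdot>\<^sub>A h) v \<oplus>\<^sub>H \<pi> (k \<cdot>\<^sub>A k) v = \<pi> \<one>\<^sub>A v"
 using rep_simps(3)[of "h \<cdot>\<^sub>A h" "k \<cdot>\<^sub>A k" v] hc kc v by simp
then have "Re (ip H v (\<pi> (h \<cdot>\<^sub>A h) v)) + Re (ip H v (\<pi> (k \<cdot>\<^sub>A k) v)) = Re (ip H v (\<pi> \<one>\<^sub>A v))"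
 using H.ip_add_right[of v "\<pi> (h \<cdot>\<^sub>A h) v" "\<pi> (k \<cdot>\<^sub>A k) v"] hc kc v by simp
then have "(hnorm H (\<pi> h v))\<^sup>2 + (hnorm H (\<pi> k v))\<^sup>2 = (hnorm H (\<pi> \<one>\<^sub>A v))\<^sup>2"
 using rep_norm_square[OF hc v] rep_norm_square[OF kc v] rep_norm_square[of "\<one>\<^sub>A" v] h k v by simp
then have "(hnorm H (\<pi> h v))\<^sup>2 <= (hnorm H (\<pi> \<one>\<^sub>A v))\<^sup>2"
 using zero_le_power2[of "hnorm H (\<pi> k v)"] by linarith
then have "hnorm H (\<pi> h v) <= hnorm H (\<pi> \<one>\<^sub>A v)" by (rule power2_le_imp_le) (use v in auto)
then show ?thesis using rep_one_contractive[OF v] by linarith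
qed

text \<open>For a self-adjoint contraction \<open>h\<close> with \<open>k = (1 - h\<^sup>2)\<^sup>1\<^sup>/\<^sup>2\<close> the squares of the norms of \<open>h v\<close> and \<open>k v\<close>
  add up to at most that of \<open>v\<close>; the general case follows from the C*-identity.\<close>

lemma rep_contractive:
assumes x: "x : cr A" and v: "v : cr H"
shows "hnorm H (\<pi> x v) <= nrm A x * hnorm H v"
proof -
define n where "n = (nrm A x)\<^sup>2"
have n: "n = nrm A (x\<^sup>*\<^sub>A \<cdot>\<^sub>A x)" using A.nrm_cstar[OF x] by (simp add: n_def)
have le: "hnorm H (\<pi> (x\<^sup>*\<^sub>A \<cdot>\<^sub>A x) v) <= n * hnorm H v"
proof (cases "n = 0")
 case True
 then have "x\<^sup>*\<^sub>A \<cdot>\<^sub>A x = \<zero>\<^sub>A" using n A.nrm_eq_0D x by simp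
 then show ?thesis using True v rep_zero by simp
next
 case False
 have np: "n > 0" using False by (simp add: n_def)
 let ?h = "of_real (1/n) \<odot>\<^sub>A (x\<^sup>*\<^sub>A \<cdot>\<^sub>A x)"
 have "A.self_adj ?h" using x by (intro A.self_adj_combine A.self_adj_star_mult)
 moreover have "nrm A ?h <= 1" using x np n[symmetric] by (simp add: A.nrm_smult norm_divide)
 ultimately have "hnorm H (\<pi> ?h v) <= hnorm H v" using v by (rule rep_self_adj_contractive)
 moreover have "hnorm H (\<pi> ?h v) = hnorm H (\<pi> (x\<^sup>*\<^sub>A \<cdot>\<^sub>A x) v) / n"
  using x v np by (subst rep_simps(5)) (auto simp: H.hnorm_smult norm_divide)
 ultimately have "hnorm H (\<pi> (x\<^sup>*\<^sub>A \<cdot>\<^sub>A x) v) / n <= hnorm H v" by linarith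
 then show ?thesis using np by (simp add: pos_divide_le_eq mult.commute)
qed
have "(hnorm H (\<pi> x v))\<^sup>2 <= hnorm H v * hnorm H (\<pi> (x\<^sup>*\<^sub>A \<cdot>\<^sub>A x) v)"
 unfolding rep_norm_square[OF x v]
 by (rule order_trans[OF complex_Re_le_cmod H.Cauchy_Schwarz]) (use x v in auto)
also have "... <= hnorm H v * (n * hnorm H v)" using le v by (intro mult_left_mono) auto
also have "... = (nrm A x * hnorm H v)\<^sup>2" by (simp add: n_def power2_eq_square)
finally show ?thesis by (rule power2_le_imp_le) (use x v A.nrm_nonneg in auto)
qed

lemma rep_norm_lim:
assumes s: "!!k. s k : cr A" "x : cr A" "norm_lim A s x" and v: "v : cr H"
shows "hlim H (%k. \<pi> (s k) v) (\<pi> x v)"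
proof (rule H.hlim_squeeze[where b="%k. nrm A (s k \<ominus>\<^sub>A x) * hnorm H v"])
show "hnorm H (\<pi> (s k) v \<ominus>\<^sub>H \<pi> x v) <= nrm A (s k \<ominus>\<^sub>A x) * hnorm H v" for k
 using rep_contractive[of "s k \<ominus>\<^sub>A x" v] s v by (simp add: rep_diff)
show "(%k. nrm A (s k \<ominus>\<^sub>A x) * hnorm H v) ----> 0"
 using s(3) unfolding norm_lim_def by (rule tendsto_mult_left_zero)
qed (use s v in auto)

end

section \<open>Representations of universal C*-algebras\<close>

context universal_alg
begin

text \<open>The operator norm of the given representation is one of the C*-seminorms over which the universal norm is the supremum. So the action is
  continuous and extends to limits of polynomials.\<close>

lemma extend_rep:
fixes H :: "('h, 'l) hilbert_scheme"
assumes act: "representation poly_alg H act"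
 and kill: "!!r v. r : R ==> v : cr H ==> act r v = \<zero>\<^sub>H"
obtains \<pi> where "representation ucstar H \<pi>"
 "!!p v. p : polys G ==> v : cr H ==> \<pi> (\<iota> p) v = act p v"
proof -
interpret H: hilbert_space H using act by (simp add: representation_def)
interpret S: star_rep poly_alg H act using act by unfold_locales
let ?F = "polys G"
define opn where "opn p = Inf {C. 0 <= C & (ALL v:cr H. hnorm H (act p v) <= C * hnorm H v)}" for p
have cl: "act p v : cr H" if "p : ?F" "v : cr H" for p v using S.rep_closed that by simp
have opn_le: "opn p <= C" if "0 <= C" "!!v. v : cr H ==> hnorm H (act p v) <= C * hnorm H v" for p C
 unfolding opn_def by (rule cInf_lower) (use that in \<open>auto intro!: bdd_belowI[of _ 0]\<close>)
have ex: "{C. 0 <= C & (ALL v:cr H. hnorm H (act p v) <= C * hnorm H v)} ~= {}" if p: "p : ?F" for p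
proof -
 obtain C where "C >= 0" "!!v. v : cr H ==> hnorm H (act p v) <= C * hnorm H v"
  using S.rep_bounded[of p] p by auto
 then show ?thesis by blast
qed
have opn_nonneg: "0 <= opn p" if p: "p : ?F" for p
 unfolding opn_def by (rule cInf_greatest[OF ex[OF p]]) auto
have bound: "hnorm H (act p v) <= opn p * hnorm H v" if p: "p : ?F" and v: "v : cr H" for p v
proof (cases "hnorm H v = 0")
 case True
 then have "v = \<zero>\<^sub>H" using H.hnorm_eq_0D v by blast
 then show ?thesis using S.rep_zero_right[of p] p by simp
next
 case False
 then have pos: "hnorm H v > 0" using H.hnorm_nonneg[OF v] by linarith
 have "hnorm H (act p v) / hnorm H v <= opn p" unfolding opn_def
  by (rule cInf_greatest[OF ex[OF p]]) (use pos v in \<open>auto simp: pos_divide_le_eq\<close>)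
 then show ?thesis using pos by (simp add: pos_divide_le_eq)
qed
have opn_star: "opn (poly_star p) <= opn p" if p: "p : ?F" for p
proof (rule opn_le[OF opn_nonneg[OF p]])
 fix v assume v: "v : cr H"
 let ?w = "act (poly_star p) v"
 have ps: "poly_star p : ?F" using p by blast
 have w: "?w : cr H" using cl ps v by simp
 have "(hnorm H ?w)\<^sup>2 = Re (ip H v (act p ?w))"
  using S.rep_norm_square[of "poly_star p" v] S.rep_simps(4)[of p "poly_star p" v] ps p v by simp
 also have "... <= hnorm H v * hnorm H (act p ?w)"
  by (rule order_trans[OF complex_Re_le_cmod H.Cauchy_Schwarz]) (use v cl p w in auto)
 also have "... <= hnorm H v * (opn p * hnorm H ?w)"
  using bound[OF p w] v by (intro mult_left_mono) auto
 finally have le: "hnorm H ?w * hnorm H ?w <= (opn p * hnorm H v) * hnorm H ?w"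
  by (simp add: power2_eq_square mult.commute mult.left_commute)
 show "hnorm H ?w <= opn p * hnorm H v"
 proof (cases "hnorm H ?w = 0")
  case True
  then show ?thesis using opn_nonneg[OF p] v by simp
 next
  case False
  then have "0 < hnorm H ?w" using H.hnorm_nonneg[OF w] by linarith
  then show ?thesis using le by (simp only: mult_le_cancel_right_pos)
 qed
qed
have opn_mult: "opn (x * y) <= opn x * opn y" if x: "x : ?F" and y: "y : ?F" for x y
proof (rule opn_le)
 fix v assume v: "v : cr H"
 have "hnorm H (act (x * y) v) = hnorm H (act x (act y v))" using S.rep_simps(4)[of x y v] x y v by simp
 also have "... <= opn x * hnorm H (act y v)" using bound x y v cl by simp
 also have "... <= opn x * (opn y * hnorm H v)" using bound y v opn_nonneg[OF x] by (intro mult_left_mono) auto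
 finally show "hnorm H (act (x * y) v) <= opn x * opn y * hnorm H v" by simp
qed (use opn_nonneg x y in auto)
have "cstar_seminorm G opn"
 unfolding cstar_seminorm_def
proof (intro ballI conjI allI)
 fix x y c assume x: "x : ?F"
 show "0 <= opn x" using opn_nonneg x .
 have xx: "poly_star x * x : ?F" using x by blast
 show "opn (poly_star x * x) = (opn x)\<^sup>2"
 proof (rule antisym)
  have "opn (poly_star x * x) <= opn (poly_star x) * opn x" using x by (intro opn_mult) auto
  also have "... <= opn x * opn x" using opn_star[OF x] opn_nonneg[OF x] by (rule mult_right_mono)
  finally show "opn (poly_star x * x) <= (opn x)\<^sup>2" by (simp add: power2_eq_square)
  have "opn x <= sqrt (opn (poly_star x * x))"
  proof (rule opn_le)
   fix v assume v: "v : cr H"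
   have "(hnorm H (act x v))\<^sup>2 = Re (ip H v (act (poly_star x * x) v))"
    using S.rep_norm_square[of x v] x v by simp
   also have "... <= hnorm H v * hnorm H (act (poly_star x * x) v)"
    by (rule order_trans[OF complex_Re_le_cmod H.Cauchy_Schwarz]) (use v cl xx in auto)
   also have "... <= hnorm H v * (opn (poly_star x * x) * hnorm H v)"
    using bound[OF xx v] v by (intro mult_left_mono) auto
   also have "... = (sqrt (opn (poly_star x * x)) * hnorm H v)\<^sup>2"
    using opn_nonneg[OF xx] by (simp add: power_mult_distrib power2_eq_square[of "hnorm H v"])
   finally show "hnorm H (act x v) <= sqrt (opn (poly_star x * x)) * hnorm H v"
    by (rule power2_le_imp_le) (use v opn_nonneg[OF xx] in auto)
  qed (use opn_nonneg[OF xx] in auto)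
  then have "(opn x)\<^sup>2 <= (sqrt (opn (poly_star x * x)))\<^sup>2" using opn_nonneg[OF x] by (rule power_mono)
  then show "(opn x)\<^sup>2 <= opn (poly_star x * x)" using opn_nonneg[OF xx] by simp
 qed
 have sc: "poly_scale c x : ?F" using x by blast
 have eq: "hnorm H (act (poly_scale c x) v) = cmod c * hnorm H (act x v)" if v: "v : cr H" for v
  using S.rep_simps(5)[of x v c] x v cl[OF x v] by (simp add: H.hnorm_smult)
 show "opn (poly_scale c x) = cmod c * opn x"
 proof (rule antisym)
  show "opn (poly_scale c x) <= cmod c * opn x"
   by (rule opn_le) (use eq bound[OF x] opn_nonneg[OF x] in \<open>auto simp: mult.assoc intro!: mult_left_mono\<close>)
  show "cmod c * opn x <= opn (poly_scale c x)"
  proof (cases "c = 0")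
   case False
   have "opn x <= opn (poly_scale c x) / cmod c"
   proof (rule opn_le)
    fix v assume v: "v : cr H"
    show "hnorm H (act x v) <= opn (poly_scale c x) / cmod c * hnorm H v"
     using bound[OF sc v] eq[OF v] False by (simp add: pos_le_divide_eq mult.commute)
   qed (use opn_nonneg[OF sc] in auto)
   then show ?thesis using False by (simp add: pos_le_divide_eq mult.commute)
  qed (use opn_nonneg[OF sc] in simp)
 qed
 fix y assume y: "y : ?F"
 show "opn (x * y) <= opn x * opn y" using opn_mult x y .
 show "opn (x + y) <= opn x + opn y"
 proof (rule opn_le)
  fix v assume v: "v : cr H"
  have "hnorm H (act (x + y) v) <= hnorm H (act x v) + hnorm H (act y v)"
   using S.rep_simps(3)[of x y v] x y v H.hnorm_triangle[OF cl[OF x v] cl[OF y v]] by simp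
  also have "... <= opn x * hnorm H v + opn y * hnorm H v" by (intro add_mono bound x y v)
  finally show "hnorm H (act (x + y) v) <= (opn x + opn y) * hnorm H v" by (simp add: distrib_right)
 qed (use opn_nonneg x y in auto)
qed
moreover have "opn r = 0" if r: "r : R" for r
 using opn_le[of 0 r] opn_nonneg[of r] kill[OF r] relators r by force
ultimately have adm: "adm opn" by blast
have ub: "hnorm H (act p v) <= universal_norm G R p * hnorm H v" if p: "p : ?F" and v: "v : cr H" for p v
 using bound[OF p v] mult_right_mono[OF adm_le_universal[OF adm p] H.hnorm_nonneg[OF v]] by linarith
have dub: "hnorm H (act p v \<ominus>\<^sub>H act p' v) <= universal_norm G R (p - p') * hnorm H v"
 if p: "p : ?F" "p' : ?F" and v: "v : cr H" for p p' v
 using ub[of "p - p'" v] S.rep_diff[of p p' v] p v free_star_carrier_diff[OF p] by simp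
have lim_zero: "(%k. universal_norm G R (s k - t k)) ----> 0" if "t : cauchy_class poly_alg s" for s t
proof -
 note c = P.cauchy_class_memD[OF that]
 have F: "s k : ?F" "t k : ?F" for k using P.cauchy_seqsD[OF c(1)] P.cauchy_seqsD[OF c(2)] by auto
 then show ?thesis using c(3) P.cauchy_class_eq_iff[OF c(2,1)] by simp
qed
define \<pi> where "\<pi> X v = (THE u. u : cr H & (ALL s:X. hlim H (%k. act (s k) v) u))" for X v
have key: "\<pi> (cauchy_class poly_alg s) v : cr H & hlim H (%k. act (s k) v) (\<pi> (cauchy_class poly_alg s) v)"
 if s: "s : cauchy_seqs poly_alg" and v: "v : cr H" for s v
proof -
 have F: "s k : ?F" for k using P.cauchy_seqsD[OF s] by simp
 have "EX u:cr H. hlim H (%k. act (s k) v) u"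
 proof (rule H.complete)
  fix e :: real assume e: "e > 0"
  define d where "d = e / (hnorm H v + 1)"
  have d: "d > 0" "d * (hnorm H v + 1) = e" using e H.hnorm_nonneg[OF v] by (auto simp: d_def)
  obtain N where N: "!!k l. k >= N ==> l >= N ==> universal_norm G R (s k - s l) < d"
   using P.cauchy_seqsD'[OF s d(1)] F by auto
  have "hnorm H (act (s k) v \<ominus>\<^sub>H act (s l) v) < e" if "k >= N" "l >= N" for k l
  proof -
   have "hnorm H (act (s k) v \<ominus>\<^sub>H act (s l) v) <= d * hnorm H v"
    using dub[OF F F v, of k l] mult_right_mono[OF less_imp_le[OF N[OF that]] H.hnorm_nonneg[OF v]] by linarith
   also have "... < d * (hnorm H v + 1)" unfolding mult_less_cancel_left_pos[OF d(1)] by simp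
   finally show ?thesis using d by simp
  qed
  then show "EX N. ALL k>=N. ALL l>=N. hnorm H (act (s k) v \<ominus>\<^sub>H act (s l) v) < e" by blast
 qed (use cl F v in simp)
 then obtain u where u: "u : cr H" "hlim H (%k. act (s k) v) u" by blast
 have all: "hlim H (%k. act (t k) v) u" if t: "t : cauchy_class poly_alg s" for t
 proof -
  have tF: "t k : ?F" for k using P.cauchy_seqsD[OF P.cauchy_class_memD(1)[OF t]] by simp
  have l: "(%k. universal_norm G R (s k - t k) * hnorm H v + hnorm H (act (s k) v \<ominus>\<^sub>H u)) ----> 0"
   using u(2) unfolding hlim_def by (intro tendsto_add_zero tendsto_mult_left_zero lim_zero t)
  show ?thesis
  proof (rule H.hlim_squeeze[OF _ u(1) _ l])
   fix k
   show "hnorm H (act (t k) v \<ominus>\<^sub>H u) <= universal_norm G R (s k - t k) * hnorm H v + hnorm H (act (s k) v \<ominus>\<^sub>H u)"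
    using dub[OF F tF v, of k k] H.hnorm_diff_commute[OF cl[OF F v] cl[OF tF v], of k k]
     H.hnorm_diff_triangle[OF cl[OF tF v] cl[OF F v] u(1), of k k] by linarith
  qed (use cl tF v in simp)
 qed
 have self: "s : cauchy_class poly_alg s" by (rule P.cauchy_class_self[OF s])
 have "\<pi> (cauchy_class poly_alg s) v = u" unfolding \<pi>_def
 proof (rule the_equality)
  show "u : cr H & (ALL t:cauchy_class poly_alg s. hlim H (%k. act (t k) v) u)" using u(1) all by simp
  fix w assume "w : cr H & (ALL t:cauchy_class poly_alg s. hlim H (%k. act (t k) v) w)"
  then have w: "w : cr H" "hlim H (%k. act (s k) v) w" using self by auto
  show "w = u" by (rule H.hlim_unique[OF cl[OF F v] w(1) u(1) w(2) u(2)])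
 qed
 then show ?thesis using u by simp
qed
have ops: "cauchy_class poly_alg s \<oplus>\<^sub>ucstar cauchy_class poly_alg t = cauchy_class poly_alg (%k. s k + t k)"
 "cauchy_class poly_alg s \<cdot>\<^sub>ucstar cauchy_class poly_alg t = cauchy_class poly_alg (%k. s k * t k)"
 "c \<odot>\<^sub>ucstar cauchy_class poly_alg s = cauchy_class poly_alg (%k. poly_scale c (s k))"
 "(cauchy_class poly_alg s)\<^sup>*\<^sub>ucstar = cauchy_class poly_alg (%k. poly_star (s k))"
 "(%k. s k + t k) : cauchy_seqs poly_alg" "(%k. s k * t k) : cauchy_seqs poly_alg"
 "(%k. poly_scale c (s k)) : cauchy_seqs poly_alg" "(%k. poly_star (s k)) : cauchy_seqs poly_alg"
 if "s : cauchy_seqs poly_alg" "t : cauchy_seqs poly_alg" for s t c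
 using that P.completion_mult[of s t] P.completion_add[of s t] P.completion_smult[of s c] P.completion_star[of s] P.cauchy_seqs_mult[of s t] P.cauchy_seqs_add[of s t]
  P.cauchy_seqs_smult[of s c] P.cauchy_seqs_star[of s]
 by (simp_all add: universal_cstar_def)
have rep: "representation ucstar H \<pi>"
 unfolding representation_def
proof (intro conjI ballI allI)
 show "hilbert_space H" by unfold_locales
 fix X assume "X : cr ucstar"
 then obtain s where s: "s : cauchy_seqs poly_alg" "X = cauchy_class poly_alg s" by (rule \<iota>_dense)
 have sF: "s k : ?F" for k using P.cauchy_seqsD[OF s(1)] by simp
 note ks = key[OF s(1), folded s(2)]
 show "bounded_operator H (\<pi> X)"
  unfolding bounded_operator_def hlinear_def
 proof (intro conjI ballI allI exI)
  show "\<pi> X : cr H \<rightarrow> cr H" using ks by blast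
  fix u c assume u: "u : cr H"
  have "hlim H (%k. c \<odot>\<^sub>H act (s k) u) (c \<odot>\<^sub>H \<pi> X u)"
   by (rule H.hlim_smult) (use ks u cl sF in auto)
  moreover have "act (s k) (c \<odot>\<^sub>H u) = c \<odot>\<^sub>H act (s k) u" for k using S.rep_simps(2)[of "s k" u c] sF u by simp
  ultimately have l1: "hlim H (%k. act (s k) (c \<odot>\<^sub>H u)) (c \<odot>\<^sub>H \<pi> X u)" by simp
  have cu: "c \<odot>\<^sub>H u : cr H" using u by simp
  show "\<pi> X (c \<odot>\<^sub>H u) = c \<odot>\<^sub>H \<pi> X u"
   by (rule H.hlim_unique[OF cl[OF sF cu] _ _ conjunct2[OF ks[OF cu]] l1]) (use ks[OF cu] ks[OF u] in auto)
  have l: "(%k. universal_norm G R (s k) * hnorm H u) ----> nrm ucstar X * hnorm H u"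
   using P.completion_nrm[OF s(1)] by (intro tendsto_mult_right) (simp add: s universal_cstar_def)
  show "hnorm H (\<pi> X u) <= nrm ucstar X * hnorm H u"
   by (rule LIMSEQ_le[OF H.hlim_hnorm[of "%k. act (s k) u"] l]) (use ks u cl sF ub in auto)
 next
  fix u v assume u: "u : cr H" and v: "v : cr H"
  have "hlim H (%k. act (s k) u \<oplus>\<^sub>H act (s k) v) (\<pi> X u \<oplus>\<^sub>H \<pi> X v)"
   by (rule H.hlim_add) (use ks u v cl sF in auto)
  moreover have "act (s k) (u \<oplus>\<^sub>H v) = act (s k) u \<oplus>\<^sub>H act (s k) v" for k
   using S.rep_simps(1)[of "s k" u v] sF u v by simp
  ultimately have l1: "hlim H (%k. act (s k) (u \<oplus>\<^sub>H v)) (\<pi> X u \<oplus>\<^sub>H \<pi> X v)" by simp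
  have cu: "u \<oplus>\<^sub>H v : cr H" using u v by simp
  show "\<pi> X (u \<oplus>\<^sub>H v) = \<pi> X u \<oplus>\<^sub>H \<pi> X v"
   by (rule H.hlim_unique[OF cl[OF sF cu] _ _ conjunct2[OF ks[OF cu]] l1]) (use ks[OF cu] ks[OF u] ks[OF v] in auto)
 qed
 fix v assume v: "v : cr H"
 note kv = ks[OF v]
 show "\<pi> (c \<odot>\<^sub>ucstar X) v = c \<odot>\<^sub>H \<pi> X v" for c
 proof (rule H.hlim_unique[of "%k. act (poly_scale c (s k)) v"])
  show "hlim H (%k. act (poly_scale c (s k)) v) (c \<odot>\<^sub>H \<pi> X v)"
   using H.hlim_smult[of "%k. act (s k) v" "\<pi> X v" c] kv cl sF v S.rep_simps(5)[of "s _" v c] by simp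
 qed (use key[OF ops(7)[OF s(1) s(1)] v] ops(3)[OF s(1) s(1)] s(2) kv sF v in \<open>auto intro!: cl polys_closed\<close>)
 show "ip H (\<pi> X u) v = ip H u (\<pi> (X\<^sup>*\<^sub>ucstar) v)" if u: "u : cr H" for u
 proof (rule LIMSEQ_unique)
  show "(%k. ip H (act (s k) u) v) ----> ip H (\<pi> X u) v"
   using H.hlim_ip[of "%k. act (s k) u" "\<pi> X u" "%_. v" v] ks[OF u] cl sF u v H.hlim_const by simp
  have "(%k. ip H u (act (poly_star (s k)) v)) ----> ip H u (\<pi> (X\<^sup>*\<^sub>ucstar) v)"
   using H.hlim_ip[of "%_. u" u "%k. act (poly_star (s k)) v" "\<pi> (X\<^sup>*\<^sub>ucstar) v"]
    key[OF ops(8)[OF s(1) s(1)] v] ops(4)[OF s(1) s(1)] s(2) cl[OF polys_closed(6)[OF sF] v] u v H.hlim_const by auto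
  then show "(%k. ip H (act (s k) u) v) ----> ip H u (\<pi> (X\<^sup>*\<^sub>ucstar) v)"
   using S.rep_adjoint[of "s _" u v] sF u v by simp
 qed
 fix Y assume "Y : cr ucstar"
 then obtain t where t: "t : cauchy_seqs poly_alg" "Y = cauchy_class poly_alg t" by (rule \<iota>_dense)
 have tF: "t k : ?F" for k using P.cauchy_seqsD[OF t(1)] by simp
 note kt = key[OF t(1), folded t(2)]
 show "\<pi> (X \<oplus>\<^sub>ucstar Y) v = \<pi> X v \<oplus>\<^sub>H \<pi> Y v"
 proof (rule H.hlim_unique[of "%k. act (s k + t k) v"])
  show "hlim H (%k. act (s k + t k) v) (\<pi> X v \<oplus>\<^sub>H \<pi> Y v)"
   using H.hlim_add[of "%k. act (s k) v" "%k. act (t k) v" "\<pi> X v" "\<pi> Y v"] kv kt[OF v] cl sF tF v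
    S.rep_simps(3)[of "s _" "t _" v] by simp
 qed (use key[OF ops(5)[OF s(1) t(1)] v] ops(1)[OF s(1) t(1)] s(2) t(2) kv kt[OF v] sF tF v in \<open>auto intro!: cl polys_closed\<close>)
 show "\<pi> (X \<cdot>\<^sub>ucstar Y) v = \<pi> X (\<pi> Y v)"
 proof (rule H.hlim_unique[of "%k. act (s k * t k) v"])
  let ?w = "\<pi> Y v"
  have w: "?w : cr H" using kt v by blast
  obtain M where M: "!!k. universal_norm G R (s k) <= M" using P.cauchy_seqs_bounded[OF s(1)] by auto
  have l: "(%k. M * hnorm H (act (t k) v \<ominus>\<^sub>H ?w) + hnorm H (act (s k) ?w \<ominus>\<^sub>H \<pi> X ?w)) ----> 0"
   using kt[OF v] ks[OF w] unfolding hlim_def by (intro tendsto_add_zero tendsto_mult_right_zero) auto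
  show "hlim H (%k. act (s k * t k) v) (\<pi> X ?w)"
  proof (rule H.hlim_squeeze[OF _ _ _ l])
   fix k
   have c: "act (t k) v : cr H" "act (s k) (act (t k) v) : cr H" "act (s k) ?w : cr H"
    "\<pi> X ?w : cr H" using cl sF tF v w ks[OF w] by auto
   have e: "act (s k * t k) v = act (s k) (act (t k) v)" using S.rep_simps(4)[of "s k" "t k" v] sF tF v by simp
   then show "act (s k * t k) v : cr H" using c by simp
   have "act (s k) (act (t k) v) \<ominus>\<^sub>H act (s k) ?w = act (s k) (act (t k) v \<ominus>\<^sub>H ?w)"
    using S.rep_simps(1,2)[of "s k"] sF[of k] c w by (simp add: H.hdiff_eq)
   then have "hnorm H (act (s k) (act (t k) v) \<ominus>\<^sub>H act (s k) ?w) <= M * hnorm H (act (t k) v \<ominus>\<^sub>H ?w)"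
    using ub[OF sF, of "act (t k) v \<ominus>\<^sub>H ?w" k] mult_right_mono[OF M[of k], of "hnorm H (act (t k) v \<ominus>\<^sub>H ?w)"] c w
    by simp
   then show "hnorm H (act (s k * t k) v \<ominus>\<^sub>H \<pi> X ?w)
     <= M * hnorm H (act (t k) v \<ominus>\<^sub>H ?w) + hnorm H (act (s k) ?w \<ominus>\<^sub>H \<pi> X ?w)"
    using H.hnorm_diff_triangle[OF c(2,3,4)] e by simp
  qed (use ks[OF w] in blast)
  show "\<pi> X ?w : cr H" using ks[OF w] by blast
 qed (use key[OF ops(6)[OF s(1) t(1)] v] ops(2)[OF s(1) t(1)] s(2) t(2) sF tF v in \<open>auto intro!: cl polys_closed\<close>)
qed
have "\<pi> (\<iota> p) v = act p v" if p: "p : ?F" and v: "v : cr H" for p v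
 using H.hlim_unique[of "%_. act p v", OF _ _ _ _ H.hlim_const] key[OF cauchy_const[OF p] v] cl[OF p v]
 by (simp add: \<iota>_def)
then show ?thesis using rep that by blast
qed

end

section \<open>The relations of the quantum ball\<close>

context seminorm_alg
begin

lemma finsum_nrm:
assumes "finite I" "!!i. i : I ==> f i : cr A"
shows "nrm A (\<Oplus>i\<in>I. f i) <= (\<Sum>i\<in>I. nrm A (f i))"
using assms
proof (induction I rule: finite_induct)
case (insert i I)
then show ?case
 using nrm_triangle[of "f i" "\<Oplus>i\<in>I. f i"] by (force simp: finsum_insert)
qed simp

end

locale ball_relations = cstar_alg A for A :: "('a, 'm) cstar_scheme" (structure) +
fixes q :: real and n :: nat and z :: "nat => 'a"
assumes q: "0 < q" "q < 1"
 and z_closed: "1 <= i ==> i <= n ==> z i : cr A"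
 and rel_zz: "1 <= i ==> i < j ==> j <= n ==> z i \<cdot> z j = of_real (sqrt q) \<odot> (z j \<cdot> z i)"
 and rel_zs: "1 <= i ==> i < j ==> j <= n ==> z i \<cdot> (z j)\<^sup>* = of_real (1 / sqrt q) \<odot> ((z j)\<^sup>* \<cdot> z i)"
 and rel_sz: "1 <= i ==> i <= n ==> (z i)\<^sup>* \<cdot> z i =
  of_real q \<odot> (z i \<cdot> (z i)\<^sup>*) \<oplus> of_real (1 - q) \<odot> (\<one> \<ominus> (\<Oplus>j\<in>{i+1..n}. z j \<cdot> (z j)\<^sup>*))"
 and dense: "E <= cr A ==> \<one> : E ==> (!!i. 1 <= i ==> i <= n ==> z i : E) ==>
  (!!i. 1 <= i ==> i <= n ==> (z i)\<^sup>* : E) ==> (!!x y. x : E ==> y : E ==> x \<oplus> y : E) ==>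
  (!!c x. x : E ==> c \<odot> x : E) ==> (!!x y. x : E ==> y : E ==> x \<cdot> y : E) ==>
  x : cr A ==> EX s. (ALL k. s k : E) & norm_lim A s x"
begin

lemma z_closed' [simp]: "1 <= i ==> i <= n ==> z i : cr A"
"Suc 0 <= i ==> i <= n ==> z i : cr A"
using z_closed by auto

abbreviation rq :: complex where "rq \<equiv> of_real (sqrt q)"

lemma rq [simp]: "rq * rq = of_real q" "rq ~= 0" "rq * (1 / rq) = 1" "(1 / rq) * rq = 1"
using q by (simp_all add: of_real_mult[symmetric] del: of_real_mult)

definition D :: "nat => 'a" where
"D i = \<one> \<ominus> (\<Oplus>j\<in>{i+1..n}. z j \<cdot> (z j)\<^sup>*)"

lemma zz_sum_closed [simp]: "(\<Oplus>j\<in>{Suc i..n}. z j \<cdot> (z j)\<^sup>*) : cr A"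
by (rule finsum_closed) auto

lemma D_closed [simp, intro]: "D i : cr A"
by (simp add: D_def)

lemma D_n: "D n = \<one>"
by (simp add: D_def minus_eq)

lemma D_step: "1 <= i ==> i <= n ==> D (i - 1) = D i \<ominus> z i \<cdot> (z i)\<^sup>*"
proof -
assume i: "1 <= i" "i <= n"
have "{i - 1 + 1..n} = insert i {i+1..n}" using i by auto
then have "(\<Oplus>j\<in>{i - 1 + 1..n}. z j \<cdot> (z j)\<^sup>*) = z i \<cdot> (z i)\<^sup>* \<oplus> (\<Oplus>j\<in>{i+1..n}. z j \<cdot> (z j)\<^sup>*)"
 using i by (simp add: finsum_insert Pi_def del: One_nat_def)
then show ?thesis unfolding D_def using i by (simp add: minus_eq minus_add a_ac)
qed

lemma D_Suc: "i < n ==> D i = D (Suc i) \<ominus> z (Suc i) \<cdot> (z (Suc i))\<^sup>*"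
using D_step[of "Suc i"] by simp

lemma z_star_z: "1 <= i ==> i <= n ==> (z i)\<^sup>* \<cdot> z i = of_real q \<odot> (z i \<cdot> (z i)\<^sup>*) \<oplus> of_real (1 - q) \<odot> D i"
unfolding D_def by (rule rel_sz)

lemma D_minus_z_star_z:
assumes i: "1 <= i" "i <= n"
shows "D i \<ominus> (z i)\<^sup>* \<cdot> z i = of_real q \<odot> D (i - 1)"
proof -
define p where "p = z i \<cdot> (z i)\<^sup>*"
define d where "d = D i"
have c: "p : cr A" "d : cr A" using i by (auto simp: p_def d_def)
have e1: "of_real (1 - q) \<odot> d = d \<ominus> of_real q \<odot> d"
 using smult_l_distr[of d 1 "- of_real q"] c by (simp add: smult_neg minus_eq)
have e2: "of_real q \<odot> (d \<ominus> p) = of_real q \<odot> d \<ominus> of_real q \<odot> p" using c by (rule smult_diff[rotated])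
show ?thesis
 unfolding z_star_z[OF i] D_step[OF i] unfolding p_def[symmetric] d_def[symmetric] e1 e2
 using c smult_closed[OF c(1), of "of_real q"] smult_closed[OF c(2), of "of_real q"] by algebra
qed

lemma z_star_z_ne:
assumes "1 <= i" "i <= n" "1 <= j" "j <= n" "i ~= j"
shows "(z i)\<^sup>* \<cdot> z j = rq \<odot> (z j \<cdot> (z i)\<^sup>*)"
proof (cases "i < j")
case True
have "(z i \<cdot> (z j)\<^sup>*)\<^sup>* = (of_real (1 / sqrt q) \<odot> ((z j)\<^sup>* \<cdot> z i))\<^sup>*"
 using rel_zs True assms by simp
then have "z j \<cdot> (z i)\<^sup>* = (1 / rq) \<odot> ((z i)\<^sup>* \<cdot> z j)"
 using assms by (simp add: star_mult star_smult)
then show ?thesis using assms q by (simp add: smult_smult)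
next
case False
then have "z j \<cdot> (z i)\<^sup>* = (1 / rq) \<odot> ((z i)\<^sup>* \<cdot> z j)"
 using rel_zs[of j i] assms by simp
then show ?thesis using assms q by (simp add: smult_smult)
qed

lemma zz_commute_lower:
assumes "1 <= i" "i < j" "j <= n"
shows "z i \<cdot> (z j \<cdot> (z j)\<^sup>*) = (z j \<cdot> (z j)\<^sup>*) \<cdot> z i"
proof -
have c: "z i : cr A" "z j : cr A" "(z j)\<^sup>* : cr A" using assms by auto
have "z i \<cdot> (z j \<cdot> (z j)\<^sup>*) = rq \<odot> (z j \<cdot> (z i \<cdot> (z j)\<^sup>*))"
 using c rel_zz[OF assms] by (simp add: m_assoc[symmetric] smult_mult_left)
also have "... = z j \<cdot> ((z j)\<^sup>* \<cdot> z i)"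
 using c rel_zs[OF assms] q by (simp add: smult_mult_right smult_smult)
finally show ?thesis using c by (simp add: m_assoc)
qed

lemma zz_q_commute_higher:
assumes "1 <= i" "i < j" "j <= n"
shows "(z i \<cdot> (z i)\<^sup>*) \<cdot> z j = of_real q \<odot> (z j \<cdot> (z i \<cdot> (z i)\<^sup>*))"
proof -
have c: "z i : cr A" "z j : cr A" "(z i)\<^sup>* : cr A" using assms by auto
have "(z i \<cdot> (z i)\<^sup>*) \<cdot> z j = rq \<odot> ((z i \<cdot> z j) \<cdot> (z i)\<^sup>*)"
 using c z_star_z_ne[of i j] assms by (simp add: m_assoc smult_mult_right)
also have "... = of_real q \<odot> (z j \<cdot> z i \<cdot> (z i)\<^sup>*)"
 using c rel_zz[OF assms] by (simp add: smult_mult_left smult_smult)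
finally show ?thesis using c by (simp add: m_assoc)
qed

lemma self_adj_D: "m <= n ==> self_adj (D m)"
proof (induction m rule: inc_induct)
case base
then show ?case by (simp add: D_n self_adj_combine)
next
case (step m)
then show ?case using D_Suc[of m] self_adj_star_mult[of "(z (Suc m))\<^sup>*"]
 by (auto intro: self_adj_combine)
qed

lemma D_commute:
assumes "m <= n" "1 <= k" "k <= m"
shows "D m \<cdot> z k = z k \<cdot> D m"
using assms
proof (induction m rule: inc_induct)
case base
then show ?case by (simp add: D_n)
next
case (step m)
have c: "z k : cr A" "z (Suc m) : cr A" using step by auto
have "z k \<cdot> (z (Suc m) \<cdot> (z (Suc m))\<^sup>*) = (z (Suc m) \<cdot> (z (Suc m))\<^sup>*) \<cdot> z k"
 by (rule zz_commute_lower) (use step in auto)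
moreover have "D (Suc m) \<cdot> z k = z k \<cdot> D (Suc m)" using step by simp
ultimately show ?case unfolding D_Suc[OF step(2)] using c by (simp add: minus_eq l_distr r_distr l_minus r_minus)
qed

lemma D_commute_star:
assumes "m <= n" "1 <= k" "k <= m"
shows "D m \<cdot> (z k)\<^sup>* = (z k)\<^sup>* \<cdot> D m"
proof -
have "(D m \<cdot> z k)\<^sup>* = (z k \<cdot> D m)\<^sup>*" using D_commute[OF assms] by simp
then show ?thesis using assms self_adj_D[of m] by (simp add: star_mult)
qed

lemma D_q_commute:
assumes "m < j" "j <= n"
shows "D m \<cdot> z j = of_real q \<odot> (z j \<cdot> D m)"
proof -
have mn: "m <= n" using assms by simp
show ?thesis using mn assms
proof (induction m rule: inc_induct)
 case (step m)
 have c: "z j : cr A" "z (Suc m) : cr A" using step by auto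
 show ?case
 proof (cases "j = Suc m")
  case True
  have "D m \<cdot> z j = z j \<cdot> (D j \<ominus> (z j)\<^sup>* \<cdot> z j)"
   unfolding D_Suc[OF step(2)] True using c D_commute[of "Suc m" "Suc m"] step
   by (simp add: minus_eq l_distr r_distr l_minus r_minus m_assoc)
  then show ?thesis using D_minus_z_star_z[of j] step c True by (simp add: smult_mult_right)
 next
  case False
  then have "D (Suc m) \<cdot> z j = of_real q \<odot> (z j \<cdot> D (Suc m))" using step by simp
  moreover have "(z (Suc m) \<cdot> (z (Suc m))\<^sup>*) \<cdot> z j = of_real q \<odot> (z j \<cdot> (z (Suc m) \<cdot> (z (Suc m))\<^sup>*))"
   by (rule zz_q_commute_higher) (use step False in auto)
  ultimately show ?thesis unfolding D_Suc[OF step(2)] using c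
   by (simp add: diff_eq_smult smult_r_distr l_distr r_distr smult_mult_left smult_mult_right smult_smult mult.commute)
 qed
qed (use assms in simp)
qed

lemma pow_q_commute:
assumes x: "x : cr A" "w : cr A" "x \<cdot> w = of_real q \<odot> (w \<cdot> x)"
shows "x [^] k \<cdot> w = of_real (q ^ k) \<odot> (w \<cdot> x [^] (k::nat))"
proof (induction k)
case (Suc k)
have "x [^] Suc k \<cdot> w = x [^] k \<cdot> (x \<cdot> w)" using x by (simp add: m_assoc)
also have "... = of_real q \<odot> ((x [^] k \<cdot> w) \<cdot> x)" using x by (simp add: smult_mult_right m_assoc)
also have "... = of_real (q ^ Suc k) \<odot> (w \<cdot> x [^] Suc k)"
 unfolding Suc using x by (simp add: smult_mult_left smult_smult m_assoc)
finally show ?case .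
qed (use x in simp)

lemma one_minus_D: "\<one> \<ominus> D m = (\<Oplus>j\<in>{Suc m..n}. z j \<cdot> (z j)\<^sup>*)"
proof -
have "\<one> \<ominus> (\<one> \<ominus> y) = y" if "y : cr A" for y using that by algebra
then show ?thesis by (simp add: D_def)
qed

definition zbound :: real where "zbound = (\<Sum>j\<in>{1..n}. (nrm A (z j))\<^sup>2)"

lemma zbound_nonneg: "0 <= zbound"
by (simp add: zbound_def sum_nonneg)

text \<open>Since \<open>\<one> - D m\<close> is the sum of the \<open>z\<^sub>jz\<^sub>j\<^sup>\<star>\<close>, an element that \<open>q\<close>-commutes with the \<open>z\<^sub>j\<close>
  has powers that nearly vanish off the unit eigenspace of \<open>D m\<close>.\<close>

lemma q_commuting_pow_bound:
assumes x: "x : cr A" "!!j. m < j ==> j <= n ==> x \<cdot> z j = of_real q \<odot> (z j \<cdot> x)"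
shows "nrm A (x [^] k \<cdot> (\<one> \<ominus> D m)) <= zbound * q ^ k * nrm A (x [^] (k::nat))"
proof -
have "x [^] k \<cdot> (\<one> \<ominus> D m) = (\<Oplus>j\<in>{Suc m..n}. x [^] k \<cdot> (z j \<cdot> (z j)\<^sup>*))"
 unfolding one_minus_D using x by (subst finsum_rdistr) auto
then have "nrm A (x [^] k \<cdot> (\<one> \<ominus> D m)) <= (\<Sum>j\<in>{Suc m..n}. nrm A (x [^] k \<cdot> (z j \<cdot> (z j)\<^sup>*)))"
 using finsum_nrm[of "{Suc m..n}" "%j. x [^] k \<cdot> (z j \<cdot> (z j)\<^sup>*)"] x by simp
also have "... <= (\<Sum>j\<in>{Suc m..n}. (nrm A (z j))\<^sup>2 * (q ^ k * nrm A (x [^] k)))"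
proof (rule sum_mono)
 fix j assume j: "j : {Suc m..n}"
 then have zj: "z j : cr A" "(z j)\<^sup>* : cr A" by auto
 have "x [^] k \<cdot> (z j \<cdot> (z j)\<^sup>*) = of_real (q ^ k) \<odot> (z j \<cdot> (x [^] k \<cdot> (z j)\<^sup>*))"
  using pow_q_commute[OF x(1) zj(1) x(2), of k] j zj x
  by (simp add: m_assoc[symmetric] smult_mult_left)
 then have "nrm A (x [^] k \<cdot> (z j \<cdot> (z j)\<^sup>*)) = q ^ k * nrm A (z j \<cdot> (x [^] k \<cdot> (z j)\<^sup>*))"
  using zj x q by (simp add: nrm_smult norm_power)
 also have "... <= q ^ k * (nrm A (z j) * (nrm A (x [^] k) * nrm A ((z j)\<^sup>*)))"
  using zj x q nrm_nonneg by (intro mult_left_mono order_trans[OF nrm_mult] nrm_mult) auto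
 also have "... = (nrm A (z j))\<^sup>2 * (q ^ k * nrm A (x [^] k))" using zj by (simp add: power2_eq_square)
 finally show "nrm A (x [^] k \<cdot> (z j \<cdot> (z j)\<^sup>*)) <= (nrm A (z j))\<^sup>2 * (q ^ k * nrm A (x [^] k))" .
qed
also have "... = (\<Sum>j\<in>{Suc m..n}. (nrm A (z j))\<^sup>2) * (q ^ k * nrm A (x [^] k))"
 by (simp add: sum_distrib_right)
also have "... <= zbound * (q ^ k * nrm A (x [^] k))"
 unfolding zbound_def using x q nrm_nonneg by (intro mult_right_mono sum_mono2) auto
finally show ?thesis by (simp add: mult.assoc)
qed

text \<open>If the norm exceeded 1, the norms of the powers \<open>(D m)\<^sup>k\<close> would grow geometrically; but consecutive powers differ by a
  factor \<open>1 + O(q\<^sup>k)\<close>, so they stay bounded.\<close>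

lemma nrm_D_le_1:
assumes m: "m <= n" shows "nrm A (D m) <= 1"
proof (rule ccontr)
assume "\<not> nrm A (D m) <= 1"
then have gt: "nrm A (D m) > 1" by simp
define C where "C = exp (zbound / (1 - q))"
have step: "nrm A (D m [^] Suc k) <= (1 + zbound * q ^ k) * nrm A (D m [^] k)" for k :: nat
proof -
 have "D m [^] Suc k = D m [^] k \<ominus> D m [^] k \<cdot> (\<one> \<ominus> D m)"
  using D_closed[of m] by (simp add: minus_eq r_distr r_minus minus_add) (simp add: a_assoc[symmetric] r_neg)
 then have "nrm A (D m [^] Suc k) <= nrm A (D m [^] k) + nrm A (D m [^] k \<cdot> (\<one> \<ominus> D m))"
  using nrm_diff[of "D m [^] k" "D m [^] k \<cdot> (\<one> \<ominus> D m)"] by simp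
 also have "nrm A (D m [^] k \<cdot> (\<one> \<ominus> D m)) <= zbound * q ^ k * nrm A (D m [^] k)"
  by (rule q_commuting_pow_bound) (use D_q_commute in auto)
 finally show ?thesis by (simp add: algebra_simps)
qed
have a: "nrm A (D m [^] k) <= exp (zbound * (\<Sum>i<k. q ^ i))" for k :: nat
proof (induction k)
 case (Suc k)
 have "1 + zbound * q ^ k <= exp (zbound * q ^ k)" by (rule exp_ge_add_one_self)
 then have "(1 + zbound * q ^ k) * nrm A (D m [^] k) <= exp (zbound * q ^ k) * exp (zbound * (\<Sum>i<k. q ^ i))"
  using Suc zbound_nonneg q nrm_nonneg by (intro mult_mono) auto
 then show ?case using step[of k] by (simp add: distrib_left mult_exp_exp add.commute)
qed (simp add: nrm_one_le)
have bd: "nrm A (D m [^] k) <= C" for k :: nat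
proof -
 have "(\<Sum>i<k. q ^ i) <= 1 / (1 - q)" using q by (simp add: sum_gp_strict divide_right_mono)
 then have "zbound * (\<Sum>i<k. q ^ i) <= zbound * (1 / (1 - q))" using zbound_nonneg by (rule mult_left_mono)
 then have "exp (zbound * (\<Sum>i<k. q ^ i)) <= C" by (simp add: C_def)
 then show ?thesis using a[of k] by linarith
qed
obtain N where N: "C < nrm A (D m) ^ N" using real_arch_pow[OF gt] by blast
also have "... <= nrm A (D m) ^ (2 ^ N)" using gt by (intro power_increasing) (auto intro: less_imp_le)
also have "... = nrm A (D m [^] (2 ^ N :: nat))" using nrm_self_adj_pow2[OF self_adj_D[OF m]] by simp
finally show False using bd[of "2 ^ N"] by simp
qed

text \<open>Let \<open>R\<close> be the root of \<open>(D m)\<^sup>2\<close>. Both \<open>R\<close> and \<open>D m\<close> \<open>q\<close>-commute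
  with the \<open>z\<^sub>j\<close>, \<open>j > m\<close>, hence so does \<open>x = R - D m\<close>. Its powers are then concentrated on the unit
  eigenspace of \<open>D m\<close>, where \<open>x\<close> vanishes.\<close>

theorem pos_D:
assumes m: "m <= n" shows "pos (D m)"
proof -
define d where "d = D m"
have d: "self_adj d" "d : cr A" "nrm A d <= 1" using self_adj_D[OF m] nrm_D_le_1[OF m] by (auto simp: d_def)
have pd: "pos (d \<cdot> d)" using d by (intro pos_square) auto
define R where "R = csqrt (d \<cdot> d)"
have R: "pos R" "R \<cdot> R = d \<cdot> d" "R : cr A"
 using csqrt_pos[OF pd] csqrt_square[OF pd] posD by (auto simp: R_def)
have Rd: "d \<cdot> R = R \<cdot> d" unfolding R_def by (rule csqrt_commute) (use d pd in \<open>auto simp: m_assoc\<close>)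
define x where "x = R \<ominus> d"
have x: "self_adj x" "x : cr A" using R d posD by (auto simp: x_def intro: self_adj_combine)
have xz: "x \<cdot> z j = of_real q \<odot> (z j \<cdot> x)" if j: "m < j" "j <= n" for j
proof -
 have zj: "z j : cr A" using j by auto
 have dz: "d \<cdot> z j = of_real q \<odot> (z j \<cdot> d)" unfolding d_def using j by (rule D_q_commute)
 have qq: "pos (of_real (q * q) \<odot> (d \<cdot> d))" by (rule pos_scale[OF pd]) (use q mult_le_one[of q q] in auto)
 have "csqrt (of_real (q * q) \<odot> (d \<cdot> d)) = of_real q \<odot> R"
  by (rule csqrt_eqI[OF qq pos_scale[OF R(1)]])
    (use q R d in \<open>auto simp: smult_mult_left smult_mult_right smult_smult\<close>)
 moreover have "z j \<cdot> (of_real (q * q) \<odot> (d \<cdot> d)) = (d \<cdot> d) \<cdot> z j"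
 proof -
  have "(d \<cdot> d) \<cdot> z j = d \<cdot> (d \<cdot> z j)" using d(2) zj by (simp add: m_assoc)
  also have "... = of_real q \<odot> ((d \<cdot> z j) \<cdot> d)"
   using d(2) zj by (subst dz) (simp add: m_assoc smult_mult_right)
  also have "... = of_real (q * q) \<odot> (z j \<cdot> (d \<cdot> d))" unfolding dz using d(2) zj by (simp add: m_assoc smult_mult_left smult_smult)
  finally show ?thesis using d zj by (simp add: smult_mult_right)
 qed
 ultimately have "z j \<cdot> (of_real q \<odot> R) = R \<cdot> z j"
  using csqrt_intertwine[OF qq pd zj] by (simp add: R_def)
 then have "R \<cdot> z j = of_real q \<odot> (z j \<cdot> R)" using R zj by (simp add: smult_mult_right)
 then show ?thesis using dz d R zj unfolding x_def
  by (simp add: diff_eq_smult smult_r_distr l_distr r_distr smult_mult_left smult_mult_right smult_smult mult.commute)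
qed
have "x \<cdot> (d \<oplus> R) = (R \<cdot> R \<ominus> d \<cdot> d) \<oplus> (R \<cdot> d \<ominus> d \<cdot> R)"
 unfolding x_def using d R by algebra
also have "... = \<zero>" using R d Rd by (simp add: minus_eq r_neg)
finally have xdR: "x \<cdot> (d \<oplus> R) = \<zero>" .
have key: "x [^] Suc k \<oplus> x [^] Suc k = x [^] Suc k \<cdot> (\<one> \<ominus> d) \<oplus> x [^] Suc k \<cdot> (\<one> \<ominus> R)" for k
proof -
 have "x [^] Suc k \<cdot> (\<one> \<ominus> d) \<oplus> x [^] Suc k \<cdot> (\<one> \<ominus> R)
   = (x [^] Suc k \<oplus> x [^] Suc k) \<ominus> x [^] k \<cdot> (x \<cdot> (d \<oplus> R))"
 proof -
  define w where "w = x [^] k \<cdot> x"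
  have w: "w : cr A" "x [^] Suc k = w" using x by (simp_all add: w_def)
  have "x [^] k \<cdot> (x \<cdot> (d \<oplus> R)) = w \<cdot> (d \<oplus> R)" using x d R by (simp add: w_def m_assoc)
  then show ?thesis using w d(2) R(3) by (simp add: ring_simprules)
 qed
 then show ?thesis using xdR x by (simp add: minus_eq)
qed
have le: "2 * nrm A (x [^] Suc k) <= zbound * q ^ Suc k * nrm A (x [^] Suc k) + nrm A (x [^] Suc k)" for k
proof -
 let ?y = "x [^] Suc k"
 have y: "?y : cr A" using x by blast
 have "2 * nrm A ?y = nrm A (?y \<oplus> ?y)" using y by (simp only: smult_collect(7) nrm_smult) simp
 also have "... <= nrm A (?y \<cdot> (\<one> \<ominus> d)) + nrm A (?y \<cdot> (\<one> \<ominus> R))"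
  unfolding key using y d R by (intro nrm_triangle) auto
 also have "nrm A (?y \<cdot> (\<one> \<ominus> d)) <= zbound * q ^ Suc k * nrm A ?y"
  unfolding d_def by (rule q_commuting_pow_bound[OF x(2) xz]) auto
 also have "nrm A (?y \<cdot> (\<one> \<ominus> R)) <= nrm A ?y * 1"
  using nrm_mult[of ?y "\<one> \<ominus> R"] mult_left_mono[OF posD(2)[OF R(1)] nrm_nonneg[OF y]] y R(3) by fastforce
 finally show ?thesis by simp
qed
have "(%k. zbound * q ^ k) ----> zbound * 0"
 using q by (intro tendsto_mult_left LIMSEQ_power_zero) auto
then have "\<forall>\<^sub>F k in sequentially. zbound * q ^ k < 1" by (intro order_tendstoD) auto
then obtain N where N: "!!k. k >= N ==> zbound * q ^ k < 1" by (auto simp: eventually_sequentially)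
have zero: "nrm A (x [^] Suc k) = 0" if k: "Suc k >= N" for k
proof (rule ccontr)
 assume "nrm A (x [^] Suc k) ~= 0"
 then have "nrm A (x [^] Suc k) > 0" using nrm_nonneg[of "x [^] Suc k"] x(2) nat_pow_closed by fastforce
 then have "zbound * q ^ Suc k * nrm A (x [^] Suc k) < 1 * nrm A (x [^] Suc k)"
  using N[OF k] by (intro mult_strict_right_mono) auto
 then show False using le[of k] by linarith
qed
have "nrm A x ^ (2 ^ N) = nrm A (x [^] (2 ^ N :: nat))" using nrm_self_adj_pow2[OF x(1)] by simp
also have "(2 ^ N :: nat) = Suc (2 ^ N - 1)" by simp
also have "nrm A (x [^] Suc (2 ^ N - 1)) = 0" by (rule zero) (use less_exp[of N] in simp)
finally have "nrm A x = 0" by simp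
then have "R = d" unfolding x_def using nrm_diff_eq_0D R d by blast
then show ?thesis using R by (simp add: d_def)
qed

end

subsection \<open>The boundary ideal\<close>

lemma (in star_alg) idealI':
assumes "I <= cr A" "\<zero> : I" "!!x y. x : I ==> y : I ==> x \<oplus> y : I"
 "!!a x. a : cr A ==> x : I ==> a \<cdot> x : I" "!!a x. a : cr A ==> x : I ==> x \<cdot> a : I"
shows "ideal I A"
proof (rule idealI[OF ring_axioms])
have neg: "\<ominus> x : I" if "x : I" for x
 using assms(4)[of "\<ominus> \<one>" x] that assms(1) by (auto simp: l_minus)
show "subgroup I (add_monoid A)"
 by unfold_locales (use assms neg in \<open>auto simp: a_inv_def[symmetric]\<close>)
qed (use assms in auto)

lemma (in star_alg) ideal_smult:
assumes "ideal I A" "x : I" shows "c \<odot> x : I"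
proof -
have x: "x : cr A" using ideal.Icarr[OF assms] .
have "(c \<odot> \<one>) \<cdot> x : I" by (rule ideal.I_l_closed[OF assms]) simp
then show ?thesis using x by (simp add: smult_mult_left)
qed

lemma (in star_alg) ideal_add: "ideal I A ==> x : I ==> y : I ==> x \<oplus> y : I"
by (simp add: additive_subgroup.a_closed ideal.axioms(1))

lemma (in star_alg) ideal_zero: "ideal I A ==> \<zero> : I"
by (simp add: additive_subgroup.zero_closed ideal.axioms(1))

lemma (in star_alg) ideal_diff: "ideal I A ==> x : I ==> y : I ==> x \<ominus> y : I"
using ideal_add[of I x "(-1) \<odot> y"] ideal_smult[of I y "-1"] ideal.Icarr[of I A] by (simp add: diff_eq_smult)

lemma (in cstar_alg) closed_ideal_props:
assumes X: "X <= cr A"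
shows "ideal (closed_ideal A X) A" "norm_closed A (closed_ideal A X)" "X <= closed_ideal A X"
 "!!I. ideal I A ==> norm_closed A I ==> X <= I ==> closed_ideal A X <= I"
proof -
let ?F = "{I. ideal I A & norm_closed A I & X <= I}"
have ne: "cr A : ?F" using X oneideal by (auto simp: norm_closed_def)
show "ideal (closed_ideal A X) A" unfolding closed_ideal_def
 by (rule i_Intersect) (use ne in auto)
show "X <= closed_ideal A X" by (auto simp: closed_ideal_def)
show "closed_ideal A X <= I" if "ideal I A" "norm_closed A I" "X <= I" for I
 using that by (auto simp: closed_ideal_def)
show "norm_closed A (closed_ideal A X)"
proof (rule norm_closedI)
 show "closed_ideal A X <= cr A" using ne by (auto simp: closed_ideal_def)
 fix s x assume s: "!!k. s k : closed_ideal A X" "x : cr A" "norm_lim A s x"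
 show "x : closed_ideal A X" unfolding closed_ideal_def
 proof (rule InterI)
  fix I assume I: "I : ?F"
  then have "s k : I" for k using s(1)[of k] by (auto simp: closed_ideal_def)
  then show "x : I" using I s norm_closedD[of A I s x] by blast
 qed
qed
qed

context ball_relations
begin

definition J :: "'a set" where "J = closed_ideal A {D 0}"

lemma J_props: "ideal J A" "norm_closed A J" "D 0 : J"
"!!I. ideal I A ==> norm_closed A I ==> D 0 : I ==> J <= I"
unfolding J_def using closed_ideal_props[of "{D 0}"] by auto

lemma J_closed: "x : J ==> x : cr A"
using ideal.Icarr[OF J_props(1)] .

lemmas J_ideal = ideal.I_l_closed[OF J_props(1)] ideal.I_r_closed[OF J_props(1)]
ideal_smult[OF J_props(1)] ideal_add[OF J_props(1)] ideal_zero[OF J_props(1)] ideal_diff[OF J_props(1)]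

lemma J_star: "x : J ==> x\<^sup>* : J"
proof -
let ?I = "{x : cr A. x\<^sup>* : J}"
have "J <= ?I"
proof (rule J_props(4))
 show "ideal ?I A" by (rule idealI') (auto simp: star_add star_mult J_ideal)
 show "norm_closed A ?I"
 proof (rule norm_closedI)
  fix s x assume s: "!!k. s k : ?I" "x : cr A" "norm_lim A s x"
  have sk: "s k : cr A" "(s k)\<^sup>* : J" for k using s(1)[of k] by auto
  have "x\<^sup>* : J"
   by (rule norm_closedD[OF J_props(2) sk(2) star_closed[OF s(2)] norm_lim_star[OF sk(1) s(2,3)]])
  then show "x : ?I" using s by simp
 qed auto
 show "D 0 : ?I" using self_adj_D[of 0] J_props(3) by simp
qed
then show "x : J ==> x\<^sup>* : J" by blast
qed

primrec geom :: "nat => 'a" where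
"geom 0 = \<zero>"
| "geom (Suc k) = geom k \<oplus> (\<one> \<ominus> D 0) [^] k"

definition v :: "nat => 'a" where "v k = of_real (1 / real (Suc k)) \<odot> geom (Suc k)"

lemma geom_closed [simp]: "geom k : cr A"
by (induction k) auto

lemma v_closed [simp]: "v k : cr A"
by (simp add: v_def del: geom.simps)

lemma D_geom: "D 0 \<cdot> geom k = \<one> \<ominus> (\<one> \<ominus> D 0) [^] k"
proof (induction k)
case 0 then show ?case by (simp add: minus_eq r_neg)
next
case (Suc k)
define d where "d = D 0"
define y where "y = (\<one> \<ominus> d) [^] k"
define g where "g = geom k"
have c: "d : cr A" "y : cr A" "g : cr A" by (auto simp: d_def y_def g_def)
have IH: "d \<cdot> g = \<one> \<ominus> y" using Suc by (simp add: d_def y_def g_def)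
have "(\<one> \<ominus> d) [^] Suc k = (\<one> \<ominus> d) \<cdot> y" unfolding y_def using c nat_pow_Suc2[of "\<one> \<ominus> d" k] by simp
moreover have "d \<cdot> (g \<oplus> y) = (\<one> \<ominus> y) \<oplus> d \<cdot> y" using c by (simp add: r_distr IH)
moreover have "(\<one> \<ominus> y) \<oplus> d \<cdot> y = \<one> \<ominus> (\<one> \<ominus> d) \<cdot> y" using c by algebra
ultimately show ?case by (simp add: d_def y_def g_def)
qed

lemma nrm_pow_one_minus_D: "nrm A ((\<one> \<ominus> D 0) [^] (k::nat)) <= 1"
proof (cases k)
case (Suc l)
have "nrm A ((\<one> \<ominus> D 0) [^] Suc l) <= nrm A (\<one> \<ominus> D 0) ^ Suc l" by (rule nrm_pow) simp
also have "... <= 1" using posD(2)[OF pos_D[of 0]] nrm_nonneg[of "\<one> \<ominus> D 0"] by (intro power_le_one) auto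
finally show ?thesis by (simp add: Suc)
qed (simp add: nrm_one_le)

lemma nrm_v: "nrm A (v k) <= 1"
proof -
have "nrm A (geom k) <= real k" for k
proof (induction k)
 case (Suc k)
 then show ?case using nrm_triangle[of "geom k" "(\<one> \<ominus> D 0) [^] k"] nrm_pow_one_minus_D[of k] by simp
qed simp
from this[of "Suc k"] show ?thesis by (simp add: v_def nrm_smult norm_divide field_simps del: geom.simps of_nat_Suc)
qed

lemma self_adj_v: "self_adj (v k)"
proof -
have "self_adj (geom k)" for k
 by (induction k) (auto intro!: self_adj_combine self_adj_pow self_adj_D)
then show ?thesis unfolding v_def by (intro self_adj_combine)
qed

lemma nrm_D_v: "nrm A (D 0 \<cdot> v k) <= 2 / real (Suc k)"
proof -
have "D 0 \<cdot> v k = of_real (1 / real (Suc k)) \<odot> (\<one> \<ominus> (\<one> \<ominus> D 0) [^] Suc k)"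
 unfolding v_def D_geom[symmetric] by (simp add: smult_mult_right del: geom.simps)
moreover have "nrm A (\<one> \<ominus> (\<one> \<ominus> D 0) [^] Suc k) <= 2"
 using nrm_diff[of \<one> "(\<one> \<ominus> D 0) [^] Suc k"] nrm_one_le nrm_pow_one_minus_D[of "Suc k"] by simp
ultimately show ?thesis by (simp add: nrm_smult norm_divide divide_right_mono del: of_nat_Suc nat_pow_Suc)
qed

lemma one_minus_v: "\<one> \<ominus> v k : J"
proof -
have "of_nat k \<odot> \<one> \<ominus> geom k : J" for k
proof (induction k)
 case 0 then show ?case by (simp add: minus_eq J_ideal)
next
 case (Suc k)
 define y where "y = (\<one> \<ominus> D 0) [^] k"
 have c: "y : cr A" "geom k : cr A" "of_nat k \<odot> \<one> : cr A" by (auto simp: y_def)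
 have "\<one> \<ominus> y : J" unfolding y_def D_geom[symmetric] by (rule J_ideal(2)[OF J_props(3)]) simp
 then have "(of_nat k \<odot> \<one> \<ominus> geom k) \<oplus> (\<one> \<ominus> y) : J" by (rule J_ideal(4)[OF Suc])
 moreover have "(of_nat k \<odot> \<one> \<ominus> geom k) \<oplus> (\<one> \<ominus> y) = (of_nat k \<odot> \<one> \<oplus> \<one>) \<ominus> (geom k \<oplus> y)"
  using c by algebra
 moreover have "of_nat k \<odot> \<one> \<oplus> \<one> = of_nat (Suc k) \<odot> \<one>" using smult_l_distr[of \<one> "of_nat k" 1] by (simp add: add.commute)
 ultimately show ?case by (simp add: y_def)
qed
then have "of_real (1 / real (Suc k)) \<odot> (of_nat (Suc k) \<odot> \<one> \<ominus> geom (Suc k)) : J" by (rule J_ideal(3))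
moreover have "of_real (1 / real (Suc k)) \<odot> (of_nat (Suc k) \<odot> \<one> \<ominus> geom (Suc k)) = \<one> \<ominus> v k"
 unfolding v_def by (subst smult_diff) (auto simp: smult_smult simp del: geom.simps of_nat_Suc)
ultimately show ?thesis by simp
qed

lemma D_v_lim: assumes "x : cr A" shows "(%k. nrm A (D 0 \<cdot> (x \<cdot> v k))) ----> 0"
proof -
let ?E = "{x : cr A. EX x':cr A. D 0 \<cdot> x = x' \<cdot> D 0}"
have q0: "complex_of_real q ~= 0" using q by simp
have gen: "z i : ?E" "(z i)\<^sup>* : ?E" if i: "1 <= i" "i <= n" for i
proof -
 have e: "D 0 \<cdot> z i = of_real q \<odot> (z i \<cdot> D 0)" by (rule D_q_commute) (use i in auto)
 then show "z i : ?E" using i by (auto intro!: bexI[of _ "of_real q \<odot> z i"] simp: smult_mult_left)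
 have "(D 0 \<cdot> z i)\<^sup>* = (of_real q \<odot> (z i \<cdot> D 0))\<^sup>*" using e by simp
 then have "(z i)\<^sup>* \<cdot> D 0 = of_real q \<odot> (D 0 \<cdot> (z i)\<^sup>*)"
  using i self_adj_D[of 0] by (simp add: star_mult star_smult)
 then have "D 0 \<cdot> (z i)\<^sup>* = ((1 / of_real q) \<odot> (z i)\<^sup>*) \<cdot> D 0"
  using i q0 by (simp add: smult_mult_left smult_smult)
 then show "(z i)\<^sup>* : ?E" using i by (auto intro!: bexI[of _ "(1 / of_real q) \<odot> (z i)\<^sup>*"])
qed
have sub: "EX s. (ALL k. s k : ?E) & norm_lim A s x"
proof (rule dense[OF _ _ gen])
 fix x y assume "x : ?E" "y : ?E"
 then obtain x' y' where xy: "x : cr A" "y : cr A" "x' : cr A" "y' : cr A"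
  "D 0 \<cdot> x = x' \<cdot> D 0" "D 0 \<cdot> y = y' \<cdot> D 0" by blast
 show "x \<oplus> y : ?E" using xy by (auto intro!: bexI[of _ "x' \<oplus> y'"] simp: r_distr l_distr)
 have "D 0 \<cdot> (x \<cdot> y) = (x' \<cdot> y') \<cdot> D 0" using xy by (metis D_closed m_assoc)
 then show "x \<cdot> y : ?E" using xy by auto
 show "c \<odot> x : ?E" for c using xy by (auto intro!: bexI[of _ "c \<odot> x'"] simp: smult_mult_left smult_mult_right)
next
 show "\<one> : ?E" by (auto intro!: bexI[of _ \<one>])
qed (use assms in auto)
then obtain s where s: "!!k. s k : ?E" "norm_lim A s x" by blast
have sc: "s k : cr A" for k using s(1)[of k] by simp
have lim: "(%k. nrm A (D 0 \<cdot> (y \<cdot> v k))) ----> 0" if "y : ?E" for y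
proof -
 obtain y' where y: "y : cr A" "y' : cr A" "D 0 \<cdot> y = y' \<cdot> D 0" using \<open>y : ?E\<close> by blast
 have le: "nrm A (D 0 \<cdot> (y \<cdot> v k)) <= nrm A y' * (2 / real (Suc k))" for k
 proof -
  have "D 0 \<cdot> (y \<cdot> v k) = y' \<cdot> (D 0 \<cdot> v k)" using y by (metis D_closed v_closed m_assoc)
  then have "nrm A (D 0 \<cdot> (y \<cdot> v k)) <= nrm A y' * nrm A (D 0 \<cdot> v k)" using nrm_mult[of y'] y by simp
  also have "... <= nrm A y' * (2 / real (Suc k))" using nrm_D_v nrm_nonneg y by (intro mult_left_mono) auto
  finally show ?thesis .
 qed
 have l: "(%k. nrm A y' * (2 / real (Suc k))) ----> 0"
  using tendsto_mult_right_zero[OF LIMSEQ_Suc[OF lim_1_over_n], of "nrm A y' * 2"] by simp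
 show ?thesis by (rule tendsto_sandwich[OF _ _ tendsto_const l]) (use le y nrm_nonneg in auto)
qed
show ?thesis
proof (rule LIMSEQ_I)
 fix e :: real assume e: "0 < e"
 obtain m where m: "nrm A (s m \<ominus> x) < e / 2"
  using s(2) e unfolding norm_lim_def
  by (metis (no_types, lifting) eventually_happens' half_gt_zero order_tendstoD(2) sequentially_bot)
 obtain N where N: "!!k. k >= N ==> nrm A (D 0 \<cdot> (s m \<cdot> v k)) < e / 2"
  using order_tendstoD(2)[OF lim[OF s(1)[of m]], of "e/2"] e by (auto simp: eventually_sequentially)
 have "nrm A (D 0 \<cdot> (x \<cdot> v k)) < e" if k: "k >= N" for k
 proof -
  have "D 0 \<cdot> (x \<cdot> v k) = D 0 \<cdot> (s m \<cdot> v k) \<ominus> D 0 \<cdot> ((s m \<ominus> x) \<cdot> v k)"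
   using sc[of m] assms v_closed[of k] D_closed[of 0] by algebra
  then have "nrm A (D 0 \<cdot> (x \<cdot> v k)) <= nrm A (D 0 \<cdot> (s m \<cdot> v k)) + nrm A (D 0 \<cdot> ((s m \<ominus> x) \<cdot> v k))"
   using nrm_diff[of "D 0 \<cdot> (s m \<cdot> v k)" "D 0 \<cdot> ((s m \<ominus> x) \<cdot> v k)"] sc assms by simp
  also have "nrm A (D 0 \<cdot> ((s m \<ominus> x) \<cdot> v k)) <= nrm A (D 0) * (nrm A (s m \<ominus> x) * nrm A (v k))"
   using sc assms nrm_nonneg by (intro order_trans[OF nrm_mult] mult_left_mono nrm_mult) auto
  also have "... <= 1 * (nrm A (s m \<ominus> x) * 1)"
   using nrm_D_le_1[of 0] nrm_v sc assms nrm_nonneg by (intro mult_mono) auto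
  finally show ?thesis using N[OF k] m by simp
 qed
 then show "EX N. ALL k>=N. norm (nrm A (D 0 \<cdot> (x \<cdot> v k)) - 0) < e"
  using nrm_nonneg assms by (intro exI[of _ N]) auto
qed
qed

text \<open>The \<open>v k\<close> are complementary to an approximate unit of \<open>J\<close>.\<close>

lemma J_v_lim:
assumes "x : J" shows "(%k. nrm A (x \<cdot> v k)) ----> 0"
proof -
let ?I = "{x : cr A. ALL y:cr A. (%k. nrm A (x \<cdot> (y \<cdot> v k))) ----> 0}"
have "J <= ?I"
proof (rule J_props(4))
 show "D 0 : ?I" using D_v_lim by simp
 show "ideal ?I A"
 proof (rule idealI')
  fix a b assume a: "a : ?I" and b: "b : ?I"
  have "(%k. nrm A ((a \<oplus> b) \<cdot> (y \<cdot> v k))) ----> 0" if y: "y : cr A" for y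
  proof (rule tendsto_sandwich[OF _ _ tendsto_const])
   show "(%k. nrm A (a \<cdot> (y \<cdot> v k)) + nrm A (b \<cdot> (y \<cdot> v k))) ----> 0"
    using a b y by (intro tendsto_add_zero) auto
  qed (use a b y nrm_nonneg nrm_triangle in \<open>auto simp: l_distr\<close>)
  then show "a \<oplus> b : ?I" using a b by auto
 next
  fix a x assume a: "a : cr A" and x: "x : ?I"
  have "(%k. nrm A ((a \<cdot> x) \<cdot> (y \<cdot> v k))) ----> 0" if y: "y : cr A" for y
  proof (rule tendsto_sandwich[OF _ _ tendsto_const])
   show "(%k. nrm A a * nrm A (x \<cdot> (y \<cdot> v k))) ----> 0"
    using x y by (intro tendsto_mult_right_zero) auto
  qed (use a x y nrm_nonneg nrm_mult in \<open>auto simp: m_assoc\<close>)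
  then show "a \<cdot> x : ?I" using a x by auto
  have "(%k. nrm A ((x \<cdot> a) \<cdot> (y \<cdot> v k))) ----> 0" if y: "y : cr A" for y
  proof -
   have "(%k. nrm A (x \<cdot> ((a \<cdot> y) \<cdot> v k))) ----> 0" using x a y by auto
   then show ?thesis using x a y by (simp add: m_assoc)
  qed
  then show "x \<cdot> a : ?I" using a x by auto
 qed auto
 show "norm_closed A ?I"
 proof (rule norm_closedI)
  fix s x assume s: "!!k. s k : ?I" and x: "x : cr A" and l: "norm_lim A s x"
  have sc: "s k : cr A" for k using s[of k] by simp
  have "(%k. nrm A (x \<cdot> (y \<cdot> v k))) ----> 0" if y: "y : cr A" for y
  proof (rule LIMSEQ_I)
   fix e :: real assume e: "0 < e"
   define b where "b = nrm A y + 1"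
   have b: "b > 0" "nrm A y < b" using nrm_nonneg[OF y] by (auto simp: b_def)
   obtain m where m: "nrm A (s m \<ominus> x) < e / 2 / b"
    using l e b unfolding norm_lim_def
    by (metis (no_types, lifting) eventually_happens' half_gt_zero divide_pos_pos order_tendstoD(2) sequentially_bot)
   have lm: "(%k. nrm A (s m \<cdot> (y \<cdot> v k))) ----> 0" using s[of m] y by blast
   obtain N where N: "!!k. k >= N ==> nrm A (s m \<cdot> (y \<cdot> v k)) < e / 2"
    using order_tendstoD(2)[OF lm, of "e/2"] e by (auto simp: eventually_sequentially)
   have "nrm A (x \<cdot> (y \<cdot> v k)) < e" if k: "k >= N" for k
   proof -
    have "x \<cdot> (y \<cdot> v k) = s m \<cdot> (y \<cdot> v k) \<ominus> (s m \<ominus> x) \<cdot> (y \<cdot> v k)"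
     using sc[of m] x y v_closed[of k] by algebra
    then have "nrm A (x \<cdot> (y \<cdot> v k)) <= nrm A (s m \<cdot> (y \<cdot> v k)) + nrm A ((s m \<ominus> x) \<cdot> (y \<cdot> v k))"
     using nrm_diff[of "s m \<cdot> (y \<cdot> v k)" "(s m \<ominus> x) \<cdot> (y \<cdot> v k)"] sc x y by simp
    also have "nrm A ((s m \<ominus> x) \<cdot> (y \<cdot> v k)) <= nrm A (s m \<ominus> x) * (nrm A y * nrm A (v k))"
     using sc x y nrm_nonneg by (intro order_trans[OF nrm_mult] mult_left_mono nrm_mult) auto
    also have "... <= (e / 2 / b) * (b * 1)"
     using m b nrm_v sc x y nrm_nonneg e by (intro mult_mono) auto
    finally show ?thesis using N[OF k] b by simp
   qed
   then show "EX N. ALL k>=N. norm (nrm A (x \<cdot> (y \<cdot> v k)) - 0) < e"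
    using nrm_nonneg x y by (intro exI[of _ N]) auto
  qed
  then show "x : ?I" using x by blast
 qed auto
qed
then have "(%k. nrm A (x \<cdot> (\<one> \<cdot> v k))) ----> 0" using assms one_closed by blast
then show ?thesis by simp
qed

text \<open>\<open>asym_le x c\<close> says that the image of \<open>x\<close> in the quotient by \<open>J\<close> has norm at most \<open>c\<close>.\<close>

definition asym_le :: "'a => real => bool" where
"asym_le x c \<longleftrightarrow> (ALL e>0. \<forall>\<^sub>F k in sequentially. nrm A (x \<cdot> v k) < c + e)"

lemma asym_le_nrm: assumes "x : cr A" shows "asym_le x (nrm A x)"
unfolding asym_le_def
proof (intro allI impI always_eventually)
fix e :: real and k assume e: "e > 0"
have "nrm A (x \<cdot> v k) <= nrm A x * nrm A (v k)" using assms by (intro nrm_mult) auto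
also have "... <= nrm A x * 1" using nrm_v nrm_nonneg assms by (intro mult_left_mono) auto
finally show "nrm A (x \<cdot> v k) < nrm A x + e" using e by simp
qed

lemma asym_le_mono: "asym_le x c ==> c <= d ==> asym_le x d"
unfolding asym_le_def
proof (intro allI impI)
fix e :: real assume a: "ALL e>0. \<forall>\<^sub>F k in sequentially. nrm A (x \<cdot> v k) < c + e" "c <= d" "0 < e"
then have "\<forall>\<^sub>F k in sequentially. nrm A (x \<cdot> v k) < c + e" by blast
then show "\<forall>\<^sub>F k in sequentially. nrm A (x \<cdot> v k) < d + e" by eventually_elim (use a(2) in linarith)
qed

lemma asym_le_add:
assumes xy: "x : cr A" "y : cr A" and a: "asym_le x c" "asym_le y d"
shows "asym_le (x \<oplus> y) (c + d)"
unfolding asym_le_def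
proof (intro allI impI)
fix e :: real assume e: "e > 0"
have "\<forall>\<^sub>F k in sequentially. nrm A (x \<cdot> v k) < c + e/2" "\<forall>\<^sub>F k in sequentially. nrm A (y \<cdot> v k) < d + e/2"
 using a e unfolding asym_le_def by (meson half_gt_zero)+
then show "\<forall>\<^sub>F k in sequentially. nrm A ((x \<oplus> y) \<cdot> v k) < c + d + e"
proof eventually_elim
 case (elim k)
 then show ?case using nrm_triangle[of "x \<cdot> v k" "y \<cdot> v k"] xy by (simp add: l_distr)
qed
qed

lemma asym_le_J: assumes "x : J" shows "asym_le x 0"
unfolding asym_le_def using J_v_lim[OF assms] by (auto intro: order_tendstoD)

lemma asym_le_smult:
assumes x: "x : cr A" and a: "asym_le x c"
shows "asym_le (b \<odot> x) (cmod b * c)"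
unfolding asym_le_def
proof (intro allI impI)
fix e :: real assume e: "e > 0"
define d where "d = e / (cmod b + 1)"
have d: "d > 0" "cmod b * d < e" using e by (auto simp: d_def add_nonneg_pos pos_divide_less_eq)
have "\<forall>\<^sub>F k in sequentially. nrm A (x \<cdot> v k) < c + d" using a d unfolding asym_le_def by blast
then show "\<forall>\<^sub>F k in sequentially. nrm A ((b \<odot> x) \<cdot> v k) < cmod b * c + e"
proof eventually_elim
 case (elim k)
 have "nrm A ((b \<odot> x) \<cdot> v k) = cmod b * nrm A (x \<cdot> v k)" using x by (simp add: smult_mult_left nrm_smult)
 also have "... <= cmod b * (c + d)" using elim by (intro mult_left_mono) auto
 finally show ?case using d by (simp add: distrib_left)
qed
qed

lemma asym_le_star_mult:
assumes x: "x : cr A" and c: "c >= 0" and a: "asym_le (x\<^sup>* \<cdot> x) (c\<^sup>2)"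
shows "asym_le x c"
unfolding asym_le_def
proof (intro allI impI)
fix e :: real assume e: "e > 0"
have "\<forall>\<^sub>F k in sequentially. nrm A ((x\<^sup>* \<cdot> x) \<cdot> v k) < c\<^sup>2 + e\<^sup>2"
 using a e unfolding asym_le_def by simp
then show "\<forall>\<^sub>F k in sequentially. nrm A (x \<cdot> v k) < c + e"
proof eventually_elim
 case (elim k)
 have "(nrm A (x \<cdot> v k))\<^sup>2 = nrm A ((x \<cdot> v k)\<^sup>* \<cdot> (x \<cdot> v k))" using x by (simp add: nrm_cstar)
 also have "(x \<cdot> v k)\<^sup>* \<cdot> (x \<cdot> v k) = v k \<cdot> ((x\<^sup>* \<cdot> x) \<cdot> v k)"
  using x self_adj_v[of k] by (simp add: star_mult m_assoc)
 also have "nrm A ... <= nrm A (v k) * nrm A ((x\<^sup>* \<cdot> x) \<cdot> v k)" using x by (intro nrm_mult) auto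
 also have "... <= 1 * nrm A ((x\<^sup>* \<cdot> x) \<cdot> v k)" using nrm_v x nrm_nonneg by (intro mult_right_mono) auto
 also have "... < c\<^sup>2 + e\<^sup>2" using elim by simp
 also have "... <= (c + e)\<^sup>2" using c e by (simp add: power2_sum)
 finally show ?case by (rule power2_less_imp_less) (use c e in auto)
qed
qed

lemma asym_le_dist:
assumes x: "x : cr A" and a: "asym_le x c" and e: "e > 0"
shows "EX j:J. nrm A (x \<ominus> j) < c + e"
proof -
obtain k where k: "nrm A (x \<cdot> v k) < c + e"
 using a e eventually_happens'[OF sequentially_bot] unfolding asym_le_def by blast
have "x \<cdot> (\<one> \<ominus> v k) : J" using one_minus_v J_ideal(1) x by simp
moreover have "x \<ominus> x \<cdot> (\<one> \<ominus> v k) = x \<cdot> v k"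
 using x v_closed[of k] by (simp add: ring_simprules)
ultimately show ?thesis using k by (intro bexI[of _ "x \<cdot> (\<one> \<ominus> v k)"]) auto
qed

lemma asym_le_0D:
assumes x: "x : cr A" and a: "asym_le x 0"
shows "x : J"
proof -
have "EX j. j : J & nrm A (x \<ominus> j) < 1 / real (Suc k)" for k
 using asym_le_dist[OF x a, of "1 / real (Suc k)"] by auto
then obtain j where j: "!!k. j k : J" "!!k. nrm A (x \<ominus> j k) < 1 / real (Suc k)" by metis
have "norm_lim A j x"
 by (rule norm_lim_squeeze[OF _ x _ LIMSEQ_Suc[OF lim_1_over_n]])
   (use j J_closed x nrm_diff_commute less_imp_le in \<open>metis+\<close>)
then show ?thesis using norm_closedD[OF J_props(2)] j(1) x by blast
qed

definition T :: 'a where "T = csqrt (D 0)"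

lemma T_props: "pos T" "T \<cdot> T = D 0" "T : cr A" "self_adj T"
unfolding T_def using csqrt_pos csqrt_square pos_D[of 0] posD csqrt_self_adj by auto

lemma T_in_J: "T : J"
proof (rule asym_le_0D[OF T_props(3)], rule asym_le_star_mult)
have "asym_le (D 0) 0" by (rule asym_le_J[OF J_props(3)])
then show "asym_le (T\<^sup>* \<cdot> T) (0\<^sup>2)" using T_props by simp
qed (use T_props in auto)

lemma csqrt_q_D: "pos (of_real q \<odot> D 0)" "csqrt (of_real q \<odot> D 0) = rq \<odot> T"
proof -
show p: "pos (of_real q \<odot> D 0)" using pos_scale[OF pos_D] q by auto
show "csqrt (of_real q \<odot> D 0) = rq \<odot> T"
 by (rule csqrt_eqI[OF p pos_scale[OF T_props(1)]])
   (use q T_props in \<open>auto simp: smult_mult_left smult_mult_right smult_smult simp del: of_real_sqrt\<close>)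
qed

end

section \<open>Gluing two quantum balls\<close>

definition pair_alg :: "('a, 'm) cstar_scheme => ('a \<times> 'a) set => ('a \<times> 'a) cstar" where
"pair_alg B S =
  \<lparr>carrier = S,
  mult = (%(x, y) (x', y'). (x \<cdot>\<^sub>B x', y \<cdot>\<^sub>B y')),
  one = (\<one>\<^sub>B, \<one>\<^sub>B),
  zero = (\<zero>\<^sub>B, \<zero>\<^sub>B),
  add = (%(x, y) (x', y'). (x \<oplus>\<^sub>B x', y \<oplus>\<^sub>B y')),
  smult = (%c (x, y). (c \<odot>\<^sub>B x, c \<odot>\<^sub>B y)),
  star = (%(x, y). (x\<^sup>*\<^sub>B, y\<^sup>*\<^sub>B)),
  nrm = (%(x, y). max (nrm B x) (nrm B y))\<rparr>"

lemma pair_alg_simps [simp]: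
"cr (pair_alg B S) = S"
"(x, y) \<cdot>\<^bsub>pair_alg B S\<^esub> (x', y') = (x \<cdot>\<^sub>B x', y \<cdot>\<^sub>B y')"
"\<one>\<^bsub>pair_alg B S\<^esub> = (\<one>\<^sub>B, \<one>\<^sub>B)" "\<zero>\<^bsub>pair_alg B S\<^esub> = (\<zero>\<^sub>B, \<zero>\<^sub>B)"
"(x, y) \<oplus>\<^bsub>pair_alg B S\<^esub> (x', y') = (x \<oplus>\<^sub>B x', y \<oplus>\<^sub>B y')"
"c \<odot>\<^bsub>pair_alg B S\<^esub> (x, y) = (c \<odot>\<^sub>B x, c \<odot>\<^sub>B y)"
"(x, y)\<^sup>*\<^bsub>pair_alg B S\<^esub> = (x\<^sup>*\<^sub>B, y\<^sup>*\<^sub>B)"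
"nrm (pair_alg B S) (x, y) = max (nrm B x) (nrm B y)"
by (simp_all add: pair_alg_def)

text \<open>The gluing is used only as a relation between the two components. This hides the boundary algebra and the automorphism.\<close>

locale sphere_rel = ball_relations +
fixes S :: "('a \<times> 'a) set"
assumes S_closed: "(x, y) : S ==> x : cr A & y : cr A"
 and S_one: "(\<one>, \<one>) : S"
 and S_add: "(x, y) : S ==> (x', y') : S ==> (x \<oplus> x', y \<oplus> y') : S"
 and S_mult: "(x, y) : S ==> (x', y') : S ==> (x \<cdot> x', y \<cdot> y') : S"
 and S_smult: "(x, y) : S ==> (c \<odot> x, c \<odot> y) : S"
 and S_star: "(x, y) : S ==> (x\<^sup>*, y\<^sup>*) : S"
 and S_left_total: "x : cr A ==> EX y. (x, y) : S"
 and S_right_total: "y : cr A ==> EX x. (x, y) : S"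
 and S_J_iff: "(x, y) : S ==> x : J \<longleftrightarrow> y : J"
 and S_J: "x : J ==> y : J ==> (x, y) : S"
 and n_pos: "1 <= n"
 and S_gen1: "((z 1)\<^sup>*, z 1) : S"
 and S_gen: "2 <= i ==> i <= n ==> (z i, z i) : S"
begin

abbreviation SP where "SP \<equiv> pair_alg A S"

lemma S_closed' [simp]: "(x, y) : S ==> x : cr A" "(x, y) : S ==> y : cr A"
using S_closed by blast+

lemma S_zero: "(\<zero>, \<zero>) : S"
using S_J J_ideal(5) by blast

lemma S_diff: "(x, y) : S ==> (x', y') : S ==> (x \<ominus> x', y \<ominus> y') : S"
using S_add[OF _ S_smult[of x' y' "-1"]] by (simp add: diff_eq_smult)

lemma star_alg_SP: "star_alg SP"
proof -
have "ring SP"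
proof (rule ringI)
 show "abelian_group SP"
 proof (rule abelian_groupI)
  fix p assume "p : cr SP"
  then obtain x y where p: "p = (x, y)" "(x, y) : S" by (cases p) auto
  have "(- 1) \<odot>\<^sub>SP p \<oplus>\<^sub>SP p = \<zero>\<^sub>SP" using p by (simp add: minus_eq_smult[symmetric] l_neg)
  moreover have "(- 1) \<odot>\<^sub>SP p : cr SP" using p S_smult by simp
  ultimately show "EX p':cr SP. p' \<oplus>\<^sub>SP p = \<zero>\<^sub>SP" by blast
 qed (auto simp: S_add S_zero a_ac)
 show "monoid SP" by (rule monoidI) (auto simp: S_mult S_one m_assoc)
qed (auto simp: l_distr r_distr)
then interpret SP: ring SP .
show ?thesis
 by unfold_locales
   (auto simp: S_smult S_star smult_r_distr smult_l_distr smult_smult smult_mult_left smult_mult_right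
    star_add star_mult star_smult)
qed

lemma SP_diff: "(x, y) : S ==> (x', y') : S ==> (x, y) \<ominus>\<^sub>SP (x', y') = (x \<ominus> x', y \<ominus> y')"
proof -
interpret SP: star_alg SP by (rule star_alg_SP)
assume s: "(x, y) : S" "(x', y') : S"
then show ?thesis using SP.diff_eq_smult[of "(x, y)" "(x', y')"] by (simp add: diff_eq_smult)
qed

lemma S_same_right: "(x, y) : S ==> (x', y) : S ==> x \<ominus> x' : J"
proof -
assume s: "(x, y) : S" "(x', y) : S"
have "y \<ominus> y = \<zero>" using s by (simp add: minus_eq r_neg)
then have "(x \<ominus> x', \<zero>) : S" using S_diff[OF s] by simp
then show ?thesis using S_J_iff J_ideal(5) by blast
qed

text \<open>On self-adjoint contractions the unitary \<open>\<surd>(\<one> - y\<^sup>2) + \<i>y\<close> transports the norm bound across the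
  gluing: its partner is unitary modulo \<open>J\<close>, and so has quotient norm 1.\<close>

lemma glue_contractive_self_adj:
assumes s: "(x, y) : S" and y: "self_adj y" "nrm A y <= 1"
shows "asym_le x 1"
proof -
have c: "x : cr A" "y : cr A" using s by auto
define a where "a = \<one> \<ominus> y \<cdot> y"
have pa: "pos a"
proof -
 have "\<one> \<ominus> a = y \<cdot> y" unfolding a_def using c by algebra
 moreover have "nrm A (y \<cdot> y) <= 1"
  using nrm_self_adj_square[OF y(1)] y nrm_nonneg[OF c(2)] by (simp add: abs_square_le_1)
 ultimately show ?thesis unfolding pos_def a_def using y by (auto intro: self_adj_combine)
qed
define k where "k = csqrt a"
have k: "self_adj k" "k : cr A" "k \<cdot> k = a"
 using csqrt_self_adj[OF pa] csqrt_square[OF pa] by (auto simp: k_def)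
have yk: "y \<cdot> k = k \<cdot> y" unfolding k_def
 by (rule csqrt_commute[OF pa c(2)]) (use c in \<open>simp add: a_def expand_simps\<close>)
have sq: "k \<cdot> k \<oplus> y \<cdot> y = \<one>" unfolding k(3) a_def using c by algebra
obtain k' where k': "(k', k) : S" using S_right_total k by blast
have bound: "asym_le (k' \<oplus> b \<odot> x) 1" if b: "b = \<i> \<or> b = - \<i>" for b
proof -
 let ?u = "k' \<oplus> b \<odot> x" and ?w = "k \<oplus> b \<odot> y"
 have U: "(?u, ?w) : S" using S_add[OF k' S_smult[OF s]] .
 have ws: "?w\<^sup>* = k \<oplus> cnj b \<odot> y" using k y c by (simp add: star_add star_smult)
 have "?w\<^sup>* \<cdot> ?w = k \<cdot> k \<oplus> y \<cdot> y"
  unfolding ws using b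
 proof
  assume "b = \<i>"
  then show "(k \<oplus> cnj b \<odot> y) \<cdot> (k \<oplus> b \<odot> y) = k \<cdot> k \<oplus> y \<cdot> y"
   using k(2) c yk by (simp add: expand_simps a_ac smult_collect)
 next
  assume "b = - \<i>"
  then show "(k \<oplus> cnj b \<odot> y) \<cdot> (k \<oplus> b \<odot> y) = k \<cdot> k \<oplus> y \<cdot> y"
   using k(2) c yk by (simp add: expand_simps a_ac smult_collect)
 qed
 then have "(?u\<^sup>* \<cdot> ?u, \<one>) : S" using S_mult[OF S_star[OF U] U] sq by simp
 then have j: "?u\<^sup>* \<cdot> ?u \<ominus> \<one> : J" using S_same_right S_one by blast
 have uc: "?u : cr A" using U by simp
 have "asym_le \<one> 1" using asym_le_mono[OF asym_le_nrm[OF one_closed] nrm_one_le] .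
 then have "asym_le ((?u\<^sup>* \<cdot> ?u \<ominus> \<one>) \<oplus> \<one>) (0 + 1)"
  using asym_le_add[OF _ _ asym_le_J[OF j]] uc by simp
 moreover have "(?u\<^sup>* \<cdot> ?u \<ominus> \<one>) \<oplus> \<one> = ?u\<^sup>* \<cdot> ?u"
  using m_closed[OF star_closed[OF uc] uc] by algebra
 ultimately show ?thesis using asym_le_star_mult[OF uc, of 1] by simp
qed
have k'c: "k' : cr A" using k' by simp
have "asym_le ((1/2) \<odot> ((- \<i>) \<odot> (k' \<oplus> \<i> \<odot> x) \<oplus> \<i> \<odot> (k' \<oplus> (- \<i>) \<odot> x))) (cmod (1/2) * (cmod (- \<i>) * 1 + cmod \<i> * 1))"
 by (intro asym_le_smult asym_le_add bound) (use c k'c in auto)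
moreover have "(1/2) \<odot> ((- \<i>) \<odot> (k' \<oplus> \<i> \<odot> x) \<oplus> \<i> \<odot> (k' \<oplus> (- \<i>) \<odot> x)) = x"
 using c(1) k'c by (simp add: expand_simps a_ac smult_collect)
ultimately show ?thesis by simp
qed

text \<open>Splitting into real and imaginary parts costs the factor 2.\<close>

lemma glue_bounded:
assumes s: "(x, y) : S" shows "asym_le x (2 * nrm A y)"
proof -
have sa: "asym_le x' (nrm A y')" if s': "(x', y') : S" and y': "self_adj y'" for x' y'
proof (cases "nrm A y' = 0")
 case True
 then have "y' = \<zero>" using nrm_eq_0D s' by auto
 then have "x' : J" using S_J_iff[OF s'] J_ideal(5) by simp
 then show ?thesis using asym_le_J True by simp
next
 case False
 define t where "t = nrm A y'"
 have t: "t > 0" using False nrm_nonneg[of y'] s' by (simp add: t_def order_less_le)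
 have c: "x' : cr A" "y' : cr A" using s' by auto
 have "asym_le (of_real (1/t) \<odot> x') 1"
  by (rule glue_contractive_self_adj[OF S_smult[OF s']])
    (use t y' c in \<open>auto intro!: self_adj_combine(3) simp: nrm_smult norm_divide t_def simp del: of_real_divide\<close>)
 then have "asym_le (of_real t \<odot> (of_real (1/t) \<odot> x')) (cmod (of_real t) * 1)"
  by (rule asym_le_smult[rotated]) (use c in auto)
 then show ?thesis using t c by (simp add: smult_smult t_def)
qed
have c: "x : cr A" "y : cr A" using s by auto
define r where "r = (1/2) \<odot> (y \<oplus> y\<^sup>*)"
define i where "i = (- \<i>/2) \<odot> (y \<ominus> y\<^sup>*)"
note ri = real_imag_parts[OF c(2), folded r_def i_def]
obtain x1 x2 where x12: "(x1, r) : S" "(x2, i) : S"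
 using S_right_total ri by (meson self_adjD(1))
have xc: "x1 : cr A" "x2 : cr A" using x12 by auto
have "(x1 \<oplus> \<i> \<odot> x2, y) : S" using S_add[OF x12(1) S_smult[OF x12(2), of \<i>]] ri(3) by simp
then have j: "x \<ominus> (x1 \<oplus> \<i> \<odot> x2) : J" using S_same_right s by blast
have "asym_le ((x \<ominus> (x1 \<oplus> \<i> \<odot> x2)) \<oplus> (x1 \<oplus> \<i> \<odot> x2)) (0 + (nrm A r + cmod \<i> * nrm A i))"
 by (intro asym_le_add asym_le_smult asym_le_J[OF j] sa x12 ri) (use xc c in auto)
moreover have "(x \<ominus> (x1 \<oplus> \<i> \<odot> x2)) \<oplus> (x1 \<oplus> \<i> \<odot> x2) = x"
 using c xc smult_closed[OF xc(2), of \<i>] by algebra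
ultimately have "asym_le x (nrm A r + nrm A i)" by simp
then show ?thesis by (rule asym_le_mono) (use ri in linarith)
qed

lemma norm_lim_pair:
assumes "!!k. (x k, y k) : S" "(a, b) : S" "norm_lim A x a" "norm_lim A y b"
shows "norm_lim SP (%k. (x k, y k)) (a, b)"
proof -
have "(%k. max (nrm A (x k \<ominus> a)) (nrm A (y k \<ominus> b))) ----> max 0 0"
 using assms(3,4) unfolding norm_lim_def by (rule tendsto_max)
then show ?thesis using assms(1,2) by (simp add: norm_lim_def SP_diff)
qed

definition e_gen :: "nat => 'a \<times> 'a" where
"e_gen i = (if i = 0 then (rq \<odot> T, \<ominus> T) else if i = 1 then ((z 1)\<^sup>*, z 1) else (z i, z i))"

lemma e_gen_in_S: "i <= n ==> e_gen i : S"
using S_gen1 S_gen[of i] S_J[of "rq \<odot> T" "\<ominus> T"] T_in_J J_ideal(3)[OF T_in_J] T_props(3)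
by (auto simp: e_gen_def minus_eq_smult)

text \<open>The pair \<open>(q\<^sup>1\<^sup>/\<^sup>2 T, T)\<close> is the root of \<open>e\<^sub>0\<^sup>2\<close>; subtracting \<open>e\<^sub>0\<close> and adding it isolates
  \<open>T\<close> in either component, hence \<open>J\<close>. Then the subalgebra contains every pair whose second entry is a limit of polynomials.\<close>

lemma closed_star_subalgebra_full:
assumes sub: "closed_star_subalgebra SP E" and gen: "!!i. i <= n ==> e_gen i : E"
shows "E = S"
proof
have cl: "norm_closed SP E" and zero: "(\<zero>, \<zero>) : E"
 and add: "!!p r. p : E ==> r : E ==> p \<oplus>\<^sub>SP r : E" and mult: "!!p r. p : E ==> r : E ==> p \<cdot>\<^sub>SP r : E"
 and smult: "!!c p. p : E ==> c \<odot>\<^sub>SP p : E" and star: "!!p. p : E ==> p\<^sup>*\<^sub>SP : E"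
 using sub by (auto simp: closed_star_subalgebra_def)
have add': "(x \<oplus> x', y \<oplus> y') : E" and mult': "(x \<cdot> x', y \<cdot> y') : E"
 if "(x, y) : E" "(x', y') : E" for x y x' y'
 using add[OF that] mult[OF that] by simp_all
have smult': "(c \<odot> x, c \<odot> y) : E" if "(x, y) : E" for c x y using smult[OF that] by simp
have E_S: "E <= S" using cl by (simp add: norm_closed_def)
then show "E <= S" .
have Ec: "x : cr A" "y : cr A" if "(x, y) : E" for x y using that E_S S_closed' by blast+
have lim: "(a, b) : E" if "!!k. (x k, y k) : E" "(a, b) : S" "norm_lim A x a" "norm_lim A y b" for x y a b
 by (rule norm_closedD[OF cl, of "%k. (x k, y k)"])
   (use that E_S norm_lim_pair[of x y a b] in auto)
have T0: "T : cr A" "self_adj T" "T \<cdot> T = D 0" by (rule T_props)+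
have e0: "(rq \<odot> T, \<ominus> T) : E" using gen[of 0] by (simp add: e_gen_def)
have e0sq: "(of_real q \<odot> D 0, D 0) : E"
 using mult[OF e0 e0] T0 by (simp add: smult_mult_left smult_mult_right smult_smult l_minus r_minus)
have gen1: "((z 1)\<^sup>*, z 1) : E" using gen[of 1] n_pos by (simp add: e_gen_def)
have geni: "(z i, z i) : E" if "2 <= i" "i <= n" for i using gen[of i] that by (simp add: e_gen_def)
\<comment> \<open>The unit is \<open>e\<^sub>0\<^sup>2 + \<Sum> e\<^sub>ie\<^sub>i\<^sup>\<star>\<close>.\<close>
have one: "(\<one>, \<one>) : E"
proof -
 have "(\<one> \<ominus> D m, \<one> \<ominus> D m) : E" if "1 <= m" "m <= n" for m
  using that(2,1)
 proof (induction m rule: inc_induct)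
  case base then show ?case using zero by (simp add: D_n minus_eq r_neg)
 next
  case (step m)
  let ?z = "z (Suc m)"
  have zc: "?z : cr A" using step by auto
  have "(?z, ?z) : E" using geni step by simp
  from mult[OF this star[OF this]] have zz: "(?z \<cdot> ?z\<^sup>*, ?z \<cdot> ?z\<^sup>*) : E" by simp
  have ih: "(\<one> \<ominus> D (Suc m), \<one> \<ominus> D (Suc m)) : E" using step by simp
  from add[OF ih zz] have "((\<one> \<ominus> D (Suc m)) \<oplus> ?z \<cdot> ?z\<^sup>*, (\<one> \<ominus> D (Suc m)) \<oplus> ?z \<cdot> ?z\<^sup>*) : E" by simp
  moreover have "(\<one> \<ominus> D (Suc m)) \<oplus> ?z \<cdot> ?z\<^sup>* = \<one> \<ominus> D m"
   unfolding D_Suc[OF step(2)] using m_closed[OF zc star_closed[OF zc]] D_closed[of "Suc m"] by algebra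
  ultimately show ?case by simp
 qed
 from this[of 1] have a: "(\<one> \<ominus> D 1, \<one> \<ominus> D 1) : E" using n_pos by simp
 have z1: "z 1 : cr A" using n_pos by simp
 have b: "((z 1)\<^sup>* \<cdot> z 1, z 1 \<cdot> (z 1)\<^sup>*) : E" using mult[OF gen1 star[OF gen1]] z1 by simp
 have c1: "of_real q \<odot> D 0 = D 1 \<ominus> (z 1)\<^sup>* \<cdot> z 1" "D 0 = D 1 \<ominus> z 1 \<cdot> (z 1)\<^sup>*"
  using D_minus_z_star_z[of 1] D_step[of 1] n_pos by simp_all
 have "((\<one> \<ominus> D 1) \<oplus> ((z 1)\<^sup>* \<cdot> z 1 \<oplus> of_real q \<odot> D 0), (\<one> \<ominus> D 1) \<oplus> (z 1 \<cdot> (z 1)\<^sup>* \<oplus> D 0)) : E"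
  using add[OF a add[OF b e0sq]] by simp
 moreover have "(\<one> \<ominus> D 1) \<oplus> ((z 1)\<^sup>* \<cdot> z 1 \<oplus> of_real q \<odot> D 0) = \<one>"
  unfolding c1(1) using m_closed[OF star_closed[OF z1] z1] D_closed[of 1] by algebra
 moreover have "(\<one> \<ominus> D 1) \<oplus> (z 1 \<cdot> (z 1)\<^sup>* \<oplus> D 0) = \<one>"
  unfolding c1(2) using m_closed[OF z1 star_closed[OF z1]] D_closed[of 1] by algebra
 ultimately show ?thesis by simp
qed
have diff: "(x \<ominus> x', y \<ominus> y') : E" if "(x, y) : E" "(x', y') : E" for x y x' y'
 using add[OF that(1) smult[OF that(2), of "-1"]] Ec[OF that(1)] Ec[OF that(2)] by (simp add: diff_eq_smult)
\<comment> \<open>The absolute value of \<open>e\<^sub>0\<close>, as the limit of the square root iteration for \<open>e\<^sub>0\<^sup>2\<close>.\<close>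
have abs: "(rq \<odot> T, T) : E"
proof -
 let ?a = "of_real q \<odot> D 0"
 have it: "(sqrt_iter A (\<one> \<ominus> ?a) k, sqrt_iter A (\<one> \<ominus> D 0) k) : E" for k
 proof (induction k)
  case (Suc k)
  show ?case using smult[OF add[OF diff[OF one e0sq] mult[OF Suc Suc]], of "1/2"] by simp
 qed (use zero in simp)
 have "(\<one> \<ominus> rq \<odot> T, \<one> \<ominus> T) : E"
 proof (rule lim[OF it])
  show "(\<one> \<ominus> rq \<odot> T, \<one> \<ominus> T) : S" using S_diff[OF S_one S_J[OF J_ideal(3)[OF T_in_J] T_in_J]] .
  show "norm_lim A (sqrt_iter A (\<one> \<ominus> ?a)) (\<one> \<ominus> rq \<odot> T)"
   using csqrt_lim(2)[OF csqrt_q_D(1)] csqrt_q_D(2) by simp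
  show "norm_lim A (sqrt_iter A (\<one> \<ominus> D 0)) (\<one> \<ominus> T)"
   unfolding T_def by (rule csqrt_lim(2)[OF pos_D]) simp
 qed
 from diff[OF one this] show ?thesis
 proof -
  have "\<one> \<ominus> (\<one> \<ominus> x) = x" if "x : cr A" for x using that by algebra
  then show ?thesis using \<open>(\<one> \<ominus> (\<one> \<ominus> rq \<odot> T), \<one> \<ominus> (\<one> \<ominus> T)) : E\<close> T0 by simp
 qed
qed
have D_l: "(D 0, \<zero>) : E"
proof -
 have "(rq \<odot> T \<oplus> rq \<odot> T, T \<oplus> \<ominus> T) : E" using add[OF abs e0] by simp
 then have "((2 * rq) \<odot> T, \<zero>) : E" using T0 by (simp add: smult_l_distr[symmetric] r_neg)
 from smult[OF this, of "1 / (2 * rq)"] have t: "(T, \<zero>) : E" using T0 q by (simp add: smult_smult)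
 show ?thesis using mult[OF t t] T0 by simp
qed
have D_r: "(\<zero>, D 0) : E"
proof -
 have "(of_real q \<odot> D 0, \<zero>) : E" using smult[OF D_l, of "of_real q"] by simp
 from diff[OF e0sq this] have "(\<zero>, D 0 \<ominus> \<zero>) : E" by (simp add: minus_eq r_neg)
 then show ?thesis by (simp add: minus_eq)
qed
\<comment> \<open>Both coordinate projections of \<open>E\<close> are dense.\<close>
have dense_l: "EX s. (ALL k. EX y. (s k, y) : E) & norm_lim A s x" if x: "x : cr A" for x
proof -
 have g: "z i : {x. EX y. (x, y) : E}" "(z i)\<^sup>* : {x. EX y. (x, y) : E}" if "1 <= i" "i <= n" for i
  using that gen1 star[OF gen1] geni[of i] star[OF geni[of i]] by (cases "i = 1"; force)+
 have "EX s. (ALL k. s k : {x. EX y. (x, y) : E}) & norm_lim A s x"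
 proof (rule dense[OF _ _ g])
  show "{x. EX y. (x, y) : E} <= cr A" using Ec by blast
 qed (use one x in \<open>blast intro: add' mult' smult'\<close>)+
 then show ?thesis by simp
qed
have dense_r: "EX s. (ALL k. EX x. (x, s k) : E) & norm_lim A s y" if y: "y : cr A" for y
proof -
 have g: "z i : {y. EX x. (x, y) : E}" "(z i)\<^sup>* : {y. EX x. (x, y) : E}" if "1 <= i" "i <= n" for i
  using that gen1 star[OF gen1] geni[of i] star[OF geni[of i]] by (cases "i = 1"; force)+
 have "EX s. (ALL k. s k : {y. EX x. (x, y) : E}) & norm_lim A s y"
 proof (rule dense[OF _ _ g])
  show "{y. EX x. (x, y) : E} <= cr A" using Ec by blast
 qed (use one y in \<open>blast intro: add' mult' smult'\<close>)+
 then show ?thesis by simp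
qed
have J_l: "(x, \<zero>) : E" if "x : J" for x
proof -
 have "J <= {x : cr A. (x, \<zero>) : E}"
 proof (rule J_props(4))
  show "D 0 : {x : cr A. (x, \<zero>) : E}" using D_l by simp
  have cl': "x : J ==> (!!k. (s k, \<zero>) : E) ==> norm_lim A s x ==> (x, \<zero>) : E" for s x
   by (rule lim[of s "%_. \<zero>"]) (auto intro: S_J J_ideal(5) norm_lim_const)
  have inJ: "x : J" if "(x, \<zero>) : E" for x using that E_S S_J_iff J_ideal(5) by blast
  show "norm_closed A {x : cr A. (x, \<zero>) : E}"
  proof (rule norm_closedI)
   fix s x assume s: "!!k. s k : {x : cr A. (x, \<zero>) : E}" "x : cr A" "norm_lim A s x"
   have sE: "(s k, \<zero>) : E" for k using s(1)[of k] by simp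
   have "x : J" by (rule norm_closedD[OF J_props(2) inJ[OF sE] s(2,3)])
   then show "x : {x : cr A. (x, \<zero>) : E}" using cl'[OF _ sE s(3)] s(2) by simp
  qed auto
  show "ideal {x : cr A. (x, \<zero>) : E} A"
  proof (rule idealI')
   fix x y assume "x : {x : cr A. (x, \<zero>) : E}" "y : {x : cr A. (x, \<zero>) : E}"
   then show "x \<oplus> y : {x : cr A. (x, \<zero>) : E}" using add[of "(x, \<zero>)" "(y, \<zero>)"] by simp
  next
   fix a x assume a: "a : cr A" and x: "x : {x : cr A. (x, \<zero>) : E}"
   then have xc: "x : cr A" "(x, \<zero>) : E" "x : J" using inJ by auto
   obtain s where s: "!!k. EX y. (s k, y) : E" "norm_lim A s a" using dense_l[OF a] by blast
   have sc: "s k : cr A" for k using s(1)[of k] Ec by blast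
   have sx: "(s k \<cdot> x, \<zero>) : E" "(x \<cdot> s k, \<zero>) : E" for k
   proof -
    obtain y where "(s k, y) : E" using s(1) by blast
    then show "(s k \<cdot> x, \<zero>) : E" "(x \<cdot> s k, \<zero>) : E"
     using mult[OF _ xc(2)] mult[OF xc(2)] Ec by force+
   qed
   have lx: "norm_lim A (%k. s k \<cdot> x) (a \<cdot> x)" "norm_lim A (%k. x \<cdot> s k) (x \<cdot> a)"
    by (auto intro!: norm_lim_mult norm_lim_const sc a xc s)
   have "(a \<cdot> x, \<zero>) : E" "(x \<cdot> a, \<zero>) : E"
    by (rule cl'[OF J_ideal(1)[OF xc(3) a] sx(1) lx(1)], rule cl'[OF J_ideal(2)[OF xc(3) a] sx(2) lx(2)])
   then show "a \<cdot> x : {x : cr A. (x, \<zero>) : E}" "x \<cdot> a : {x : cr A. (x, \<zero>) : E}" using a xc by auto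
  qed (use zero in auto)
 qed
 then show ?thesis using that by blast
qed
show "S <= E"
proof (clarify)
 fix x y assume xy: "(x, y) : S"
 have c: "x : cr A" "y : cr A" using xy by auto
 obtain t where t: "!!k. EX x. (x, t k) : E" "norm_lim A t y" using dense_r[OF c(2)] by blast
 obtain s where s: "!!k. (s k, t k) : E" using t(1) by metis
 have sc: "s k : cr A" "t k : cr A" for k using Ec[OF s[of k]] by auto
 have sS: "(s k, t k) : S" for k using s[of k] E_S by blast
 have "EX j. j : J & nrm A ((x \<ominus> s k) \<ominus> j) < 2 * nrm A (y \<ominus> t k) + 1 / real (Suc k)" for k
  using asym_le_dist[OF _ glue_bounded[OF S_diff[OF xy sS[of k]]], of "1 / real (Suc k)"] c sc[of k] by auto
 then obtain j where j: "!!k. j k : J"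
  "!!k. nrm A ((x \<ominus> s k) \<ominus> j k) < 2 * nrm A (y \<ominus> t k) + 1 / real (Suc k)" by metis
 have jc: "j k : cr A" for k using j(1) J_closed by blast
 show "(x, y) : E"
 proof (rule lim[of "%k. s k \<oplus> j k" t])
  show "(s k \<oplus> j k, t k) : E" for k using add[OF s[of k] J_l[OF j(1)[of k]]] sc by simp
  have l: "(%k. 2 * nrm A (t k \<ominus> y) + 1 / real (Suc k)) ----> 0"
   using t(2) unfolding norm_lim_def by (intro tendsto_add_zero tendsto_mult_right_zero LIMSEQ_Suc[OF lim_1_over_n])
  show "norm_lim A (%k. s k \<oplus> j k) x"
  proof (rule norm_lim_squeeze[OF _ c(1) _ l])
   fix k
   have "nrm A (s k \<oplus> j k \<ominus> x) = nrm A (x \<ominus> (s k \<oplus> j k))"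
    using nrm_diff_commute[of "s k \<oplus> j k" x] sc jc c by simp
   also have "x \<ominus> (s k \<oplus> j k) = (x \<ominus> s k) \<ominus> j k" using sc[of k] jc[of k] c(1) by algebra
   finally show "nrm A (s k \<oplus> j k \<ominus> x) <= 2 * nrm A (t k \<ominus> y) + 1 / real (Suc k)"
    using j(2)[of k] nrm_diff_commute[OF c(2) sc(2)[of k]] by simp
  qed (use sc jc in auto)
 qed (use xy t in auto)
qed
qed

theorem generated: "generated_cstar SP (e_gen ` {0..n}) = S"
proof
have "closed_star_subalgebra SP S"
 unfolding closed_star_subalgebra_def norm_closed_def using S_zero S_add S_mult S_smult S_star by auto
then show "generated_cstar SP (e_gen ` {0..n}) <= S"
 unfolding generated_cstar_def using e_gen_in_S by auto
show "S <= generated_cstar SP (e_gen ` {0..n})"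
 unfolding generated_cstar_def using closed_star_subalgebra_full by fastforce
qed

end

section \<open>The quantum ball and its boundary\<close>

declare One_nat_def [simp del]

lemma sum_seminorm_le:
assumes N: "cstar_seminorm G N" and f: "!!i. i : I ==> f i : polys G"
shows "N (sum f I) <= (\<Sum>i\<in>I. N (f i))"
proof -
interpret seminorm_alg "free_star_algebra G N" using N by (simp add: cstar_seminorm_iff)
show ?thesis using f
proof (induction I rule: infinite_finite_induct)
 case (insert i I)
 then show ?case using nrm_triangle[of "f i" "sum f I"] free_star_carrier_sum[of I f G] by force
qed (use nrm_zero in auto)
qed

locale quantum_ball =
fixes q :: real and n :: nat
assumes q: "0 < q" "q < 1"
begin

abbreviation zp :: "nat => nat star_poly" where "zp \<equiv> poly_gen"
abbreviation zs :: "nat => nat star_poly" where "zs i \<equiv> poly_star (poly_gen i)"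

lemma zp_closed: "i : {1..n} ==> zp i : polys {1..n}" "i : {1..n} ==> zs i : polys {1..n}"
using free_star_carrier_gen[of i "{1..n}"] by auto

definition rel3 :: "nat => nat star_poly" where
"rel3 i = zs i * zp i - poly_scale (of_real q) (zp i * zs i)
 - poly_scale (of_real (1 - q)) (1 - (\<Sum>j=i+1..n. zp j * zs j))"

lemma relators_iff:
"r : qball_relators q n \<longleftrightarrow>
 (EX i j. 1 <= i & i < j & j <= n & r = zp i * zp j - poly_scale (of_real (sqrt q)) (zp j * zp i)) \<or>
 (EX i j. 1 <= i & i < j & j <= n & r = zp i * zs j - poly_scale (of_real (1 / sqrt q)) (zs j * zp i)) \<or>
 (EX i. 1 <= i & i <= n & r = rel3 i)"
proof -
have p1: "q powr (1/2) = sqrt q" using q by (simp add: powr_half_sqrt)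
have p2: "q powr (-1/2) = 1 / sqrt q"
 using powr_minus_divide[of q "1/2"] q by (simp add: powr_half_sqrt)
show ?thesis unfolding qball_relators_def Let_def rel3_def p1 p2 Un_iff mem_Collect_eq
 by (intro iffI; elim disjE exE conjE; blast)
qed

lemma sum_zz_closed: "1 <= i ==> (\<Sum>j=i+1..n. zp j * zs j) : polys {1..n}"
by (intro free_star_carrier_sum polys_closed(4) zp_closed) auto

lemma rel3_closed: "1 <= i ==> i <= n ==> rel3 i : polys {1..n}"
unfolding rel3_def
by (intro free_star_carrier_diff polys_closed(2,4,5) sum_zz_closed zp_closed) auto

lemma relators_closed: "qball_relators q n <= polys {1..n}"
proof
fix r assume "r : qball_relators q n"
then show "r : polys {1..n}"
 unfolding relators_iff
 by (elim disjE exE conjE; simp only:)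
   (intro free_star_carrier_diff polys_closed(4,5) zp_closed rel3_closed; simp)+
qed

text \<open>The supremum that defines the universal norm is finite: by descending induction on the index, the relation for \<open>z\<^sub>g\<^sup>*
  z\<^sub>g\<close> bounds \<open>(1 - q) N(z\<^sub>g)\<^sup>2\<close> by the norms of the later generators.\<close>

lemma gen_bound:
assumes "g : {1..n}"
shows "EX B. ALL N. cstar_seminorm {1..n} N & (ALL r:qball_relators q n. N r = 0) --> N (poly_gen g) <= B"
using assms
proof (induction "n - g" arbitrary: g rule: less_induct)
case less
let ?adm = "%N. cstar_seminorm {1..n} N & (ALL r:qball_relators q n. N r = 0)"
have "ALL j:{g+1..n}. EX B. ALL N. ?adm N --> N (zp j) <= B"
 using less.hyps less.prems by auto
then obtain B where B: "!!j N. j : {g+1..n} ==> ?adm N ==> N (zp j) <= B j" by metis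
define C where "C = 1 + (\<Sum>j=g+1..n. \<bar>B j\<bar> * \<bar>B j\<bar>)"
have C1: "C >= 1" by (simp add: C_def sum_nonneg)
have "N (zp g) <= C" if N: "?adm N" for N
proof -
 interpret seminorm_alg "free_star_algebra {1..n} N" using N by (simp add: cstar_seminorm_iff)
 have g: "1 <= g" "g <= n" using less.prems by auto
 have zc: "zp j : polys {1..n}" "zs j : polys {1..n}" if "j : {g..n}" for j
  using zp_closed[of j] that g by auto
 let ?s = "\<Sum>j=g+1..n. zp j * zs j"
 have sc: "?s : polys {1..n}" using sum_zz_closed g by blast
 have nm: "N (x * y) <= N x * N y" "N (x + y) <= N x + N y" "N (x - y) <= N x + N y"
  if "x : polys {1..n}" "y : polys {1..n}" for x y
  using nrm_mult[of x y] nrm_triangle[of x y] nrm_diff[of x y] that by simp_all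
 have ns: "N (poly_scale c x) = cmod c * N x" "N (poly_star x) = N x" "0 <= N x"
  if "x : polys {1..n}" for x c
  using nrm_smult[of x c] nrm_star[of x] nrm_nonneg[of x] that by simp_all
 have "N ?s <= (\<Sum>j=g+1..n. N (zp j * zs j))"
  by (rule sum_seminorm_le) (use N zc in auto)
 also have "... <= (\<Sum>j=g+1..n. \<bar>B j\<bar> * \<bar>B j\<bar>)"
 proof (rule sum_mono)
  fix j assume j: "j : {g+1..n}"
  then have z: "zp j : polys {1..n}" "zs j : polys {1..n}" using zc by auto
  have "N (zp j * zs j) <= N (zp j) * N (zp j)" using nm(1)[OF z] ns(2)[OF z(1)] by simp
  also have "... <= \<bar>B j\<bar> * \<bar>B j\<bar>"
   using B[OF j N] ns(3)[OF z(1)] by (intro mult_mono) auto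
  finally show "N (zp j * zs j) <= \<bar>B j\<bar> * \<bar>B j\<bar>" .
 qed
 finally have "N ?s <= C - 1" by (simp add: C_def)
 then have n1: "N (1 - ?s) <= C" using nm(3)[of 1 ?s] sc nrm_one_le by fastforce
 have zg: "zp g : polys {1..n}" "zs g : polys {1..n}" using zc g by auto
 have os: "1 - ?s : polys {1..n}" using sc by auto
 have "N (rel3 g) = 0" using N g relators_iff by blast
 moreover have "zs g * zp g = rel3 g + (poly_scale (of_real q) (zp g * zs g) + poly_scale (of_real (1 - q)) (1 - ?s))"
  by (simp add: rel3_def)
 ultimately have "N (zs g * zp g) <= N (poly_scale (of_real q) (zp g * zs g) + poly_scale (of_real (1 - q)) (1 - ?s))"
  using nm(2)[OF rel3_closed[OF g], of "poly_scale (of_real q) (zp g * zs g) + poly_scale (of_real (1 - q)) (1 - ?s)"]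
   zg os by (auto intro!: polys_closed)
 also have "... <= N (poly_scale (of_real q) (zp g * zs g)) + N (poly_scale (of_real (1 - q)) (1 - ?s))"
  using zg os by (intro nm) auto
 also have "... = q * N (zp g * zs g) + (1 - q) * N (1 - ?s)"
  using q zg os by (simp add: ns(1) polys_closed(4) del: of_real_diff)
 also have "... <= q * (N (zp g) * N (zp g)) + (1 - q) * C"
  using q n1 nm(1)[OF zg] ns(2)[OF zg(1)] by (intro add_mono mult_left_mono) auto
 finally have "(N (zp g))\<^sup>2 <= q * (N (zp g))\<^sup>2 + (1 - q) * C"
  using nrm_cstar[of "zp g"] zg by (simp add: power2_eq_square)
 then have "(1 - q) * (N (zp g))\<^sup>2 <= (1 - q) * C" by (simp add: algebra_simps)
 then have le: "(N (zp g))\<^sup>2 <= C" using q by (simp only: mult_le_cancel_left_pos diff_gt_0_iff_gt)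
 show "N (zp g) <= C"
 proof (cases "N (zp g) <= 1")
  case False
  then have "N (zp g) <= (N (zp g))\<^sup>2" by (simp add: power2_eq_square)
  then show ?thesis using le by linarith
 qed (use C1 in linarith)
qed
then show ?case by blast
qed

sublocale universal_alg "{1..n}" "qball_relators q n"
by unfold_locales (use relators_closed gen_bound in auto)

lemma qball_eq: "qball q n = ucstar"
by (simp add: qball_def)

lemma qball_gen_eq: "qball_gen q n i = \<iota> (zp i)"
by (simp add: qball_gen_def universal_gen_def \<iota>_def)

lemma \<iota>_sum:
assumes "!!i. i : I ==> f i : polys {1..n}" "finite I"
shows "\<iota> (sum f I) = (\<Oplus>\<^bsub>ucstar\<^esub>i\<in>I. \<iota> (f i))"
using assms(2,1)
proof (induction I rule: finite_induct)
case (insert i I)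
have "(\<Oplus>\<^bsub>ucstar\<^esub>j\<in>insert i I. \<iota> (f j)) = \<iota> (f i) \<oplus>\<^sub>ucstar (\<Oplus>\<^bsub>ucstar\<^esub>j\<in>I. \<iota> (f j))"
 using insert by (intro U.finsum_insert) auto
then show ?case using insert free_star_carrier_sum[of I f] by (simp add: \<iota>_hom)
qed (simp add: \<iota>_hom)

sublocale B: ball_relations "qball q n" q n "qball_gen q n"
proof -
let ?F = "polys {1..n}"
have eq0: "x = y" if "x : cr ucstar" "y : cr ucstar" "x \<ominus>\<^sub>ucstar y = \<zero>\<^sub>ucstar" for x y
 using U.nrm_diff_eq_0D[OF that(1,2)] that(3) by simp
show "ball_relations (qball q n) q n (qball_gen q n)"
 unfolding qball_eq
proof (intro ball_relations.intro ball_relations_axioms.intro)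
 show "cstar_alg ucstar" ..
 show "qball_gen q n i : cr ucstar" if "1 <= i" "i <= n" for i
  using that zp_closed[of i] by (auto simp: qball_gen_eq)
 show "qball_gen q n i \<cdot>\<^sub>ucstar qball_gen q n j = of_real (sqrt q) \<odot>\<^sub>ucstar (qball_gen q n j \<cdot>\<^sub>ucstar qball_gen q n i)"
  if ij: "1 <= i" "i < j" "j <= n" for i j
 proof -
  have c: "zp i : ?F" "zp j : ?F" using zp_closed ij by auto
  let ?r = "zp i * zp j - poly_scale (of_real (sqrt q)) (zp j * zp i)"
  have "?r : qball_relators q n" unfolding relators_iff using ij by blast
  then have z: "\<iota> ?r = \<zero>\<^sub>ucstar" by (rule \<iota>_relator)
  have m: "zp i * zp j : ?F" "zp j * zp i : ?F" "poly_scale (of_real (sqrt q)) (zp j * zp i) : ?F"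
   by (intro polys_closed(4,5) c)+
  show ?thesis unfolding qball_gen_eq
  proof (rule eq0)
   show "\<iota> (zp i) \<cdot>\<^sub>ucstar \<iota> (zp j) \<ominus>\<^sub>ucstar of_real (sqrt q) \<odot>\<^sub>ucstar (\<iota> (zp j) \<cdot>\<^sub>ucstar \<iota> (zp i)) = \<zero>\<^sub>ucstar"
    using z by (simp only: \<iota>_hom(4)[OF m(1,3)] \<iota>_hom(5)[OF c] \<iota>_hom(5)[OF c(2,1)] \<iota>_hom(6)[OF m(2)])
  qed (intro U.smult_closed U.m_closed \<iota>_closed c)+
 qed
 show "qball_gen q n i \<cdot>\<^sub>ucstar (qball_gen q n j)\<^sup>*\<^sub>ucstar =
   of_real (1 / sqrt q) \<odot>\<^sub>ucstar ((qball_gen q n j)\<^sup>*\<^sub>ucstar \<cdot>\<^sub>ucstar qball_gen q n i)"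
  if ij: "1 <= i" "i < j" "j <= n" for i j
 proof -
  have c: "zp i : ?F" "zp j : ?F" using zp_closed ij by auto
  let ?r = "zp i * zs j - poly_scale (of_real (1 / sqrt q)) (zs j * zp i)"
  have "?r : qball_relators q n" unfolding relators_iff using ij by blast
  then have z: "\<iota> ?r = \<zero>\<^sub>ucstar" by (rule \<iota>_relator)
  have m: "zp i * zs j : ?F" "zs j * zp i : ?F" "poly_scale (of_real (1 / sqrt q)) (zs j * zp i) : ?F" "zs j : ?F"
   by (intro polys_closed(4,5,6) c)+
  show ?thesis unfolding qball_gen_eq
  proof (rule eq0)
   show "\<iota> (zp i) \<cdot>\<^sub>ucstar (\<iota> (zp j))\<^sup>*\<^sub>ucstar \<ominus>\<^sub>ucstar
     of_real (1 / sqrt q) \<odot>\<^sub>ucstar ((\<iota> (zp j))\<^sup>*\<^sub>ucstar \<cdot>\<^sub>ucstar \<iota> (zp i)) = \<zero>\<^sub>ucstar"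
    using z by (simp only: \<iota>_hom(4)[OF m(1,3)] \<iota>_hom(5)[OF c(1) m(4)] \<iota>_hom(5)[OF m(4) c(1)] \<iota>_hom(6)[OF m(2)]
     \<iota>_hom(7)[OF c(2)])
  qed (intro U.smult_closed U.m_closed U.star_closed \<iota>_closed c)+
 qed
 show "(qball_gen q n i)\<^sup>*\<^sub>ucstar \<cdot>\<^sub>ucstar qball_gen q n i =
   of_real q \<odot>\<^sub>ucstar (qball_gen q n i \<cdot>\<^sub>ucstar (qball_gen q n i)\<^sup>*\<^sub>ucstar) \<oplus>\<^sub>ucstar
   of_real (1 - q) \<odot>\<^sub>ucstar (\<one>\<^sub>ucstar \<ominus>\<^sub>ucstar
    (\<Oplus>\<^bsub>ucstar\<^esub>j\<in>{i+1..n}. qball_gen q n j \<cdot>\<^sub>ucstar (qball_gen q n j)\<^sup>*\<^sub>ucstar))"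
  if i: "1 <= i" "i <= n" for i
 proof -
  have c: "zp i : ?F" "zs i : ?F" using zp_closed i by auto
  let ?s = "\<Sum>j=i+1..n. zp j * zs j"
  have sc: "?s : ?F" by (rule sum_zz_closed[OF i(1)])
  have os: "1 - ?s : ?F" using sc by auto
  have s: "\<iota> ?s = (\<Oplus>\<^bsub>ucstar\<^esub>j\<in>{i+1..n}. qball_gen q n j \<cdot>\<^sub>ucstar (qball_gen q n j)\<^sup>*\<^sub>ucstar)"
  proof -
   have "\<iota> ?s = (\<Oplus>\<^bsub>ucstar\<^esub>j\<in>{i+1..n}. \<iota> (zp j * zs j))"
    by (rule \<iota>_sum) (use zp_closed i in \<open>auto intro!: polys_closed(4)\<close>)
   also have "... = (\<Oplus>\<^bsub>ucstar\<^esub>j\<in>{i+1..n}. qball_gen q n j \<cdot>\<^sub>ucstar (qball_gen q n j)\<^sup>*\<^sub>ucstar)"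
   proof (rule U.finsum_cong')
    have zj: "zp j : ?F" "zs j : ?F" if "j : {i+1..n}" for j using that zp_closed[of j] i by auto
    show "\<iota> (zp j * zs j) = qball_gen q n j \<cdot>\<^sub>ucstar (qball_gen q n j)\<^sup>*\<^sub>ucstar" if "j : {i+1..n}" for j
     using \<iota>_hom(5)[OF zj[OF that]] \<iota>_hom(7)[OF zj(1)[OF that]] by (simp add: qball_gen_eq)
    show "(%j. qball_gen q n j \<cdot>\<^sub>ucstar (qball_gen q n j)\<^sup>*\<^sub>ucstar) : {i+1..n} \<rightarrow> cr ucstar"
     using \<iota>_closed[OF zj(1)] by (auto simp: qball_gen_eq)
   qed simp
   finally show ?thesis .
  qed
  have "rel3 i : qball_relators q n" unfolding relators_iff using i by blast
  then have z: "\<iota> (rel3 i) = \<zero>\<^sub>ucstar" by (rule \<iota>_relator)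
  let ?p = "poly_scale (of_real q) (zp i * zs i)" and ?r = "poly_scale (of_real (1 - q)) (1 - ?s)"
  have pr: "?p : ?F" "?r : ?F" using c os by auto
  have "zs i * zp i = rel3 i + (?p + ?r)" by (simp add: rel3_def)
  then have "\<iota> (zs i * zp i) = \<iota> (rel3 i) \<oplus>\<^sub>ucstar (\<iota> ?p \<oplus>\<^sub>ucstar \<iota> ?r)"
   using \<iota>_hom(3)[OF rel3_closed[OF i] polys_closed(3)[OF pr]] \<iota>_hom(3)[OF pr] by simp
  then have "\<iota> (zs i * zp i) = \<iota> ?p \<oplus>\<^sub>ucstar \<iota> ?r" using z \<iota>_closed[OF pr(1)] \<iota>_closed[OF pr(2)] by simp
  moreover have "zp i * zs i : ?F" using c by (intro polys_closed(4))
  ultimately show ?thesis unfolding s[symmetric] qball_gen_eq[of i]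
   by (simp only: \<iota>_hom(5)[OF c(2,1)] \<iota>_hom(5)[OF c] \<iota>_hom(7)[OF c(1)] \<iota>_hom(6) os
    \<iota>_hom(4)[OF polys_closed(2) sc] \<iota>_hom(1))
 qed
 show "EX s. (ALL k. s k : E) & norm_lim ucstar s x"
  if E: "\<one>\<^sub>ucstar : E" "!!i. 1 <= i ==> i <= n ==> qball_gen q n i : E"
   "!!i. 1 <= i ==> i <= n ==> (qball_gen q n i)\<^sup>*\<^sub>ucstar : E"
   "!!x y. x : E ==> y : E ==> x \<oplus>\<^sub>ucstar y : E" "!!c x. x : E ==> c \<odot>\<^sub>ucstar x : E"
   "!!x y. x : E ==> y : E ==> x \<cdot>\<^sub>ucstar y : E" and x: "x : cr ucstar" for E x
 proof -
  have "\<iota> p : E" if "p : ?F" for p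
   using that
  proof (induction p rule: free_star_induct)
   case one show ?case using E(1) by (simp add: \<iota>_hom)
  next
   case (gen g) then show ?case using E(2)[of g] by (simp add: qball_gen_eq)
  next
   case (gen_star g) then show ?case using E(3)[of g] zp_closed[of g] by (simp add: qball_gen_eq \<iota>_hom)
  qed (auto simp: \<iota>_hom intro: E)
  moreover obtain s where "!!k. s k : ?F" "norm_lim ucstar (%k. \<iota> (s k)) x" using \<iota>_dense[OF x] by metis
  ultimately show ?thesis by (intro exI[of _ "%k. \<iota> (s k)"]) auto
 qed
qed (use q in auto)
qed

end

section \<open>The quantum sphere as a glued algebra\<close>

locale quantum_sphere = quantum_ball +
fixes \<beta> :: "qball_elem set => qball_elem set"
assumes n: "1 <= n"
 and aut: "star_automorphism (qboundary q n) \<beta>"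
 and \<beta>_1: "\<beta> (qboundary_gen q n 1) = (qboundary_gen q n 1)\<^sup>*\<^bsub>qboundary q n\<^esub>"
 and \<beta>_i: "ALL j:{2..n}. \<beta> (qboundary_gen q n j) = qboundary_gen q n j"
begin

abbreviation (input) \<B> where "\<B> \<equiv> qball q n"
abbreviation (input) \<Q> where "\<Q> \<equiv> qboundary q n"
abbreviation (input) pr where "pr \<equiv> qboundary_proj q n"

lemma boundary_ideal_eq: "qboundary_ideal q n = B.J"
by (simp add: qboundary_ideal_def B.J_def B.D_def Let_def)

lemma pr_eq: "pr x = B.J +>\<^sub>\<B> x"
by (simp add: qboundary_proj_def boundary_ideal_eq)

lemma pr_eq_iff: "x : cr \<B> ==> y : cr \<B> ==> pr x = pr y \<longleftrightarrow> x \<ominus>\<^sub>\<B> y : B.J"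
unfolding pr_eq using B.quotient_eq_iff_same_a_r_cos[OF B.J_props(1)] by blast

lemma carrier_boundary: "cr \<Q> = pr ` cr \<B>"
unfolding qboundary_def quotient_cstar_def boundary_ideal_eq
by (auto simp: FactRing_simps pr_eq image_def)

lemma pr_coset: "x : cr \<B> ==> x' : pr x ==> x' : cr \<B> & x' \<ominus>\<^sub>\<B> x : B.J"
proof -
assume x: "x : cr \<B>" "x' : pr x"
then obtain j where j: "j : B.J" "x' = j \<oplus>\<^sub>\<B> x" by (auto simp: pr_eq a_r_coset_def' )
have jc: "j : cr \<B>" using B.J_closed j by blast
have "(j \<oplus>\<^sub>\<B> x) \<ominus>\<^sub>\<B> x = j" using jc x(1) by (simp add: B.minus_eq B.a_assoc B.r_neg)
then show ?thesis using j jc x by auto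
qed

lemma pr_self: "x : cr \<B> ==> x : pr x"
unfolding pr_eq using B.J_ideal(5) by (auto simp: a_r_coset_def' intro!: bexI[of _ "\<zero>\<^sub>\<B>"])

lemma pr_UN:
assumes x: "x : cr \<B>" and F: "!!x'. x' : cr \<B> ==> x' \<ominus>\<^sub>\<B> x : B.J ==> F x' = F x"
shows "(\<Union>x'\<in>pr x. F x') = F x"
using pr_self[OF x] pr_coset[OF x] F by blast

lemma pr_hom:
assumes x: "x : cr \<B>" and y: "y : cr \<B>"
shows "pr (x \<oplus>\<^sub>\<B> y) = pr x \<oplus>\<^sub>\<Q> pr y" "pr (x \<cdot>\<^sub>\<B> y) = pr x \<cdot>\<^sub>\<Q> pr y"
 "pr (c \<odot>\<^sub>\<B> x) = c \<odot>\<^sub>\<Q> pr x" "pr (x\<^sup>*\<^sub>\<B>) = (pr x)\<^sup>*\<^sub>\<Q>" "\<one>\<^sub>\<Q> = pr \<one>\<^sub>\<B>"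
proof -
show "pr (x \<oplus>\<^sub>\<B> y) = pr x \<oplus>\<^sub>\<Q> pr y"
 unfolding qboundary_def quotient_cstar_def boundary_ideal_eq
 using ideal.a_rcos_sum[OF B.J_props(1) x y] by (simp add: FactRing_def pr_eq)
show "pr (x \<cdot>\<^sub>\<B> y) = pr x \<cdot>\<^sub>\<Q> pr y"
 unfolding qboundary_def quotient_cstar_def boundary_ideal_eq
 using ideal.rcoset_mult_add[OF B.J_props(1) x y] by (simp add: FactRing_def pr_eq)
show "\<one>\<^sub>\<Q> = pr \<one>\<^sub>\<B>"
 unfolding qboundary_def quotient_cstar_def boundary_ideal_eq by (simp add: FactRing_def pr_eq)
have "(\<Union>x'\<in>pr x. pr (c \<odot>\<^sub>\<B> x')) = pr (c \<odot>\<^sub>\<B> x)"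
proof (rule pr_UN[OF x])
 fix x' assume x': "x' : cr \<B>" "x' \<ominus>\<^sub>\<B> x : B.J"
 then show "pr (c \<odot>\<^sub>\<B> x') = pr (c \<odot>\<^sub>\<B> x)"
  using x B.J_ideal(3)[OF x'(2), of c] by (simp add: pr_eq_iff B.smult_diff)
qed
then show "pr (c \<odot>\<^sub>\<B> x) = c \<odot>\<^sub>\<Q> pr x"
 unfolding qboundary_def quotient_cstar_def boundary_ideal_eq by (simp add: pr_eq)
have "(\<Union>x'\<in>pr x. pr (x'\<^sup>*\<^sub>\<B>)) = pr (x\<^sup>*\<^sub>\<B>)"
proof (rule pr_UN[OF x])
 fix x' assume x': "x' : cr \<B>" "x' \<ominus>\<^sub>\<B> x : B.J"
 then show "pr (x'\<^sup>*\<^sub>\<B>) = pr (x\<^sup>*\<^sub>\<B>)"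
  using x B.J_star[OF x'(2)] by (simp add: pr_eq_iff B.star_diff)
qed
then show "pr (x\<^sup>*\<^sub>\<B>) = (pr x)\<^sup>*\<^sub>\<Q>"
 unfolding qboundary_def quotient_cstar_def boundary_ideal_eq by (simp add: pr_eq)
qed

definition \<S> :: "(qball_elem \<times> qball_elem) set" where
"\<S> = {(x, y). x : cr \<B> & y : cr \<B> & pr x = \<beta> (pr y)}"

lemma qsphere_eq: "qsphere q n \<beta> = pair_alg \<B> \<S>"
by (simp add: qsphere_def pair_alg_def \<S>_def Let_def)

lemma pr_closed: "x : cr \<B> ==> pr x : cr \<Q>"
by (simp add: carrier_boundary)

lemma \<beta>_hom:
"X : cr \<Q> ==> Y : cr \<Q> ==> \<beta> (X \<oplus>\<^sub>\<Q> Y) = \<beta> X \<oplus>\<^sub>\<Q> \<beta> Y"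
"X : cr \<Q> ==> Y : cr \<Q> ==> \<beta> (X \<cdot>\<^sub>\<Q> Y) = \<beta> X \<cdot>\<^sub>\<Q> \<beta> Y"
"X : cr \<Q> ==> \<beta> (c \<odot>\<^sub>\<Q> X) = c \<odot>\<^sub>\<Q> \<beta> X"
"X : cr \<Q> ==> \<beta> (X\<^sup>*\<^sub>\<Q>) = (\<beta> X)\<^sup>*\<^sub>\<Q>"
"\<beta> \<one>\<^sub>\<Q> = \<one>\<^sub>\<Q>" "bij_betw \<beta> (cr \<Q>) (cr \<Q>)"
using aut by (auto simp: star_automorphism_def ring_iso_def ring_hom_def)

lemma \<beta>_closed: "X : cr \<Q> ==> \<beta> X : cr \<Q>"
using \<beta>_hom(6) bij_betwE by blast

lemma \<S>_D: "(x, y) : \<S> \<longleftrightarrow> x : cr \<B> & y : cr \<B> & pr x = \<beta> (pr y)"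
by (simp add: \<S>_def)

lemma \<beta>_zero: "\<beta> (pr \<zero>\<^sub>\<B>) = pr \<zero>\<^sub>\<B>"
proof -
have z: "pr \<zero>\<^sub>\<B> : cr \<Q>" by (simp add: pr_closed)
have "0 \<odot>\<^sub>\<Q> pr x = pr \<zero>\<^sub>\<B>" if "x : cr \<B>" for x
 using pr_hom(3)[OF that that, of 0] that by simp
then have s: "0 \<odot>\<^sub>\<Q> X = pr \<zero>\<^sub>\<B>" if "X : cr \<Q>" for X using that by (auto simp: carrier_boundary)
show ?thesis using \<beta>_hom(3)[OF z, of 0] s[OF z] s[OF \<beta>_closed[OF z]] by simp
qed

lemma pr_zero_iff: "x : cr \<B> ==> pr x = pr \<zero>\<^sub>\<B> \<longleftrightarrow> x : B.J"
using pr_eq_iff[of x "\<zero>\<^sub>\<B>"] by (simp add: B.minus_eq)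

sublocale S: sphere_rel "qball q n" q n "qball_gen q n" \<S>
proof
show "x : cr \<B> & y : cr \<B>" if "(x, y) : \<S>" for x y using that by (simp add: \<S>_D)
show "(\<one>\<^sub>\<B>, \<one>\<^sub>\<B>) : \<S>" using \<beta>_hom(5) pr_hom(5)[of "\<one>\<^sub>\<B>" "\<one>\<^sub>\<B>"] by (simp add: \<S>_D)
show "(x \<oplus>\<^sub>\<B> x', y \<oplus>\<^sub>\<B> y') : \<S>" "(x \<cdot>\<^sub>\<B> x', y \<cdot>\<^sub>\<B> y') : \<S>"
 if "(x, y) : \<S>" "(x', y') : \<S>" for x y x' y'
 using that by (auto simp: \<S>_D pr_hom \<beta>_hom pr_closed)
show "(c \<odot>\<^sub>\<B> x, c \<odot>\<^sub>\<B> y) : \<S>" "(x\<^sup>*\<^sub>\<B>, y\<^sup>*\<^sub>\<B>) : \<S>" if "(x, y) : \<S>" for x y c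
 using that pr_hom(3,4)[of x x] pr_hom(3,4)[of y y] by (auto simp: \<S>_D \<beta>_hom pr_closed)
show "EX y. (x, y) : \<S>" if x: "x : cr \<B>" for x
proof -
 have "pr x : \<beta> ` cr \<Q>" using pr_closed[OF x] bij_betw_imp_surj_on[OF \<beta>_hom(6)] by simp
 then obtain y where "y : cr \<B>" "pr x = \<beta> (pr y)" unfolding carrier_boundary by blast
 then show ?thesis using x by (auto simp: \<S>_D)
qed
show "EX x. (x, y) : \<S>" if y: "y : cr \<B>" for y
 using \<beta>_closed[OF pr_closed[OF y]] y by (auto simp: \<S>_D carrier_boundary)
show "x : B.J \<longleftrightarrow> y : B.J" if s: "(x, y) : \<S>" for x y
proof -
 have c: "x : cr \<B>" "y : cr \<B>" "pr x = \<beta> (pr y)" using s by (auto simp: \<S>_D)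
 have "pr x = pr \<zero>\<^sub>\<B> \<longleftrightarrow> pr y = pr \<zero>\<^sub>\<B>"
  using c \<beta>_zero \<beta>_hom(6) pr_closed[of y] pr_closed[of "\<zero>\<^sub>\<B>"] by (metis B.zero_closed bij_betw_def inj_onD)
 then show ?thesis using pr_zero_iff c by blast
qed
show "(x, y) : \<S>" if "x : B.J" "y : B.J" for x y
 using that pr_zero_iff[of x] pr_zero_iff[of y] B.J_closed \<beta>_zero by (auto simp: \<S>_D)
show "1 <= n" by (rule n)
have zc: "qball_gen q n i : cr \<B>" if "1 <= i" "i <= n" for i using B.z_closed that .
show "((qball_gen q n 1)\<^sup>*\<^sub>\<B>, qball_gen q n 1) : \<S>"
 using \<beta>_1 zc[of 1] n pr_hom(4)[of "qball_gen q n 1" "qball_gen q n 1"] by (simp add: \<S>_D qboundary_gen_def)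
show "(qball_gen q n i, qball_gen q n i) : \<S>" if "2 <= i" "i <= n" for i
 using \<beta>_i zc[of i] that by (simp add: \<S>_D qboundary_gen_def)
qed

lemma qsphere_gen_eq: "i <= n ==> qsphere_gen q n i = S.e_gen i"
proof -
have z1: "qball_gen q n 1 : cr \<B>" using B.z_closed n by simp
have "sqrt_elem \<B> (\<one>\<^sub>\<B> \<ominus>\<^sub>\<B> (\<Oplus>\<^bsub>\<B>\<^esub>j\<in>{1..n}. qball_gen q n j \<cdot>\<^sub>\<B> (qball_gen q n j)\<^sup>*\<^sub>\<B>)) = B.T"
 using B.sqrt_elem_eq_csqrt[OF B.pos_D[of 0]] by (simp add: B.T_def B.D_def)
moreover have "sqrt_elem \<B> (\<one>\<^sub>\<B> \<ominus>\<^sub>\<B> (qball_gen q n 1)\<^sup>*\<^sub>\<B> \<cdot>\<^sub>\<B> qball_gen q n 1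
  \<ominus>\<^sub>\<B> (\<Oplus>\<^bsub>\<B>\<^esub>j\<in>{2..n}. qball_gen q n j \<cdot>\<^sub>\<B> (qball_gen q n j)\<^sup>*\<^sub>\<B>)) = B.rq \<odot>\<^sub>\<B> B.T"
proof -
 define p where "p = (qball_gen q n 1)\<^sup>*\<^sub>\<B> \<cdot>\<^sub>\<B> qball_gen q n 1"
 define s where "s = (\<Oplus>\<^bsub>\<B>\<^esub>j\<in>{2..n}. qball_gen q n j \<cdot>\<^sub>\<B> (qball_gen q n j)\<^sup>*\<^sub>\<B>)"
 have c: "p : cr \<B>" "s : cr \<B>"
  using z1 B.zz_sum_closed[of 1] by (auto simp: p_def s_def numeral_2_eq_2)
 have "\<one>\<^sub>\<B> \<ominus>\<^sub>\<B> p \<ominus>\<^sub>\<B> s = B.D 1 \<ominus>\<^sub>\<B> p"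
  using c by (simp add: B.D_def s_def[symmetric] numeral_2_eq_2[symmetric] B.minus_eq B.a_ac)
 also have "... = of_real q \<odot>\<^sub>\<B> B.D 0" using B.D_minus_z_star_z[of 1] n by (simp add: p_def)
 finally show ?thesis using B.sqrt_elem_eq_csqrt[OF B.csqrt_q_D(1)] B.csqrt_q_D(2) by (simp add: p_def s_def)
qed
ultimately show "i <= n ==> qsphere_gen q n i = S.e_gen i"
 by (auto simp: qsphere_gen_def S.e_gen_def Let_def)
qed

lemma sphere_generated: "cr (qsphere q n \<beta>) = generated_cstar (qsphere q n \<beta>) (qsphere_gen q n ` {0..n})"
proof -
have "qsphere_gen q n ` {0..n} = S.e_gen ` {0..n}" by (rule image_cong) (auto simp: qsphere_gen_eq)
then show ?thesis using S.generated by (simp add: qsphere_eq)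
qed

end

section \<open>The Hilbert space of the weighted shifts\<close>

definition ell2 :: "(nat list => complex) => bool" where
"ell2 f \<longleftrightarrow> (%k. (cmod (f k))\<^sup>2) summable_on UNIV"

lemma shift_space_simps [simp]:
"cr (shift_space r) = {f. (ALL k. length k ~= r --> f k = 0) & ell2 f}"
"f \<oplus>\<^bsub>shift_space r\<^esub> g = (%k. f k + g k)" "\<zero>\<^bsub>shift_space r\<^esub> = (%_. 0)"
"c \<odot>\<^bsub>shift_space r\<^esub> f = (%k. c * f k)"
"ip (shift_space r) f g = (\<Sum>\<^sub>\<infinity>k. f k * cnj (g k))"
by (simp_all add: shift_space_def ell2_def)

lemma ell2_bound:
assumes "ell2 f" "!!k. cmod (g k) <= C * cmod (f k)"
shows "ell2 g" "(\<Sum>\<^sub>\<infinity>k. (cmod (g k))\<^sup>2) <= C\<^sup>2 * (\<Sum>\<^sub>\<infinity>k. (cmod (f k))\<^sup>2)"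
proof -
have s: "(%k. C\<^sup>2 * (cmod (f k))\<^sup>2) summable_on UNIV"
 using assms(1) unfolding ell2_def by (rule summable_on_cmult_right)
have le: "(cmod (g k))\<^sup>2 <= C\<^sup>2 * (cmod (f k))\<^sup>2" for k
 using power_mono[OF assms(2)[of k] norm_ge_zero, of 2] by (simp add: power_mult_distrib)
show g: "ell2 g" unfolding ell2_def by (rule summable_on_comparison_test[OF s le]) auto
have "(\<Sum>\<^sub>\<infinity>k. (cmod (g k))\<^sup>2) <= (\<Sum>\<^sub>\<infinity>k. C\<^sup>2 * (cmod (f k))\<^sup>2)"
 using g s le unfolding ell2_def by (intro infsum_mono) auto
then show "(\<Sum>\<^sub>\<infinity>k. (cmod (g k))\<^sup>2) <= C\<^sup>2 * (\<Sum>\<^sub>\<infinity>k. (cmod (f k))\<^sup>2)"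
 by (simp add: infsum_cmult_right')
qed

lemma ell2_add: assumes "ell2 f" "ell2 g" shows "ell2 (%k. f k + g k)"
proof -
have s: "(%k. 2 * ((cmod (f k))\<^sup>2 + (cmod (g k))\<^sup>2)) summable_on UNIV"
 using assms unfolding ell2_def by (intro summable_on_cmult_right summable_on_add)
have le: "(cmod (f k + g k))\<^sup>2 <= 2 * ((cmod (f k))\<^sup>2 + (cmod (g k))\<^sup>2)" for k
proof -
 have "(cmod (f k + g k))\<^sup>2 <= (cmod (f k) + cmod (g k))\<^sup>2" by (intro power_mono norm_triangle_ineq) auto
 also have "... <= 2 * ((cmod (f k))\<^sup>2 + (cmod (g k))\<^sup>2)"
  using zero_le_power2[of "cmod (f k) - cmod (g k)"] by (simp add: power2_sum power2_diff)
 finally show ?thesis .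
qed
show ?thesis unfolding ell2_def by (rule summable_on_comparison_test[OF s le]) auto
qed

lemma ell2_smult: "ell2 f ==> ell2 (%k. c * f k)"
by (rule ell2_bound(1)[of f _ "cmod c"]) (auto simp: norm_mult)

lemma ell2_zero [simp]: "ell2 (%_. 0)"
by (simp add: ell2_def)

lemma ell2_mult_summable:
assumes "ell2 f" "ell2 g" shows "(%k. f k * cnj (g k)) summable_on UNIV"
proof (rule abs_summable_summable)
have s: "(%k. (cmod (f k))\<^sup>2 + (cmod (g k))\<^sup>2) summable_on UNIV"
 using assms unfolding ell2_def by (rule summable_on_add)
have le: "norm (f k * cnj (g k)) <= (cmod (f k))\<^sup>2 + (cmod (g k))\<^sup>2" for k
proof -
 have "2 * (cmod (f k) * cmod (g k)) <= (cmod (f k))\<^sup>2 + (cmod (g k))\<^sup>2"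
  using zero_le_power2[of "cmod (f k) - cmod (g k)"] by (simp add: power2_diff)
 moreover have "0 <= cmod (f k) * cmod (g k)" by simp
 ultimately have "cmod (f k) * cmod (g k) <= (cmod (f k))\<^sup>2 + (cmod (g k))\<^sup>2" by linarith
 then show ?thesis by (simp add: norm_mult)
qed
show "(%k. f k * cnj (g k)) abs_summable_on UNIV"
 by (rule summable_on_comparison_test[OF s le]) auto
qed

lemma shift_space_module: "module complex_ring (shift_space r)"
proof (rule moduleI)
show "cring complex_ring"
 by (rule cringI, rule abelian_groupI, auto simp: complex_ring_def algebra_simps intro!: comm_monoidI exI[of _ "- _"])
show "abelian_group (shift_space r)"
proof (rule abelian_groupI)
 fix f assume "f : cr (shift_space r)"
 then show "EX g:cr (shift_space r). g \<oplus>\<^bsub>shift_space r\<^esub> f = \<zero>\<^bsub>shift_space r\<^esub>"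
  using ell2_smult[of f "-1"] by (intro bexI[of _ "%k. (-1) * f k"]) auto
qed (auto simp: ell2_add algebra_simps)
qed (auto simp: complex_ring_def ell2_add ell2_smult algebra_simps)

lemma shift_space_diff:
assumes "f : cr (shift_space r)" "g : cr (shift_space r)"
shows "f \<ominus>\<^bsub>shift_space r\<^esub> g = (%k. f k - g k)"
proof -
interpret module complex_ring "shift_space r" by (rule shift_space_module)
have "(%k. - g k) : cr (shift_space r)" using ell2_smult[of g "-1"] assms by simp
then have "\<ominus>\<^bsub>shift_space r\<^esub> g = (%k. - g k)"
 by (intro M.minus_equality) (use assms in auto)
then show ?thesis by (simp add: M.minus_eq)
qed

lemma ip_self_shift: assumes "ell2 f" shows "(\<Sum>\<^sub>\<infinity>k. f k * cnj (f k)) = of_real (\<Sum>\<^sub>\<infinity>k. (cmod (f k))\<^sup>2)"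
proof -
have "((%k. of_real ((cmod (f k))\<^sup>2)) has_sum (of_real (\<Sum>\<^sub>\<infinity>k. (cmod (f k))\<^sup>2) :: complex)) UNIV"
 using assms unfolding ell2_def by (intro has_sum_of_real has_sum_infsum)
moreover have "f k * cnj (f k) = of_real ((cmod (f k))\<^sup>2)" for k by (rule complex_norm_square[symmetric])
ultimately show ?thesis by (simp add: infsumI)
qed

lemma hnorm_shift:
"ell2 f ==> hnorm (shift_space r) f = sqrt (\<Sum>\<^sub>\<infinity>k. (cmod (f k))\<^sup>2)"
by (simp add: hnorm_def ip_self_shift)

lemma hnorm_shift_bound:
assumes "f : cr (shift_space r)" "!!k. cmod (g k) <= C * cmod (f k)" "C >= 0"
shows "g : cr (shift_space r)" "hnorm (shift_space r) g <= C * hnorm (shift_space r) f"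
proof -
have f: "ell2 f" and g: "ell2 g" using assms(1) ell2_bound(1)[OF _ assms(2)] by auto
have "g k = 0" if "length k ~= r" for k using assms(1) assms(2)[of k] that by simp
then show "g : cr (shift_space r)" using g by simp
have "sqrt (\<Sum>\<^sub>\<infinity>k. (cmod (g k))\<^sup>2) <= sqrt (C\<^sup>2 * (\<Sum>\<^sub>\<infinity>k. (cmod (f k))\<^sup>2))"
 using ell2_bound(2)[OF f assms(2)] by simp
then show "hnorm (shift_space r) g <= C * hnorm (shift_space r) f"
 using f g assms(3) by (simp add: hnorm_shift real_sqrt_mult)
qed

lemma cmod_le_hnorm: assumes "ell2 f" shows "cmod (f k) <= hnorm (shift_space r) f"
proof -
have "(\<Sum>\<^sub>\<infinity>l\<in>{k}. (cmod (f l))\<^sup>2) <= (\<Sum>\<^sub>\<infinity>l. (cmod (f l))\<^sup>2)"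
 using assms unfolding ell2_def by (intro infsum_mono2) auto
then have "(cmod (f k))\<^sup>2 <= (\<Sum>\<^sub>\<infinity>l. (cmod (f l))\<^sup>2)" by simp
then show ?thesis using assms by (simp add: hnorm_shift real_le_rsqrt)
qed

lemma finite_sum_le_hnorm:
assumes "ell2 f" "finite F" shows "(\<Sum>k\<in>F. (cmod (f k))\<^sup>2) <= (hnorm (shift_space r) f)\<^sup>2"
proof -
have "(\<Sum>\<^sub>\<infinity>l\<in>F. (cmod (f l))\<^sup>2) <= (\<Sum>\<^sub>\<infinity>l. (cmod (f l))\<^sup>2)"
 using assms unfolding ell2_def by (intro infsum_mono2) auto
then show ?thesis using assms by (simp add: hnorm_shift infsum_nonneg)
qed

theorem shift_space_hilbert: "hilbert_space (shift_space r)"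
proof -
interpret module complex_ring "shift_space r" by (rule shift_space_module)
show ?thesis
proof
 fix f g h c assume f: "f : cr (shift_space r)" and g: "g : cr (shift_space r)"
 then have fg: "ell2 f" "ell2 g" by auto
 show "ip (shift_space r) g f = cnj (ip (shift_space r) f g)"
  by (simp add: infsum_cnj[symmetric] mult.commute)
 show "ip (shift_space r) (c \<odot>\<^bsub>shift_space r\<^esub> f) g = c * ip (shift_space r) f g"
  using ell2_mult_summable[OF fg] by (simp add: mult.assoc infsum_cmult_right)
 assume h: "h : cr (shift_space r)"
 then have "ell2 h" by auto
 then show "ip (shift_space r) (f \<oplus>\<^bsub>shift_space r\<^esub> g) h = ip (shift_space r) f h + ip (shift_space r) g h"
  using ell2_mult_summable fg by (simp add: distrib_right infsum_add)
next
 fix f assume f: "f : cr (shift_space r)" and nz: "f ~= \<zero>\<^bsub>shift_space r\<^esub>"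
 then obtain k where k: "f k ~= 0" by auto
 have e: "ell2 f" using f by simp
 have "0 < (cmod (f k))\<^sup>2" using k by simp
 also have "... <= (hnorm (shift_space r) f)\<^sup>2" using finite_sum_le_hnorm[OF e, of "{k}"] by simp
 also have "... = Re (ip (shift_space r) f f)" using e by (simp add: hnorm_shift ip_self_shift infsum_nonneg)
 finally show "0 < Re (ip (shift_space r) f f)" .
next
 fix s :: "nat => nat list => complex" assume s: "!!k. s k : cr (shift_space r)"
  and cau: "!!e. e > 0 ==> EX N. ALL k>=N. ALL l>=N. hnorm (shift_space r) (s k \<ominus>\<^bsub>shift_space r\<^esub> s l) < e"
 have dc: "(%x. s k x - s l x) : cr (shift_space r)" for k l
  using s[of k] s[of l] ell2_add[of "s k" "%x. (-1) * s l x"] ell2_smult[of "s l" "-1"] by simp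
 have d: "s k \<ominus>\<^bsub>shift_space r\<^esub> s l = (%x. s k x - s l x)" for k l using shift_space_diff s by blast
 have "Cauchy (%k. s k x)" for x
 proof (rule CauchyI)
  fix e :: real assume "0 < e"
  then obtain N where N: "!!k l. k >= N ==> l >= N ==> hnorm (shift_space r) (%x. s k x - s l x) < e"
   using cau[of e] unfolding d by blast
  have "norm (s k x - s l x) < e" if "k >= N" "l >= N" for k l
   using cmod_le_hnorm[of "%x. s k x - s l x" x r] N[OF that] dc[of k l] by simp
  then show "EX M. ALL m>=M. ALL n>=M. norm (s m x - s n x) < e" by blast
 qed
 then have "EX y. (%k. s k x) ----> y" for x by (simp add: Cauchy_convergent_iff convergent_def)
 then obtain f where f: "!!x. (%k. s k x) ----> f x" by metis
 have part: "(\<Sum>x\<in>F. (cmod (s k x - f x))\<^sup>2) <= e\<^sup>2"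
  if N: "!!k l. k >= N ==> l >= N ==> hnorm (shift_space r) (%x. s k x - s l x) < e" and k: "k >= N" and F: "finite F" for N e k F
 proof (rule LIMSEQ_le_const2)
  show "(%l. \<Sum>x\<in>F. (cmod (s k x - s l x))\<^sup>2) ----> (\<Sum>x\<in>F. (cmod (s k x - f x))\<^sup>2)"
   by (intro tendsto_intros f)
  have "(\<Sum>x\<in>F. (cmod (s k x - s l x))\<^sup>2) <= e\<^sup>2" if l: "l >= N" for l
  proof -
   have e2: "ell2 (%x. s k x - s l x)" using dc[of k l] by simp
   have "0 <= hnorm (shift_space r) (%x. s k x - s l x)"
    using e2 by (simp add: hnorm_shift infsum_nonneg)
   then have "(hnorm (shift_space r) (%x. s k x - s l x))\<^sup>2 <= e\<^sup>2" using N[OF k l] by (intro power_mono) auto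
   then show ?thesis using finite_sum_le_hnorm[OF e2 F, of r] by linarith
  qed
  then show "EX M. ALL l>=M. (\<Sum>x\<in>F. (cmod (s k x - s l x))\<^sup>2) <= e\<^sup>2" by blast
 qed
 have diff_ell2: "ell2 (%x. s k x - f x)" and diff_norm: "e >= 0 ==> hnorm (shift_space r) (%x. s k x - f x) <= e"
  if N: "!!k l. k >= N ==> l >= N ==> hnorm (shift_space r) (%x. s k x - s l x) < e" and k: "k >= N" for N e k
 proof -
  show l2: "ell2 (%x. s k x - f x)" unfolding ell2_def
   by (rule nonneg_bdd_above_summable_on) (use part[OF N k] in \<open>auto intro!: bdd_aboveI[of _ "e\<^sup>2"]\<close>)
  have "(\<Sum>\<^sub>\<infinity>x. (cmod (s k x - f x))\<^sup>2) <= e\<^sup>2"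
   using l2 part[OF N k] unfolding ell2_def by (intro infsum_le_finite_sums) auto
  then show "hnorm (shift_space r) (%x. s k x - f x) <= e" if "e >= 0"
   using l2 that by (simp add: hnorm_shift real_le_lsqrt infsum_nonneg)
 qed
 obtain N where N: "!!k l. k >= N ==> l >= N ==> hnorm (shift_space r) (%x. s k x - s l x) < 1"
  using cau[of 1] unfolding d by auto
 have "ell2 (%x. s N x + (-1) * (s N x - f x))"
  using diff_ell2[OF N, of N] s[of N] by (intro ell2_add ell2_smult) auto
 then have "ell2 f" by simp
 moreover have "f x = 0" if "length x ~= r" for x
  using f[of x] s that LIMSEQ_unique[OF f[of x], of 0] by simp
 ultimately have fc: "f : cr (shift_space r)" by simp
 have "hlim (shift_space r) s f" unfolding hlim_def
 proof (rule LIMSEQ_I)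
  fix e :: real assume e: "0 < e"
  obtain N where N: "!!k l. k >= N ==> l >= N ==> hnorm (shift_space r) (%x. s k x - s l x) < e/2"
   using cau[of "e/2"] e unfolding d by auto
  have "norm (hnorm (shift_space r) (s k \<ominus>\<^bsub>shift_space r\<^esub> f) - 0) < e" if k: "k >= N" for k
  proof -
   have "s k \<ominus>\<^bsub>shift_space r\<^esub> f = (%x. s k x - f x)" by (rule shift_space_diff[OF s fc])
   moreover have "0 <= hnorm (shift_space r) (%x. s k x - f x)"
    using diff_ell2[OF N k] by (simp add: hnorm_shift infsum_nonneg)
   ultimately show ?thesis using diff_norm[OF N k] e by simp
  qed
  then show "EX no. ALL k>=no. norm (hnorm (shift_space r) (s k \<ominus>\<^bsub>shift_space r\<^esub> f) - 0) < e" by blast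
 qed
 then show "EX v:cr (shift_space r). hlim (shift_space r) s v" using fc by blast
qed
qed

lemma xi_carrier: "length k = r ==> \<xi> k : cr (shift_space r)"
proof -
assume k: "length k = r"
have "(%l. (cmod (\<xi> k l))\<^sup>2) summable_on UNIV \<longleftrightarrow> (%l. (cmod (\<xi> k l))\<^sup>2) summable_on {k}"
 by (rule summable_on_cong_neutral) (auto simp: xi_def)
then show ?thesis using k by (auto simp: ell2_def xi_def)
qed

lemma ip_xi: "ip (shift_space r) f (\<xi> k) = f k" "ip (shift_space r) (\<xi> k) f = cnj (f k)"
proof -
have "(\<Sum>\<^sub>\<infinity>l. f l * cnj (\<xi> k l)) = (\<Sum>\<^sub>\<infinity>l\<in>{k}. f l * cnj (\<xi> k l))"
 by (rule infsum_cong_neutral) (auto simp: xi_def)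
then show "ip (shift_space r) f (\<xi> k) = f k" by (simp add: xi_def)
have "(\<Sum>\<^sub>\<infinity>l. \<xi> k l * cnj (f l)) = (\<Sum>\<^sub>\<infinity>l\<in>{k}. \<xi> k l * cnj (f l))"
 by (rule infsum_cong_neutral) (auto simp: xi_def)
then show "ip (shift_space r) (\<xi> k) f = cnj (f k)" by (simp add: xi_def)
qed

lemma hnorm_xi: "hnorm (shift_space r) (\<xi> k) = 1"
by (simp add: hnorm_def ip_xi del: shift_space_simps) (simp add: xi_def)

text \<open>The finite truncations of a square-summable function converge to it.\<close>

lemma shift_space_span:
assumes K: "closed_subspace (shift_space r) K" and xi: "!!k. length k = r ==> \<xi> k : K"
shows "K = cr (shift_space r)"
proof
interpret H: hilbert_space "shift_space r" by (rule shift_space_hilbert)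
note Kp = H.closed_subspaceD[OF K]
show "K <= cr (shift_space r)" by (rule Kp(1))
show "cr (shift_space r) <= K"
proof
 fix f assume f: "f : cr (shift_space r)"
 then have e2: "ell2 f" by simp
 have fin: "(%l. if l : F then f l else 0) : K" if "finite F" for F
  using that
 proof (induction F rule: finite_induct)
  case empty then show ?case using Kp(2) by simp
 next
  case (insert k F)
  have eq: "(%l. if l : insert k F then f l else 0) = (%l. (if l : F then f l else 0) + f k * \<xi> k l)"
   using insert(2) by (auto simp: xi_def fun_eq_iff)
  show ?case
  proof (cases "length k = r")
   case True
   have "(%l. f k * \<xi> k l) : K" using Kp(4)[OF xi[OF True], of "f k"] by simp
   from Kp(3)[OF insert(3) this] show ?thesis unfolding eq by simp
  next
   case False
   then show ?thesis using insert(3) f unfolding eq by simp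
  qed
 qed
 have "EX u:K. hnorm (shift_space r) (u \<ominus>\<^bsub>shift_space r\<^esub> f) < e" if e: "e > 0" for e
 proof -
  let ?g = "%l. (cmod (f l))\<^sup>2"
  have "(?g has_sum infsum ?g UNIV) UNIV" using e2 unfolding ell2_def by (rule has_sum_infsum)
  then have "(sum ?g \<longlongrightarrow> infsum ?g UNIV) (finite_subsets_at_top UNIV)" by (simp add: has_sum_def)
  then have "\<forall>\<^sub>F F in finite_subsets_at_top UNIV. infsum ?g UNIV - e\<^sup>2 < sum ?g F"
   using e by (intro order_tendstoD) auto
  then obtain F where F: "finite F" "infsum ?g UNIV - e\<^sup>2 < sum ?g F"
   unfolding eventually_finite_subsets_at_top by blast
  define u where "u = (%l. if l : F then f l else 0)"
  have u: "u : K" unfolding u_def by (rule fin[OF F(1)])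
  have uc: "u : cr (shift_space r)" using u Kp(1) by blast
  have du: "u \<ominus>\<^bsub>shift_space r\<^esub> f = (%l. u l - f l)" by (rule shift_space_diff[OF uc f])
  have dc: "(%l. u l - f l) : cr (shift_space r)" using H.M.minus_closed[OF uc f] du by simp
  have "(\<Sum>\<^sub>\<infinity>l. (cmod (u l - f l))\<^sup>2) = (\<Sum>\<^sub>\<infinity>l\<in>UNIV - F. ?g l)"
   by (rule infsum_cong_neutral) (auto simp: u_def)
  also have "... = infsum ?g UNIV - infsum ?g F"
   using e2 F unfolding ell2_def by (intro infsum_Diff) auto
  also have "... < e\<^sup>2" using F by simp
  finally have "hnorm (shift_space r) (%l. u l - f l) < e"
   using dc e by (simp add: hnorm_shift real_less_lsqrt)
  then show ?thesis by (intro bexI[OF _ u]) (simp only: du)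
 qed
 then have "f : H.hclosure K" using H.hclosure_iff[OF Kp(1)] f by blast
 then show "f : K" using Kp(5) f unfolding H.hclosure_def by blast
qed
qed

section \<open>Polynomials in weighted composition operators\<close>

type_synonym wop = "(nat list => complex) \<times> (nat list => nat list)"

fun wop_apply :: "wop => (nat list => complex) => nat list => complex" where
"wop_apply (w, \<phi>) f l = w l * f (\<phi> l)"

text \<open>The operators of a pair are mutually adjoint when the index maps are mutually inverse on the
  supports of the weights.\<close>

definition wop_adjoint :: "nat => wop => wop => bool" where
"wop_adjoint r A B \<longleftrightarrow> (ALL l. length l = r --> fst A l ~= 0 \<longrightarrow>
  length (snd A l) = r & snd B (snd A l) = l & fst B (snd A l) = cnj (fst A l)) \<and>
 (ALL l. length l ~= r --> length (snd A l) ~= r) & (EX C. ALL l. cmod (fst A l) <= C)"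

lemma wop_adjointD:
assumes "wop_adjoint r (w, \<phi>) (w', \<phi>')"
shows "!!l. length l = r ==> w l ~= 0 ==> length (\<phi> l) = r & \<phi>' (\<phi> l) = l & w' (\<phi> l) = cnj (w l)"
 "!!l. length l ~= r ==> length (\<phi> l) ~= r" "EX C>=0. ALL l. cmod (w l) <= C"
proof -
obtain C where C: "!!l. cmod (w l) <= C" using assms by (auto simp: wop_adjoint_def)
have "C >= 0" using order_trans[OF norm_ge_zero C] .
then show "EX C>=0. ALL l. cmod (w l) <= C" using C by blast
qed (use assms in \<open>auto simp: wop_adjoint_def\<close>)

lemma wop_bounded:
assumes A: "wop_adjoint r (w, \<phi>) (w', \<phi>')" and f: "f : cr (shift_space r)"
 and C: "C >= 0" "!!l. cmod (w l) <= C"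
shows "wop_apply (w, \<phi>) f : cr (shift_space r)"
 "hnorm (shift_space r) (wop_apply (w, \<phi>) f) <= C * hnorm (shift_space r) f"
proof -
note A' = wop_adjointD[OF A]
have f2: "ell2 f" and f0: "!!l. length l ~= r ==> f l = 0" using f by auto
let ?g = "wop_apply (w, \<phi>) f"
have g0: "?g l = 0" if "length l ~= r" for l using A'(2)[OF that] f0 by simp
let ?W = "{l. length l = r & w l ~= 0}"
have inj: "inj_on \<phi> ?W" 
proof (rule inj_onI)
 fix k l assume k: "k : ?W" and l: "l : ?W" and e: "\<phi> k = \<phi> l"
 have inv: "\<phi>' (\<phi> j) = j" if "j : ?W" for j
  by (rule A'(1)[THEN conjunct2, THEN conjunct1]) (use that in simp_all)
 show "k = l" using arg_cong[OF e, of \<phi>'] unfolding inv[OF k] inv[OF l] .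
qed
have part: "(\<Sum>l\<in>F. (cmod (?g l))\<^sup>2) <= (C * hnorm (shift_space r) f)\<^sup>2" if F: "finite F" for F
proof -
 have "(\<Sum>l\<in>F. (cmod (?g l))\<^sup>2) = (\<Sum>l\<in>F \<inter> ?W. (cmod (?g l))\<^sup>2)"
  using F g0 by (intro sum.mono_neutral_right) auto
 also have "... <= (\<Sum>l\<in>F \<inter> ?W. C\<^sup>2 * (cmod (f (\<phi> l)))\<^sup>2)"
  using C by (intro sum_mono) (auto simp: norm_mult power_mult_distrib intro!: mult_right_mono power_mono)
 also have "... = C\<^sup>2 * (\<Sum>k\<in>\<phi> ` (F \<inter> ?W). (cmod (f k))\<^sup>2)"
  by (subst sum.reindex) (auto intro: inj_on_subset[OF inj] simp: sum_distrib_left)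
 also have "... <= C\<^sup>2 * (hnorm (shift_space r) f)\<^sup>2"
  using F by (intro mult_left_mono finite_sum_le_hnorm f2) auto
 finally show ?thesis by (simp add: power_mult_distrib)
qed
have g2: "ell2 ?g" unfolding ell2_def
 by (rule nonneg_bdd_above_summable_on) (use part in \<open>auto intro!: bdd_aboveI2\<close>)
then show "?g : cr (shift_space r)" using g0 by simp
have "(\<Sum>\<^sub>\<infinity>l. (cmod (?g l))\<^sup>2) <= (C * hnorm (shift_space r) f)\<^sup>2"
 using g2 part unfolding ell2_def by (intro infsum_le_finite_sums) auto
then show "hnorm (shift_space r) ?g <= C * hnorm (shift_space r) f"
 using g2 C f2 by (simp add: hnorm_shift real_le_lsqrt infsum_nonneg del: wop_apply.simps)
qed

lemma wop_adjoint_ip: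
assumes A: "wop_adjoint r (w, \<phi>) (w', \<phi>')" "wop_adjoint r (w', \<phi>') (w, \<phi>)"
 and f: "f : cr (shift_space r)" and g: "g : cr (shift_space r)"
shows "ip (shift_space r) (wop_apply (w, \<phi>) f) g = ip (shift_space r) f (wop_apply (w', \<phi>') g)"
proof -
note A1 = wop_adjointD[OF A(1)] and A2 = wop_adjointD[OF A(2)]
let ?W = "{l. length l = r & w l ~= 0}" and ?W' = "{l. length l = r & w' l ~= 0}"
have "(\<Sum>\<^sub>\<infinity>l. wop_apply (w, \<phi>) f l * cnj (g l)) = (\<Sum>\<^sub>\<infinity>l\<in>?W. wop_apply (w, \<phi>) f l * cnj (g l))"
 by (rule infsum_cong_neutral) (use g in auto)
also have "... = (\<Sum>\<^sub>\<infinity>k\<in>?W'. f k * cnj (wop_apply (w', \<phi>') g k))"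
proof (rule infsum_reindex_bij_witness[where i=\<phi>' and j=\<phi>])
 fix l assume l: "l : ?W"
 then have a: "length (\<phi> l) = r" "\<phi>' (\<phi> l) = l" "w' (\<phi> l) = cnj (w l)" using A1(1)[of l] by auto
 then show "\<phi>' (\<phi> l) = l" "\<phi> l : ?W'"
  "f (\<phi> l) * cnj (wop_apply (w', \<phi>') g (\<phi> l)) = wop_apply (w, \<phi>) f l * cnj (g l)"
  using l by (auto simp: algebra_simps)
next
 fix k assume k: "k : ?W'"
 then have "length (\<phi>' k) = r" "\<phi> (\<phi>' k) = k" "w (\<phi>' k) = cnj (w' k)" using A2(1)[of k] by auto
 then show "\<phi> (\<phi>' k) = k" "\<phi>' k : ?W" using k by auto
qed
also have "... = (\<Sum>\<^sub>\<infinity>k. f k * cnj (wop_apply (w', \<phi>') g k))"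
 by (rule infsum_cong_neutral) (use f in auto)
finally show ?thesis by simp
qed

fun word_act :: "('g \<times> bool => wop) => ('g \<times> bool) list => (nat list => complex) => nat list => complex" where
"word_act L [] f = f"
| "word_act L (a # u) f = wop_apply (L a) (word_act L u f)"

definition poly_act :: "('g \<times> bool => wop) => 'g star_poly => (nat list => complex) => nat list => complex" where
"poly_act L p f l = (\<Sum>u\<in>Poly_Mapping.keys p. Poly_Mapping.lookup p u * word_act L (letters u) f l)"

lemma wop_apply_linear:
"wop_apply A (%l. f l + g l) = (%l. wop_apply A f l + wop_apply A g l)"
"wop_apply A (%l. c * f l) = (%l. c * wop_apply A f l)"
by (cases A; simp add: fun_eq_iff algebra_simps)+

lemma word_act_linear:
"word_act L u (%l. f l + g l) = (%l. word_act L u f l + word_act L u g l)"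
"word_act L u (%l. c * f l) = (%l. c * word_act L u f l)"
by (induction u) (simp_all add: wop_apply_linear)

lemma word_act_append: "word_act L (u @ v) f = word_act L u (word_act L v f)"
by (induction u) simp_all

lemma poly_act_superset:
assumes "finite K" "Poly_Mapping.keys p <= K"
shows "poly_act L p f l = (\<Sum>u\<in>K. Poly_Mapping.lookup p u * word_act L (letters u) f l)"
unfolding poly_act_def using assms by (intro sum.mono_neutral_left) (auto simp: in_keys_iff)

lemma poly_act_add: "poly_act L (p + p') f = (%l. poly_act L p f l + poly_act L p' f l)"
proof
fix l
let ?K = "Poly_Mapping.keys p \<union> Poly_Mapping.keys p'"
have "poly_act L (p + p') f l = (\<Sum>u\<in>?K. Poly_Mapping.lookup (p + p') u * word_act L (letters u) f l)"
 by (rule poly_act_superset, simp, rule keys_add)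
moreover have "poly_act L p f l = (\<Sum>u\<in>?K. Poly_Mapping.lookup p u * word_act L (letters u) f l)"
 "poly_act L p' f l = (\<Sum>u\<in>?K. Poly_Mapping.lookup p' u * word_act L (letters u) f l)"
 by (rule poly_act_superset; simp)+
ultimately show "poly_act L (p + p') f l = poly_act L p f l + poly_act L p' f l"
 by (simp add: lookup_add distrib_right sum.distrib)
qed

lemma poly_act_single: "poly_act L (Poly_Mapping.single u c) f = (%l. c * word_act L (letters u) f l)"
by (cases "c = 0") (auto simp: poly_act_def fun_eq_iff)

lemma poly_act_zero: "poly_act L 0 f = (%_. 0)"
by (simp add: poly_act_def fun_eq_iff)

lemma poly_act_linear:
"poly_act L p (%l. f l + g l) = (%l. poly_act L p f l + poly_act L p g l)"
"poly_act L p (%l. c * f l) = (%l. c * poly_act L p f l)"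
by (simp_all add: poly_act_def word_act_linear fun_eq_iff algebra_simps sum.distrib sum_distrib_left)

lemma poly_act_mult: "poly_act L (p * p') f = poly_act L p (poly_act L p' f)"
proof (induction p rule: poly_mapping_additive_induct)
case (single u a)
show ?case
proof (induction p' rule: poly_mapping_additive_induct)
 case (single v b)
 show ?case
  by (simp add: mult_single poly_act_single plus_star_word_def word_act_append word_act_linear fun_eq_iff)
next
 case zero
 have "word_act L w (%_. 0) = (%_. 0)" for w using word_act_linear(2)[of L w 0 "%_. 0"] by simp
 then show ?case by (simp add: poly_act_zero poly_act_single)
next
 case (add x y)
 then show ?case by (simp add: distrib_left poly_act_add poly_act_linear)
qed
qed (simp_all add: poly_act_zero poly_act_add distrib_right)

lemma poly_act_one: "poly_act L 1 f = f"
by (simp only: single_one[symmetric] poly_act_single) (simp add: zero_star_word_def)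

lemma poly_act_scale: "poly_act L (poly_scale c p) f = (%l. c * poly_act L p f l)"
by (simp add: poly_scale_conv_mult poly_act_mult poly_act_single zero_star_word_def)

lemma poly_act_gen: "poly_act L (poly_gen g) f = wop_apply (L (g, False)) f"
"poly_act L (poly_star (poly_gen g)) f = wop_apply (L (g, True)) f"
by (simp_all add: poly_gen_def poly_act_single word_star_def)

lemma poly_act_diff: "poly_act L (p - p') f = (%l. poly_act L p f l - poly_act L p' f l)"
proof -
have "poly_act L p f = poly_act L ((p - p') + p') f" by simp
then show ?thesis unfolding poly_act_add by (simp add: fun_eq_iff)
qed

text \<open>Boundedness and adjointness are checked on letters and propagated along sums and products.\<close>

lemma poly_act_representation:
assumes adj: "!!g b. g : G ==> wop_adjoint r (L (g, b)) (L (g, \<not> b))"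
shows "representation (free_star_algebra G N) (shift_space r) (poly_act L)"
proof -
interpret H: hilbert_space "shift_space r" by (rule shift_space_hilbert)
let ?H = "shift_space r"
have letter: "wop_apply (L (g, b)) f : cr ?H"
 "EX C. ALL f:cr ?H. hnorm ?H (wop_apply (L (g, b)) f) <= C * hnorm ?H f"
 "h : cr ?H ==> ip ?H (wop_apply (L (g, b)) f) h = ip ?H f (wop_apply (L (g, \<not> b)) h)"
 if g: "g : G" and f: "f : cr ?H" for g b f h
proof -
 obtain w \<phi> w' \<phi>' where L: "L (g, b) = (w, \<phi>)" "L (g, \<not> b) = (w', \<phi>')" by (metis surj_pair)
 have A: "wop_adjoint r (w, \<phi>) (w', \<phi>')" "wop_adjoint r (w', \<phi>') (w, \<phi>)"
  using adj[OF g, of b] adj[OF g, of "\<not> b"] L by simp_all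
 obtain C where C: "C >= 0" "!!l. cmod (w l) <= C" using wop_adjointD(3)[OF A(1)] by blast
 show "wop_apply (L (g, b)) f : cr ?H" unfolding L using wop_bounded(1)[OF A(1) f C] .
 show "EX C. ALL f:cr ?H. hnorm ?H (wop_apply (L (g, b)) f) <= C * hnorm ?H f"
  unfolding L using wop_bounded(2)[OF A(1) _ C] by blast
 show "ip ?H (wop_apply (L (g, b)) f) h = ip ?H f (wop_apply (L (g, \<not> b)) h)" if "h : cr ?H"
  unfolding L by (rule wop_adjoint_ip[OF A f that])
qed
have z: "(%_. 0) : cr ?H" by simp
have main: "(ALL f:cr ?H. poly_act L p f : cr ?H) \<and>
  (EX C>=0. ALL f:cr ?H. hnorm ?H (poly_act L p f) <= C * hnorm ?H f) \<and>
  (ALL f:cr ?H. ALL h:cr ?H. ip ?H (poly_act L p f) h = ip ?H f (poly_act L (poly_star p) h) \<and>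
   poly_act L (poly_star p) h : cr ?H)"
 if p: "p : polys G" for p
 using p
proof (induction p rule: free_star_induct)
 case one
 then show ?case by (auto simp: poly_act_one intro!: exI[of _ 1])
next
 case (gen g)
 obtain C where C: "!!f. f : cr ?H ==> hnorm ?H (wop_apply (L (g, False)) f) <= C * hnorm ?H f"
  using letter(2)[OF gen z] by blast
 have "hnorm ?H (wop_apply (L (g, False)) f) <= \<bar>C\<bar> * hnorm ?H f" if "f : cr ?H" for f
  using C[OF that] mult_right_mono[OF abs_ge_self[of C] H.hnorm_nonneg[OF that]] by linarith
 then have "EX C>=0. ALL f:cr ?H. hnorm ?H (wop_apply (L (g, False)) f) <= C * hnorm ?H f"
  by (intro exI[of _ "\<bar>C\<bar>"]) auto
 then show ?case using letter(1)[OF gen] letter(3)[OF gen, of _ _ False] unfolding poly_act_gen by auto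
next
 case (gen_star g)
 obtain C where C: "!!f. f : cr ?H ==> hnorm ?H (wop_apply (L (g, True)) f) <= C * hnorm ?H f"
  using letter(2)[OF gen_star z] by blast
 have "hnorm ?H (wop_apply (L (g, True)) f) <= \<bar>C\<bar> * hnorm ?H f" if "f : cr ?H" for f
  using C[OF that] mult_right_mono[OF abs_ge_self[of C] H.hnorm_nonneg[OF that]] by linarith
 then have "EX C>=0. ALL f:cr ?H. hnorm ?H (wop_apply (L (g, True)) f) <= C * hnorm ?H f"
  by (intro exI[of _ "\<bar>C\<bar>"]) auto
 then show ?case using letter(1)[OF gen_star] letter(3)[OF gen_star, of _ _ True]
  unfolding poly_star_poly_star poly_act_gen by auto
next
 case (add x y)
 obtain C D where C: "C >= 0" "!!f. f : cr ?H ==> hnorm ?H (poly_act L x f) <= C * hnorm ?H f"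
  and D: "D >= 0" "!!f. f : cr ?H ==> hnorm ?H (poly_act L y f) <= D * hnorm ?H f" using add by blast
 have e: "poly_act L (x + y) f = poly_act L x f \<oplus>\<^sub>?H poly_act L y f"
  "poly_act L (poly_star (x + y)) f = poly_act L (poly_star x) f \<oplus>\<^sub>?H poly_act L (poly_star y) f" for f
  by (simp_all add: poly_act_add poly_star_add)
 have cx: "poly_act L x f : cr ?H" "poly_act L y f : cr ?H" if "f : cr ?H" for f using add that by blast+
 have cs: "poly_act L (poly_star x) f : cr ?H" "poly_act L (poly_star y) f : cr ?H" if "f : cr ?H" for f using add that by blast+
 have ipx: "ip ?H (poly_act L x f) h = ip ?H f (poly_act L (poly_star x) h)" "ip ?H (poly_act L y f) h = ip ?H f (poly_act L (poly_star y) h)"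
  if "f : cr ?H" "h : cr ?H" for f h using add that by blast+
 have "hnorm ?H (poly_act L x f \<oplus>\<^sub>?H poly_act L y f) <= (C + D) * hnorm ?H f" if f: "f : cr ?H" for f
  using H.hnorm_triangle[OF cx[OF f]] C(2)[OF f] D(2)[OF f] unfolding distrib_right by linarith
 then have b: "EX C>=0. ALL f:cr ?H. hnorm ?H (poly_act L x f \<oplus>\<^sub>?H poly_act L y f) <= C * hnorm ?H f"
  using C(1) D(1) by (intro exI[of _ "C + D"]) auto
 show ?case unfolding e
 proof (intro conjI ballI b H.M.a_closed cx cs)
  fix f h assume f: "f : cr ?H" and h: "h : cr ?H"
  show "ip ?H (poly_act L x f \<oplus>\<^sub>?H poly_act L y f) h
    = ip ?H f (poly_act L (poly_star x) h \<oplus>\<^sub>?H poly_act L (poly_star y) h)"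
   unfolding H.ip_add_left[OF cx[OF f] h] H.ip_add_right[OF f cs[OF h]] ipx[OF f h] ..
 qed
next
 case (scale c x)
 obtain C where C: "C >= 0" "!!f. f : cr ?H ==> hnorm ?H (poly_act L x f) <= C * hnorm ?H f" using scale by blast
 have e: "poly_act L (poly_scale c x) f = c \<odot>\<^sub>?H poly_act L x f"
  "poly_act L (poly_star (poly_scale c x)) f = cnj c \<odot>\<^sub>?H poly_act L (poly_star x) f" for f
  by (simp_all add: poly_act_scale poly_star_scale)
 have cx: "poly_act L x f : cr ?H" if "f : cr ?H" for f using scale that by blast
 have cs: "poly_act L (poly_star x) f : cr ?H" if "f : cr ?H" for f using scale that by blast
 have ipx: "ip ?H (poly_act L x f) h = ip ?H f (poly_act L (poly_star x) h)" if "f : cr ?H" "h : cr ?H" for f h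
  using scale that by blast
 have "hnorm ?H (c \<odot>\<^sub>?H poly_act L x f) <= (cmod c * C) * hnorm ?H f" if f: "f : cr ?H" for f
  unfolding H.hnorm_smult[OF cx[OF f]] mult.assoc by (intro mult_left_mono C(2) f) simp
 then have b: "EX C>=0. ALL f:cr ?H. hnorm ?H (c \<odot>\<^sub>?H poly_act L x f) <= C * hnorm ?H f"
  using C(1) by (intro exI[of _ "cmod c * C"]) auto
 show ?case unfolding e
 proof (intro conjI ballI b H.hsmult_closed cx cs)
  fix f h assume f: "f : cr ?H" and h: "h : cr ?H"
  show "ip ?H (c \<odot>\<^sub>?H poly_act L x f) h = ip ?H f (cnj c \<odot>\<^sub>?H poly_act L (poly_star x) h)"
   unfolding H.ip_smult_left[OF cx[OF f] h] H.ip_smult_right[OF f cs[OF h]] ipx[OF f h] by simp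
 qed
next
 case (mult x y)
 obtain C D where C: "C >= 0" "!!f. f : cr ?H ==> hnorm ?H (poly_act L x f) <= C * hnorm ?H f"
  and D: "D >= 0" "!!f. f : cr ?H ==> hnorm ?H (poly_act L y f) <= D * hnorm ?H f" using mult by blast
 have e: "poly_act L (x * y) f = poly_act L x (poly_act L y f)"
  "poly_act L (poly_star (x * y)) f = poly_act L (poly_star y) (poly_act L (poly_star x) f)" for f
  by (simp_all add: poly_act_mult poly_star_mult)
 have cx: "poly_act L x f : cr ?H" "poly_act L y f : cr ?H" if "f : cr ?H" for f using mult that by blast+
 have cs: "poly_act L (poly_star x) f : cr ?H" "poly_act L (poly_star y) f : cr ?H" if "f : cr ?H" for f using mult that by blast+
 have ipx: "ip ?H (poly_act L x f) h = ip ?H f (poly_act L (poly_star x) h)" "ip ?H (poly_act L y f) h = ip ?H f (poly_act L (poly_star y) h)"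
  if "f : cr ?H" "h : cr ?H" for f h using mult that by blast+
 have "hnorm ?H (poly_act L x (poly_act L y f)) <= (C * D) * hnorm ?H f" if f: "f : cr ?H" for f
  using C(2)[OF cx(2)[OF f]] mult_left_mono[OF D(2)[OF f] C(1)] by (simp only: mult.assoc)
 then have b: "EX C>=0. ALL f:cr ?H. hnorm ?H (poly_act L x (poly_act L y f)) <= C * hnorm ?H f"
  using C(1) D(1) by (intro exI[of _ "C * D"]) auto
 show ?case unfolding e
 proof (intro conjI ballI b cx cs)
  fix f h assume f: "f : cr ?H" and h: "h : cr ?H"
  show "ip ?H (poly_act L x (poly_act L y f)) h = ip ?H f (poly_act L (poly_star y) (poly_act L (poly_star x) h))"
   unfolding ipx(1)[OF cx(2)[OF f] h] ipx(2)[OF f cs(1)[OF h]] ..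
 qed
qed
have bdd: "EX C. ALL v:cr ?H. hnorm ?H (poly_act L x v) <= C * hnorm ?H v" if "x : polys G" for x
 using main[OF that] by blast
show ?thesis
 unfolding representation_def bounded_operator_def hlinear_def free_star_algebra_simps
proof (intro conjI ballI allI bdd)
 show "hilbert_space ?H" by (rule shift_space_hilbert)
qed (use main in \<open>auto simp: poly_act_linear poly_act_add poly_act_mult poly_act_scale simp del: shift_space_simps(1,5) intro!: shift_space_simps(2,4)[symmetric]\<close>)
qed

section \<open>The model representations of the quantum ball\<close>

definition dn :: "nat => nat list => nat list" where "dn s l = l[s - 1 := l ! (s - 1) - 1]"
definition up :: "nat => nat list => nat list" where "up s l = l[s - 1 := Suc (l ! (s - 1))]"

lemma length_dn [simp]: "length (dn s l) = length l" "length (up s l) = length l"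
by (simp_all add: dn_def up_def)

lemma dn_up [simp]: "1 <= s ==> s <= length l ==> dn s (up s l) = l"
"1 <= s ==> s <= length l ==> 0 < l ! (s - 1) ==> up s (dn s l) = l"
"1 <= s ==> s <= length l ==> up s l ! (s - 1) = Suc (l ! (s - 1))"
by (auto simp: dn_def up_def)

lemma dn_up_swap: "1 <= s ==> s < t ==> dn s (dn t l) = dn t (dn s l)"
"1 <= s ==> s < t ==> dn s (up t l) = up t (dn s l)"
proof -
assume "1 <= s" "s < t"
then have "s - 1 ~= t - 1" by simp
then show "dn s (dn t l) = dn t (dn s l)" "dn s (up t l) = up t (dn s l)"
 by (simp_all add: dn_def up_def list_update_swap)
qed

lemma sum_list_up: "1 <= s ==> s <= length l ==> sum_list (up s l) = Suc (sum_list l)"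
by (simp add: up_def sum_list_update elem_le_sum_list)

lemma sum_list_drop_up:
assumes "s < t" "t <= length l" shows "sum_list (drop s (up t l)) = Suc (sum_list (drop s l))"
proof -
have "drop s (up t l) = up (t - s) (drop s l)"
 using assms by (simp add: up_def drop_update_swap add.commute)
then show ?thesis using sum_list_up[of "t - s" "drop s l"] assms by simp
qed

lemma sum_list_drop: "1 <= s ==> s <= length l ==> sum_list (drop (s - 1) l) = l ! (s - 1) + sum_list (drop s l)"
using Cons_nth_drop_Suc[of "s - 1" l] by (simp add: sum_list.Cons[symmetric])

context quantum_ball
begin

text \<open>The weight of the shift at its target: it vanishes exactly where lowering is impossible, so the truncated predecessor needs no
  guard.\<close>

definition lw :: "nat => nat list => real" where
"lw s l = sqrt ((1 - q ^ (l ! (s - 1))) * q ^ sum_list (drop s l))"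

lemma q_pow: "0 < q ^ k" "q ^ k <= 1" "0 <= 1 - q ^ k"
using q by (simp_all add: power_le_one)

lemma lw_square: "lw s l * lw s l = (1 - q ^ (l ! (s - 1))) * q ^ sum_list (drop s l)"
unfolding lw_def using q_pow by (simp add: less_imp_le)

lemma lw_bound: "\<bar>lw s l\<bar> <= 1"
proof -
have "(1 - q ^ (l ! (s - 1))) * q ^ sum_list (drop s l) <= 1 * 1"
 using q_pow by (intro mult_mono) (auto simp: less_imp_le)
then show ?thesis unfolding lw_def using q_pow by (simp add: less_imp_le)
qed

lemma lw_zero_iff: "lw s l = 0 \<longleftrightarrow> l ! (s - 1) = 0"
proof -
have "q ^ k = 1 \<longleftrightarrow> k = 0" for k :: nat
 using power_Suc_less_one[OF q, of "k - 1"] by (cases k) auto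
then show ?thesis unfolding lw_def using q by auto
qed

lemma lw_lower: "1 <= s ==> s < t ==> lw t (dn s l) = lw t l" "1 <= s ==> s < t ==> lw t (up s l) = lw t l"
by (auto simp: lw_def dn_def up_def nth_list_update_neq drop_update_cancel)

lemma lw_higher: "1 <= s ==> s < t ==> t <= length l ==> lw s (up t l) = sqrt q * lw s l"
proof -
assume st: "1 <= s" "s < t" "t <= length l"
then have "up t l ! (s - 1) = l ! (s - 1)" by (auto simp: up_def nth_list_update_neq)
then show ?thesis using sum_list_drop_up[OF st(2,3)] by (simp add: lw_def real_sqrt_mult)
qed

lemma lw_dn_higher: "1 <= s ==> s < t ==> t <= length l ==> lw t l * lw s l = lw t l * (sqrt q * lw s (dn t l))"
using lw_higher[of s t "dn t l"] lw_zero_iff[of t l] by (cases "l ! (t - 1) = 0") auto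

lemma shift_op_eq: "1 <= s ==> s <= length l ==> shift_op q s f l = of_real (lw s l) * f (dn s l)"
using lw_zero_iff[of s l]
by (auto simp: shift_op_def dn_def shift_weight_def lw_def Let_def drop_update_cancel)

end

locale ball_model = quantum_ball +
fixes m :: nat and \<theta> :: complex
assumes m_le: "m <= n" and \<theta>: "cmod \<theta> = 1"
begin

abbreviation "V \<equiv> shift_space (n - m)"

definition cw :: "nat list => real" where "cw l = sqrt (q ^ sum_list l)"

lemma cw_square: "cw l * cw l = q ^ sum_list l"
unfolding cw_def using q_pow by (simp add: less_imp_le)

lemma cw_up: "1 <= t ==> t <= length l ==> cw (up t l) = sqrt q * cw l"
by (simp add: cw_def sum_list_up real_sqrt_mult)

lemma cw_dn: "1 <= t ==> t <= length l ==> lw t l * cw l = lw t l * (sqrt q * cw (dn t l))"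
using cw_up[of t "dn t l"] lw_zero_iff[of t l] by (cases "l ! (t - 1) = 0") auto

text \<open>Letters before \<open>m\<close> act as zero, the letter \<open>m\<close> by \<open>\<theta>\<close> times a diagonal operator, and the
  later ones by the shifts with index \<open>i - m\<close>.\<close>

fun lett :: "nat \<times> bool => wop" where
"lett (i, b) = (if i < m then (%_. 0, %l. l)
 else if i = m then (%l. (if b then cnj \<theta> else \<theta>) * of_real (cw l), %l. l)
 else if b then (%l. of_real (lw (i - m) (up (i - m) l)), up (i - m))
 else (%l. of_real (lw (i - m) l), dn (i - m)))"

lemma lett_adjoint: "g : {1..n} ==> wop_adjoint (n - m) (lett (g, b)) (lett (g, \<not> b))"
proof -
assume g: "g : {1..n}"
have c: "cmod (of_real (lw s l)) <= 1" for s l using lw_bound by simp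
have "cw l <= 1" "0 <= cw l" for l unfolding cw_def using q_pow by (auto simp: less_imp_le)
then have d: "cmod (z * of_real (cw l)) <= 1" if "cmod z = 1" for z l using that by (simp add: norm_mult)
consider "g < m" | "g = m" | "m < g" by linarith
then show ?thesis
proof cases
 case 2
 have "cmod (if b then cnj \<theta> else \<theta>) = 1" using \<theta> by simp
 then show ?thesis using 2 d[of "if b then cnj \<theta> else \<theta>"]
  by (auto simp: wop_adjoint_def intro!: exI[of _ 1])
next
 case 3
 then have s: "1 <= g - m" "g - m <= n - m" using g by auto
 show ?thesis using 3 s c lw_zero_iff
  by (auto simp: wop_adjoint_def intro!: exI[of _ 1])
qed (auto simp: wop_adjoint_def)
qed

definition act :: "nat star_poly => (nat list => complex) => nat list => complex" where
"act = poly_act lett"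

text \<open>The eigenvalues of \<open>D i\<close> on the basis.\<close>

definition dw :: "nat => nat list => real" where
"dw i l = (if i < m then 0 else q ^ sum_list (drop (i - m) l))"

lemma act_z:
assumes "1 <= i" "i <= n" "f : cr V"
shows "act (zp i) f l = (if i < m then 0 else if i = m then \<theta> * of_real (cw l) * f l
  else of_real (lw (i - m) l) * f (dn (i - m) l))"
 "act (zs i) f l = (if i < m then 0 else if i = m then cnj \<theta> * of_real (cw l) * f l
  else of_real (lw (i - m) (up (i - m) l)) * f (up (i - m) l))"
unfolding act_def poly_act_gen by simp_all

lemma act_carrier: "f : cr V ==> p : polys {1..n} ==> act p f : cr V"
using poly_act_representation[OF lett_adjoint, of "{1..n}" "%_. 0"] unfolding act_def
by (simp add: representation_def bounded_operator_def hlinear_def Pi_iff)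

lemma act_zz:
assumes i: "1 <= i" "i <= n" and f: "f : cr V"
shows "act (zp i * zs i) f l = of_real (dw i l - dw (i - 1) l) * f l"
 "act (zs i * zp i) f l = of_real (dw i l - q * dw (i - 1) l) * f l"
proof -
have ic: "i : {1..n}" using i by simp
note c = act_carrier[OF f zp_closed(1)[OF ic]] act_carrier[OF f zp_closed(2)[OF ic]]
have m: "act (x * y) f l = act x (act y f) l" for x y by (simp add: act_def poly_act_mult)
have t: "\<theta> * cnj \<theta> = 1" using \<theta> by (simp add: complex_norm_square[symmetric])
consider "length l ~= n - m" | "i < m" | "i = m" "length l = n - m" | "m < i" "length l = n - m" by linarith
then have "act (zp i * zs i) f l = of_real (dw i l - dw (i - 1) l) * f l \<and>
 act (zs i * zp i) f l = of_real (dw i l - q * dw (i - 1) l) * f l"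
proof cases
 case 1
 then show ?thesis using act_carrier[OF c(1) zp_closed(2)[OF ic]] act_carrier[OF c(2) zp_closed(1)[OF ic]] f
  by (simp add: m)
next
 case 2
 then show ?thesis unfolding m act_z[OF i c(1)] act_z[OF i c(2)] by (simp add: dw_def)
next
 case 3
 have "act (zp i * zs i) f l = (\<theta> * cnj \<theta>) * of_real (cw l * cw l) * f l"
  "act (zs i * zp i) f l = (\<theta> * cnj \<theta>) * of_real (cw l * cw l) * f l"
  unfolding m act_z[OF i c(1)] act_z[OF i c(2)] act_z[OF i f] using 3 by (simp_all add: mult_ac)
 then show ?thesis unfolding t cw_square using 3 i by (simp add: dw_def)
next
 case 4
 define s where "s = i - m"
 have s: "1 <= s" "s <= length l" using 4 i s_def by auto
 have e1: "i - 1 - m = s - 1" "\<not> i - 1 < m" using 4 s_def by auto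
 have e: "dw i l = q ^ sum_list (drop s l)" "dw (i - 1) l = q ^ (l ! (s - 1)) * q ^ sum_list (drop s l)"
  using 4 sum_list_drop[OF s] e1 by (simp_all add: dw_def s_def[symmetric] power_add[symmetric])
 have u: "drop s (up s l) = drop s l" using s by (simp add: up_def drop_update_cancel)
 have "act (zp i * zs i) f l = of_real (lw s l) * (of_real (lw s (up s (dn s l))) * f (up s (dn s l)))"
  "act (zs i * zp i) f l = of_real (lw s (up s l) * lw s (up s l)) * f l"
  unfolding m act_z[OF i c(1)] act_z[OF i c(2)] act_z[OF i f] using 4 s by (simp_all add: s_def[symmetric])
 moreover have "of_real (lw s l) * (of_real (lw s (up s (dn s l))) * f (up s (dn s l))) = of_real (lw s l * lw s l) * f l"
  using s lw_zero_iff[of s l] by (cases "l ! (s - 1) = 0") auto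
 ultimately show ?thesis unfolding lw_square e u using s by (simp add: algebra_simps)
qed
then show "act (zp i * zs i) f l = of_real (dw i l - dw (i - 1) l) * f l"
 "act (zs i * zp i) f l = of_real (dw i l - q * dw (i - 1) l) * f l" by auto
qed

lemma act_D:
assumes i: "i <= n" and f: "f : cr V"
shows "act (1 - (\<Sum>j=Suc i..n. zp j * zs j)) f l = of_real (dw i l) * f l"
using i
proof (induction i rule: inc_induct)
case base
have "f l = of_real (dw n l) * f l" using f m_le by (cases "length l = n - m") (auto simp: dw_def)
then show ?case by (simp add: act_def poly_act_one)
next
case (step i)
have "(\<Sum>j=Suc i..n. zp j * zs j) = zp (Suc i) * zs (Suc i) + (\<Sum>j=Suc (Suc i)..n. zp j * zs j)"
 using step by (simp add: sum.atLeast_Suc_atMost)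
then have e: "1 - (\<Sum>j=Suc i..n. zp j * zs j) = (1 - (\<Sum>j=Suc (Suc i)..n. zp j * zs j)) - zp (Suc i) * zs (Suc i)"
 by (simp add: algebra_simps)
have "act (1 - (\<Sum>j=Suc i..n. zp j * zs j)) f l = of_real (dw (Suc i) l) * f l - act (zp (Suc i) * zs (Suc i)) f l"
 unfolding e using step.IH by (simp add: act_def poly_act_diff)
also have "... = of_real (dw i l) * f l"
 using act_zz(1)[of "Suc i" f l] step.hyps f by (simp add: left_diff_distrib)
finally show ?case .
qed

lemma act_relators:
assumes r: "r : qball_relators q n" and f: "f : cr V"
shows "act r f = \<zero>\<^sub>V"
proof
fix l
have rc: "act r f l = 0" if "length l ~= n - m"
 using act_carrier[OF f] r relators_closed that by auto
have m: "act (x * y) f = act x (act y f)" "act (x - y) f = (%l. act x f l - act y f l)"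
 "act (poly_scale c x) f = (%l. c * act x f l)" for x y c f
 by (simp_all add: act_def poly_act_mult poly_act_diff poly_act_scale)
have main: "act r f l = 0" if ll: "length l = n - m"
 using r unfolding relators_iff
proof (elim disjE exE conjE)
 fix i j assume ij: "1 <= i" "i < j" "j <= n"
 then have i: "1 <= i" "i <= n" and j: "1 <= j" "j <= n" by auto
 then have ic: "i : {1..n}" and jc: "j : {1..n}" by simp_all
 note c = act_carrier[OF f zp_closed(1)[OF ic]] act_carrier[OF f zp_closed(1)[OF jc]] act_carrier[OF f zp_closed(2)[OF jc]]
 note z = act_z[OF i f] act_z[OF j f] act_z[OF i c(2)] act_z[OF i c(3)] act_z[OF j c(1)]
 define s t where "s = i - m" and "t = j - m"
 have t: "m < i \<or> m = i ==> 1 <= t" "t <= length l" and st: "m < i ==> 1 <= s & s < t" using ij ll by (auto simp: s_def t_def)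
 have inv: "1 / sqrt q * sqrt q = 1" using q by simp
 show "act r f l = 0" if "r = zp i * zp j - poly_scale (of_real (sqrt q)) (zp j * zp i)"
 proof -
  have "act (zp i) (act (zp j) f) l = of_real (sqrt q) * act (zp j) (act (zp i) f) l"
  proof (cases "m < i")
   case True
   note st = conjunct1[OF st[OF True]] conjunct2[OF st[OF True]]
   have "act (zp i) (act (zp j) f) l = of_real (lw t l * lw s l) * f (dn t (dn s l))"
    unfolding z using True ij st by (simp add: s_def[symmetric] t_def[symmetric] lw_lower)
   also have "... = of_real (sqrt q) * act (zp j) (act (zp i) f) l"
    unfolding z lw_dn_higher[OF st t(2)] using True ij st by (simp add: s_def[symmetric] t_def[symmetric] dn_up_swap(1)[OF st])
   finally show ?thesis .
  next
   case False
   show ?thesis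
   proof (cases "m = i")
    case True
    then have t1: "1 <= t" using t by simp
    have "act (zp i) (act (zp j) f) l = \<theta> * of_real (lw t l * cw l) * f (dn t l)"
     unfolding z using True ij by (simp add: t_def)
    also have "... = of_real (sqrt q) * act (zp j) (act (zp i) f) l"
     unfolding z cw_dn[OF t1 t(2)] using True ij by (simp add: t_def)
    finally show ?thesis .
   qed (use False in \<open>simp add: z\<close>)
  qed
  then show ?thesis by (simp add: m that)
 qed
 show "act r f l = 0" if "r = zp i * zs j - poly_scale (of_real (1 / sqrt q)) (zs j * zp i)"
 proof -
  have "of_real (sqrt q) * act (zp i) (act (zs j) f) l = act (zs j) (act (zp i) f) l"
  proof (cases "m < i")
   case True
   note st = conjunct1[OF st[OF True]] conjunct2[OF st[OF True]]
   show ?thesis unfolding z using True ij st t lw_higher[OF st t(2)]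
    by (simp add: s_def[symmetric] t_def[symmetric] lw_lower dn_up_swap[symmetric])
  next
   case False
   then show ?thesis unfolding z using ij t cw_up[of t l]
    by (auto simp: s_def[symmetric] t_def[symmetric])
  qed
  then have "act (zs j) (act (zp i) f) l = of_real (sqrt q) * act (zp i) (act (zs j) f) l" by simp
  then have "act r f l = (1 - of_real (1 / sqrt q * sqrt q)) * act (zp i) (act (zs j) f) l"
   by (simp only: m that) (simp add: algebra_simps)
  then show ?thesis unfolding inv by simp
 qed
next
 fix i assume i: "1 <= i" "i <= n" and r: "r = rel3 i"
 define X where "X = 1 - (\<Sum>j=i+1..n. zp j * zs j)"
 have X: "act X f l = of_real (dw i l) * f l" using act_D[OF i(2) f] by (simp only: X_def Suc_eq_plus1)
 show "act r f l = 0"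
  unfolding r rel3_def X_def[symmetric] m(2,3) act_zz[OF i f] X by (simp add: algebra_simps)
qed
show "act r f l = \<zero>\<^sub>V l" using rc main by (cases "length l = n - m") simp_all
qed

definition mrep :: "qball_elem => (nat list => complex) => nat list => complex" where
"mrep = (SOME \<pi>. representation (qball q n) V \<pi> \<and>
  (ALL p:polys {1..n}. ALL f:cr V. \<pi> (\<iota> p) f = act p f))"

lemma mrep_ex: "representation (qball q n) V mrep \<and>
  (ALL p:polys {1..n}. ALL f:cr V. mrep (\<iota> p) f = act p f)"
unfolding mrep_def
proof (rule someI_ex[where P="%\<pi>. representation (qball q n) V \<pi> \<and>
  (ALL p:polys {1..n}. ALL f:cr V. \<pi> (\<iota> p) f = act p f)"])
have r: "representation poly_alg V act"
 unfolding act_def by (rule poly_act_representation[OF lett_adjoint])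
obtain \<pi> where "representation ucstar V \<pi>"
 "!!p f. p : polys {1..n} ==> f : cr V ==> \<pi> (\<iota> p) f = act p f"
 using extend_rep[OF r act_relators] by blast
then show "EX \<pi>. representation (qball q n) V \<pi> \<and>
  (ALL p:polys {1..n}. ALL f:cr V. \<pi> (\<iota> p) f = act p f)"
 unfolding qball_eq by blast
qed

end

sublocale ball_model \<subseteq> R: cstar_rep "qball q n" "shift_space (n - m)" mrep
by (intro cstar_rep.intro star_rep.intro star_rep_axioms.intro shift_space_hilbert B.cstar_alg_axioms
  B.star_alg_axioms conjunct1[OF mrep_ex])

lemma (in ball_model) mrep_one: "f : cr V ==> mrep \<one>\<^bsub>qball q n\<^esub> f = f"
using mrep_ex polys_closed(2)[of "{1..n}"]
by (auto simp: qball_eq \<iota>_hom(1)[symmetric] act_def poly_act_one simp del: shift_space_simps)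

text \<open>The vector \<open>w = (a - \<mu>) v\<close> satisfies \<open>a w = -\<mu> w\<close>, which positivity of \<open>a\<close> excludes unless
  \<open>w = 0\<close>.\<close>

lemma (in cstar_rep) rep_pos_eigenvector:
assumes a: "A.pos a" and v: "v : cr H" and \<mu>: "\<mu> > 0"
 and e: "\<pi> (a \<cdot>\<^sub>A a) v = of_real (\<mu> * \<mu>) \<odot>\<^sub>H v"
shows "\<pi> a v = of_real \<mu> \<odot>\<^sub>H v"
proof -
have ac: "a : cr A" using A.posD(1)[OF a] by simp
define b where "b = A.csqrt a"
have b: "b : cr A" "b\<^sup>*\<^sub>A = b" "b \<cdot>\<^sub>A b = a"
 using A.csqrt_self_adj[OF a] A.csqrt_square[OF a] by (simp_all add: b_def)
define w where "w = \<pi> a v \<ominus>\<^sub>H of_real \<mu> \<odot>\<^sub>H v"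
have w: "w : cr H" using ac v by (simp add: w_def)
have "\<pi> a w = \<pi> (a \<cdot>\<^sub>A a) v \<ominus>\<^sub>H of_real \<mu> \<odot>\<^sub>H \<pi> a v"
 using ac v by (simp add: w_def H.hdiff_eq rep_simps H.hsmult_simps)
also have "... = (- of_real \<mu>) \<odot>\<^sub>H w"
 unfolding e using ac v by (simp add: w_def H.hdiff_eq H.hsmult_simps H.M.a_comm)
finally have aw: "\<pi> a w = (- of_real \<mu>) \<odot>\<^sub>H w" .
have "(hnorm H (\<pi> b w))\<^sup>2 = Re (ip H w (\<pi> a w))"
 using rep_norm_square[OF b(1) w] unfolding b(2,3) .
also have "... = - \<mu> * (hnorm H w)\<^sup>2"
 unfolding aw H.ip_smult_right[OF w w] H.ip_self[OF w] by simp
finally have "\<mu> * (hnorm H w)\<^sup>2 <= 0" using zero_le_power2[of "hnorm H (\<pi> b w)"] by linarith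
then have "hnorm H w = 0" using \<mu> by (simp add: mult_le_0_iff)
then have "w = \<zero>\<^sub>H" using w by (rule H.hnorm_eq_0D[rotated])
then show ?thesis using H.hdiff_eq_0D[of "\<pi> a v" "of_real \<mu> \<odot>\<^sub>H v"] ac v by (simp add: w_def)
qed

context ball_model
begin

lemma mrep_\<iota>: "p : polys {1..n} ==> f : cr V ==> mrep (\<iota> p) f = act p f"
using mrep_ex by blast

lemma mrep_z:
assumes "1 <= i" "i <= n" "f : cr V"
shows "mrep (qball_gen q n i) f = act (zp i) f" "mrep ((qball_gen q n i)\<^sup>*\<^bsub>qball q n\<^esub>) f = act (zs i) f"
proof -
have p: "zp i : polys {1..n}" "zs i : polys {1..n}" using zp_closed[of i] assms by auto
show "mrep (qball_gen q n i) f = act (zp i) f" unfolding qball_gen_eq by (rule mrep_\<iota>[OF p(1) assms(3)])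
show "mrep ((qball_gen q n i)\<^sup>*\<^bsub>qball q n\<^esub>) f = act (zs i) f"
 unfolding qball_gen_eq qball_eq \<iota>_hom(7)[OF p(1), symmetric] by (rule mrep_\<iota>[OF p(2) assms(3)])
qed

lemma mrep_D: "i <= n ==> f : cr V ==> mrep (B.D i) f = (%l. of_real (dw i l) * f l)"
proof (induction i rule: inc_induct)
case base
have "f l = of_real (dw n l) * f l" for l using base m_le by (cases "length l = n - m") (auto simp: dw_def)
then show ?case unfolding B.D_n using mrep_one[OF base] by auto
next
case (step i)
have i: "1 <= Suc i" "Suc i <= n" using step by auto
note f = step.prems
have zc: "qball_gen q n (Suc i) : cr (qball q n)" using i by simp
have ic: "Suc i : {1..n}" using i by simp
have "mrep (B.D i) f = mrep (B.D (Suc i)) f \<ominus>\<^sub>V act (zp (Suc i) * zs (Suc i)) f"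
 unfolding B.D_Suc[OF step.hyps(2)] using f zc mrep_z[OF i] act_carrier[OF f zp_closed(2)[OF ic]]
 by (simp add: R.rep_diff R.rep_simps act_def poly_act_mult del: shift_space_simps)
also have "... = (%l. of_real (dw i l) * f l)"
proof -
 have c: "mrep (B.D (Suc i)) f : cr V" "act (zp (Suc i) * zs (Suc i)) f : cr V"
  by (intro R.rep_closed f B.D_closed act_carrier polys_closed(4) zp_closed ic)+
 show ?thesis unfolding shift_space_diff[OF c] unfolding step.IH[OF f] act_zz(1)[OF i f] by (simp add: algebra_simps)
qed
finally show ?case .
qed

abbreviation "vac \<equiv> \<xi> (replicate (n - m) 0)"

lemma vac: "vac : cr V" "hnorm V vac = 1" "vac ~= \<zero>\<^sub>V"
proof -
show "vac : cr V" "hnorm V vac = 1" by (rule xi_carrier, simp) (rule hnorm_xi)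
then show "vac ~= \<zero>\<^sub>V" using R.H.hnorm_zero by (metis zero_neq_one)
qed

lemma vac_coherent:
assumes i: "1 <= i" "i <= n"
shows "mrep ((qball_gen q n i)\<^sup>*\<^bsub>qball q n\<^esub>) vac = (if i = m then cnj \<theta> else 0) \<odot>\<^sub>V vac"
proof -
have "act (zs i) vac l = (if i = m then cnj \<theta> else 0) * vac l" for l
proof -
 have "\<xi> (replicate (n - m) 0) (up s l) = 0" if "1 <= s" "s <= n - m" for s
 proof -
  have "up s l ~= replicate (n - m) 0"
  proof
   assume e: "up s l = replicate (n - m) 0"
   then have "length l = n - m" using length_dn(2)[of s l] by simp
   then show False using dn_up(3)[of s l] that e by simp
  qed
  then show ?thesis by (simp add: xi_def)
 qed
 moreover have "cw l * \<xi> (replicate (n - m) 0) l = \<xi> (replicate (n - m) 0) l"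
  by (simp add: xi_def cw_def sum_list_replicate)
 ultimately show ?thesis unfolding act_z[OF i vac(1)] using i by (auto simp: mult.assoc)
qed
then show ?thesis unfolding mrep_z(2)[OF i vac(1)] by (simp add: fun_eq_iff)
qed

lemma zero_or_pos:
fixes k :: "nat list" assumes "length k = r" obtains "k = replicate r 0" | s where "1 <= s" "s <= r" "0 < k ! (s - 1)"
proof (cases "ALL x:set k. x = 0")
case True
then show ?thesis using that(1) replicate_eqI[OF assms, of 0] by blast
next
case False
then obtain i where "i < length k" "k ! i ~= 0" by (metis in_set_conv_nth)
then show ?thesis using that(2)[of "Suc i"] assms by auto
qed

lemma act_xi:
assumes s: "1 <= s" "s <= n - m" and k: "length k = n - m" "0 < k ! (s - 1)"
shows "act (zp (m + s)) (\<xi> (dn s k)) = (%l. of_real (lw s k) * \<xi> k l)"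
proof
fix l
have c: "\<xi> (dn s k) : cr V" using k by (intro xi_carrier) simp
have "lw s l = 0" if "dn s l = dn s k" "l ~= k"
proof (rule ccontr)
 assume "lw s l ~= 0"
 moreover have "length l = n - m" using that(1) k length_dn(1)[of s l] length_dn(1)[of s k] by simp
 ultimately have "up s (dn s l) = l" "up s (dn s k) = k" using s k lw_zero_iff[of s l] by auto
 then show False using that by simp
qed
then show "act (zp (m + s)) (\<xi> (dn s k)) l = of_real (lw s k) * \<xi> k l"
 using s act_z(1)[of "m + s", OF _ _ c, of l] by (auto simp: xi_def)
qed

text \<open>In a nonzero invariant subspace, adjoints lower some vector to one with nonzero coefficient at the lowest basis vector. The powers of
  \<open>D m\<close> isolate that basis vector, and the shifts raise it to all others.\<close>

theorem mrep_irreducible: "irreducible_representation (qball q n) V mrep"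
unfolding irreducible_representation_def
proof (intro conjI allI impI)
show "representation (qball q n) V mrep" using mrep_ex by blast
show "EX x:cr (qball q n). EX v:cr V. mrep x v ~= \<zero>\<^sub>V"
 using mrep_D[OF order_refl vac(1)] mrep_one[OF vac(1)] vac by (intro bexI[of _ "\<one>\<^bsub>qball q n\<^esub>"] bexI[of _ vac]) auto
fix K assume K0: "closed_subspace V K & (ALL x:cr (qball q n). ALL v:K. mrep x v : K)"
note Kp = R.H.closed_subspaceD[OF conjunct1[OF K0]]
have inv: "mrep x v : K" if "x : cr (qball q n)" "v : K" for x v using K0 that by blast
show "K = {\<zero>\<^bsub>V\<^esub>} \<or> K = cr V"
proof (cases "K = {\<zero>\<^bsub>V\<^esub>}")
 case False
 then obtain f k where f: "f : K" "f k ~= 0" using Kp(2) by (auto simp: fun_eq_iff)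
 have zK: "act (zp (m + s)) g : K" "act (zs (m + s)) g : K" if "1 <= s" "s <= n - m" "g : K" for s g
 proof -
  have i: "1 <= m + s" "m + s <= n" using that m_le by auto
  have g: "g : cr V" using that Kp(1) by blast
  have "qball_gen q n (m + s) : cr (qball q n)" using i by simp
  then show "act (zp (m + s)) g : K" "act (zs (m + s)) g : K"
   using inv[OF _ that(3)] unfolding mrep_z[OF i g, symmetric] by auto
 qed
 have "EX g:K. g (replicate (n - m) 0) ~= 0" if "f : K" "f k ~= 0" for f k
  using that
 proof (induction "sum_list k" arbitrary: f k rule: less_induct)
  case less
  have fc: "f : cr V" using less.prems Kp(1) by blast
  then have k: "length k = n - m" using less.prems by (cases "length k = n - m") simp_all
  then show ?case
  proof (cases k rule: zero_or_pos)
   case 1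
   then show ?thesis using less.prems by blast
  next
   case (2 s)
   have u: "up s (dn s k) = k" using 2 k by simp
   have "sum_list (dn s k) < sum_list k" using sum_list_up[of s "dn s k"] 2 k by simp
   moreover have "act (zs (m + s)) f (dn s k) ~= 0"
    using act_z(2)[of "m + s" f "dn s k"] 2 fc less.prems(2) lw_zero_iff[of s k] m_le by (simp add: u)
   ultimately show ?thesis using less.hyps zK(2)[OF 2(1,2) less.prems(1)] by blast
  qed
 qed
 then obtain g where g: "g : K" "g (replicate (n - m) 0) ~= 0" using f by blast
 have gc: "g : cr V" using g Kp(1) by blast
 let ?z = "replicate (n - m) (0::nat)"
 define h where "h = (%j l. of_real ((q ^ sum_list l) ^ j) * g l)"
 have hK: "h j : K" for j
 proof (induction j)
  case 0 then show ?case using g by (simp add: h_def)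
 next
  case (Suc j)
  have hc: "h j : cr V" using Suc Kp(1) by blast
  have "mrep (B.D m) (h j) = h (Suc j)"
   unfolding mrep_D[OF m_le hc] by (simp add: h_def dw_def fun_eq_iff)
  then show ?case using inv[OF B.D_closed Suc, of m] by simp
 qed
 define y where "y = g ?z \<odot>\<^sub>V vac"
 have yc: "y : cr V" unfolding y_def by (rule R.H.hsmult_closed[OF vac(1)])
 have "hlim V h y"
 proof (rule R.H.hlim_squeeze[where b="%j. q ^ j * hnorm V g"])
  show hc: "h j : cr V" for j using hK Kp(1) by blast
  show "hnorm V (h j \<ominus>\<^sub>V y) <= q ^ j * hnorm V g" for j
   unfolding shift_space_diff[OF hc yc]
  proof (rule hnorm_shift_bound(2)[OF gc])
   fix l
   show "cmod (h j l - y l) <= q ^ j * cmod (g l)"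
   proof (cases "length l = n - m")
    case True
    then show ?thesis
    proof (cases l rule: zero_or_pos)
     case 1
     then show ?thesis using q by (simp add: h_def y_def xi_def sum_list_replicate)
    next
     case (2 s)
     then have "l ~= ?z" by auto
     have "0 < sum_list l" using sum_list_up[of s "dn s l"] 2 True by simp
     then have "(q ^ sum_list l) ^ j <= (q ^ 1) ^ j"
      using q by (intro power_mono power_decreasing) auto
     then have "(q ^ sum_list l) ^ j * cmod (g l) <= q ^ j * cmod (g l)" by (intro mult_right_mono) auto
     then show ?thesis using \<open>l ~= ?z\<close> q by (simp add: h_def y_def xi_def norm_mult norm_power)
    qed
   next
    case False
    then have "g l = 0" "l ~= ?z" using gc by auto
    then show ?thesis by (simp add: h_def y_def xi_def)
   qed
  qed (use q in simp)
  show "(%j. q ^ j * hnorm V g) ----> 0"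
   using q by (intro tendsto_mult_left_zero LIMSEQ_power_zero) auto
 qed (rule yc)
 then have "y : K" by (rule Kp(5)[of h y, OF hK yc])
 then have "inverse (g ?z) \<odot>\<^sub>V y : K" by (rule Kp(4))
 then have v: "vac : K" using g(2) by (simp add: y_def mult.assoc[symmetric])
 have "\<xi> k : K" if "length k = n - m" for k
  using that
 proof (induction "sum_list k" arbitrary: k rule: less_induct)
  case less
  from less.prems show ?case
  proof (cases k rule: zero_or_pos)
   case 1
   then show ?thesis using v by simp
  next
   case (2 s)
   have "sum_list (dn s k) < sum_list k" using sum_list_up[of s "dn s k"] 2 less.prems by simp
   then have "act (zp (m + s)) (\<xi> (dn s k)) : K" using zK(1)[OF 2(1,2)] less by simp
   then have "inverse (of_real (lw s k)) \<odot>\<^sub>V (%l. of_real (lw s k) * \<xi> k l) : K"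
    unfolding act_xi[OF 2(1,2) less.prems 2(3)] by (rule Kp(4))
   then show ?thesis using 2(3) lw_zero_iff[of s k] by (simp add: mult.assoc[symmetric])
  qed
 qed
 then show ?thesis using shift_space_span[OF conjunct1[OF K0]] by blast
qed blast
qed

lemma mrep_T:
assumes k: "length k = n - m"
shows "mrep B.T (\<xi> k) = (if m = 0 then of_real (cw k) else 0) \<odot>\<^sub>V \<xi> k"
proof -
have c: "\<xi> k : cr V" by (rule xi_carrier[OF k])
have d: "mrep (B.T \<cdot>\<^bsub>qball q n\<^esub> B.T) (\<xi> k) = (if m = 0 then of_real (cw k * cw k) else 0) \<odot>\<^sub>V \<xi> k"
 unfolding B.T_props(2) mrep_D[OF _ c, of 0, OF le0] cw_square by (auto simp: dw_def xi_def)
show ?thesis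
proof (cases "m = 0")
 case True
 have "0 < cw k" unfolding cw_def using q by simp
 then show ?thesis using R.rep_pos_eigenvector[OF B.T_props(1) c, of "cw k"] d True by simp
next
 case False
 have "mrep (B.T\<^sup>*\<^bsub>qball q n\<^esub> \<cdot>\<^bsub>qball q n\<^esub> B.T) (\<xi> k) = \<zero>\<^sub>V"
  using d False B.T_props(4) by simp
 then show ?thesis using R.rep_star_mult_0D[OF B.T_props(3) c] False by simp
qed
qed

end

section \<open>Irreducible representations and vector states\<close>

context star_rep
begin

lemma irreducible_cases:
assumes "irreducible_representation A H \<pi>" "closed_subspace H K"
 "!!x v. x : cr A ==> v : K ==> \<pi> x v : K"
shows "K = {\<zero>\<^bsub>H\<^esub>} \<or> K = cr H"
using assms unfolding irreducible_representation_def by blast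

lemma kernel_closed_subspace:
assumes "X <= cr A" shows "closed_subspace H {v : cr H. ALL x:X. \<pi> x v = \<zero>\<^bsub>H\<^esub>}"
proof (rule H.closed_subspaceI)
fix s v assume s: "!!k. s k : {v : cr H. ALL x:X. \<pi> x v = \<zero>\<^bsub>H\<^esub>}" and v: "v : cr H" "hlim H s v"
have "\<pi> x v = \<zero>\<^sub>H" if x: "x : X" for x
proof -
 have xc: "x : cr A" using x assms by blast
 have "hlim H (%k. \<pi> x (s k)) (\<pi> x v)" by (rule rep_hlim[OF xc]) (use s v in auto)
 moreover have "\<pi> x (s k) = \<zero>\<^sub>H" for k using s x by blast
 ultimately have "hlim H (%k. \<zero>\<^sub>H) (\<pi> x v)" by simp
 then show ?thesis using H.hlim_unique[of "%_. \<zero>\<^sub>H" "\<pi> x v" "\<zero>\<^sub>H"] H.hlim_const[of "\<zero>\<^sub>H"] xc v by simp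
qed
then show "v : {v : cr H. ALL x:X. \<pi> x v = \<zero>\<^bsub>H\<^esub>}" using v by blast
next
fix u v c assume u: "u : {v : cr H. ALL x:X. \<pi> x v = \<zero>\<^bsub>H\<^esub>}"
have Xc: "x : X ==> x : cr A" for x using assms by blast
show "c \<odot>\<^sub>H u : {v : cr H. ALL x:X. \<pi> x v = \<zero>\<^bsub>H\<^esub>}"
 using u by (auto simp: rep_simps(2)[OF Xc] H.hsmult_simps)
assume "v : {v : cr H. ALL x:X. \<pi> x v = \<zero>\<^bsub>H\<^esub>}"
then show "u \<oplus>\<^sub>H v : {v : cr H. ALL x:X. \<pi> x v = \<zero>\<^bsub>H\<^esub>}" using u by (auto simp: rep_simps(1)[OF Xc])
qed (use assms rep_zero_right in auto)

lemma irreducible_one: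
assumes irr: "irreducible_representation A H \<pi>" and v: "v : cr H"
shows "\<pi> \<one>\<^sub>A v = v"
proof -
let ?K = "{v : cr H. ALL x:{\<one>\<^bsub>A\<^esub>}. \<pi> x v = \<zero>\<^bsub>H\<^esub>}"
have "\<pi> x u : ?K" if x: "x : cr A" and u: "u : ?K" for x u
proof -
 have uc: "u : cr H" "\<pi> \<one>\<^sub>A u = \<zero>\<^sub>H" using u by auto
 have "\<pi> \<one>\<^sub>A (\<pi> x u) = \<pi> x (\<pi> \<one>\<^sub>A u)"
  using rep_simps(4)[OF A.one_closed x uc(1)] rep_simps(4)[OF x A.one_closed uc(1)] x by simp
 then show ?thesis using x uc rep_zero_right by simp
qed
then have "?K = {\<zero>\<^bsub>H\<^esub>} \<or> ?K = cr H"
 by (intro irreducible_cases[OF irr kernel_closed_subspace]) auto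
moreover have "?K ~= cr H"
proof
 assume K: "?K = cr H"
 have "\<pi> x u = \<zero>\<^sub>H" if x: "x : cr A" and u: "u : cr H" for x u
 proof -
  have "\<pi> \<one>\<^sub>A u = \<zero>\<^sub>H" using K u by blast
  then show ?thesis using rep_simps(4)[OF x A.one_closed u] x rep_zero_right by simp
 qed
 then show False using irr unfolding irreducible_representation_def by blast
qed
moreover have "v \<ominus>\<^sub>H \<pi> \<one>\<^sub>A v : ?K"
proof -
 have "\<pi> \<one>\<^sub>A (\<pi> \<one>\<^sub>A v) = \<pi> \<one>\<^sub>A v" using rep_simps(4)[OF A.one_closed A.one_closed v] by simp
 then show ?thesis using v by (simp add: H.hdiff_eq rep_simps) (simp add: H.hdiff_eq[symmetric] H.M.minus_eq H.M.r_neg)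
qed
ultimately have "v \<ominus>\<^sub>H \<pi> \<one>\<^sub>A v = \<zero>\<^sub>H" by blast
then show ?thesis using H.hdiff_eq_0D[of v "\<pi> \<one>\<^sub>A v"] v by simp
qed

lemma irreducible_cyclic:
assumes irr: "irreducible_representation A H \<pi>" and p: "p : cr H" "p ~= \<zero>\<^sub>H" and v: "v : cr H"
shows "EX x. (ALL k. x k : cr A) & hlim H (%k. \<pi> (x k) p) v"
proof -
let ?L = "{\<pi> x p | x. x : cr A}"
have L: "?L <= cr H" using p by auto
have cl: "closed_subspace H (H.hclosure ?L)"
proof (rule H.hclosure_closed_subspace[OF L])
 show "\<zero>\<^sub>H : ?L" using rep_zero[OF p(1)] A.zero_closed by (auto intro!: exI[of _ "\<zero>\<^sub>A"])
 fix u w c assume "u : ?L"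
 then obtain x where x: "x : cr A" "u = \<pi> x p" by blast
 show "c \<odot>\<^sub>H u : ?L" using x rep_simps(5)[OF x(1) p(1), of c] by (auto intro!: exI[of _ "c \<odot>\<^sub>A x"])
 assume "w : ?L"
 then obtain y where y: "y : cr A" "w = \<pi> y p" by blast
 show "u \<oplus>\<^sub>H w : ?L" using x y rep_simps(3)[OF x(1) y(1) p(1)] by (auto intro!: exI[of _ "x \<oplus>\<^sub>A y"])
qed
have "H.hclosure ?L = {\<zero>\<^bsub>H\<^esub>} \<or> H.hclosure ?L = cr H"
proof (rule irreducible_cases[OF irr cl])
 fix a u assume a: "a : cr A" and "u : H.hclosure ?L"
 then obtain s where s: "!!k. s k : ?L" "hlim H s u" and u: "u : cr H" by (auto simp: H.hclosure_def)
 have "hlim H (%k. \<pi> a (s k)) (\<pi> a u)" by (rule rep_hlim[OF a _ u s(2)]) (use s(1) L in blast)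
 moreover have "\<pi> a (s k) : ?L" for k
 proof -
  obtain x where "x : cr A" "s k = \<pi> x p" using s(1)[of k] by blast
  then show ?thesis using rep_simps(4)[OF a, of x p] a p by (auto intro!: exI[of _ "a \<cdot>\<^sub>A x"])
 qed
 ultimately show "\<pi> a u : H.hclosure ?L" using a u unfolding H.hclosure_def by (intro CollectI conjI exI[of _ "%k. \<pi> a (s k)"]) auto
qed
moreover have "p : H.hclosure ?L"
 using H.subset_hclosure[OF L] irreducible_one[OF irr p(1)] A.one_closed by force
ultimately have "v : H.hclosure ?L" using p v by blast
then obtain s where s: "!!k. s k : ?L" "hlim H s v" by (auto simp: H.hclosure_def)
have "ALL k. EX x. x : cr A & s k = \<pi> x p" using s(1) by blast
then obtain x where x: "!!k. x k : cr A" "!!k. s k = \<pi> (x k) p" by metis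
have "s = (%k. \<pi> (x k) p)" using x(2) by (rule ext)
then show ?thesis using s(2) x(1) by blast
qed

end

text \<open>The graph of the intertwiner \<open>\<rho>(x) p \<mapsto> \<rho>'(x) p'\<close>, closed up by sequences.\<close>

definition state_limit where
"state_limit A H \<rho> p H' \<rho>' p' v w \<longleftrightarrow> (EX x. (ALL k. x k : cr A) \<and>
  hlim H (%k. \<rho> (x k) p) v & hlim H' (%k. \<rho>' (x k) p') w)"

lemma state_limit_total:
assumes "star_rep A H \<rho>" "star_rep A H' \<rho>'" and irr: "irreducible_representation A H \<rho>"
 and p: "p : cr H" "p ~= \<zero>\<^sub>H" "p' : cr H'"
 and state: "!!x. x : cr A ==> ip H (\<rho> x p) p = ip H' (\<rho>' x p') p'" and v: "v : cr H"
shows "EX w:cr H'. state_limit A H \<rho> p H' \<rho>' p' v w"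
proof -
interpret R: star_rep A H \<rho> by fact
interpret R': star_rep A H' \<rho>' by fact
obtain x where x: "!!k. x k : cr A" "hlim H (%k. \<rho> (x k) p) v"
 using R.irreducible_cyclic[OF irr p(1,2) v] by blast
have nrm: "hnorm H' (\<rho>' a p' \<ominus>\<^sub>H' \<rho>' b p') = hnorm H (\<rho> a p \<ominus>\<^sub>H \<rho> b p)"
 if ab: "a : cr A" "b : cr A" for a b
proof -
 define d where "d = a \<ominus>\<^sub>A b"
 have d: "d : cr A" using ab by (simp add: d_def)
 have sd: "d\<^sup>*\<^sub>A \<cdot>\<^sub>A d : cr A" using d by simp
 have "ip H (\<rho> d p) (\<rho> d p) = ip H (\<rho> (d\<^sup>*\<^sub>A \<cdot>\<^sub>A d) p) p"
  using d p by (simp add: R.rep_adjoint'[of d "\<rho> d p" p] R.rep_simps)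
 moreover have "ip H' (\<rho>' d p') (\<rho>' d p') = ip H' (\<rho>' (d\<^sup>*\<^sub>A \<cdot>\<^sub>A d) p') p'"
  using d p by (simp add: R'.rep_adjoint'[of d "\<rho>' d p'" p'] R'.rep_simps)
 ultimately have "hnorm H' (\<rho>' d p') = hnorm H (\<rho> d p)" using state[OF sd] by (simp add: hnorm_def)
 then show ?thesis unfolding d_def R.rep_diff[OF ab p(1)] R'.rep_diff[OF ab p(3)] .
qed
have "EX w:cr H'. hlim H' (%k. \<rho>' (x k) p') w"
proof (rule R'.H.complete)
 show "\<rho>' (x k) p' : cr H'" for k using x p by simp
 fix e :: real assume "e > 0"
 then have "\<forall>\<^sub>F k in sequentially. hnorm H (\<rho> (x k) p \<ominus>\<^sub>H v) < e/2"
  using x(2) unfolding hlim_def by (intro order_tendstoD) auto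
 then obtain N where N: "!!k. k >= N ==> hnorm H (\<rho> (x k) p \<ominus>\<^sub>H v) < e/2" by (auto simp: eventually_sequentially)
 have "hnorm H (\<rho> (x k) p \<ominus>\<^sub>H \<rho> (x l) p) < e" if "k >= N" "l >= N" for k l
 proof -
  have c: "\<rho> (x k) p : cr H" "\<rho> (x l) p : cr H" using x p by simp_all
  show ?thesis
   using R.H.hnorm_diff_triangle[OF c(1) v c(2)] R.H.hnorm_diff_commute[OF v c(2)] N[OF that(1)] N[OF that(2)] by linarith
 qed
 then show "EX N. ALL k>=N. ALL l>=N. hnorm H' (\<rho>' (x k) p' \<ominus>\<^sub>H' \<rho>' (x l) p') < e"
  unfolding nrm[OF x(1) x(1)] by blast
qed
then show ?thesis unfolding state_limit_def using x by blast
qed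

text \<open>Uniqueness in the Gelfand-Naimark-Segal construction: equal states make the graph isometric, and irreducibility makes both of its
  projections onto.\<close>

theorem equal_vector_states_equivalent:
assumes R: "star_rep A H \<rho>" and R': "star_rep A H' \<rho>'"
 and irr: "irreducible_representation A H \<rho>" "irreducible_representation A H' \<rho>'"
 and p: "p : cr H" "p ~= \<zero>\<^sub>H" "p' : cr H'" "p' ~= \<zero>\<^sub>H'"
 and state: "!!x. x : cr A ==> ip H (\<rho> x p) p = ip H' (\<rho>' x p') p'"
shows "unitarily_equivalent A H \<rho> H' \<rho>'"
proof -
interpret R: star_rep A H \<rho> by fact
interpret R': star_rep A H' \<rho>' by fact
let ?\<Gamma> = "state_limit A H \<rho> p H' \<rho>' p'"
have ip: "ip H u v = ip H' s t" if gam: "?\<Gamma> u s" "?\<Gamma> v t" and c: "u : cr H" "v : cr H" "s : cr H'" "t : cr H'" for u v s t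
proof -
 obtain x y where x: "!!k. x k : cr A" "hlim H (%k. \<rho> (x k) p) u" "hlim H' (%k. \<rho>' (x k) p') s"
  and y: "!!k. y k : cr A" "hlim H (%k. \<rho> (y k) p) v" "hlim H' (%k. \<rho>' (y k) p') t"
  using gam unfolding state_limit_def by blast
 have "(%k. ip H (\<rho> (x k) p) (\<rho> (y k) p)) ----> ip H u v"
  by (rule R.H.hlim_ip[OF _ c(1) _ c(2) x(2) y(2)]) (use x(1) y(1) p in auto)
 moreover have "(%k. ip H' (\<rho>' (x k) p') (\<rho>' (y k) p')) ----> ip H' s t"
  by (rule R'.H.hlim_ip[OF _ c(3) _ c(4) x(3) y(3)]) (use x(1) y(1) p in auto)
 moreover have "ip H (\<rho> (x k) p) (\<rho> (y k) p) = ip H' (\<rho>' (x k) p') (\<rho>' (y k) p')" for k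
 proof -
  note xy = x(1)[of k] y(1)[of k]
  have yx: "(y k)\<^sup>*\<^sub>A \<cdot>\<^sub>A x k : cr A" using xy by simp
  have "ip H (\<rho> (x k) p) (\<rho> (y k) p) = ip H (\<rho> ((y k)\<^sup>*\<^sub>A \<cdot>\<^sub>A x k) p) p"
   using xy p by (simp add: R.rep_adjoint'[of "y k" "\<rho> (x k) p" p] R.rep_simps)
  moreover have "ip H' (\<rho>' (x k) p') (\<rho>' (y k) p') = ip H' (\<rho>' ((y k)\<^sup>*\<^sub>A \<cdot>\<^sub>A x k) p') p'"
   using xy p by (simp add: R'.rep_adjoint'[of "y k" "\<rho>' (x k) p'" p'] R'.rep_simps)
  ultimately show ?thesis using state[OF yx] by simp
 qed
 ultimately show ?thesis using LIMSEQ_unique by simp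
qed
have fn: "s = t" if gam: "?\<Gamma> u s" "?\<Gamma> u t" and c: "u : cr H" "s : cr H'" "t : cr H'" for u s t
proof -
 have "ip H' (s \<ominus>\<^sub>H' t) (s \<ominus>\<^sub>H' t) = 0"
  using ip[OF gam(1,1) c(1,1,2,2)] ip[OF gam(1,2) c(1,1,2,3)] ip[OF gam(2,1) c(1,1,3,2)] ip[OF gam(2,2) c(1,1,3,3)] c
  by (simp add: R'.H.ip_diff_left R'.H.ip_diff_right)
 then have "s \<ominus>\<^sub>H' t = \<zero>\<^sub>H'" using c by (intro R'.H.hnorm_eq_0D) (auto simp: hnorm_def)
 then show ?thesis by (rule R'.H.hdiff_eq_0D[OF c(2,3)])
qed
define U where "U v = (SOME w. w : cr H' & ?\<Gamma> v w)" for v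
have U: "U v : cr H'" "?\<Gamma> v (U v)" if v: "v : cr H" for v
proof -
 have "EX w. w : cr H' & ?\<Gamma> v w" using state_limit_total[OF R R' irr(1) p(1,2,3) state v] by blast
 from someI_ex[OF this] show "U v : cr H'" "?\<Gamma> v (U v)" unfolding U_def by auto
qed
have UI: "U v = w" if "v : cr H" "w : cr H'" "?\<Gamma> v w" for v w
 using fn[OF U(2)[OF that(1)] that(3) that(1) U(1)[OF that(1)] that(2)] .
have lin: "?\<Gamma> (u \<oplus>\<^sub>H v) (U u \<oplus>\<^sub>H' U v)" "?\<Gamma> (c \<odot>\<^sub>H u) (c \<odot>\<^sub>H' U u)" "?\<Gamma> (\<rho> a u) (\<rho>' a (U u))"
 if c: "u : cr H" "v : cr H" and a: "a : cr A" for u v c a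
proof -
 obtain x y where x: "!!k. x k : cr A" "hlim H (%k. \<rho> (x k) p) u" "hlim H' (%k. \<rho>' (x k) p') (U u)"
  and y: "!!k. y k : cr A" "hlim H (%k. \<rho> (y k) p) v" "hlim H' (%k. \<rho>' (y k) p') (U v)"
  using U(2)[OF c(1)] U(2)[OF c(2)] unfolding state_limit_def by blast
 have m: "\<rho> (x k) p : cr H" "\<rho> (y k) p : cr H" "\<rho>' (x k) p' : cr H'" "\<rho>' (y k) p' : cr H'" for k
  using x(1) y(1) p by auto
 note Uc = U(1)[OF c(1)] U(1)[OF c(2)]
 show "?\<Gamma> (u \<oplus>\<^sub>H v) (U u \<oplus>\<^sub>H' U v)" unfolding state_limit_def
  using R.H.hlim_add[OF m(1,2) c x(2) y(2)] R'.H.hlim_add[OF m(3,4) Uc x(3) y(3)] x(1) y(1) p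
  by (intro exI[of _ "%k. x k \<oplus>\<^sub>A y k"]) (simp add: R.rep_simps R'.rep_simps)
 show "?\<Gamma> (c \<odot>\<^sub>H u) (c \<odot>\<^sub>H' U u)" unfolding state_limit_def
  using R.H.hlim_smult[OF m(1) c(1) x(2)] R'.H.hlim_smult[OF m(3) Uc(1) x(3)] x(1) p
  by (intro exI[of _ "%k. c \<odot>\<^sub>A x k"]) (simp add: R.rep_simps R'.rep_simps)
 show "?\<Gamma> (\<rho> a u) (\<rho>' a (U u))" unfolding state_limit_def
  using R.rep_hlim[OF a m(1) c(1) x(2)] R'.rep_hlim[OF a m(3) Uc(1) x(3)] x(1) p a
  by (intro exI[of _ "%k. a \<cdot>\<^sub>A x k"]) (simp add: R.rep_simps R'.rep_simps)
qed
have Uip: "ip H' (U u) (U v) = ip H u v" if "u : cr H" "v : cr H" for u v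
 using ip[OF U(2) U(2) that] U(1) that by simp
have inj: "inj_on U (cr H)"
proof (rule inj_onI)
 fix u v assume c: "u : cr H" "v : cr H" and e: "U u = U v"
 have "ip H (u \<ominus>\<^sub>H v) (u \<ominus>\<^sub>H v) = 0"
  using Uip[OF c(1,1)] Uip[OF c(1,2)] Uip[OF c(2,1)] Uip[OF c(2,2)] c
  by (simp add: R.H.ip_diff_left R.H.ip_diff_right e)
 then have "u \<ominus>\<^sub>H v = \<zero>\<^sub>H" using c by (intro R.H.hnorm_eq_0D) (auto simp: hnorm_def)
 then show "u = v" by (rule R.H.hdiff_eq_0D[OF c])
qed
have surj: "U ` cr H = cr H'"
proof
 show "U ` cr H <= cr H'" using U(1) by blast
 show "cr H' <= U ` cr H"
 proof
  fix w assume w: "w : cr H'"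
  obtain v where v: "v : cr H" "state_limit A H' \<rho>' p' H \<rho> p w v"
   using state_limit_total[OF R' R irr(2) p(3,4,1) state[symmetric] w] by blast
  then have "?\<Gamma> v w" unfolding state_limit_def by blast
  then show "w : U ` cr H" using UI[OF v(1) w] v(1) by blast
 qed
qed
have "unitary_op H H' U"
 unfolding unitary_op_def hlinear_def bij_betw_def
proof (intro conjI ballI allI inj surj)
 show "U : cr H \<rightarrow> cr H'" using U(1) by blast
 fix u v c assume c: "u : cr H" "v : cr H"
 show "ip H' (U u) (U v) = ip H u v" by (rule Uip[OF c])
 show "U (u \<oplus>\<^sub>H v) = U u \<oplus>\<^sub>H' U v" by (rule UI[OF _ _ lin(1)[OF c R.A.one_closed]]) (use c U(1) in auto)
next
 fix u c assume c: "u : cr H"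
 show "U (c \<odot>\<^sub>H u) = c \<odot>\<^sub>H' U u" by (rule UI[OF _ _ lin(2)[OF c c R.A.one_closed]]) (use c U(1) in auto)
qed
moreover have "U (\<rho> x v) = \<rho>' x (U v)" if "x : cr A" "v : cr H" for x v
 by (rule UI[OF _ _ lin(3)[OF that(2,2,1)]]) (use that U(1) in auto)
ultimately show ?thesis unfolding unitarily_equivalent_def by blast
qed

section \<open>Coherent vectors\<close>

text \<open>Normally ordered elements: products of the \<open>z\<^sub>j\<close> applied on the left to elements of \<open>X\<close>.\<close>

inductive_set (in ball_relations) zspan :: "'a set => 'a set" for X where
base: "x : X ==> x : zspan X"
| add: "x : zspan X ==> y : zspan X ==> x \<oplus> y : zspan X"
| scale: "x : zspan X ==> c \<odot> x : zspan X"
| mult: "1 <= j ==> j <= n ==> x : zspan X ==> z j \<cdot> x : zspan X"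

context ball_relations
begin

lemma zspan_closed: "x : zspan X ==> X <= cr A ==> x : cr A"
by (induction rule: zspan.induct) auto

text \<open>The relations move every \<open>z\<^sub>i\<^sup>*\<close> to the right through the \<open>z\<^sub>j\<close>, where it meets
  \<open>X\<close> and is absorbed modulo the given congruence. The congruence is a parameter because it compares the action on one vector in two
  representations at once in one application, and the action on a whole subspace in the other.\<close>

lemma normal_order:
fixes eqv :: "'a => 'a => bool"
assumes X: "X <= cr A" "\<one> : X"
 and refl: "!!x. x : cr A ==> eqv x x" and trans: "!!x y w. eqv x y ==> eqv y w ==> eqv x w"
 and add: "!!x y x' y'. eqv x y ==> eqv x' y' ==> eqv (x \<oplus> x') (y \<oplus> y')"
 and scale: "!!c x y. eqv x y ==> eqv (c \<odot> x) (c \<odot> y)"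
 and mult: "!!a x y. a : cr A ==> eqv x y ==> eqv (a \<cdot> x) (a \<cdot> y)"
 and dom: "!!x y. eqv x y ==> x : cr A & y : cr A"
 and low: "!!i x. 1 <= i ==> i <= n ==> x : X ==> EX y:zspan X. eqv ((z i)\<^sup>* \<cdot> x) y"
 and a: "a : cr A"
shows "EX s. (ALL k. s k : cr A & (EX y:zspan X. eqv (s k) y)) & norm_lim A s a"
proof -
have star: "ALL i. 1 <= i --> i <= n --> (EX y:zspan X. eqv ((z i)\<^sup>* \<cdot> x) y)" if "x : zspan X" for x
 using that
proof (induction rule: zspan.induct)
 case (base x)
 then show ?case using low by blast
next
 case (add x x')
 show ?case
 proof (intro allI impI)
  fix i assume i: "1 <= i" "i <= n"
  obtain y y' where y: "y : zspan X" "eqv ((z i)\<^sup>* \<cdot> x) y" "y' : zspan X" "eqv ((z i)\<^sup>* \<cdot> x') y'"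
   using add.IH i by blast
  have "(z i)\<^sup>* \<cdot> (x \<oplus> x') = (z i)\<^sup>* \<cdot> x \<oplus> (z i)\<^sup>* \<cdot> x'"
   using i zspan_closed[OF add.hyps(1) X(1)] zspan_closed[OF add.hyps(2) X(1)] by (simp add: r_distr)
  then show "EX y:zspan X. eqv ((z i)\<^sup>* \<cdot> (x \<oplus> x')) y"
   using assms(5)[OF y(2,4)] zspan.add[OF y(1,3)] by auto
 qed
next
 case (scale x c)
 show ?case
 proof (intro allI impI)
  fix i assume i: "1 <= i" "i <= n"
  obtain y where y: "y : zspan X" "eqv ((z i)\<^sup>* \<cdot> x) y" using scale.IH i by blast
  have "(z i)\<^sup>* \<cdot> (c \<odot> x) = c \<odot> ((z i)\<^sup>* \<cdot> x)"
   using i zspan_closed[OF scale.hyps X(1)] by (simp add: smult_mult_right)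
  then show "EX y:zspan X. eqv ((z i)\<^sup>* \<cdot> (c \<odot> x)) y"
   using assms(6)[OF y(2)] zspan.scale[OF y(1)] by auto
 qed
next
 case (mult j x)
 have xc: "x : cr A" using zspan_closed[OF mult.hyps(3) X(1)] .
 have zzx: "EX y:zspan X. eqv (z i \<cdot> ((z k)\<^sup>* \<cdot> x)) y" if ik: "1 <= i" "i <= n" "1 <= k" "k <= n" for i k
 proof -
  obtain y where y: "y : zspan X" "eqv ((z k)\<^sup>* \<cdot> x) y" using mult.IH ik by blast
  show ?thesis using assms(7)[OF z_closed[OF ik(1,2)] y(2)] zspan.mult[OF ik(1,2) y(1)] by blast
 qed
 have Dx: "EX y:zspan X. eqv (D m \<cdot> x) y" if "m <= n" for m
  using that
 proof (induction m rule: inc_induct)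
  case base
  show ?case using mult.hyps(3) refl[OF xc] xc by (auto simp: D_n)
 next
  case (step m)
  have zc: "z (Suc m) : cr A" using step by auto
  obtain y where y: "y : zspan X" "eqv (D (Suc m) \<cdot> x) y" using step by blast
  obtain y' where y': "y' : zspan X" "eqv (z (Suc m) \<cdot> ((z (Suc m))\<^sup>* \<cdot> x)) y'"
   using zzx[of "Suc m" "Suc m"] step by auto
  have "D m \<cdot> x = D (Suc m) \<cdot> x \<oplus> (- 1) \<odot> (z (Suc m) \<cdot> ((z (Suc m))\<^sup>* \<cdot> x))"
   unfolding D_Suc[OF step.hyps(2)] using zc xc by (simp add: diff_eq_smult l_distr smult_mult_left m_assoc)
  then show ?case using assms(5)[OF y(2) assms(6)[OF y'(2), of "- 1"]] zspan.add[OF y(1) zspan.scale[OF y'(1)]] by auto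
 qed
 show ?case
 proof (intro allI impI)
  fix i assume i: "1 <= i" "i <= n"
  have c: "z i : cr A" "z j : cr A" using i mult.hyps by auto
  show "EX y:zspan X. eqv ((z i)\<^sup>* \<cdot> (z j \<cdot> x)) y"
  proof (cases "i = j")
   case True
   obtain y where y: "y : zspan X" "eqv (z i \<cdot> ((z i)\<^sup>* \<cdot> x)) y" using zzx[OF i i] by blast
   obtain y' where y': "y' : zspan X" "eqv (D i \<cdot> x) y'" using Dx i by blast
   have "(z i)\<^sup>* \<cdot> (z j \<cdot> x) = ((z i)\<^sup>* \<cdot> z i) \<cdot> x" using True c xc by (simp add: m_assoc)
   also have "... = of_real q \<odot> (z i \<cdot> ((z i)\<^sup>* \<cdot> x)) \<oplus> of_real (1 - q) \<odot> (D i \<cdot> x)"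
    unfolding z_star_z[OF i] using c xc D_closed[of i] by (simp add: l_distr smult_mult_left m_assoc)
   finally show ?thesis
    using assms(5)[OF assms(6)[OF y(2), of "of_real q"] assms(6)[OF y'(2), of "of_real (1 - q)"]]
     zspan.add[OF zspan.scale[OF y(1)] zspan.scale[OF y'(1)]] by auto
  next
   case False
   obtain y where y: "y : zspan X" "eqv (z j \<cdot> ((z i)\<^sup>* \<cdot> x)) y" using zzx[OF mult.hyps(1,2) i] by blast
   have "(z i)\<^sup>* \<cdot> (z j \<cdot> x) = ((z i)\<^sup>* \<cdot> z j) \<cdot> x" using c xc by (simp add: m_assoc)
   also have "... = rq \<odot> (z j \<cdot> ((z i)\<^sup>* \<cdot> x))"
    using z_star_z_ne[of i j] False i mult.hyps c xc by (simp add: smult_mult_left m_assoc)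
   finally show ?thesis using assms(6)[OF y(2), of rq] zspan.scale[OF y(1), of rq] by auto
  qed
 qed
qed
let ?E = "{b : cr A. ALL x:zspan X. EX y:zspan X. eqv (b \<cdot> x) y}"
have zc: "x : cr A" if "x : zspan X" for x using zspan_closed[OF that X(1)] .
have "EX s. (ALL k. s k : ?E) & norm_lim A s a"
proof (rule dense[OF _ _ _ _ _ _ _ a])
 show "?E <= cr A" by blast
 show "\<one> : ?E" using refl zc by auto
 show "z i : ?E" if "1 <= i" "i <= n" for i
 proof (intro CollectI conjI ballI)
  show "z i : cr A" using that by simp
  fix x assume x: "x : zspan X"
  show "EX y:zspan X. eqv (z i \<cdot> x) y"
   by (rule bexI[OF refl zspan.mult[OF that x]]) (use that zc[OF x] in simp)
 qed
 show "(z i)\<^sup>* : ?E" if "1 <= i" "i <= n" for i using that star by auto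
 show "b \<oplus> b' : ?E" if b: "b : ?E" "b' : ?E" for b b'
 proof (intro CollectI conjI ballI)
  show "b \<oplus> b' : cr A" using b by auto
  fix x assume x: "x : zspan X"
  obtain y y' where y: "y : zspan X" "eqv (b \<cdot> x) y" "y' : zspan X" "eqv (b' \<cdot> x) y'" using b x by blast
  have "(b \<oplus> b') \<cdot> x = b \<cdot> x \<oplus> b' \<cdot> x" using b zc[OF x] by (auto simp: l_distr)
  then show "EX y:zspan X. eqv ((b \<oplus> b') \<cdot> x) y" using add[OF y(2,4)] zspan.add[OF y(1,3)] by auto
 qed
 show "c \<odot> b : ?E" if b: "b : ?E" for b c
 proof (intro CollectI conjI ballI)
  show "c \<odot> b : cr A" using b by auto
  fix x assume x: "x : zspan X"
  obtain y where y: "y : zspan X" "eqv (b \<cdot> x) y" using b x by blast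
  have "(c \<odot> b) \<cdot> x = c \<odot> (b \<cdot> x)" using b zc[OF x] by (auto simp: smult_mult_left)
  then show "EX y:zspan X. eqv ((c \<odot> b) \<cdot> x) y" using scale[OF y(2)] zspan.scale[OF y(1)] by auto
 qed
 show "b \<cdot> b' : ?E" if b: "b : ?E" "b' : ?E" for b b'
 proof (intro CollectI conjI ballI)
  show "b \<cdot> b' : cr A" using b by auto
  fix x assume x: "x : zspan X"
  obtain y where y: "y : zspan X" "eqv (b' \<cdot> x) y" using b x by blast
  obtain y' where y': "y' : zspan X" "eqv (b \<cdot> y) y'" using b y by blast
  have "(b \<cdot> b') \<cdot> x = b \<cdot> (b' \<cdot> x)" using b zc[OF x] by (auto simp: m_assoc)
  then show "EX y:zspan X. eqv ((b \<cdot> b') \<cdot> x) y" using trans[OF mult[OF _ y(2), of b] y'(2)] b y'(1) by auto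
 qed
qed
then obtain s where s: "!!k. s k : ?E" "norm_lim A s a" by blast
have "s k : cr A & (EX y:zspan X. eqv (s k) y)" for k
proof -
 obtain y where "y : zspan X" "eqv (s k \<cdot> \<one>) y" using s(1)[of k] zspan.base[OF X(2)] by blast
 then show ?thesis using s(1)[of k] by auto
qed
then show ?thesis using s(2) by blast
qed

text \<open>On normally ordered elements the vector state of \<open>p\<close> is computed from the \<open>c\<^sub>i\<close> alone.\<close>

theorem coherent_equivalent:
assumes R: "cstar_rep A H \<rho>" and R': "cstar_rep A H' \<rho>'"
 and irr: "irreducible_representation A H \<rho>" "irreducible_representation A H' \<rho>'"
 and p: "p : cr H" "hnorm H p = 1" "p' : cr H'" "hnorm H' p' = 1"
 and c: "!!i. 1 <= i ==> i <= n ==> \<rho> ((z i)\<^sup>*) p = c i \<odot>\<^sub>H p"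
 and c': "!!i. 1 <= i ==> i <= n ==> \<rho>' ((z i)\<^sup>*) p' = c i \<odot>\<^sub>H' p'"
shows "unitarily_equivalent A H \<rho> H' \<rho>'"
proof -
interpret R: cstar_rep A H \<rho> by fact
interpret R': cstar_rep A H' \<rho>' by fact
have nz: "p ~= \<zero>\<^sub>H" "p' ~= \<zero>\<^sub>H'" using p(2,4) by auto
note one = R.irreducible_one[OF irr(1) p(1)] R'.irreducible_one[OF irr(2) p(3)]
define eqv where "eqv x y \<longleftrightarrow> x : cr A & y : cr A & \<rho> x p = \<rho> y p & \<rho>' x p' = \<rho>' y p'" for x y
have X1: "{\<one>} <= cr A" by simp
have on_zspan: "ip H (\<rho> y p) p = ip H' (\<rho>' y p') p'" if "y : zspan {\<one>}" for y
 using that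
proof (induction rule: zspan.induct)
 case (base x)
 then show ?case using one p by (simp add: R.H.ip_self R'.H.ip_self)
next
 case (add x y)
 then show ?case using zspan_closed[OF add.hyps(1) X1] zspan_closed[OF add.hyps(2) X1] p
  by (simp add: R.rep_simps R'.rep_simps R.H.ip_add_left R'.H.ip_add_left)
next
 case (scale x b)
 then show ?case using zspan_closed[OF scale.hyps X1] p
  by (simp add: R.rep_simps R'.rep_simps R.H.ip_smult_left R'.H.ip_smult_left)
next
 case (mult j x)
 have xc: "x : cr A" "z j : cr A" using zspan_closed[OF mult.hyps(3) X1] mult.hyps by auto
 have "ip H (\<rho> (z j \<cdot> x) p) p = ip H (\<rho> x p) (c j \<odot>\<^sub>H p)"
  using xc p by (simp add: R.rep_simps R.rep_adjoint c[OF mult.hyps(1,2)])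
 moreover have "ip H' (\<rho>' (z j \<cdot> x) p') p' = ip H' (\<rho>' x p') (c j \<odot>\<^sub>H' p')"
  using xc p by (simp add: R'.rep_simps R'.rep_adjoint c'[OF mult.hyps(1,2)])
 ultimately show ?case using mult.IH xc p by (simp add: R.H.ip_smult_right R'.H.ip_smult_right)
qed
have state: "ip H (\<rho> a p) p = ip H' (\<rho>' a p') p'" if a: "a : cr A" for a
proof -
 have "EX s. (ALL k. s k : cr A & (EX y:zspan {\<one>}. eqv (s k) y)) & norm_lim A s a"
 proof (rule normal_order[OF X1 _ _ _ _ _ _ _ _ a])
  fix i x assume i: "1 <= i" "i <= n" and x: "x : {\<one>}"
  have "eqv ((z i)\<^sup>* \<cdot> x) (c i \<odot> \<one>)"
   using c[OF i] c'[OF i] i x p one by (simp add: eqv_def R.rep_simps R'.rep_simps)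
  then show "EX y:zspan {\<one>}. eqv ((z i)\<^sup>* \<cdot> x) y" using zspan.scale[OF zspan.base] by blast
 qed (use p in \<open>auto simp: eqv_def R.rep_simps R'.rep_simps\<close>)
 then obtain s where s: "!!k. s k : cr A" "!!k. EX y:zspan {\<one>}. eqv (s k) y" "norm_lim A s a" by blast
 have e: "ip H (\<rho> (s k) p) p = ip H' (\<rho>' (s k) p') p'" for k
  using s(2)[of k] on_zspan unfolding eqv_def by metis
 have "(%k. ip H (\<rho> (s k) p) p) ----> ip H (\<rho> a p) p"
  by (rule R.H.hlim_ip[OF _ _ _ _ R.rep_norm_lim[OF s(1) a s(3) p(1)] R.H.hlim_const]) (use s(1) a p in auto)
 moreover have "(%k. ip H' (\<rho>' (s k) p') p') ----> ip H' (\<rho>' a p') p'"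
  by (rule R'.H.hlim_ip[OF _ _ _ _ R'.rep_norm_lim[OF s(1) a s(3) p(3)] R'.H.hlim_const]) (use s(1) a p in auto)
 ultimately show ?thesis unfolding e by (rule LIMSEQ_unique)
qed
show ?thesis
 by (rule equal_vector_states_equivalent[OF R.star_rep_axioms R'.star_rep_axioms irr p(1) nz(1) p(3) nz(2) state])
qed

end

section \<open>The irreducible representations of the quantum ball\<close>

locale ball_irrep = ball_relations A q n z + R: cstar_rep A H \<rho>
for A :: "('a, 'm) cstar_scheme" (structure) and q n z
 and H :: "('h, 'l) hilbert_scheme" and \<rho> :: "'a => 'h => 'h" +
assumes irr: "irreducible_representation A H \<rho>"
begin

lemma one [simp]: "u : cr H ==> \<rho> \<one> u = u"
by (rule R.irreducible_one[OF irr])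

text \<open>Since \<open>D n = 1\<close>, there is a least index whose \<open>D\<close> acts nontrivially.\<close>

lemma D_nonzero: "EX m<=n. (EX u:cr H. \<rho> (D m) u ~= \<zero>\<^sub>H) & (ALL i<m. ALL u:cr H. \<rho> (D i) u = \<zero>\<^sub>H)"
proof -
let ?P = "%m. EX u:cr H. \<rho> (D m) u ~= \<zero>\<^sub>H"
obtain x u where xu: "x : cr A" "u : cr H" "\<rho> x u ~= \<zero>\<^sub>H"
 using irr unfolding irreducible_representation_def by blast
then have "u ~= \<zero>\<^sub>H" using R.rep_zero_right by auto
then have P: "?P n" using xu(2) by (auto simp: D_n)
have "(LEAST m. ?P m) <= n" "?P (LEAST m. ?P m)" by (rule Least_le[of ?P, OF P], rule LeastI[of ?P, OF P])
then show ?thesis using not_less_Least[of _ ?P] by blast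
qed

lemma zz_rep:
assumes "1 <= i" "i <= n" "u : cr H"
shows "\<rho> (z i) (\<rho> ((z i)\<^sup>*) u) = \<rho> (D i) u \<ominus>\<^sub>H \<rho> (D (i - 1)) u"
 "\<rho> ((z i)\<^sup>*) (\<rho> (z i) u) = \<rho> (D i) u \<ominus>\<^sub>H of_real q \<odot>\<^sub>H \<rho> (D (i - 1)) u"
proof -
have zc: "z i : cr A" "(z i)\<^sup>* : cr A" using assms by auto
have "x \<ominus> (x \<ominus> y) = y" if "x : cr A" "y : cr A" for x y using that by algebra
note sub = this
have "z i \<cdot> (z i)\<^sup>* = D i \<ominus> D (i - 1)" unfolding D_step[OF assms(1,2)] using zc by (simp add: sub)
then show "\<rho> (z i) (\<rho> ((z i)\<^sup>*) u) = \<rho> (D i) u \<ominus>\<^sub>H \<rho> (D (i - 1)) u"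
 using R.rep_simps(4)[OF zc assms(3)] R.rep_diff[OF D_closed D_closed assms(3)] by simp
have "(z i)\<^sup>* \<cdot> z i = D i \<ominus> of_real q \<odot> D (i - 1)"
 unfolding D_minus_z_star_z[OF assms(1,2), symmetric] using zc by (simp add: sub)
then show "\<rho> ((z i)\<^sup>*) (\<rho> (z i) u) = \<rho> (D i) u \<ominus>\<^sub>H of_real q \<odot>\<^sub>H \<rho> (D (i - 1)) u"
 using R.rep_simps(4)[OF zc(2,1) assms(3)] R.rep_diff[OF D_closed, of "of_real q \<odot> D (i - 1)" u] assms(3)
 by (simp add: R.rep_simps)
qed

lemma rep_finsum_ip:
assumes "finite I" "!!i. i : I ==> f i : cr A" and u: "u : cr H"
shows "ip H (\<rho> (\<Oplus>i\<in>I. f i) u) u = (\<Sum>i\<in>I. ip H (\<rho> (f i) u) u)"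
using assms(1,2)
proof (induction I rule: finite_induct)
case (insert i I)
have "(\<Oplus>j\<in>insert i I. f j) = f i \<oplus> (\<Oplus>j\<in>I. f j)" using insert by (intro finsum_insert) auto
moreover have "(\<Oplus>j\<in>I. f j) : cr A" using insert by auto
ultimately show ?case using insert u by (simp add: R.rep_simps R.H.ip_add_left)
qed (use u R.rep_zero in simp)

lemma one_minus_D_form:
assumes u: "u : cr H"
shows "Re (ip H (\<rho> (\<one> \<ominus> D m) u) u) = (\<Sum>j\<in>{Suc m..n}. (hnorm H (\<rho> ((z j)\<^sup>*) u))\<^sup>2)"
proof -
have "ip H (\<rho> (z j \<cdot> (z j)\<^sup>*) u) u = of_real ((hnorm H (\<rho> ((z j)\<^sup>*) u))\<^sup>2)" if "j : {Suc m..n}" for j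
proof -
 have zc: "z j : cr A" using that by auto
 show ?thesis using zc u R.H.ip_self[of "\<rho> ((z j)\<^sup>*) u"] by (simp add: R.rep_simps R.rep_adjoint[of "z j"])
qed
then show ?thesis unfolding one_minus_D
 using rep_finsum_ip[of "{Suc m..n}" "%j. z j \<cdot> (z j)\<^sup>*", OF _ _ u] by simp
qed

lemma D_pow_step:
assumes m: "m <= n" and u: "u : cr H"
shows "hnorm H (\<rho> (D m [^] k) u \<ominus>\<^sub>H \<rho> (D m [^] Suc k) u) <= zbound * hnorm H u * q ^ (k::nat)"
proof -
have p1: "nrm A (D m [^] k) <= 1" for k :: nat
proof (induction k)
 case (Suc k)
 have "nrm A (D m [^] k \<cdot> D m) <= nrm A (D m [^] k) * nrm A (D m)" by (rule nrm_mult) simp_all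
 also have "... <= 1 * 1" using Suc nrm_D_le_1[OF m] nrm_nonneg by (intro mult_mono) auto
 finally show ?case by simp
qed (simp add: nrm_one_le)
have "D m [^] k \<ominus> D m [^] Suc k = D m [^] k \<cdot> (\<one> \<ominus> D m)"
 by (simp add: minus_eq r_distr r_minus)
then have "\<rho> (D m [^] k) u \<ominus>\<^sub>H \<rho> (D m [^] Suc k) u = \<rho> (D m [^] k \<cdot> (\<one> \<ominus> D m)) u"
 using R.rep_diff[of "D m [^] k" "D m [^] Suc k" u] u by simp
also have "hnorm H ... <= nrm A (D m [^] k \<cdot> (\<one> \<ominus> D m)) * hnorm H u" by (rule R.rep_contractive) (use u in simp_all)
also have "... <= (zbound * q ^ k * nrm A (D m [^] k)) * hnorm H u"
 by (rule mult_right_mono[OF q_commuting_pow_bound]) (use D_q_commute u in auto)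
also have "... <= (zbound * q ^ k * 1) * hnorm H u"
 using p1 zbound_nonneg q u by (intro mult_right_mono mult_left_mono) auto
finally show ?thesis by (simp add: mult_ac)
qed

lemma D_pow_limit:
assumes m: "m <= n" and u: "u : cr H"
shows "EX p:cr H. hlim H (%k. \<rho> (D m [^] (k::nat)) u) p & \<rho> (D m) p = p"
proof -
let ?s = "%k::nat. \<rho> (D m [^] k) u"
define B where "B = zbound * hnorm H u"
have B: "0 <= B" using zbound_nonneg u by (simp add: B_def)
have sc: "?s k : cr H" for k using u by simp
have b: "hnorm H (?s k \<ominus>\<^sub>H ?s (k + l)) <= B * (q ^ k - q ^ (k + l)) / (1 - q)" for k l
proof (induction l)
 case 0
 then show ?case using sc[of k] by (simp add: R.H.M.minus_eq R.H.M.r_neg)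
next
 case (Suc l)
 have "hnorm H (?s k \<ominus>\<^sub>H ?s (k + Suc l)) <= B * (q ^ k - q ^ (k + l)) / (1 - q) + B * q ^ (k + l)"
  using R.H.hnorm_diff_triangle[OF sc[of k] sc[of "k + l"] sc[of "Suc (k + l)"]] Suc D_pow_step[OF m u, of "k + l"]
  by (simp add: B_def)
 also have "... = B * (q ^ k - q ^ (k + Suc l)) / (1 - q)" using q by (simp add: field_simps)
 finally show ?case .
qed
have "EX p:cr H. hlim H ?s p"
proof (rule R.H.hcauchy_limI[OF sc])
 fix k l :: nat assume "k <= l"
 then have "hnorm H (?s k \<ominus>\<^sub>H ?s l) <= B * (q ^ k - q ^ l) / (1 - q)" using b[of k "l - k"] by simp
 also have "... <= B / (1 - q) * q ^ k" using q B by (simp add: divide_right_mono mult_left_mono)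
 finally show "hnorm H (?s k \<ominus>\<^sub>H ?s l) <= B / (1 - q) * q ^ k" .
qed (use q in \<open>auto intro!: tendsto_mult_right_zero LIMSEQ_power_zero\<close>)
then obtain p where p: "p : cr H" "hlim H ?s p" by blast
have "hlim H (%k. \<rho> (D m) (?s k)) (\<rho> (D m) p)" by (rule R.rep_hlim[OF D_closed sc p])
moreover have "\<rho> (D m) (?s k) = ?s (Suc k)" for k
 using R.rep_simps(4)[of "D m" "D m [^] k" u] u nat_pow_Suc2[of "D m" k] by simp
ultimately have "hlim H (%k. ?s (Suc k)) (\<rho> (D m) p)" by simp
moreover have "hlim H (%k. ?s (Suc k)) p" using p(2) unfolding hlim_def by (rule LIMSEQ_Suc)
ultimately have "\<rho> (D m) p = p" using R.H.hlim_unique[of "%k. ?s (Suc k)" "\<rho> (D m) p" p, OF sc _ p(1)] p(1) by simp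
then show ?thesis using p by blast
qed

text \<open>For \<open>r = (1 - D m)\<^sup>1\<^sup>/\<^sup>2\<close> the relation \<open>D m (1 - D m) = q \<Sum> z\<^sub>j (D m)
  z\<^sub>j\<^sup>*\<close> improves the bound \<open>c\<close> to \<open>q c\<close> on the range of \<open>r\<close>. This range is dense: \<open>v -
  (D m)\<^sup>k v\<close> lies in it and tends to \<open>v\<close>.\<close>

lemma D_form_contracts:
assumes m: "m <= n" and c: "0 <= c"
 and lim0: "!!u. u : cr H ==> hlim H (%k. \<rho> (D m [^] (k::nat)) u) \<zero>\<^sub>H"
 and le: "!!u. u : cr H ==> Re (ip H (\<rho> (D m) u) u) <= c * (hnorm H u)\<^sup>2"
 and u: "u : cr H"
shows "Re (ip H (\<rho> (D m) u) u) <= (q * c) * (hnorm H u)\<^sup>2"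
proof -
define d where "d = D m"
have d: "d : cr A" "self_adj d" "nrm A d <= 1" using self_adj_D[OF m] nrm_D_le_1[OF m] by (auto simp: d_def)
have "\<one> \<ominus> (\<one> \<ominus> d) = d" using d(1) by algebra
then have pos: "pos (\<one> \<ominus> d)" unfolding pos_def using d by (auto intro!: self_adj_combine)
define r where "r = csqrt (\<one> \<ominus> d)"
have r: "r : cr A" "r\<^sup>* = r" "r \<cdot> r = \<one> \<ominus> d"
 using csqrt_self_adj[OF pos] csqrt_square[OF pos] by (simp_all add: r_def)
have dr: "d \<cdot> r = r \<cdot> d" unfolding r_def
 by (rule csqrt_commute[OF pos d(1)]) (use d(1) in \<open>simp add: minus_eq r_distr l_distr r_minus l_minus\<close>)
have range: "Re (ip H (\<rho> d (\<rho> r y)) (\<rho> r y)) <= (q * c) * (hnorm H (\<rho> r y))\<^sup>2" if y: "y : cr H" for y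
proof -
 have "r \<cdot> (d \<cdot> r) = d \<cdot> (\<one> \<ominus> d)"
  unfolding r(3)[symmetric] dr using d(1) r(1) by (metis dr m_assoc m_closed)
 then have "ip H (\<rho> d (\<rho> r y)) (\<rho> r y) = ip H (\<rho> (d \<cdot> (\<one> \<ominus> d)) y) y"
  using R.rep_adjoint'[of r "\<rho> d (\<rho> r y)" y] R.rep_simps(4)[of r "d \<cdot> r" y] R.rep_simps(4)[of d r y] d(1) r y by simp
 also have "d \<cdot> (\<one> \<ominus> d) = (\<Oplus>j\<in>{Suc m..n}. d \<cdot> (z j \<cdot> (z j)\<^sup>*))"
  unfolding d_def one_minus_D by (subst finsum_rdistr) auto
 also have "ip H (\<rho> ... y) y = (\<Sum>j\<in>{Suc m..n}. ip H (\<rho> (d \<cdot> (z j \<cdot> (z j)\<^sup>*)) y) y)"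
  by (rule rep_finsum_ip) (use d(1) y in auto)
 also have "... = (\<Sum>j\<in>{Suc m..n}. of_real q * ip H (\<rho> d (\<rho> ((z j)\<^sup>*) y)) (\<rho> ((z j)\<^sup>*) y))"
 proof (rule sum.cong[OF refl])
  fix j assume j: "j : {Suc m..n}"
  then have zc: "z j : cr A" "(z j)\<^sup>* : cr A" by auto
  have "d \<cdot> (z j \<cdot> (z j)\<^sup>*) = of_real q \<odot> (z j \<cdot> (d \<cdot> (z j)\<^sup>*))"
   using D_q_commute[of m j] j zc d(1) by (simp add: d_def m_assoc[symmetric] smult_mult_left)
  then show "ip H (\<rho> (d \<cdot> (z j \<cdot> (z j)\<^sup>*)) y) y = of_real q * ip H (\<rho> d (\<rho> ((z j)\<^sup>*) y)) (\<rho> ((z j)\<^sup>*) y)"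
   using zc d(1) y by (simp add: R.rep_simps R.H.ip_smult_left R.rep_adjoint[of "z j"])
 qed
 finally have "Re (ip H (\<rho> d (\<rho> r y)) (\<rho> r y)) = (\<Sum>j\<in>{Suc m..n}. q * Re (ip H (\<rho> d (\<rho> ((z j)\<^sup>*) y)) (\<rho> ((z j)\<^sup>*) y)))"
  by simp
 also have "... <= (\<Sum>j\<in>{Suc m..n}. q * (c * (hnorm H (\<rho> ((z j)\<^sup>*) y))\<^sup>2))"
  using q y unfolding d_def by (intro sum_mono mult_left_mono le) auto
 also have "... = (q * c) * Re (ip H (\<rho> (\<one> \<ominus> d) y) y)"
  unfolding d_def one_minus_D_form[OF y] by (simp add: sum_distrib_left mult.assoc)
 also have "Re (ip H (\<rho> (\<one> \<ominus> d) y) y) = (hnorm H (\<rho> r y))\<^sup>2"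
  using R.rep_norm_square[OF r(1) y] R.rep_adjoint'[of "\<one> \<ominus> d" y y] d y
  unfolding r(2,3) by (simp add: star_diff)
 finally show ?thesis .
qed
have "EX g:cr A. \<one> \<ominus> d [^] k = (\<one> \<ominus> d) \<cdot> g" for k :: nat
proof (induction k)
 case 0
 then show ?case by (intro bexI[of _ \<zero>]) (use d(1) in \<open>simp_all add: minus_eq r_neg\<close>)
next
 case (Suc k)
 then obtain g where g: "g : cr A" "\<one> \<ominus> d [^] k = (\<one> \<ominus> d) \<cdot> g" by blast
 have pc: "d [^] k : cr A" "d [^] Suc k : cr A" using d(1) by simp_all
 have "\<one> \<ominus> d [^] Suc k = (\<one> \<ominus> d [^] k) \<oplus> (d [^] k \<ominus> d [^] Suc k)" using pc one_closed by algebra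
 also have "d [^] k \<ominus> d [^] Suc k = (\<one> \<ominus> d) \<cdot> d [^] k"
  using nat_pow_Suc2[OF d(1), of k] d(1) by (simp add: minus_eq l_distr l_minus del: nat_pow_Suc)
 finally show ?case unfolding g(2)
  by (intro bexI[of _ "g \<oplus> d [^] k"]) (use g(1) pc d(1) in \<open>simp_all add: r_distr\<close>)
qed
then obtain g where g: "!!k. g k : cr A" "!!k. \<one> \<ominus> d [^] (k::nat) = (\<one> \<ominus> d) \<cdot> g k" by metis
define w where "w = (%k::nat. u \<ominus>\<^sub>H \<rho> (d [^] k) u)"
have wr: "w k = \<rho> r (\<rho> (r \<cdot> g k) u)" for k
proof -
 have "w k = \<rho> (\<one> \<ominus> d [^] k) u" using R.rep_diff[of \<one> "d [^] k" u] d(1) u by (simp add: w_def)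
 also have "\<one> \<ominus> d [^] k = r \<cdot> (r \<cdot> g k)" unfolding g(2) r(3)[symmetric] using r(1) g(1) by (simp add: m_assoc)
 finally show ?thesis using R.rep_simps(4)[of r "r \<cdot> g k" u] r(1) g(1) u by simp
qed
have wc: "w k : cr H" for k using d(1) u by (simp add: w_def)
have wl: "hlim H w u"
proof -
 have "hlim H (%k. u \<oplus>\<^sub>H (- 1) \<odot>\<^sub>H \<rho> (d [^] k) u) (u \<oplus>\<^sub>H (- 1) \<odot>\<^sub>H \<zero>\<^sub>H)"
  by (intro R.H.hlim_add R.H.hlim_const R.H.hlim_smult lim0[unfolded d_def[symmetric]]) (use u d(1) in auto)
 then show ?thesis using u d(1) by (simp add: w_def R.H.hdiff_eq R.H.hsmult_simps)
qed
have dl: "hlim H (%k. \<rho> d (w k)) (\<rho> d u)" by (rule R.rep_hlim[OF d(1) wc u wl])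
have "(%k. Re (ip H (\<rho> d (w k)) (w k))) ----> Re (ip H (\<rho> d u) u)"
 by (intro tendsto_Re R.H.hlim_ip dl wl) (use wc d(1) u in auto)
moreover have "(%k. (q * c) * (hnorm H (w k))\<^sup>2) ----> (q * c) * (hnorm H u)\<^sup>2"
 by (intro tendsto_intros R.H.hlim_hnorm[OF wc u wl])
moreover have "Re (ip H (\<rho> d (w k)) (w k)) <= (q * c) * (hnorm H (w k))\<^sup>2" for k
 unfolding wr by (rule range) (use r(1) g(1) u in simp)
ultimately show ?thesis unfolding d_def by (intro LIMSEQ_le) auto
qed

text \<open>Without fixed vectors all \<open>(D m)\<^sup>k v\<close> tend to 0, so iterating the preceding contraction makes the quadratic form of the
  positive operator \<open>D m\<close> vanish.\<close>

lemma vacuum_exists: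
assumes m: "m <= n" and nz: "EX u:cr H. \<rho> (D m) u ~= \<zero>\<^sub>H"
shows "EX p:cr H. hnorm H p = 1 & \<rho> (D m) p = p"
proof (rule ccontr)
assume none: "\<not> ?thesis"
have zero: "p = \<zero>\<^sub>H" if p: "p : cr H" "\<rho> (D m) p = p" for p
proof (rule ccontr)
 assume "p ~= \<zero>\<^sub>H"
 then have h: "hnorm H p ~= 0" using R.H.hnorm_eq_0D p(1) by blast
 let ?p = "of_real (1 / hnorm H p) \<odot>\<^sub>H p"
 have "hnorm H ?p = 1" using h p R.H.hnorm_nonneg[OF p(1)] by (simp add: R.H.hnorm_smult norm_divide)
 moreover have "\<rho> (D m) ?p = ?p" using p by (simp add: R.rep_simps del: of_real_divide)
 ultimately show False using none p(1) by blast
qed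
have lim0: "hlim H (%k. \<rho> (D m [^] (k::nat)) u) \<zero>\<^sub>H" if "u : cr H" for u
 using D_pow_limit[OF m that] zero by blast
have le: "Re (ip H (\<rho> (D m) u) u) <= q ^ j * (hnorm H u)\<^sup>2" if u: "u : cr H" for u j
 using u
proof (induction j arbitrary: u)
 case 0
 have "Re (ip H (\<rho> (D m) u) u) <= hnorm H (\<rho> (D m) u) * hnorm H u"
  by (rule order_trans[OF complex_Re_le_cmod R.H.Cauchy_Schwarz]) (use 0 in auto)
 also have "... <= (nrm A (D m) * hnorm H u) * hnorm H u"
  using R.rep_contractive[OF D_closed 0] 0 by (intro mult_right_mono) auto
 also have "... <= (1 * hnorm H u) * hnorm H u" using nrm_D_le_1[OF m] 0 by (intro mult_right_mono) auto
 finally show ?case by (simp add: power2_eq_square)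
next
 case (Suc j)
 have "Re (ip H (\<rho> (D m) u) u) <= (q * q ^ j) * (hnorm H u)\<^sup>2"
  by (rule D_form_contracts[OF m _ lim0 Suc.IH Suc.prems]) (use q in auto)
 then show ?case by simp
qed
obtain u where u: "u : cr H" "\<rho> (D m) u ~= \<zero>\<^sub>H" using nz by blast
have "(%j. q ^ j * (hnorm H u)\<^sup>2) ----> 0" using q by (intro tendsto_mult_left_zero LIMSEQ_power_zero) auto
then have le0: "Re (ip H (\<rho> (D m) u) u) <= 0" by (rule LIMSEQ_le_const) (use le[OF u(1)] in auto)
define t where "t = csqrt (D m)"
have t: "t : cr A" "t\<^sup>* = t" "t \<cdot> t = D m"
 using csqrt_self_adj[OF pos_D[OF m]] csqrt_square[OF pos_D[OF m]] by (simp_all add: t_def)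
have "(hnorm H (\<rho> t u))\<^sup>2 = Re (ip H (\<rho> (D m) u) u)"
 using R.rep_norm_square[OF t(1) u(1)] R.rep_adjoint'[of "D m" u u] self_adj_D[OF m] u(1) unfolding t(2,3) by simp
then have "hnorm H (\<rho> t u) = 0" using le0 zero_le_power2[of "hnorm H (\<rho> t u)"] by simp
then have "\<rho> t u = \<zero>\<^sub>H" using t(1) u(1) by (intro R.H.hnorm_eq_0D) auto
then have "\<rho> (D m) u = \<zero>\<^sub>H" using R.rep_simps(4)[OF t(1) t(1) u(1)] t R.rep_zero_right[OF t(1)] by simp
then show False using u(2) by simp
qed

text \<open>Let \<open>V\<close> be the fixed space of \<open>D m\<close>, on which \<open>z\<^sub>m\<close> is unitary. Take a self-adjoint
  \<open>h\<close> among the real and imaginary parts of \<open>z\<^sub>m\<close>, let \<open>w\<close> be a multiple of \<open>h - \<mu>\<close> with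
  \<open>\<mu> = \<langle>h p, p\<rangle>\<close>, and \<open>R = (w\<^sup>2)\<^sup>1\<^sup>/\<^sup>2\<close>. As \<open>(R + w)(R - w) = 0\<close>, the
  subspaces generated by \<open>(R - w) V\<close> and \<open>(R + w) V\<close> are orthogonal, so by irreducibility \<open>w = R\<close> or \<open>w =
  -R\<close> on \<open>V\<close>. Since \<open>\<langle>w p, p\<rangle> = 0\<close>, it follows that \<open>R p = 0\<close> and \<open>h p = \<mu>
  p\<close>.\<close>

lemma coherent_of_vacuum:
assumes m: "1 <= m" "m <= n" and low: "!!i u. i < m ==> u : cr H ==> \<rho> (D i) u = \<zero>\<^sub>H"
 and p: "p : cr H" "hnorm H p = 1" "\<rho> (D m) p = p"
 and above: "!!j u. m < j ==> j <= n ==> u : cr H ==> \<rho> (D m) u = u ==> \<rho> ((z j)\<^sup>*) u = \<zero>\<^sub>H"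
 and below: "!!i u. 1 <= i ==> i < m ==> u : cr H ==> \<rho> ((z i)\<^sup>*) u = \<zero>\<^sub>H"
shows "EX c. cmod c = 1 & \<rho> ((z m)\<^sup>*) p = c \<odot>\<^sub>H p"
proof -
have zc: "z m : cr A" "(z m)\<^sup>* : cr A" using m by auto
define V where "V = {u : cr H. \<rho> (D m) u = u}"
have V: "u : V ==> u : cr H" "u : V ==> \<rho> (D m) u = u" for u by (simp_all add: V_def)
have pV: "p : V" using p by (simp add: V_def)
have comm: "\<rho> x u : V" if "x : cr A" "D m \<cdot> x = x \<cdot> D m" "u : V" for x u
 using R.rep_simps(4)[OF D_closed that(1) V(1)[OF that(3)], of m] R.rep_simps(4)[OF that(1) D_closed V(1)[OF that(3)], of m]
  that V[OF that(3)] by (simp add: V_def)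
have ZV: "\<rho> (z m) u : V" "\<rho> ((z m)\<^sup>*) u : V" if "u : V" for u
 using comm[OF zc(1) D_commute[OF m(2) m(1) order_refl] that] comm[OF zc(2) D_commute_star[OF m(2) m(1) order_refl] that] .
have lm: "\<rho> (D (m - 1)) u = \<zero>\<^sub>H" if "u : cr H" for u using low[OF _ that] m by simp
have ZZ: "\<rho> (z m) (\<rho> ((z m)\<^sup>*) u) = u" "\<rho> ((z m)\<^sup>*) (\<rho> (z m) u) = u" if u: "u : V" for u
 using zz_rep[OF m V(1)[OF u]] V[OF u] lm[OF V(1)[OF u]] by (simp_all add: R.H.hdiff_eq R.H.hsmult_simps)
(* C is norm-closed, so it contains the roots of its positive elements. *)
define C where "C = {x : cr A. ALL u:V. \<rho> x u : V & \<rho> x (\<rho> ((z m)\<^sup>*) u) = \<rho> ((z m)\<^sup>*) (\<rho> x u)}"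
have CD: "x : cr A" "!!u. u : V ==> \<rho> x u : V"
 "!!u. u : V ==> \<rho> x (\<rho> ((z m)\<^sup>*) u) = \<rho> ((z m)\<^sup>*) (\<rho> x u)" if "x : C" for x
 using that by (auto simp: C_def)
have Vlin: "u \<oplus>\<^sub>H w : V" "b \<odot>\<^sub>H u : V" if "u : V" "w : V" for u w b
 using that by (simp_all add: V_def R.rep_simps)
have C_one: "\<one> : C" using V ZV zc by (simp add: C_def)
have C_z: "z m : C" "(z m)\<^sup>* : C" using ZV ZZ zc by (simp_all add: C_def)
have C_add: "x \<oplus> y : C" and C_mult: "x \<cdot> y : C" and C_smult0: "b \<odot> x : C" if "x : C" "y : C" for x y b
proof -
 note x = CD[OF that(1)] and y = CD[OF that(2)]
 have e: "\<rho> (x \<oplus> y) u = \<rho> x u \<oplus>\<^sub>H \<rho> y u" "\<rho> (x \<cdot> y) u = \<rho> x (\<rho> y u)" "\<rho> (b \<odot> x) u = b \<odot>\<^sub>H \<rho> x u"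
  if "u : V" for u using R.rep_simps(3,4,5) x(1) y(1) V(1)[OF that] by auto
 show "x \<oplus> y : C" using x(1) y(1)
  by (auto simp: C_def e ZV Vlin x(2,3) y(2,3) R.rep_simps(1)[OF zc(2)] V(1))
 show "x \<cdot> y : C" using x(1) y(1) by (auto simp: C_def e ZV x(2,3) y(2,3))
 show "b \<odot> x : C" using x(1) by (auto simp: C_def e ZV Vlin x(2,3) R.rep_simps(2)[OF zc(2)] V(1))
qed
have C_smult: "b \<odot> x : C" if "x : C" for b x by (rule C_smult0[OF that that])
have C_closed: "norm_closed A C" unfolding norm_closed_def
proof (intro conjI allI impI)
 show "C <= cr A" using CD(1) by blast
 fix s x assume a: "(ALL k. s k : C) & x : cr A & norm_lim A s x"
 then have s: "!!k. s k : C" "!!k. s k : cr A" and x: "x : cr A" and l: "norm_lim A s x" using CD(1) by auto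
 have lim: "hlim H (%k. \<rho> (s k) u) (\<rho> x u)" if "u : cr H" for u by (rule R.rep_norm_lim[OF s(2) x l that])
 have "\<rho> x u : V & \<rho> x (\<rho> ((z m)\<^sup>*) u) = \<rho> ((z m)\<^sup>*) (\<rho> x u)" if u: "u : V" for u
 proof
  have sc: "\<rho> (s k) u : cr H" "\<rho> (s k) (\<rho> ((z m)\<^sup>*) u) : cr H" for k using s(2) V(1)[OF u] zc by auto
  have xc: "\<rho> x u : cr H" using x V(1)[OF u] by simp
  have "hlim H (%k. \<rho> (D m) (\<rho> (s k) u)) (\<rho> (D m) (\<rho> x u))" by (rule R.rep_hlim[OF D_closed sc(1) xc lim[OF V(1)[OF u]]])
  moreover have "\<rho> (D m) (\<rho> (s k) u) = \<rho> (s k) u" for k using V(2)[OF CD(2)[OF s(1) u]] .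
  ultimately have "hlim H (%k. \<rho> (s k) u) (\<rho> (D m) (\<rho> x u))" by simp
  then have "\<rho> (D m) (\<rho> x u) = \<rho> x u"
   using R.H.hlim_unique[of "%k. \<rho> (s k) u", OF sc(1) _ xc _ lim[OF V(1)[OF u]]] xc by simp
  then show "\<rho> x u : V" using xc by (simp add: V_def)
  have "hlim H (%k. \<rho> ((z m)\<^sup>*) (\<rho> (s k) u)) (\<rho> ((z m)\<^sup>*) (\<rho> x u))"
   by (rule R.rep_hlim[OF zc(2) sc(1) xc lim[OF V(1)[OF u]]])
  moreover have "\<rho> ((z m)\<^sup>*) (\<rho> (s k) u) = \<rho> (s k) (\<rho> ((z m)\<^sup>*) u)" for k using CD(3)[OF s(1) u] by simp
  ultimately have "hlim H (%k. \<rho> (s k) (\<rho> ((z m)\<^sup>*) u)) (\<rho> ((z m)\<^sup>*) (\<rho> x u))" by simp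
  moreover have "hlim H (%k. \<rho> (s k) (\<rho> ((z m)\<^sup>*) u)) (\<rho> x (\<rho> ((z m)\<^sup>*) u))" using lim V(1)[OF u] zc by simp
  ultimately show "\<rho> x (\<rho> ((z m)\<^sup>*) u) = \<rho> ((z m)\<^sup>*) (\<rho> x u)"
   using R.H.hlim_unique[of "%k. \<rho> (s k) (\<rho> ((z m)\<^sup>*) u)", OF sc(2)] xc x zc V(1)[OF u] by simp
 qed
 then show "x : C" using x by (simp add: C_def)
qed
have dichotomy: "(ALL u:V. \<rho> x u = \<zero>\<^sub>H) \<or> (ALL u:V. \<rho> y u = \<zero>\<^sub>H)"
 if x: "x : C" and y: "y : C" "y\<^sup>* = y" and yx: "y \<cdot> x = \<zero>" for x y
proof (rule ccontr)
 assume "\<not> ?thesis"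
 then obtain u0 w0 where u0: "u0 : V" "\<rho> x u0 ~= \<zero>\<^sub>H" and w0: "w0 : V" "\<rho> y w0 ~= \<zero>\<^sub>H" by blast
 define f where "f = \<rho> x u0"
 have f: "f : V" "f : cr H" using CD(2)[OF x u0(1)] V(1) by (auto simp: f_def)
 have yf: "\<rho> y f = \<zero>\<^sub>H"
  using R.rep_simps(4)[of y x u0] CD(1)[OF x] CD(1)[OF y(1)] V(1)[OF u0(1)] yx R.rep_zero by (simp add: f_def)
 (* X contains the adjoint of z m, the only one that normal ordering does not send to zero. *)
 define X where "X = {b : cr A. ALL u:V. \<rho> b u : V & (ALL a:C. \<rho> a (\<rho> b u) = \<rho> b (\<rho> a u))}"
 have X: "X <= cr A" "\<one> : X" using V CD by (auto simp: X_def)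
 define eqv where "eqv a b \<longleftrightarrow> a : cr A & b : cr A & (ALL u:V. \<rho> a u = \<rho> b u)" for a b
 have perp: "ALL w:V. ip H (\<rho> b f) (\<rho> y w) = 0" if "b : zspan X" for b
  using that
 proof (induction rule: zspan.induct)
  case (base b)
  have b: "b : cr A" "\<rho> y (\<rho> b f) = \<rho> b (\<rho> y f)" using base f y(1) by (auto simp: X_def)
  have "ip H (\<rho> b f) (\<rho> y w) = 0" if w: "w : V" for w
   using R.rep_adjoint'[of y "\<rho> b f" w] CD(1)[OF y(1)] y(2) b yf R.rep_zero_right[of b] f(2) V(1)[OF w] by simp
  then show ?case by blast
 next
  case (add b b')
  then show ?case using zspan_closed[OF add.hyps(1) X(1)] zspan_closed[OF add.hyps(2) X(1)] f(2) CD(1)[OF y(1)] V(1)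
   by (simp add: R.rep_simps R.H.ip_add_left)
 next
  case (scale b a)
  then show ?case using zspan_closed[OF scale.hyps X(1)] f(2) CD(1)[OF y(1)] V(1)
   by (simp add: R.rep_simps R.H.ip_smult_left)
 next
  case (mult j b)
  have bc: "b : cr A" "z j : cr A" using zspan_closed[OF mult.hyps(3) X(1)] mult.hyps by auto
  show ?case
  proof
   fix w assume w: "w : V"
   have yw: "\<rho> y w : V" "\<rho> y w : cr H" using CD(2)[OF y(1) w] V(1) by auto
   have e: "ip H (\<rho> (z j \<cdot> b) f) (\<rho> y w) = ip H (\<rho> b f) (\<rho> ((z j)\<^sup>*) (\<rho> y w))"
    using bc f(2) yw(2) by (simp add: R.rep_simps R.rep_adjoint)
   have bf: "\<rho> b f : cr H" using bc f(2) by simp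
   consider "j < m" | "j = m" | "m < j" by linarith
   then show "ip H (\<rho> (z j \<cdot> b) f) (\<rho> y w) = 0"
   proof cases
    case 1
    then show ?thesis unfolding e below[OF mult.hyps(1) 1 yw(2)] using bf by simp
   next
    case 2
    show ?thesis using e mult.IH ZV(2)[OF w] unfolding 2 CD(3)[OF y(1) w, symmetric] by simp
   next
    case 3
    then show ?thesis unfolding e above[OF 3 mult.hyps(2) yw(2) V(2)[OF yw(1)]] using bf by simp
   qed
  qed
 qed
 have all: "ip H (\<rho> a f) (\<rho> y w) = 0" if a: "a : cr A" and w: "w : V" for a w
 proof -
  have "EX s. (ALL k. s k : cr A & (EX b:zspan X. eqv (s k) b)) & norm_lim A s a"
  proof (rule normal_order[OF X _ _ _ _ _ _ _ a])
   fix i b assume i: "1 <= i" "i <= n" and b: "b : X"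
   have bc: "b : cr A" "(z i)\<^sup>* : cr A" using b X i by auto
   have bV: "\<rho> b u : V" "\<rho> b u : cr H" if "u : V" for u using b that V(1) by (auto simp: X_def)
   show "EX y:zspan X. eqv ((z i)\<^sup>* \<cdot> b) y"
   proof (cases "i = m")
    case True
    have "\<rho> ((z m)\<^sup>* \<cdot> b) u : V & (ALL a:C. \<rho> a (\<rho> ((z m)\<^sup>* \<cdot> b) u) = \<rho> ((z m)\<^sup>* \<cdot> b) (\<rho> a u))" if u: "u : V" for u
    proof (intro conjI ballI)
     have e: "\<rho> ((z m)\<^sup>* \<cdot> b) u = \<rho> ((z m)\<^sup>*) (\<rho> b u)" if "u : V" for u
      by (rule R.rep_simps(4)[OF zc(2) bc(1) V(1)[OF that]])
     show "\<rho> ((z m)\<^sup>* \<cdot> b) u : V" unfolding e[OF u] by (rule ZV(2)[OF bV(1)[OF u]])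
     fix a assume a: "a : C"
     show "\<rho> a (\<rho> ((z m)\<^sup>* \<cdot> b) u) = \<rho> ((z m)\<^sup>* \<cdot> b) (\<rho> a u)"
      unfolding e[OF u] e[OF CD(2)[OF a u]] CD(3)[OF a bV(1)[OF u]] using b u a by (simp add: X_def)
    qed
    then have "(z m)\<^sup>* \<cdot> b : X" using bc zc by (simp add: X_def)
    then show ?thesis unfolding True by (intro bexI[OF _ zspan.base]) (use bc zc in \<open>simp_all add: eqv_def\<close>)
   next
    case False
    have "\<rho> ((z i)\<^sup>*) (\<rho> b u) = \<zero>\<^sub>H" if u: "u : V" for u
    proof (cases "i < m")
     case True
     then show ?thesis using below[OF i(1) True bV(2)[OF u]] by simp
    next
     case nl: False
     then have "m < i" using False by simp
     then show ?thesis using above[OF _ i(2) bV(2)[OF u] V(2)[OF bV(1)[OF u]]] by simp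
    qed
    then have "eqv ((z i)\<^sup>* \<cdot> b) (0 \<odot> b)"
     using bc V(1) by (simp add: eqv_def R.rep_simps R.rep_zero)
    then show ?thesis using zspan.scale[OF zspan.base[OF b]] by blast
   qed
  qed (use V in \<open>auto simp: eqv_def R.rep_simps\<close>)
  then obtain s where s: "!!k. s k : cr A" "!!k. EX b:zspan X. eqv (s k) b" "norm_lim A s a" by blast
  have "ip H (\<rho> (s k) f) (\<rho> y w) = 0" for k
  proof -
   obtain b where b: "b : zspan X" "\<rho> (s k) f = \<rho> b f" using s(2)[of k] f(1) unfolding eqv_def by blast
   then show ?thesis using perp[OF b(1)] w by simp
  qed
  moreover have "(%k. ip H (\<rho> (s k) f) (\<rho> y w)) ----> ip H (\<rho> a f) (\<rho> y w)"
   by (rule R.H.hlim_ip[OF _ _ _ _ R.rep_norm_lim[OF s(1) a s(3) f(2)] R.H.hlim_const])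
     (use s(1) a f(2) CD(1)[OF y(1)] V(1)[OF w] in auto)
  ultimately have "(%k. 0) ----> ip H (\<rho> a f) (\<rho> y w)" by simp
  then show ?thesis using LIMSEQ_unique tendsto_const by blast
 qed
 have yw: "\<rho> y w0 : cr H" using CD(2)[OF y(1) w0(1)] V(1) by blast
 obtain s where s: "!!k. s k : cr A" "hlim H (%k. \<rho> (s k) f) (\<rho> y w0)"
  using R.irreducible_cyclic[OF irr f(2) u0(2)[folded f_def] yw] by blast
 have "(%k. ip H (\<rho> (s k) f) (\<rho> y w0)) ----> ip H (\<rho> y w0) (\<rho> y w0)"
  by (rule R.H.hlim_ip[OF _ yw _ yw s(2) R.H.hlim_const[OF yw]]) (use s(1) f(2) yw in auto)
 then have "(%k. 0) ----> ip H (\<rho> y w0) (\<rho> y w0)" using all[OF s(1) w0(1)] by simp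
 then have "ip H (\<rho> y w0) (\<rho> y w0) = 0" using LIMSEQ_unique tendsto_const by blast
 then have "\<rho> y w0 = \<zero>\<^sub>H" using yw by (intro R.H.hnorm_eq_0D) (auto simp: hnorm_def)
 then show False using w0(2) by simp
qed
have eigen: "EX \<mu>. \<rho> h p = \<mu> \<odot>\<^sub>H p" if h: "h : C" "self_adj h" for h
proof -
 define \<mu> where "\<mu> = Re (ip H (\<rho> h p) p)"
 have hc: "h : cr A" using h by simp
 have il: "ip H (\<rho> h p) p = of_real \<mu>"
 proof -
  have "cnj (ip H (\<rho> h p) p) = ip H (\<rho> h p) p"
   using R.H.ip_commute[of "\<rho> h p" p] R.rep_adjoint[OF hc p(1) p(1)] h(2) hc p(1) by simp
  then show ?thesis unfolding \<mu>_def by (simp add: complex_eq_iff)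
 qed
 define w0 where "w0 = h \<oplus> (- of_real \<mu>) \<odot> \<one>"
 have w0: "w0 : C" unfolding w0_def by (intro C_add C_smult h(1) C_one)
 have w0c: "w0 : cr A" using CD(1)[OF w0] .
 have w0s: "self_adj w0" unfolding w0_def using h(2) self_adj_combine(3)[OF self_adj_combine(5), of "- \<mu>"] by (intro self_adj_combine(1)) auto
 (* Scaling to a contraction makes the square root available. *)
 define b where "b = 1 / (nrm A w0 + 1)"
 have b: "0 < b" "b * nrm A w0 <= 1" using nrm_nonneg[OF w0c] by (simp_all add: b_def field_simps)
 define w where "w = of_real b \<odot> w0"
 have wC: "w : C" unfolding w_def by (rule C_smult[OF w0])
 have w: "self_adj w" "nrm A w <= 1" "w : cr A"
  using self_adj_combine(3)[OF w0s] b w0c by (simp_all add: w_def nrm_smult)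
 have pw: "pos (w \<cdot> w)" by (rule pos_square[OF w(1,2)])
 define R' where "R' = csqrt (w \<cdot> w)"
 have RC: "R' : C" unfolding R'_def
  by (rule csqrt_mem[OF C_closed C_smult C_add C_mult C_one C_mult[OF wC wC] pw])
 have R': "R' : cr A" "R'\<^sup>* = R'" "R' \<cdot> R' = w \<cdot> w" "pos R'"
  using csqrt_self_adj[OF pw] csqrt_square[OF pw] csqrt_pos[OF pw] by (simp_all add: R'_def)
 have wR: "w \<cdot> R' = R' \<cdot> w" unfolding R'_def by (rule csqrt_commute[OF pw w(3)]) (use w in \<open>simp add: m_assoc\<close>)
 have yx: "(R' \<oplus> w) \<cdot> (R' \<oplus> (- 1) \<odot> w) = \<zero>"
 proof -
  have c: "R' \<cdot> R' : cr A" "R' \<cdot> w : cr A" "w \<cdot> w : cr A" using w(3) R'(1) by auto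
  have "(R' \<oplus> w) \<cdot> (R' \<ominus> w) = (R' \<cdot> R' \<ominus> R' \<cdot> w) \<oplus> (w \<cdot> R' \<ominus> w \<cdot> w)"
   using w(3) R'(1) by (simp add: minus_eq l_distr r_distr r_minus l_minus a_ac minus_add)
  also have "... = R' \<cdot> R' \<ominus> w \<cdot> w" unfolding wR using c by algebra
  finally have "(R' \<oplus> w) \<cdot> (R' \<ominus> w) = R' \<cdot> R' \<ominus> w \<cdot> w" .
  then show ?thesis using w(3) R'(1,3) by (simp add: diff_eq_smult[symmetric] minus_eq r_neg)
 qed
 have pm: "\<rho> w p = \<rho> R' p \<or> \<rho> w p = (- 1) \<odot>\<^sub>H \<rho> R' p"
 proof -
  have "R' \<oplus> (- 1) \<odot> w : C" "R' \<oplus> w : C" "(R' \<oplus> w)\<^sup>* = R' \<oplus> w"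
   using C_add RC wC C_smult w R' by (auto simp: star_add)
  then have "\<rho> (R' \<oplus> (- 1) \<odot> w) p = \<zero>\<^sub>H \<or> \<rho> (R' \<oplus> w) p = \<zero>\<^sub>H" using dichotomy[OF _ _ _ yx] pV by blast
  then show ?thesis
  proof
   assume "\<rho> (R' \<oplus> (- 1) \<odot> w) p = \<zero>\<^sub>H"
   then have "\<rho> R' p \<ominus>\<^sub>H \<rho> w p = \<zero>\<^sub>H" using R'(1) w(3) p(1) by (simp add: R.rep_simps R.H.hdiff_eq)
   then have "\<rho> R' p = \<rho> w p" using R.H.hdiff_eq_0D R'(1) w(3) p(1) by blast
   then show ?thesis by simp
  next
   assume "\<rho> (R' \<oplus> w) p = \<zero>\<^sub>H"
   then have "\<rho> w p \<ominus>\<^sub>H (- 1) \<odot>\<^sub>H \<rho> R' p = \<zero>\<^sub>H"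
    using R'(1) w(3) p(1) by (simp add: R.rep_simps R.H.hdiff_eq R.H.hsmult_simps R.H.M.a_comm)
   then show ?thesis using R.H.hdiff_eq_0D[of "\<rho> w p" "(- 1) \<odot>\<^sub>H \<rho> R' p"] R'(1) w(3) p(1) by simp
  qed
 qed
 have w0p: "\<rho> w0 p = \<rho> h p \<ominus>\<^sub>H of_real \<mu> \<odot>\<^sub>H p"
  unfolding w0_def using hc p(1) by (simp add: R.rep_simps R.H.hdiff_eq R.H.hsmult_simps)
 have "ip H (\<rho> w0 p) p = 0"
  unfolding w0p using hc p(1,2) il by (simp add: R.H.ip_diff_left R.H.ip_smult_left R.H.ip_self)
 then have "ip H (\<rho> w p) p = 0" using w0c p(1) by (simp add: w_def R.rep_simps R.H.ip_smult_left)
 then have R0: "ip H (\<rho> R' p) p = 0" using pm R'(1) p(1) by (auto simp: R.H.ip_smult_left)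
 define t where "t = csqrt R'"
 have t: "t : cr A" "t\<^sup>* = t" "t \<cdot> t = R'"
  using csqrt_self_adj[OF R'(4)] csqrt_square[OF R'(4)] by (simp_all add: t_def)
 have "(hnorm H (\<rho> t p))\<^sup>2 = Re (ip H (\<rho> R' p) p)"
  using R.rep_norm_square[OF t(1) p(1)] R.rep_adjoint'[of R' p p] R'(1,2) p(1) unfolding t(2,3) by simp
 then have "hnorm H (\<rho> t p) = 0" using R0 by simp
 then have "\<rho> t p = \<zero>\<^sub>H" using t(1) p(1) by (intro R.H.hnorm_eq_0D) auto
 then have "\<rho> R' p = \<zero>\<^sub>H" using R.rep_simps(4)[OF t(1) t(1) p(1)] t(3) R.rep_zero_right[OF t(1)] by simp
 then have "\<rho> w p = \<zero>\<^sub>H" using pm by (auto simp: R.H.hsmult_simps)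
 then have "of_real (1 / b) \<odot>\<^sub>H (of_real b \<odot>\<^sub>H \<rho> w0 p) = of_real (1 / b) \<odot>\<^sub>H \<zero>\<^sub>H"
  using w0c p(1) by (simp add: w_def R.rep_simps)
 then have "\<rho> w0 p = \<zero>\<^sub>H"
  using b(1) w0c p(1) by (simp add: R.H.hsmult_simps of_real_mult[symmetric] del: of_real_mult of_real_divide)
 then have "\<rho> h p = of_real \<mu> \<odot>\<^sub>H p"
  unfolding w0p using R.H.hdiff_eq_0D[of "\<rho> h p" "of_real \<mu> \<odot>\<^sub>H p"] hc p(1) by simp
 then show ?thesis by blast
qed
have "self_adj (z m \<oplus> (z m)\<^sup>*)" "self_adj (\<i> \<odot> z m \<oplus> (- \<i>) \<odot> (z m)\<^sup>*)"
 using zc by (auto intro!: self_adjI simp: star_add star_smult a_comm)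
moreover have "z m \<oplus> (z m)\<^sup>* : C" "\<i> \<odot> z m \<oplus> (- \<i>) \<odot> (z m)\<^sup>* : C"
 using C_add C_smult C_z by blast+
ultimately obtain a b where ab: "\<rho> (z m \<oplus> (z m)\<^sup>*) p = a \<odot>\<^sub>H p" "\<rho> (\<i> \<odot> z m \<oplus> (- \<i>) \<odot> (z m)\<^sup>*) p = b \<odot>\<^sub>H p"
 using eigen by blast
have "(z m)\<^sup>* = (1/2) \<odot> ((z m \<oplus> (z m)\<^sup>*) \<oplus> \<i> \<odot> (\<i> \<odot> z m \<oplus> (- \<i>) \<odot> (z m)\<^sup>*))" (is "_ = ?x")
proof -
 have "?x = (1/2) \<odot> (z m \<oplus> (z m)\<^sup>* \<oplus> ((- 1) \<odot> z m \<oplus> (z m)\<^sup>*))"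
  using zc by (simp add: smult_r_distr smult_smult)
 also have "z m \<oplus> (z m)\<^sup>* \<oplus> ((- 1) \<odot> z m \<oplus> (z m)\<^sup>*) = (z m)\<^sup>* \<oplus> (z m)\<^sup>*"
 proof -
  have "(- 1) \<odot> z m = \<ominus> z m" using zc(1) diff_eq_smult[OF zero_closed zc(1)] by (simp add: minus_eq)
  then show ?thesis using zc by algebra
 qed
 also have "(1/2) \<odot> ((z m)\<^sup>* \<oplus> (z m)\<^sup>*) = (z m)\<^sup>*"
  using zc by (simp add: smult_smult smult_collect)
 finally show ?thesis by simp
qed
then have "\<rho> ((z m)\<^sup>*) p = \<rho> ?x p" by simp
also have "... = (1/2) \<odot>\<^sub>H (\<rho> (z m \<oplus> (z m)\<^sup>*) p \<oplus>\<^sub>H \<i> \<odot>\<^sub>H \<rho> (\<i> \<odot> z m \<oplus> (- \<i>) \<odot> (z m)\<^sup>*) p)"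
 by (subst R.rep_simps(5), use zc p(1) in simp_all, subst R.rep_simps(3), use zc p(1) in simp_all, subst R.rep_simps(5), use zc p(1) in simp_all)
also have "... = ((1/2) * (a + \<i> * b)) \<odot>\<^sub>H p" unfolding ab using p(1) by (simp add: R.H.hsmult_simps distrib_left)
finally have c: "\<rho> ((z m)\<^sup>*) p = ((1/2) * (a + \<i> * b)) \<odot>\<^sub>H p" .
have "(hnorm H (\<rho> ((z m)\<^sup>*) p))\<^sup>2 = Re (ip H p p)"
 using R.rep_norm_square[OF zc(2) p(1)] R.rep_simps(4)[OF zc p(1)] ZZ(1)[OF pV] zc by simp
then have "(cmod ((1/2) * (a + \<i> * b)))\<^sup>2 = 1"
 using p(1,2) unfolding c R.H.hnorm_smult[OF p(1)] by (simp add: R.H.ip_self)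
then have "cmod ((1/2) * (a + \<i> * b)) = 1" using norm_ge_zero power2_eq_1_iff by (metis abs_norm_cancel abs_1 abs_minus_cancel)
then show ?thesis using c by blast
qed

text \<open>For the sphere it matters which of these representations are nonzero on the ideal generated by \<open>D 0\<close>: those with \<open>m =
  0\<close>.\<close>

theorem coherent_vector_exists:
"EX m c p. m <= n & (m = 0 \<longleftrightarrow> (EX u:cr H. \<rho> (D 0) u ~= \<zero>\<^sub>H)) & cmod c = 1 & p : cr H & hnorm H p = 1 \<and>
  (ALL i. 1 <= i --> i <= n --> \<rho> ((z i)\<^sup>*) p = (if i = m then c else 0) \<odot>\<^sub>H p)"
proof -
obtain m where m: "m <= n" "EX u:cr H. \<rho> (D m) u ~= \<zero>\<^sub>H"
 and low: "!!i u. i < m ==> u : cr H ==> \<rho> (D i) u = \<zero>\<^sub>H" using D_nonzero by blast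
obtain p where p: "p : cr H" "hnorm H p = 1" "\<rho> (D m) p = p" using vacuum_exists[OF m] by blast
have above: "\<rho> ((z j)\<^sup>*) u = \<zero>\<^sub>H" if j: "m < j" "j <= n" and u: "u : cr H" "\<rho> (D m) u = u" for j u
proof -
 have "\<rho> (\<one> \<ominus> D m) u = \<zero>\<^sub>H" using R.rep_diff[of \<one> "D m" u] u by (simp add: R.H.M.minus_eq R.H.M.r_neg)
 then have "(\<Sum>j\<in>{Suc m..n}. (hnorm H (\<rho> ((z j)\<^sup>*) u))\<^sup>2) = 0"
  using one_minus_D_form[OF u(1), of m] u(1) by simp
 then have "(hnorm H (\<rho> ((z j)\<^sup>*) u))\<^sup>2 = 0" using j by (subst (asm) sum_nonneg_eq_0_iff) auto
 then show ?thesis using u(1) j by (intro R.H.hnorm_eq_0D) auto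
qed
have below: "\<rho> ((z i)\<^sup>*) u = \<zero>\<^sub>H" if i: "1 <= i" "i < m" and u: "u : cr H" for i u
proof -
 have zc: "z i : cr A" and il: "i <= n" using i m(1) by auto
 have "\<rho> (z i) (\<rho> ((z i)\<^sup>*) u) = \<zero>\<^sub>H"
  unfolding zz_rep(1)[OF i(1) il u] using low[OF i(2) u] low[of "i - 1" u] i u by (simp add: R.H.M.minus_eq)
 then show ?thesis using R.rep_star_mult_0D[of "(z i)\<^sup>*" u] zc u by (simp add: R.rep_simps)
qed
have "EX c. cmod c = 1 & (1 <= m --> \<rho> ((z m)\<^sup>*) p = c \<odot>\<^sub>H p)"
proof (cases "1 <= m")
 case True
 then show ?thesis using coherent_of_vacuum[OF True m(1) low p above below] by blast
next
 case False
 then show ?thesis by (intro exI[of _ 1]) simp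
qed
then obtain c where c: "cmod c = 1" "1 <= m ==> \<rho> ((z m)\<^sup>*) p = c \<odot>\<^sub>H p" by blast
have "\<rho> ((z i)\<^sup>*) p = (if i = m then c else 0) \<odot>\<^sub>H p" if i: "1 <= i" "i <= n" for i
proof -
 consider "i < m" | "i = m" | "m < i" by linarith
 then show ?thesis
 proof cases
  case 1 then show ?thesis using below[OF i(1) 1 p(1)] p(1) by (simp add: R.H.hsmult_simps)
 next
  case 2 then show ?thesis using c(2) i by simp
 next
  case 3 then show ?thesis using above[OF 3 i(2) p(1,3)] p(1) by (simp add: R.H.hsmult_simps)
 qed
qed
moreover have "m = 0 \<longleftrightarrow> (EX u:cr H. \<rho> (D 0) u ~= \<zero>\<^sub>H)" using m(2) low[of 0] by (cases "m = 0") auto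
ultimately show ?thesis using m(1) c(1) p(1,2) by blast
qed

end

context quantum_ball
begin

theorem ball_irrep_classification:
assumes irr: "irreducible_representation (qball q n) H \<rho>"
shows "EX m \<theta>. m <= n & cmod \<theta> = 1 & (m = 0 --> \<theta> = 1) \<and>
 (m = 0 \<longleftrightarrow> (EX u:cr H. \<rho> (B.D 0) u ~= \<zero>\<^sub>H)) \<and>
 unitarily_equivalent (qball q n) H \<rho> (shift_space (n - m)) (ball_model.mrep q n m \<theta>)"
proof -
have rep: "representation (qball q n) H \<rho>" using irr by (simp add: irreducible_representation_def)
have cr: "cstar_rep (qball q n) H \<rho>"
 by (intro cstar_rep.intro star_rep.intro star_rep_axioms.intro rep B.cstar_alg_axioms B.star_alg_axioms)
   (use rep in \<open>simp add: representation_def\<close>)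
interpret I: ball_irrep "qball q n" q n "qball_gen q n" H \<rho>
 by (intro ball_irrep.intro ball_irrep_axioms.intro B.ball_relations_axioms cr irr)
obtain m c p where m: "m <= n" "m = 0 \<longleftrightarrow> (EX u:cr H. \<rho> (B.D 0) u ~= \<zero>\<^sub>H)" "cmod c = 1"
 and p: "p : cr H" "hnorm H p = 1"
 and coh: "!!i. 1 <= i ==> i <= n ==> \<rho> ((qball_gen q n i)\<^sup>*\<^bsub>qball q n\<^esub>) p = (if i = m then c else 0) \<odot>\<^sub>H p"
 using I.coherent_vector_exists by blast
define \<theta> where "\<theta> = (if m = 0 then 1 else cnj c)"
interpret M: ball_model q n m \<theta> by unfold_locales (use m in \<open>auto simp: \<theta>_def\<close>)
have "unitarily_equivalent (qball q n) H \<rho> (shift_space (n - m)) M.mrep"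
proof (rule B.coherent_equivalent[OF cr M.R.cstar_rep_axioms irr M.mrep_irreducible p M.vac(1,2)])
 fix i assume i: "1 <= i" "i <= n"
 show "\<rho> ((qball_gen q n i)\<^sup>*\<^bsub>qball q n\<^esub>) p = (if i = m then c else 0) \<odot>\<^sub>H p" by (rule coh[OF i])
 show "M.mrep ((qball_gen q n i)\<^sup>*\<^bsub>qball q n\<^esub>) M.vac = (if i = m then c else 0) \<odot>\<^bsub>M.V\<^esub> M.vac"
  unfolding M.vac_coherent[OF i] using i by (auto simp: \<theta>_def)
qed
then show ?thesis using m M.\<theta> by (intro exI[of _ m] exI[of _ \<theta>]) (auto simp: \<theta>_def)
qed

end

section \<open>Representations and surjective homomorphisms\<close>

locale star_epi =
fixes A :: "('a, 'm) cstar_scheme" and B :: "('b, 'k) cstar_scheme" and f :: "'a => 'b"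
assumes A: "star_alg A" and onto: "f ` cr A = cr B"
 and hom: "!!x y. x : cr A ==> y : cr A ==> f (x \<oplus>\<^sub>A y) = f x \<oplus>\<^sub>B f y"
  "!!x y. x : cr A ==> y : cr A ==> f (x \<cdot>\<^sub>A y) = f x \<cdot>\<^sub>B f y"
  "!!x c. x : cr A ==> f (c \<odot>\<^sub>A x) = c \<odot>\<^sub>B f x"
  "!!x. x : cr A ==> f (x\<^sup>*\<^sub>A) = (f x)\<^sup>*\<^sub>B"
begin

lemma f_closed: "x : cr A ==> f x : cr B"
using onto by blast

text \<open>Invariant subspaces and the representation axioms only see the operators, and these are the same on both sides.\<close>

lemma irreducible_transfer:
assumes e: "!!x v. x : cr A ==> v : cr H ==> \<rho> x v = \<sigma> (f x) v"
 and bdd: "!!x. x : cr A ==> bounded_operator H (\<rho> x) \<longleftrightarrow> bounded_operator H (\<sigma> (f x))"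
shows "irreducible_representation A H \<rho> \<longleftrightarrow> irreducible_representation B H \<sigma>"
proof -
interpret A: star_alg A by (rule A)
have B: "(ALL y:cr B. P y) \<longleftrightarrow> (ALL x:cr A. P (f x))" "(EX y:cr B. P y) \<longleftrightarrow> (EX x:cr A. P (f x))" for P
 unfolding onto[symmetric] by auto
have rc: "v : cr H ==> \<sigma> (f x) v : cr H" if "bounded_operator H (\<sigma> (f x))" for x v
 using that by (auto simp: bounded_operator_def hlinear_def)
have r: "representation A H \<rho> \<longleftrightarrow> representation B H \<sigma>"
proof (cases "ALL x:cr A. bounded_operator H (\<sigma> (f x))")
 case True
 have cl: "\<sigma> (f x) v : cr H" if "x : cr A" "v : cr H" for x v using True rc that by blast
 have "(ALL y:cr A. \<rho> (x \<oplus>\<^sub>A y) v = \<rho> x v \<oplus>\<^sub>H \<rho> y v & \<rho> (x \<cdot>\<^sub>A y) v = \<rho> x (\<rho> y v)) \<and>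
   (ALL c. \<rho> (c \<odot>\<^sub>A x) v = c \<odot>\<^sub>H \<rho> x v) & (ALL u:cr H. ip H (\<rho> x u) v = ip H u (\<rho> (x\<^sup>*\<^sub>A) v)) \<longleftrightarrow>
   (ALL y:cr A. \<sigma> (f x \<oplus>\<^sub>B f y) v = \<sigma> (f x) v \<oplus>\<^sub>H \<sigma> (f y) v & \<sigma> (f x \<cdot>\<^sub>B f y) v = \<sigma> (f x) (\<sigma> (f y) v)) \<and>
   (ALL c. \<sigma> (c \<odot>\<^sub>B f x) v = c \<odot>\<^sub>H \<sigma> (f x) v) & (ALL u:cr H. ip H (\<sigma> (f x) u) v = ip H u (\<sigma> ((f x)\<^sup>*\<^sub>B) v))"
  if x: "x : cr A" and v: "v : cr H" for x v
  using x v by (simp add: e cl hom)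
 then show ?thesis unfolding representation_def B using bdd by simp
next
 case False
 then show ?thesis unfolding representation_def B using bdd by blast
qed
have "(ALL x:cr A. ALL v:K. \<rho> x v : K) \<longleftrightarrow> (ALL x:cr A. ALL v:K. \<sigma> (f x) v : K)" if K: "closed_subspace H K" and H: "hilbert_space H" for K
proof -
 have "K <= cr H" by (rule hilbert_space.closed_subspaceD(1)[OF H K])
 then have "\<rho> x v = \<sigma> (f x) v" if "x : cr A" "v : K" for x v using e that by blast
 then show ?thesis by simp
qed
note inv = this
have nz: "(EX x:cr A. EX v:cr H. \<rho> x v ~= \<zero>\<^sub>H) \<longleftrightarrow> (EX x:cr A. EX v:cr H. \<sigma> (f x) v ~= \<zero>\<^sub>H)"
 using e by simp
show ?thesis
proof (cases "hilbert_space H")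
 case True
 have "(closed_subspace H K & (ALL x:cr A. ALL v:K. \<rho> x v : K)) = (closed_subspace H K & (ALL x:cr A. ALL v:K. \<sigma> (f x) v : K))" for K
  using inv[OF _ True] by blast
 then show ?thesis unfolding irreducible_representation_def B r nz by simp
next
 case False
 then show ?thesis by (simp add: irreducible_representation_def representation_def)
qed
qed

lemma irreducible_pullback:
"irreducible_representation B H \<sigma> ==> irreducible_representation A H (%x. \<sigma> (f x))"
using irreducible_transfer[of H "%x. \<sigma> (f x)" \<sigma>] by simp

lemma irreducible_factor:
assumes irr: "irreducible_representation A H \<rho>"
 and ker: "!!x y v. x : cr A ==> y : cr A ==> f x = f y ==> v : cr H ==> \<rho> x v = \<rho> y v"
obtains \<sigma> where "irreducible_representation B H \<sigma>" "!!x v. x : cr A ==> v : cr H ==> \<rho> x v = \<sigma> (f x) v"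
proof -
interpret R: star_rep A H \<rho>
 using irr A by (intro star_rep.intro star_rep_axioms.intro) (auto simp: irreducible_representation_def representation_def)
define \<sigma> where "\<sigma> b = \<rho> (inv_into (cr A) f b)" for b
have i: "inv_into (cr A) f (f x) : cr A" "f (inv_into (cr A) f (f x)) = f x" if "x : cr A" for x
 using that by (auto intro: inv_into_into f_inv_into_f)
have e: "\<rho> x v = \<sigma> (f x) v" if "x : cr A" "v : cr H" for x v
 unfolding \<sigma>_def by (rule ker[OF that(1) i(1)[OF that(1)] i(2)[OF that(1), symmetric] that(2)])
have "bounded_operator H (\<rho> x) \<longleftrightarrow> bounded_operator H (\<sigma> (f x))" if "x : cr A" for x
 using R.rep i(1)[OF that] that by (simp add: \<sigma>_def representation_def)
then have "irreducible_representation B H \<sigma>" using irr irreducible_transfer[of H \<rho> \<sigma>, OF e] by blast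
then show ?thesis using that e by blast
qed

lemma equivalent_pullback:
assumes "unitarily_equivalent B H \<sigma> K \<tau>" "!!x v. x : cr A ==> v : cr H ==> \<rho> x v = \<sigma> (f x) v"
shows "unitarily_equivalent A H \<rho> K (%x. \<tau> (f x))"
using assms f_closed unfolding unitarily_equivalent_def by metis

lemma equivalent_pullback_iff:
"unitarily_equivalent A H (%x. \<sigma> (f x)) K (%x. \<tau> (f x)) \<longleftrightarrow> unitarily_equivalent B H \<sigma> K \<tau>"
unfolding unitarily_equivalent_def onto[symmetric] by simp

end

text \<open>Equivalent representations have the same kernel; this separates most of the models.\<close>

lemma equivalent_kernel:
assumes eq: "unitarily_equivalent A H \<rho> K \<sigma>" and H: "hilbert_space H" and K: "hilbert_space K"
 and x: "x : cr A" and cl: "!!u. u : cr H ==> \<rho> x u : cr H"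
shows "(ALL u:cr H. \<rho> x u = \<zero>\<^sub>H) \<longleftrightarrow> (ALL w:cr K. \<sigma> x w = \<zero>\<^sub>K)"
proof -
interpret H: hilbert_space H by fact
interpret K: hilbert_space K by fact
obtain U where U: "unitary_op H K U" "!!u. u : cr H ==> U (\<rho> x u) = \<sigma> x (U u)"
 using eq x unfolding unitarily_equivalent_def by blast
have b: "bij_betw U (cr H) (cr K)" using U(1) by (simp add: unitary_op_def)
have UK: "U u : cr K" if "u : cr H" for u using b that bij_betwE by blast
have "U (0 \<odot>\<^sub>H \<zero>\<^sub>H) = 0 \<odot>\<^sub>K U \<zero>\<^sub>H" using U(1) H.M.zero_closed unfolding unitary_op_def hlinear_def by blast
then have U0: "U \<zero>\<^sub>H = \<zero>\<^sub>K" using UK[of "\<zero>\<^sub>H"] by (simp add: H.hsmult_simps K.hsmult_simps)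
have "\<rho> x u = \<zero>\<^sub>H \<longleftrightarrow> \<sigma> x (U u) = \<zero>\<^sub>K" if "u : cr H" for u
 using U(2)[OF that] U0 inj_onD[OF bij_betw_imp_inj_on[OF b], of "\<rho> x u" "\<zero>\<^sub>H"] cl[OF that] by auto
then show ?thesis unfolding bij_betw_imp_surj_on[OF b, symmetric] by simp
qed

section \<open>The formulae for the model representations\<close>

context ball_model
begin

lemma cw_powr: "cw k = q powr (real (sum_list k) / 2)"
proof -
have "q powr (real (sum_list k) / 2) = (q powr real (sum_list k)) powr (1/2)" by (simp add: powr_powr)
then show ?thesis using q by (simp add: cw_def powr_realpow powr_half_sqrt)
qed

lemma mrep_shift:
assumes i: "m < i" "i <= n" and f: "f : cr V"
shows "mrep (qball_gen q n i) f = shift_op q (i - m) f"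
proof
fix l
have i1: "1 <= i" using i by simp
have "act (zp i) f l = shift_op q (i - m) f l"
proof (cases "length l = n - m")
 case True
 then show ?thesis using i act_z(1)[OF i1 i(2) f, of l] shift_op_eq[of "i - m" l f] by simp
next
 case False
 then show ?thesis using i f act_z(1)[OF i1 i(2) f, of l] by (simp add: shift_op_def Let_def)
qed
then show "mrep (qball_gen q n i) f l = shift_op q (i - m) f l" using mrep_z(1)[OF i1 i(2) f] by simp
qed

lemma mrep_lower: "1 <= i ==> i < m ==> f : cr V ==> mrep (qball_gen q n i) f = (%_. 0)"
using m_le by (simp add: mrep_z fun_eq_iff act_z del: shift_space_simps)

lemma mrep_m: "1 <= m ==> f : cr V ==> mrep (qball_gen q n m) f = (%l. \<theta> * of_real (cw l) * f l)"
using m_le by (simp add: mrep_z fun_eq_iff act_z del: shift_space_simps)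

lemma mrep_m_xi:
assumes "1 <= m" "length k = n - m"
shows "mrep (qball_gen q n m) (\<xi> k) = (%l. \<theta> * of_real (q powr (real (sum_list k) / 2)) * \<xi> k l)"
unfolding mrep_m[OF assms(1) xi_carrier[OF assms(2)]] by (auto simp: xi_def cw_powr)

lemma mrep_minus_T:
assumes "length k = n - m"
shows "mrep (\<ominus>\<^bsub>qball q n\<^esub> B.T) (\<xi> k) = (%l. - (if m = 0 then of_real (q powr (real (sum_list k) / 2)) else 0) * \<xi> k l)"
proof -
have "\<ominus>\<^bsub>qball q n\<^esub> B.T = (- 1) \<odot>\<^bsub>qball q n\<^esub> B.T" by (rule B.minus_eq_smult[OF B.T_props(3)])
then show ?thesis using mrep_T[OF assms] R.rep_simps(5)[OF B.T_props(3) xi_carrier[OF assms], of "- 1"]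
 by (simp add: cw_powr fun_eq_iff)
qed

end

text \<open>The index \<open>m\<close> is read off from which \<open>D i\<close> act as zero, and \<open>\<theta>\<close> from the eigenvalue of
  \<open>z\<^sub>m\<^sup>*\<close> at the image of the lowest vector: an eigenvalue of modulus 1 occurs only there.\<close>

lemma (in quantum_ball) models_inequivalent:
assumes M: "ball_model q n m \<theta>" "ball_model q n m' \<theta>'"
 and eq: "unitarily_equivalent (qball q n) (shift_space (n - m)) (ball_model.mrep q n m \<theta>)
  (shift_space (n - m')) (ball_model.mrep q n m' \<theta>')"
shows "m = m' & (1 <= m --> \<theta> = \<theta>')"
proof -
interpret M: ball_model q n m \<theta> by fact
interpret M': ball_model q n m' \<theta>' by fact
have D: "(ALL u:cr (shift_space (n - k)). ball_model.mrep q n k \<alpha> (B.D i) u = \<zero>\<^bsub>shift_space (n - k)\<^esub>) \<longleftrightarrow> i < k"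
 if "ball_model q n k \<alpha>" and i: "i <= n" for k \<alpha> i
proof -
 interpret K: ball_model q n k \<alpha> by fact
 show ?thesis
 proof (cases "i < k")
  case True
  then show ?thesis using K.mrep_D[OF i] by (simp add: K.dw_def)
 next
  case False
  then have "K.mrep (B.D i) K.vac (replicate (n - k) 0) ~= 0"
   unfolding K.mrep_D[OF i K.vac(1)] using q by (simp add: K.dw_def xi_def)
  then have "K.mrep (B.D i) K.vac ~= (%_. 0)" by auto
  then show ?thesis using False K.vac(1) by (auto simp del: shift_space_simps(1))
 qed
qed
have less: "i < m \<longleftrightarrow> i < m'" if "i <= n" for i
 using equivalent_kernel[OF eq shift_space_hilbert shift_space_hilbert B.D_closed M.R.rep_closed[OF B.D_closed], of i]
 unfolding D[OF M(1) that] D[OF M(2) that] .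
then have mm: "m = m'" using less[OF M.m_le] less[OF M'.m_le] by linarith
have "\<theta> = \<theta>'" if m1: "1 <= m"
proof -
 obtain U where U: "unitary_op M.V M'.V U" "!!x u. x : cr (qball q n) ==> u : cr M.V ==> U (M.mrep x u) = M'.mrep x (U u)"
  using eq unfolding unitarily_equivalent_def by blast
 define f where "f = U M.vac"
 have fc: "f : cr M'.V" using U(1) M.vac(1) unfolding unitary_op_def hlinear_def f_def by blast
 have "ip M'.V f f = ip M.V M.vac M.vac" using U(1) M.vac(1) by (simp add: unitary_op_def f_def del: shift_space_simps)
 then have "f ~= \<zero>\<^bsub>M'.V\<^esub>" using M.vac(2) M'.R.H.hnorm_zero by (auto simp: hnorm_def simp del: shift_space_simps)
 then obtain l where l: "f l ~= 0" by (auto simp: fun_eq_iff)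
 let ?z = "(qball_gen q n m)\<^sup>*\<^bsub>qball q n\<^esub>"
 have zc: "?z : cr (qball q n)" using m1 M.m_le by simp
 have "M'.mrep ?z f = U (M.mrep ?z M.vac)" using U(2)[OF zc M.vac(1)] by (simp add: f_def)
 also have "... = cnj \<theta> \<odot>\<^bsub>M'.V\<^esub> f"
  using M.vac_coherent[OF m1 M.m_le] U(1) M.vac(1) by (simp add: unitary_op_def hlinear_def f_def del: shift_space_simps)
 finally have "M'.mrep ?z f l = cnj \<theta> * f l" by simp
 then have "cnj \<theta>' * of_real (M'.cw l) * f l = cnj \<theta> * f l"
  using M'.mrep_z(2)[OF m1 M.m_le fc] M'.act_z(2)[OF m1 M.m_le fc, of l] mm by simp
 then have e: "cnj \<theta>' * of_real (M'.cw l) = cnj \<theta>" using l by simp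
 have "M'.cw l = 1" using arg_cong[OF e, of cmod] M.\<theta> M'.\<theta> q by (simp add: norm_mult M'.cw_def)
 then show "\<theta> = \<theta>'" using e by simp
qed
then show ?thesis using mm by blast
qed

section \<open>The irreducible representations of the sphere\<close>

context quantum_sphere
begin

abbreviation "\<Sigma> \<equiv> qsphere q n \<beta>"

lemma epi: "star_epi \<Sigma> \<B> fst" "star_epi \<Sigma> \<B> snd"
proof -
have "fst ` \<S> = cr \<B>"
proof (intro equalityI subsetI)
 fix x assume "x : cr \<B>"
 then obtain y where "(x, y) : \<S>" using S.S_left_total by blast
 then show "x : fst ` \<S>" by (rule image_eqI[rotated]) simp
qed (use S.S_closed in auto)
moreover have "snd ` \<S> = cr \<B>"
proof (intro equalityI subsetI)
 fix y assume "y : cr \<B>"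
 then obtain x where "(x, y) : \<S>" using S.S_right_total by blast
 then show "y : snd ` \<S>" by (rule image_eqI[rotated]) simp
qed (use S.S_closed in auto)
ultimately show "star_epi \<Sigma> \<B> fst" "star_epi \<Sigma> \<B> snd"
 unfolding qsphere_eq by (intro star_epi.intro S.star_alg_SP; auto)+
qed

text \<open>In the last family \<open>e\<^sub>1\<close> is given by the action of \<open>z\<^sub>1\<^sup>*\<close> in the first component; in the
  second component, used here, this is the model with conjugate parameter.\<close>

definition glue_param :: "nat => complex => complex" where
"glue_param j \<theta> = (if j = 1 \<or> j < n then \<theta> else cnj \<theta>)"

lemma glue_param: "glue_param j (glue_param j \<theta>) = \<theta>" "cmod (glue_param j \<theta>) = cmod \<theta>"
by (simp_all add: glue_param_def)

fun irrep :: "irrep_label => qball_elem \<times> qball_elem => (nat list => complex) => nat list => complex" where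
"irrep (Rho j \<theta>) = (%x. ball_model.mrep q n (n - j + 1) (glue_param j \<theta>) (snd x))"
| "irrep Sigma_plus = (%x. ball_model.mrep q n 0 1 (fst x))"
| "irrep Sigma_minus = (%x. ball_model.mrep q n 0 1 (snd x))"

lemma model_Rho: "1 <= j ==> j <= n ==> cmod \<theta> = 1 ==> ball_model q n (n - j + 1) (glue_param j \<theta>)"
"j >= 1 ==> j <= n ==> n - (n - j + 1) = j - 1"
by (intro ball_model.intro ball_model_axioms.intro quantum_ball_axioms) (auto simp: glue_param)

lemma model_0: "ball_model q n 0 1"
by (intro ball_model.intro ball_model_axioms.intro quantum_ball_axioms) auto

lemma irrep_irreducible:
assumes "l : irrep_labels n"
shows "irreducible_representation \<Sigma> (shift_space (irrep_dim n l)) (irrep l)"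
proof (cases l)
case (Rho j \<theta>)
then have j: "1 <= j" "j <= n" "cmod \<theta> = 1" using assms by (auto simp: irrep_labels_def)
show ?thesis
 using star_epi.irreducible_pullback[OF epi(2) ball_model.mrep_irreducible[OF model_Rho(1)[OF j]]]
 unfolding model_Rho(2)[OF j(1,2)] by (simp add: Rho)
next
case Sigma_plus
then show ?thesis using star_epi.irreducible_pullback[OF epi(1) ball_model.mrep_irreducible[OF model_0]] by simp
next
case Sigma_minus
then show ?thesis using star_epi.irreducible_pullback[OF epi(2) ball_model.mrep_irreducible[OF model_0]] by simp
qed

lemma irrep_values:
assumes l: "l : irrep_labels n" and i: "i <= n" and k: "length k = irrep_dim n l"
shows "irrep l (qsphere_gen q n i) (\<xi> k) = irrep_formula q n l i k"
proof (cases l)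
case (Rho j \<theta>)
then have j: "1 <= j" "j <= n" "cmod \<theta> = 1" using l by (auto simp: irrep_labels_def)
interpret M: ball_model q n "n - j + 1" "glue_param j \<theta>" by (rule model_Rho(1)[OF j])
have k': "length k = n - (n - j + 1)" using k Rho model_Rho(2)[OF j(1,2)] by simp
note c = xi_carrier[OF k']
have g: "irrep l (qsphere_gen q n i) (\<xi> k) = (if i = 0 then M.mrep (\<ominus>\<^sub>\<B> B.T) (\<xi> k) else M.mrep (qball_gen q n i) (\<xi> k))"
 using i by (simp add: Rho qsphere_gen_eq S.e_gen_def)
consider "i = 0" | "1 <= i" "i < n - j + 1" | "i = n - j + 1" | "n - j + 1 < i" by linarith
then show ?thesis
proof cases
 case 1
 then have "irrep l (qsphere_gen q n i) (\<xi> k) = (%_. 0)" using g M.mrep_minus_T[OF k'] by simp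
 then show ?thesis using 1 j n by (auto simp: Rho)
next
 case 2
 then have "irrep l (qsphere_gen q n i) (\<xi> k) = (%_. 0)" using g M.mrep_lower[OF 2 c] by simp
 then show ?thesis using 2 j by (auto simp: Rho)
next
 case 3
 have "irrep l (qsphere_gen q n i) (\<xi> k) = (%l. glue_param j \<theta> * of_real (q powr (real (sum_list k) / 2)) * \<xi> k l)"
  using g M.mrep_m_xi[OF _ k'] by (simp add: 3)
 moreover have "sum_list k = 0" if "j = 1" using k' that j by simp
 ultimately show ?thesis using 3 j q by (auto simp: Rho glue_param_def)
next
 case 4
 have "irrep l (qsphere_gen q n i) (\<xi> k) = shift_op q (i - (n - j + 1)) (\<xi> k)" using g M.mrep_shift[OF 4 i c] 4 by simp
 moreover have "i - (n - j + 1) = i + j - n - 1" "\<not> j <= n - 1 ==> i - (n - j + 1) = i - 1"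
  "j ~= 1" "i ~= 0" "\<not> i <= n - j" "i ~= n - j + 1" "\<not> j <= n - 1 ==> i ~= 1"
  using 4 i j by arith+
 ultimately show ?thesis unfolding Rho irrep_formula.simps by (cases "j <= n - 1") (simp_all only: if_False if_True simp_thms)
qed
next
case Sigma_plus
interpret M: ball_model q n 0 1 by (rule model_0)
have k': "length k = n - 0" using k Sigma_plus by simp
note c = xi_carrier[OF k']
consider "i = 0" | "i = 1" | "1 < i" by linarith
then show ?thesis
proof cases
 case 1
 have "sqrt q * M.cw k = q powr (real (1 + sum_list k) / 2)"
  using q by (simp add: M.cw_powr powr_half_sqrt[symmetric] powr_add[symmetric] add_divide_distrib)
 then have "B.rq * of_real (M.cw k) = of_real (q powr (real (1 + sum_list k) / 2))" by (simp only: of_real_mult[symmetric])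
 moreover have "irrep l (qsphere_gen q n i) (\<xi> k) = (%l. B.rq * of_real (M.cw k) * \<xi> k l)"
  using M.R.rep_simps(5)[OF B.T_props(3) c, of B.rq] M.mrep_T[OF k'] 1
  by (simp add: Sigma_plus qsphere_gen_eq S.e_gen_def mult.assoc)
 ultimately show ?thesis using 1 by (simp add: Sigma_plus)
next
 case 2
 let ?z = "qball_gen q n 1"
 have zc: "?z : cr \<B>" using n by simp
 have "adjoint_op (shift_space (n - 0)) (shift_op q 1) (\<xi> k) = M.mrep (?z\<^sup>*\<^sub>\<B>) (\<xi> k)"
 proof (rule M.R.H.adjoint_op_eq[OF c])
  show "M.mrep (?z\<^sup>*\<^sub>\<B>) (\<xi> k) : cr (shift_space (n - 0))" by (rule M.R.rep_closed[OF _ c]) (use zc in simp)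
  show "ip (shift_space (n - 0)) (shift_op q 1 w) (\<xi> k) = ip (shift_space (n - 0)) w (M.mrep (?z\<^sup>*\<^sub>\<B>) (\<xi> k))"
   if w: "w : cr (shift_space (n - 0))" for w
   using M.R.rep_adjoint[OF zc w c] M.mrep_shift[of 1 w] n w by (simp del: shift_space_simps)
 qed
 then show ?thesis using 2 n by (simp add: Sigma_plus qsphere_gen_eq S.e_gen_def)
next
 case 3
 then show ?thesis using M.mrep_shift[OF _ i c] i by (simp add: Sigma_plus qsphere_gen_eq S.e_gen_def)
qed
next
case Sigma_minus
interpret M: ball_model q n 0 1 by (rule model_0)
have k': "length k = n - 0" using k Sigma_minus by simp
show ?thesis
 using M.mrep_minus_T[OF k'] M.mrep_shift[OF _ i xi_carrier[OF k']] i
 by (auto simp: Sigma_minus qsphere_gen_eq S.e_gen_def)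
qed

lemma plus_kernel:
"(B.T, \<zero>\<^sub>\<B>) : cr \<Sigma>" "ball_model.mrep q n 0 1 B.T (\<xi> (replicate n 0)) ~= (%_. 0)"
proof -
interpret M: ball_model q n 0 1 by (rule model_0)
show "(B.T, \<zero>\<^sub>\<B>) : cr \<Sigma>" using S.S_J[OF B.T_in_J B.J_ideal(5)] by (simp add: qsphere_eq)
have "M.mrep B.T (\<xi> (replicate n 0)) (replicate n 0) ~= 0"
 using M.mrep_T[of "replicate n 0"] q by (simp add: M.cw_def xi_def)
then show "M.mrep B.T (\<xi> (replicate n 0)) ~= (%_. 0)" by auto
qed

lemma irrep_kills:
assumes l: "l : irrep_labels n"
shows "(\<forall>u\<in>cr (shift_space (irrep_dim n l)). irrep l (B.T, \<zero>\<^sub>\<B>) u = \<zero>\<^bsub>shift_space (irrep_dim n l)\<^esub>) \<longleftrightarrow> l ~= Sigma_plus"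
proof (cases l)
case (Rho j \<theta>)
then have j: "1 <= j" "j <= n" "cmod \<theta> = 1" using l by (auto simp: irrep_labels_def)
interpret M: ball_model q n "n - j + 1" "glue_param j \<theta>" by (rule model_Rho(1)[OF j])
show ?thesis using M.R.rep_zero unfolding model_Rho(2)[OF j(1,2)] by (simp add: Rho)
next
case Sigma_plus
have "\<xi> (replicate n 0) : cr (shift_space n)" by (rule xi_carrier) simp
then show ?thesis using plus_kernel(2) by (auto simp: Sigma_plus simp del: shift_space_simps(1))
next
case Sigma_minus
interpret M: ball_model q n 0 1 by (rule model_0)
show ?thesis using M.R.rep_zero by (simp add: Sigma_minus)
qed

lemma irrep_inequivalent:
assumes l: "l : irrep_labels n" "l' : irrep_labels n" "l ~= l'"
shows "\<not> unitarily_equivalent \<Sigma> (shift_space (irrep_dim n l)) (irrep l) (shift_space (irrep_dim n l')) (irrep l')"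
proof
assume eq: "unitarily_equivalent \<Sigma> (shift_space (irrep_dim n l)) (irrep l) (shift_space (irrep_dim n l')) (irrep l')"
have cl: "irrep l (B.T, \<zero>\<^sub>\<B>) u : cr (shift_space (irrep_dim n l))" if "u : cr (shift_space (irrep_dim n l))" for u
proof -
 interpret I: star_rep \<Sigma> "shift_space (irrep_dim n l)" "irrep l"
  by (intro star_rep.intro star_rep_axioms.intro shift_space_hilbert S.star_alg_SP[folded qsphere_eq]
    irrep_irreducible[OF l(1), unfolded irreducible_representation_def, THEN conjunct1])
 show ?thesis by (rule I.rep_closed[OF plus_kernel(1) that])
qed
have p: "l = Sigma_plus \<longleftrightarrow> l' = Sigma_plus"
 using equivalent_kernel[OF eq shift_space_hilbert shift_space_hilbert plus_kernel(1) cl]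
 unfolding irrep_kills[OF l(1)] irrep_kills[OF l(2)] by blast
define mm where "mm l = (case l of Rho j \<theta> => n - j + 1 | _ => 0)" for l
define tt where "tt l = (case l of Rho j \<theta> => glue_param j \<theta> | _ => 1)" for l
have mod: "ball_model q n (mm l) (tt l) & irrep_dim n l = n - mm l & irrep l = (%x. ball_model.mrep q n (mm l) (tt l) (snd x))"
 if "l : irrep_labels n" "l ~= Sigma_plus" for l
proof (cases l)
 case (Rho j \<theta>)
 then have j: "1 <= j" "j <= n" "cmod \<theta> = 1" using that by (auto simp: irrep_labels_def)
 show ?thesis using model_Rho(1)[OF j] model_Rho(2)[OF j(1,2)] by (simp add: Rho mm_def tt_def)
qed (use that model_0 in \<open>simp_all add: mm_def tt_def\<close>)
have ns: "l ~= Sigma_plus" "l' ~= Sigma_plus" using p l(3) by auto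
note m = mod[OF l(1) ns(1)] mod[OF l(2) ns(2)]
have "unitarily_equivalent \<B> (shift_space (n - mm l)) (ball_model.mrep q n (mm l) (tt l))
  (shift_space (n - mm l')) (ball_model.mrep q n (mm l') (tt l'))"
 using eq m star_epi.equivalent_pullback_iff[OF epi(2), of "shift_space (n - mm l)" "ball_model.mrep q n (mm l) (tt l)"
   "shift_space (n - mm l')" "ball_model.mrep q n (mm l') (tt l')"] by simp
then have e: "mm l = mm l'" "1 <= mm l ==> tt l = tt l'" using models_inequivalent m by blast+
show False
proof (cases l; cases l')
 fix j \<theta> j' \<theta>' assume r: "l = Rho j \<theta>" "l' = Rho j' \<theta>'"
 then have "j = j'" using e(1) l(1,2) by (auto simp: mm_def irrep_labels_def)
 moreover have "glue_param j \<theta> = glue_param j' \<theta>'" using e(2) r by (simp add: mm_def tt_def)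
 ultimately have "\<theta> = \<theta>'" using glue_param(1) by metis
 then show False using \<open>j = j'\<close> r l(3) by simp
qed (use e(1) ns l(3) in \<open>auto simp: mm_def\<close>)
qed

text \<open>Let \<open>P\<close> and \<open>Q\<close> be the copies of \<open>J\<close> in the two components. Their product is zero, so if
  \<open>P\<close> acts nontrivially, its image consists of vectors killed by \<open>Q\<close>, and by irreducibility \<open>Q\<close> acts as
  zero.\<close>

lemma irrep_complete:
fixes H :: "'h hilbert"
assumes irr: "irreducible_representation \<Sigma> H \<rho>"
shows "EX l:irrep_labels n. unitarily_equivalent \<Sigma> H \<rho> (shift_space (irrep_dim n l)) (irrep l)"
proof -
have sa: "star_alg \<Sigma>" unfolding qsphere_eq by (rule S.star_alg_SP)
interpret R: star_rep \<Sigma> H \<rho>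
 using irr sa by (intro star_rep.intro star_rep_axioms.intro) (auto simp: irreducible_representation_def representation_def)
have car: "cr \<Sigma> = \<S>" by (simp add: qsphere_eq)
have z0: "\<zero>\<^sub>\<B> : B.J" by (rule B.J_ideal(5))
have jc: "(x, \<zero>\<^sub>\<B>) : cr \<Sigma>" "(\<zero>\<^sub>\<B>, x) : cr \<Sigma>" if "x : B.J" for x
 using S.S_J[OF that z0] S.S_J[OF z0 that] car by simp_all
let ?K = "%X. {v : cr H. ALL x:X. \<rho> x v = \<zero>\<^bsub>H\<^esub>}"
define P where "P = (%x. (x, \<zero>\<^sub>\<B>)) ` B.J"
define Q where "Q = (%x. (\<zero>\<^sub>\<B>, x)) ` B.J"
have PQ: "P <= cr \<Sigma>" "Q <= cr \<Sigma>" using jc by (auto simp: P_def Q_def)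
have mul: "x \<cdot>\<^sub>\<Sigma> a : P" if "x : P" "a : cr \<Sigma>" for x a
 using that B.J_ideal(2) S.S_closed by (cases a) (auto simp: P_def qsphere_eq)
have mul': "x \<cdot>\<^sub>\<Sigma> a : Q" if "x : Q" "a : cr \<Sigma>" for x a
 using that B.J_ideal(2) S.S_closed by (cases a) (auto simp: Q_def qsphere_eq)
have cases: "?K X = {\<zero>\<^bsub>H\<^esub>} \<or> ?K X = cr H"
 if X: "X <= cr \<Sigma>" "!!x a. x : X ==> a : cr \<Sigma> ==> x \<cdot>\<^sub>\<Sigma> a : X" for X
proof (rule R.irreducible_cases[OF irr R.kernel_closed_subspace[OF X(1)]])
 fix a v assume a: "a : cr \<Sigma>" and v: "v : ?K X"
 have "\<rho> x (\<rho> a v) = \<zero>\<^sub>H" if "x : X" for x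
  using R.rep_simps(4)[of x a v] X(1) X(2)[OF that a] that a v by auto
 then show "\<rho> a v : ?K X" using a v by simp
qed
note cP = cases[OF PQ(1) mul] and cQ = cases[OF PQ(2) mul']
have fac: "EX m \<theta>. m <= n & cmod \<theta> = 1 & (m = 0 --> \<theta> = 1) \<and>
  (m = 0 \<or> (ALL x:cr \<Sigma>. f x : B.J --> (ALL v:cr H. \<rho> x v = \<zero>\<^sub>H))) \<and>
  unitarily_equivalent \<Sigma> H \<rho> (shift_space (n - m)) (%x. ball_model.mrep q n m \<theta> (f x))"
 if f: "star_epi \<Sigma> \<B> f" and ker: "!!x y v. x : cr \<Sigma> ==> y : cr \<Sigma> ==> f x = f y ==> v : cr H ==> \<rho> x v = \<rho> y v" for f
proof -
 obtain \<sigma> where s: "irreducible_representation \<B> H \<sigma>" "!!x v. x : cr \<Sigma> ==> v : cr H ==> \<rho> x v = \<sigma> (f x) v"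
  using star_epi.irreducible_factor[OF f irr ker] by blast
 interpret C: cstar_rep \<B> H \<sigma>
  using s(1) by (intro cstar_rep.intro star_rep.intro star_rep_axioms.intro B.cstar_alg_axioms B.star_alg_axioms)
   (auto simp: irreducible_representation_def representation_def)
 obtain m \<theta> where m: "m <= n" "cmod \<theta> = 1" "m = 0 --> \<theta> = 1" "m = 0 \<longleftrightarrow> (EX u:cr H. \<sigma> (B.D 0) u ~= \<zero>\<^sub>H)"
  "unitarily_equivalent \<B> H \<sigma> (shift_space (n - m)) (ball_model.mrep q n m \<theta>)"
  using ball_irrep_classification[OF s(1)] by blast
 have "\<sigma> x v = \<zero>\<^sub>H" if D0: "m ~= 0" and x: "x : B.J" and v: "v : cr H" for x v
 proof -
  let ?I = "{x : cr \<B>. ALL v:cr H. \<sigma> x v = \<zero>\<^bsub>H\<^esub>}"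
  have "ideal ?I \<B>"
   by (rule B.idealI') (auto simp: C.rep_simps C.rep_zero C.rep_zero_right)
  moreover have "norm_closed \<B> ?I"
   unfolding norm_closed_def
  proof (intro conjI allI impI)
   fix s x assume a: "(ALL k. s k : ?I) & x : cr \<B> & norm_lim \<B> s x"
   then have sc: "!!k. s k : cr \<B>" "!!k v. v : cr H ==> \<sigma> (s k) v = \<zero>\<^sub>H" by auto
   have "\<sigma> x v = \<zero>\<^sub>H" if v: "v : cr H" for v
   proof -
    have "hlim H (%k. \<sigma> (s k) v) (\<sigma> x v)" by (rule C.rep_norm_lim[OF sc(1) _ _ v]) (use a in auto)
    then have "hlim H (%k. \<zero>\<^sub>H) (\<sigma> x v)" using sc(2)[OF v] by simp
    then show ?thesis
     using R.H.hlim_unique[of "%_. \<zero>\<^sub>H" "\<sigma> x v" "\<zero>\<^sub>H"] R.H.hlim_const[of "\<zero>\<^sub>H"] a v by simp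
   qed
   then show "x : ?I" using a by simp
  qed blast
  ultimately have "B.J <= ?I" using B.J_props(4) D0 m(4) by auto
  then show ?thesis using x v by blast
 qed
 then have "m = 0 \<or> (ALL x:cr \<Sigma>. f x : B.J --> (ALL v:cr H. \<rho> x v = \<zero>\<^sub>H))" using s(2) by auto
 then show ?thesis using m(1,2,3) star_epi.equivalent_pullback[OF f m(5) s(2)] by blast
qed
have ker: "\<rho> x v = \<rho> y v" if xy: "x : cr \<Sigma>" "y : cr \<Sigma>" and v: "v : cr H" and z: "\<rho> (x \<ominus>\<^sub>\<Sigma> y) v = \<zero>\<^sub>H" for x y v
 using R.rep_diff[OF xy v] z R.H.hdiff_eq_0D[of "\<rho> x v" "\<rho> y v"] xy v by simp
show ?thesis
proof (cases "?K P = cr H")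
 case True
 have "\<rho> x v = \<rho> y v" if xy: "x : cr \<Sigma>" "y : cr \<Sigma>" "snd x = snd y" and v: "v : cr H" for x y v
 proof (rule ker[OF xy(1,2) v])
  obtain a b a' where e: "x = (a, b)" "y = (a', b)" using xy(3) by (cases x; cases y) auto
  have s: "(a, b) : \<S>" "(a', b) : \<S>" using xy e car by auto
  have "b \<ominus>\<^sub>\<B> b = \<zero>\<^sub>\<B>" using S.S_closed[OF s(1)] by (simp add: B.minus_eq B.r_neg)
  then have "x \<ominus>\<^sub>\<Sigma> y = (a \<ominus>\<^sub>\<B> a', \<zero>\<^sub>\<B>)" using S.SP_diff[OF s] by (simp add: e qsphere_eq)
  then have "x \<ominus>\<^sub>\<Sigma> y : P" using S.S_same_right[OF s] by (simp add: P_def)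
  then show "\<rho> (x \<ominus>\<^sub>\<Sigma> y) v = \<zero>\<^sub>H" using True v by blast
 qed
 then obtain m \<theta> where m: "m <= n" "cmod \<theta> = 1" "m = 0 --> \<theta> = 1"
  "unitarily_equivalent \<Sigma> H \<rho> (shift_space (n - m)) (%x. ball_model.mrep q n m \<theta> (snd x))"
  using fac[OF epi(2)] by blast
 show ?thesis
 proof (cases "m = 0")
  case True
  then show ?thesis using m by (intro bexI[of _ Sigma_minus]) (auto simp: irrep_labels_def)
 next
  case False
  define j where "j = n - m + 1"
  have j: "n - j + 1 = m" "j - 1 = n - m" "1 <= j" "j <= n" using False m(1) by (auto simp: j_def)
  show ?thesis
   by (rule bexI[of _ "Rho j (glue_param j \<theta>)"]) (use m(2,4) j in \<open>auto simp: irrep_labels_def glue_param\<close>)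
 qed
next
 case False
 then have KP: "?K P = {\<zero>\<^bsub>H\<^esub>}" using cP by blast
 obtain x0 v0 where x0: "x0 : cr \<Sigma>" "\<rho> x0 v0 ~= \<zero>\<^sub>H" and "v0 : cr H"
  using irr unfolding irreducible_representation_def by blast
 have "v0 ~= \<zero>\<^sub>H" using x0(2) R.rep_zero_right[OF x0(1)] by blast
 then have "v0 ~: ?K P" using KP by blast
 then obtain a where a: "a : B.J" "\<rho> (a, \<zero>\<^sub>\<B>) v0 ~= \<zero>\<^sub>H" using \<open>v0 : cr H\<close> by (auto simp: P_def)
 let ?w = "\<rho> (a, \<zero>\<^sub>\<B>) v0"
 have wc: "?w : cr H" using jc(1)[OF a(1)] \<open>v0 : cr H\<close> by simp
 have "\<rho> (\<zero>\<^sub>\<B>, b) ?w = \<zero>\<^sub>H" if b: "b : B.J" for b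
 proof -
  have "(\<zero>\<^sub>\<B>, b) \<cdot>\<^sub>\<Sigma> (a, \<zero>\<^sub>\<B>) = \<zero>\<^sub>\<Sigma>" using B.J_closed a(1) b by (simp add: qsphere_eq)
  then show ?thesis
   using R.rep_simps(4)[OF jc(2)[OF b] jc(1)[OF a(1)] \<open>v0 : cr H\<close>] R.rep_zero[OF \<open>v0 : cr H\<close>] by simp
 qed
 then have "?w : ?K Q" using wc by (auto simp: Q_def)
 then have KQ: "?K Q = cr H" using cQ a(2) by blast
 have "\<rho> x v = \<rho> y v" if xy: "x : cr \<Sigma>" "y : cr \<Sigma>" "fst x = fst y" and v: "v : cr H" for x y v
 proof (rule ker[OF xy(1,2) v])
  obtain a b b' where e: "x = (a, b)" "y = (a, b')" using xy(3) by (cases x; cases y) auto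
  have s: "(a, b) : \<S>" "(a, b') : \<S>" using xy e car by auto
  have "a \<ominus>\<^sub>\<B> a = \<zero>\<^sub>\<B>" using S.S_closed[OF s(1)] by (simp add: B.minus_eq B.r_neg)
  then have d: "x \<ominus>\<^sub>\<Sigma> y = (\<zero>\<^sub>\<B>, b \<ominus>\<^sub>\<B> b')" "(\<zero>\<^sub>\<B>, b \<ominus>\<^sub>\<B> b') : \<S>"
   using S.SP_diff[OF s] S.S_diff[OF s] by (simp_all add: e qsphere_eq)
  have "b \<ominus>\<^sub>\<B> b' : B.J" using S.S_J_iff[OF d(2)] z0 by simp
  then have "x \<ominus>\<^sub>\<Sigma> y : Q" unfolding d(1) by (simp add: Q_def)
  then show "\<rho> (x \<ominus>\<^sub>\<Sigma> y) v = \<zero>\<^sub>H" using KQ v by blast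
 qed
 then obtain m \<theta> where m: "m <= n" "cmod \<theta> = 1" "m = 0 --> \<theta> = 1"
  "m = 0 \<or> (ALL x:cr \<Sigma>. fst x : B.J --> (ALL v:cr H. \<rho> x v = \<zero>\<^sub>H))"
  "unitarily_equivalent \<Sigma> H \<rho> (shift_space (n - m)) (%x. ball_model.mrep q n m \<theta> (fst x))"
  using fac[OF epi(1)] by blast
 have "m = 0"
 proof (rule ccontr)
  assume "m ~= 0"
  then have "\<rho> (a, \<zero>\<^sub>\<B>) v0 = \<zero>\<^sub>H" using m(4) jc(1)[OF a(1)] a(1) \<open>v0 : cr H\<close> by simp
  then show False using a(2) by simp
 qed
 then show ?thesis using m by (intro bexI[of _ Sigma_plus]) (auto simp: irrep_labels_def)
qed
qed

end

theorem proposition7p4: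
  fixes q :: real and n :: nat and \<beta> :: "qball_elem set \<Rightarrow> qball_elem set"
  assumes "0 < q" and "q < 1" and "n \<ge> 1"
    and "star_automorphism (qboundary q n) \<beta>"
    and "\<beta> (qboundary_gen q n 1) = (qboundary_gen q n 1)\<^sup>\<star>\<^bsub>qboundary q n\<^esub>"
    and "\<forall>j\<in>{2..n}. \<beta> (qboundary_gen q n j) = qboundary_gen q n j"
  shows "carrier (qsphere q n \<beta>) = generated_cstar (qsphere q n \<beta>) (qsphere_gen q n ` {0..n}) \<and>
    (\<exists>\<pi>.
      (\<forall>l\<in>irrep_labels n.
         irreducible_representation (qsphere q n \<beta>) (shift_space (irrep_dim n l)) (\<pi> l) \<and>
         (\<forall>i\<in>{0..n}. \<forall>k. length k = irrep_dim n l \<longrightarrow>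
            \<pi> l (qsphere_gen q n i) (\<xi> k) = irrep_formula q n l i k)) \<and>
      (\<forall>l\<in>irrep_labels n. \<forall>l'\<in>irrep_labels n. l \<noteq> l' \<longrightarrow>
         \<not> unitarily_equivalent (qsphere q n \<beta>)
             (shift_space (irrep_dim n l)) (\<pi> l) (shift_space (irrep_dim n l')) (\<pi> l')) \<and>
      (\<forall>(H :: 'h hilbert) \<rho>. irreducible_representation (qsphere q n \<beta>) H \<rho> \<longrightarrow>
         (\<exists>l\<in>irrep_labels n. unitarily_equivalent (qsphere q n \<beta>)
             H \<rho> (shift_space (irrep_dim n l)) (\<pi> l))))"
proof -
interpret Q: quantum_sphere q n \<beta> by unfold_locales (use assms in simp_all)
show ?thesis
proof (intro conjI exI[of _ Q.irrep] ballI allI impI)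
 show "cr (qsphere q n \<beta>) = generated_cstar (qsphere q n \<beta>) (qsphere_gen q n ` {0..n})"
  by (rule Q.sphere_generated)
 fix l assume l: "l : irrep_labels n"
 show "irreducible_representation (qsphere q n \<beta>) (shift_space (irrep_dim n l)) (Q.irrep l)"
  by (rule Q.irrep_irreducible[OF l])
 show "Q.irrep l (qsphere_gen q n i) (\<xi> k) = irrep_formula q n l i k" if "i : {0..n}" "length k = irrep_dim n l" for i k
  by (rule Q.irrep_values[OF l _ that(2)]) (use that(1) in simp)
 show "\<not> unitarily_equivalent (qsphere q n \<beta>) (shift_space (irrep_dim n l)) (Q.irrep l)
   (shift_space (irrep_dim n l')) (Q.irrep l')" if "l' : irrep_labels n" "l ~= l'" for l'
  by (rule Q.irrep_inequivalent[OF l that])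
qed (rule Q.irrep_complete)
qed

end
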